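(* Let $m$ be a positive integer. The spaces $S^m\mathbb{CP}^{\infty}$ and $\mathbf{Gr}(m,\infty)$ are piecewise isomorphic in the following sense: there exist partitions $S^m\mathbb{CP}^{\infty}=\coprod_j U_j$ and $\mathbf{Gr}(m,\infty)=\coprod_j V_j$ (indexed by the same set) into pairwise isomorphic quasi-projective varieties $U_j$ and $V_j$ (that is, $U_j\cong V_j$ for each $j$), such that the first partition is compatible with the filtration $\{S^m\mathbb{CP}^N\}_N$ and the second one is compatible with the filtration $\{\mathbf{Gr}(m,N)\}_N$.
   Context: All varieties are complex quasi-projective varieties (not necessarily irreducible). For a variety $X$, $S^mX:=X^m/S_m$ is its $m$-th symmetric power (quotient of $X^m$ by the symmetric group permuting the factors). $\mathbf{Gr}(m,N)$ is the Grassmannian of $m$-dimensional linear subspaces of $\mathbb{C}^N$. $\mathbb{CP}^{\infty}=\varinjlim \mathbb{CP}^N$ is the infinite dimensional complex projective space and $\mathbf{Gr}(m,\infty)=\varinjlim\mathbf{Gr}(m,N)$ is the infinite dimensional Grassmannian; in both cases the inductive limit is with respect to the natural sequence of inclusions ($\mathbb{CP}^N\subset\mathbb{CP}^{N+1}$ and $\mathbf{Gr}(m,N)\subset\mathbf{Gr}(m,N+1)$, induced by the standard inclusions of coordinate spaces $\mathbb{C}^k\subset\mathbb{C}^{k+1}$). The symmetric power $S^m\mathbb{CP}^{\infty}$ is the inductive limit of the quasi-projective varieties $S^m\mathbb{CP}^N$. For a sequence $X_1\subset X_2\subset X_3\subset\ldots$ of quasi-projective varieties, let $X=\varinjlim X_i\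 (=\bigcup_i X_i)$ be its inductive limit. A partition of the space $X$ compatible with the filtration $\{X_i\}$ is a representation of $X$ as a disjoint union $\coprod_j Z_j$ of not more than countably many quasi-projective varieties $Z_j$ such that each $X_i$ is the union of a subset of the strata $Z_j$ and each $Z_j$ is a Zariski locally closed subset in the corresponding $X_i$ (i.e. in an $X_i$ containing it). *)

theory Defs
  imports
    "HOL-Analysis.Abstract_Topology"
    "HOL-Library.Multiset"
    "HOL-Library.Countable_Set"
    "HOL-Library.Disjoint_Sets"
    "HOL-Library.Function_Algebras"
    "Jordan_Normal_Form.Determinant"
begin

section \<open>Spaces with functions\<close>

text \<open>
  Complex varieties are treated in the classical (reduced, not necessarily irreducible) sense: a
  set of points with its Zariski topology and its sheaf of regular complex-valued functions.
  A member of \<open>regular X W\<close> is a total HOL function of which only the values on the open set \<open>W\<close>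
  matter; \<open>regular X W\<close> is empty when \<open>W\<close> is not open.
\<close>

record 'a fspace =
  ztop :: "'a topology"
  regular :: "'a set \<Rightarrow> ('a \<Rightarrow> complex) set"

abbreviation points :: "'a fspace \<Rightarrow> 'a set" where
  "points X \<equiv> topspace (ztop X)"

definition morphism :: "'a fspace \<Rightarrow> 'b fspace \<Rightarrow> ('a \<Rightarrow> 'b) \<Rightarrow> bool" where
  "morphism X Y \<phi> \<longleftrightarrow>
     continuous_map (ztop X) (ztop Y) \<phi> \<and>
     (\<forall>W. \<forall>f \<in> regular Y W. f \<circ> \<phi> \<in> regular X {x \<in> points X. \<phi> x \<in> W})"

definition isomorphic :: "'a fspace \<Rightarrow> 'b fspace \<Rightarrow> bool" (infix "\<cong>\<^sub>v" 50) where
  "X \<cong>\<^sub>v Y \<longleftrightarrow>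
     (\<exists>\<phi> \<psi>. morphism X Y \<phi> \<and> morphism Y X \<psi> \<and>
        (\<forall>x \<in> points X. \<psi> (\<phi> x) = x) \<and> (\<forall>y \<in> points Y. \<phi> (\<psi> y) = y))"

definition locally_on ::
  "'a topology \<Rightarrow> ('a set \<Rightarrow> ('a \<Rightarrow> complex) \<Rightarrow> bool) \<Rightarrow> 'a set \<Rightarrow> ('a \<Rightarrow> complex) set" where
  "locally_on T P W =
     {f. openin T W \<and> (\<forall>x \<in> W. \<exists>W'. openin T W' \<and> x \<in> W' \<and> W' \<subseteq> W \<and> P W' f)}"

text \<open>
  The structure induced on \<open>A\<close> by an injection \<open>\<phi>\<close> of \<open>A\<close> into \<open>X\<close>; for \<open>A\<close> locally closed in \<open>X\<close>
  and \<open>\<phi>\<close> the inclusion this is the reduced structure of a subvariety.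
\<close>

definition induced_fspace :: "'a set \<Rightarrow> ('a \<Rightarrow> 'b) \<Rightarrow> 'b fspace \<Rightarrow> 'a fspace" where
  "induced_fspace A \<phi> X =
     (let T = pullback_topology A \<phi> (ztop X) in
      \<lparr>ztop = T,
       regular = locally_on T (\<lambda>W f. \<exists>V. \<exists>g \<in> regular X V. \<forall>x \<in> W. \<phi> x \<in> V \<and> f x = g (\<phi> x))\<rparr>)"

abbreviation subvariety :: "'a fspace \<Rightarrow> 'a set \<Rightarrow> 'a fspace" where
  "subvariety X Z \<equiv> induced_fspace Z (\<lambda>x. x) X"

definition zariski_locally_closed :: "'a fspace \<Rightarrow> 'a set \<Rightarrow> bool" where
  "zariski_locally_closed X Z \<longleftrightarrow>
     (\<exists>G F. openin (ztop X) G \<and> closedin (ztop X) F \<and> Z = G \<inter> F)"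


section \<open>Symmetric powers\<close>

text \<open>
  The \<open>m\<close>-fold product has the lists of length \<open>m\<close> as points. As in any product of spaces with
  functions, the open sets are generated by the non-vanishing loci \<open>nonvanishing Us h\<close> inside boxes
  \<open>U\<^sub>1 \<times> \<dots> \<times> U\<^sub>m\<close> of functions \<open>h\<close> in the algebra generated by the regular functions on the
  \<open>U\<^sub>k\<close>, and the regular functions are locally quotients of two such functions. For projective
  spaces this is the usual multihomogeneous (Segre) structure.
\<close>

inductive_set box_algebra :: "'a fspace \<Rightarrow> 'a set list \<Rightarrow> ('a list \<Rightarrow> complex) set"
  for X :: "'a fspace" and Us :: "'a set list" where
  const: "(\<lambda>_. c) \<in> box_algebra X Us"
| coord: "\<lbrakk>k < length Us; f \<in> regular X (Us ! k)\<rbrakk> \<Longrightarrow> (\<lambda>xs. f (xs ! k)) \<in> box_algebra X Us"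
| add: "\<lbrakk>f \<in> box_algebra X Us; g \<in> box_algebra X Us\<rbrakk> \<Longrightarrow> (\<lambda>xs. f xs + g xs) \<in> box_algebra X Us"
| mult: "\<lbrakk>f \<in> box_algebra X Us; g \<in> box_algebra X Us\<rbrakk> \<Longrightarrow> (\<lambda>xs. f xs * g xs) \<in> box_algebra X Us"

definition open_boxes :: "nat \<Rightarrow> 'a fspace \<Rightarrow> 'a set list set" where
  "open_boxes m X = {Us. length Us = m \<and> (\<forall>U \<in> set Us. openin (ztop X) U)}"

definition nonvanishing :: "'a set list \<Rightarrow> ('a list \<Rightarrow> complex) \<Rightarrow> 'a list set" where
  "nonvanishing Us h = {xs \<in> listset Us. h xs \<noteq> 0}"

definition power_fspace :: "nat \<Rightarrow> 'a fspace \<Rightarrow> 'a list fspace" where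
  "power_fspace m X =
     (let T = topology_generated_by
                {nonvanishing Us h | Us h. Us \<in> open_boxes m X \<and> h \<in> box_algebra X Us} in
      \<lparr>ztop = T,
       regular = locally_on T (\<lambda>W f. \<exists>Us \<in> open_boxes m X. \<exists>g \<in> box_algebra X Us. \<exists>h \<in> box_algebra X Us.
         W \<subseteq> nonvanishing Us h \<and> (\<forall>xs \<in> W. f xs = g xs / h xs))\<rparr>)"

definition quotient_topology :: "('a \<Rightarrow> 'b) \<Rightarrow> 'a topology \<Rightarrow> 'b topology" where
  "quotient_topology q T =
     topology (\<lambda>U. U \<subseteq> q ` topspace T \<and> openin T {x \<in> topspace T. q x \<in> U})"

lemma openin_quotient_topology:
  "openin (quotient_topology q T) U \<longleftrightarrow>
     U \<subseteq> q ` topspace T \<and> openin T {x \<in> topspace T. q x \<in> U}"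
proof -
  let ?L = "\<lambda>U. U \<subseteq> q ` topspace T \<and> openin T {x \<in> topspace T. q x \<in> U}"
  have "istopology ?L"
    unfolding istopology_def
  proof (intro conjI allI impI)
    fix A B assume "?L A" "?L B"
    moreover have "{x \<in> topspace T. q x \<in> A \<inter> B} =
        {x \<in> topspace T. q x \<in> A} \<inter> {x \<in> topspace T. q x \<in> B}" by blast
    ultimately show "openin T {x \<in> topspace T. q x \<in> A \<inter> B}" by auto
    show "A \<inter> B \<subseteq> q ` topspace T" using \<open>?L A\<close> by blast
  next
    fix \<K> assume *: "\<forall>K \<in> \<K>. ?L K"
    then show "\<Union>\<K> \<subseteq> q ` topspace T" by blast
    have "{x \<in> topspace T. q x \<in> \<Union>\<K>} = (\<Union>K \<in> \<K>. {x \<in> topspace T. q x \<in> K})" by blast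
    with * show "openin T {x \<in> topspace T. q x \<in> \<Union>\<K>}" by auto
  qed
  then show ?thesis
    unfolding quotient_topology_def by (simp add: topology_inverse')
qed

definition quotient_fspace :: "('a \<Rightarrow> 'b) \<Rightarrow> 'a fspace \<Rightarrow> 'b fspace" where
  "quotient_fspace q X =
     \<lparr>ztop = quotient_topology q (ztop X),
      regular = (\<lambda>W. {f. openin (quotient_topology q (ztop X)) W \<and>
                         f \<circ> q \<in> regular X {x \<in> points X. q x \<in> W}})\<rparr>"

lemma points_induced_fspace: "points (induced_fspace A \<phi> X) = A \<inter> \<phi> -` points X"
  by (auto simp: induced_fspace_def Let_def topspace_pullback_topology)

lemma in_listset_iff: "xs \<in> listset Us \<longleftrightarrow> list_all2 (\<in>) xs Us"
  by (induction Us arbitrary: xs) (auto simp: set_Cons_def list_all2_Cons2)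

lemma points_power_fspace: "points (power_fspace m X) = {xs. length xs = m \<and> set xs \<subseteq> points X}"
proof -
  have "xs \<in> points (power_fspace m X)" if "length xs = m" "set xs \<subseteq> points X" for xs
  proof -
    let ?Us = "replicate m (points X)"
    have "xs \<in> nonvanishing ?Us (\<lambda>_. 1)"
      using that by (auto simp: nonvanishing_def in_listset_iff list_all2_conv_all_nth subset_iff)
    moreover have "?Us \<in> open_boxes m X"
      by (auto simp: open_boxes_def)
    ultimately show ?thesis
      using box_algebra.const[of 1 X ?Us] by (auto simp: power_fspace_def Let_def)
  qed
  moreover have "length xs = m \<and> set xs \<subseteq> points X" if "xs \<in> points (power_fspace m X)" for xs
  proof -
    from that obtain Us where Us: "Us \<in> open_boxes m X" "list_all2 (\<in>) xs Us"
      by (auto simp: power_fspace_def Let_def nonvanishing_def in_listset_iff)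
    have "x \<in> points X" if "x \<in> set xs" for x
    proof -
      from that obtain k where "k < length xs" "x = xs ! k" by (auto simp: in_set_conv_nth)
      with Us(2) have "x \<in> Us ! k" "Us ! k \<in> set Us" by (auto simp: list_all2_conv_all_nth)
      with Us(1) show ?thesis using openin_subset by (auto simp: open_boxes_def)
    qed
    with Us show ?thesis by (auto simp: open_boxes_def dest: list_all2_lengthD)
  qed
  ultimately show ?thesis by blast
qed

lemma points_quotient_fspace: "points (quotient_fspace q X) = q ` points X"
proof -
  have "{x \<in> points X. q x \<in> q ` points X} = points X" by blast
  then have "openin (quotient_topology q (ztop X)) (q ` points X)"
    by (simp add: openin_quotient_topology)
  moreover have "U \<subseteq> q ` points X" if "openin (quotient_topology q (ztop X)) U" for U
    using that by (simp add: openin_quotient_topology)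
  ultimately have "topspace (quotient_topology q (ztop X)) = q ` points X"
    by (intro equalityI openin_subset) (metis openin_topspace)
  then show ?thesis by (simp add: quotient_fspace_def)
qed

text \<open>
  The fibres of \<open>mset\<close> on lists of length \<open>m\<close> are exactly the orbits of the symmetric group
  permuting the entries.
\<close>

definition symmetric_power :: "nat \<Rightarrow> 'a fspace \<Rightarrow> 'a multiset fspace" where
  "symmetric_power m X = quotient_fspace mset (power_fspace m X)"

lemma points_symmetric_power:
  "points (symmetric_power m X) = {M. size M = m \<and> set_mset M \<subseteq> points X}"
proof -
  have "M \<in> mset ` {xs. length xs = m \<and> set xs \<subseteq> points X}"
    if "size M = m" "set_mset M \<subseteq> points X" for M
  proof -
    obtain xs where "mset xs = M" using ex_mset by blast
    with that show ?thesis by auto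
  qed
  then show ?thesis
    by (auto simp: symmetric_power_def points_quotient_fspace points_power_fspace)
qed


section \<open>Projective spaces and Grassmannians\<close>

definition scale_fun :: "complex \<Rightarrow> ('i \<Rightarrow> complex) \<Rightarrow> 'i \<Rightarrow> complex" where
  "scale_fun c v = (\<lambda>i. c * v i)"

global_interpretation cfun: vector_space scale_fun
  by unfold_locales (auto simp: scale_fun_def fun_eq_iff algebra_simps)

text \<open>
  \<open>coord_space I\<close> is the complex coordinate space with coordinates indexed by \<open>I\<close>, realised inside
  the space of all functions, so that the standard inclusions of coordinate spaces, and hence those
  of projective spaces and of Grassmannians, are inclusions of sets.
\<close>

definition coord_space :: "'i set \<Rightarrow> ('i \<Rightarrow> complex) set" where
  "coord_space I = {v. \<forall>i. i \<notin> I \<longrightarrow> v i = 0}"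

definition linear_subspaces :: "nat \<Rightarrow> 'i set \<Rightarrow> ('i \<Rightarrow> complex) set set" where
  "linear_subspaces m I = {W. cfun.subspace W \<and> W \<subseteq> coord_space I \<and> cfun.dim W = m}"

text \<open>Homogeneous polynomials of degree \<open>d\<close> in the coordinates indexed by \<open>I\<close>.\<close>

inductive homogeneous :: "'i set \<Rightarrow> nat \<Rightarrow> (('i \<Rightarrow> complex) \<Rightarrow> complex) \<Rightarrow> bool"
  for I :: "'i set" where
  zero: "homogeneous I d (\<lambda>_. 0)"
| const: "homogeneous I 0 (\<lambda>_. c)"
| var: "i \<in> I \<Longrightarrow> homogeneous I 1 (\<lambda>v. v i)"
| add: "\<lbrakk>homogeneous I d p; homogeneous I d q\<rbrakk> \<Longrightarrow> homogeneous I d (\<lambda>v. p v + q v)"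
| mult: "\<lbrakk>homogeneous I d p; homogeneous I e q\<rbrakk> \<Longrightarrow> homogeneous I (d + e) (\<lambda>v. p v * q v)"

text \<open>
  The points are the lines \<open>L\<close> in \<open>coord_space I\<close>; any \<open>v \<in> L - {0}\<close> is a tuple of homogeneous
  coordinates of \<open>L\<close>.
\<close>

definition projective_space :: "'i set \<Rightarrow> ('i \<Rightarrow> complex) set fspace" where
  "projective_space I =
     (let T = topology_generated_by
                {{L \<in> linear_subspaces 1 I. \<forall>v \<in> L - {0}. p v \<noteq> 0} | p. \<exists>d. homogeneous I d p} in
      \<lparr>ztop = T,
       regular = locally_on T (\<lambda>W f. \<exists>d p q. homogeneous I d p \<and> homogeneous I d q \<and>
         (\<forall>L \<in> W. \<forall>v \<in> L - {0}. q v \<noteq> 0 \<and> f L = p v / q v))\<rparr>)"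

lemma points_projective_space: "points (projective_space I) = linear_subspaces 1 I"
proof -
  let ?B = "{{L \<in> linear_subspaces 1 I. \<forall>v \<in> L - {0}. p v \<noteq> 0} | p. \<exists>d. homogeneous I d p}"
  have "\<exists>d. homogeneous I d (\<lambda>_. 1)"
    using homogeneous.const by blast
  then have "linear_subspaces 1 I \<in> ?B"
    by (intro CollectI exI[of _ "\<lambda>_. 1"]) auto
  then have "\<Union>?B = linear_subspaces 1 I" by blast
  then show ?thesis
    by (simp only: projective_space_def Let_def fspace.simps topology_generated_by_topspace)
qed

definition CP :: "nat \<Rightarrow> (nat \<Rightarrow> complex) set fspace" where
  "CP N = projective_space {..N}"

text \<open>
  The Pluecker line of an \<open>m\<close>-dimensional subspace \<open>W\<close> of \<open>coord_space {..<N}\<close> is spanned by the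
  vectors of maximal minors of the \<open>m\<close>-tuples of vectors of \<open>W\<close>; any basis of \<open>W\<close> already gives a
  spanning vector, and the other tuples give its multiples.
\<close>

definition plucker_indices :: "nat \<Rightarrow> nat \<Rightarrow> nat set set" where
  "plucker_indices m N = {I. I \<subseteq> {..<N} \<and> card I = m}"

definition plucker_vector :: "nat \<Rightarrow> nat \<Rightarrow> (nat \<Rightarrow> complex) list \<Rightarrow> nat set \<Rightarrow> complex" where
  "plucker_vector m N vs = (\<lambda>I.
     if I \<in> plucker_indices m N
     then det (mat m m (\<lambda>(k, l). (vs ! k) (sorted_list_of_set I ! l)))
     else 0)"

definition plucker :: "nat \<Rightarrow> nat \<Rightarrow> (nat \<Rightarrow> complex) set \<Rightarrow> (nat set \<Rightarrow> complex) set" where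
  "plucker m N W = cfun.span {plucker_vector m N vs | vs. length vs = m \<and> set vs \<subseteq> W}"

definition Grassmannian :: "nat \<Rightarrow> nat \<Rightarrow> (nat \<Rightarrow> complex) set fspace" where
  "Grassmannian m N =
     induced_fspace (linear_subspaces m {..<N}) (plucker m N)
       (projective_space (plucker_indices m N))"


section \<open>Quasi-projective varieties and compatible partitions\<close>

definition quasi_projective :: "'a fspace \<Rightarrow> bool" where
  "quasi_projective X \<longleftrightarrow>
     (\<exists>N Z. zariski_locally_closed (CP N) Z \<and> X \<cong>\<^sub>v subvariety (CP N) Z)"

text \<open>
  A filtration is a sequence of spaces whose sets of points increase; the points of its inductive
  limit are the union.
\<close>

definition compatible_partition :: "(nat \<Rightarrow> 'a fspace) \<Rightarrow> 'j set \<Rightarrow> ('j \<Rightarrow> 'a fspace) \<Rightarrow> bool" where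
  "compatible_partition X J Z \<longleftrightarrow>
     countable J \<and>
     (\<forall>j \<in> J. quasi_projective (Z j)) \<and>
     disjoint_family_on (\<lambda>j. points (Z j)) J \<and>
     (\<Union>j \<in> J. points (Z j)) = (\<Union>i. points (X i)) \<and>
     (\<forall>i. \<exists>K \<subseteq> J. points (X i) = (\<Union>j \<in> K. points (Z j))) \<and>
     (\<forall>j \<in> J. \<exists>i. zariski_locally_closed (X i) (points (Z j)) \<and>
                   Z j = subvariety (X i) (points (Z j)))"

end

theory Submission
  imports Defs "HOL-Computational_Algebra.Fundamental_Theorem_Algebra"
begin

text \<open>
  Both spaces are cut into pieces that are isomorphic to the same locally closed subsets of affine
  spaces. The coarse matching is by the nondecreasing sequences \<open>ks\<close> of length \<open>m\<close>, that is, by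
  partitions with at most \<open>m\<close> parts.

  In the Grassmannian, \<open>ks\<close> stands for the Schubert cell of the subspaces whose reduced echelon basis
  has its pivots (here: last non-zero positions) at \<open>ks ! l + l\<close>. The free entries of that basis
  identify the cell with an affine space of dimension \<open>sum_list ks\<close> (\<open>schubert_isomorphic\<close>): they are
  quotients of Pluecker coordinates, and the Pluecker coordinates are polynomials in them.

  Infinite projective space is the disjoint union of affine cells, the cell of a line being the
  position of the last non-zero homogeneous coordinate. In the symmetric power, \<open>ks\<close> stands for the
  stratum of the multisets whose points lie in the cells listed in \<open>ks\<close>. It is a product of symmetric
  powers of affine spaces and hence not an affine space itself, but there is a natural bijection with
  the affine space of dimension \<open>sum_list ks\<close> (\<open>bij_coordinates\<close>). Normalize the last coordinate of
  each point to 1 and add the coordinates one at a time, from high to low index. Suppose that the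
  coordinates above \<open>j\<close> are known, so that the truncated points form a multiset \<open>A\<close>. A non-zero point
  \<open>s\<close> of multiplicity \<open>c\<close> in \<open>A\<close> then needs a multiset of \<open>c\<close> values of the coordinate \<open>j\<close>, which is
  given by the \<open>c\<close> coefficients of a polynomial of degree \<open>c\<close>. Each of these coefficients is a
  function on the set of the points of multiplicity \<open>c\<close>, and a function on \<open>r\<close> points is given by
  \<open>r\<close> complex numbers: the coefficients of its interpolation polynomial in a linear form that
  separates the points. The number of new coordinates is the number of points of \<open>A\<close> that are not \<open>0\<close>,
  counted with multiplicity; so it depends on \<open>ks\<close> alone.

  The bijection is not a morphism, because the number of points, their multiplicities and the choice
  of the linear form jump. These data are finite combinatorial \<open>types\<close>; the pieces are the sets on
  which all of them are constant. Such a set is locally closed (\<open>loc_closed_supp_type\<close>), and on it the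
  bijection is regular in both directions (\<open>coordinates_regular\<close>, \<open>affine_piece_psum\<close>). The last
  point rests on the following facts.

   \<^item> The functions on a symmetric power are quotients of symmetric multihomogeneous polynomials
     (\<open>symmetric_power_graded\<close>), and these are polynomials in the power sums \<open>\<Sum>v\<in>#M. g v\<close> of
     the normalized points (\<open>msum_tensors_subalg\<close>). So regularity of a map to or from a stratum is a
     statement on power sums.
   \<^item> Where the number of points is constant, sums over the points \<^emph>\<open>without\<close> multiplicities are
     quotients of symmetric polynomials (\<open>poly_trace\<close>). Cramer's rule for the Hankel matrix of a
     separating linear form then makes interpolation coefficients regular (\<open>coefficient_ratio\<close>);
     in particular the multiplicity is a polynomial function of the point with regular coefficients
     (\<open>fam_count\<close>), and so is the indicator function of the points of a given multiplicity.
   \<^item> Newton's identities pass between the coefficients of the polynomials in the fibres and the power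
     sums (\<open>newton_identity\<close>).

  All spaces are compared through \<open>graded_fspace\<close>: a set with a graded algebra of functions, whose open
  sets are generated by the non-vanishing loci of homogeneous elements and whose regular functions are
  locally fractions of equal degree.
\<close>

section \<open>Spaces whose functions are homogeneous fractions\<close>

text \<open>
  A family that is closed under intersections up to refinement and refines the generators refines
  every open set. It is applied with non-vanishing loci, where intersections come from products.
\<close>

lemma topology_generated_by_base:
  assumes base: "\<And>A x. A \<in> S \<Longrightarrow> x \<in> A \<Longrightarrow> \<exists>B \<in> \<B>. x \<in> B \<and> B \<subseteq> A"
    and inter: "\<And>B C x. B \<in> \<B> \<Longrightarrow> C \<in> \<B> \<Longrightarrow> x \<in> B \<Longrightarrow> x \<in> C \<Longrightarrow> \<exists>D \<in> \<B>. x \<in> D \<and> D \<subseteq> B \<inter> C"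
    and W: "openin (topology_generated_by S) W" and x: "x \<in> W"
  shows "\<exists>B \<in> \<B>. x \<in> B \<and> B \<subseteq> W"
proof -
  have "generate_topology_on S W"
    using W by (simp add: openin_topology_generated_by_iff)
  then show ?thesis using x
  proof (induction arbitrary: x)
    case Empty
    then show ?case by simp
  next
    case (Int a b)
    then obtain B C where "B \<in> \<B>" "x \<in> B" "B \<subseteq> a" "C \<in> \<B>" "x \<in> C" "C \<subseteq> b" by blast
    with inter[of B C x] show ?case by blast
  next
    case (UN K)
    then obtain k where "k \<in> K" "x \<in> k" by blast
    with UN.IH[of k x] show ?case by blast
  next
    case (Basis s)
    with base show ?case by blast
  qed
qed

text \<open>
  The fractions of equal degree whose denominator vanishes nowhere on \<open>P\<close>: one global fraction, not a
  locally defined one.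
\<close>

definition ratios :: "(nat \<Rightarrow> ('a \<Rightarrow> complex) set) \<Rightarrow> 'a set \<Rightarrow> ('a \<Rightarrow> complex) set" where
  "ratios G P = {f. \<exists>d. \<exists>g \<in> G d. \<exists>h \<in> G d. \<forall>x \<in> P. h x \<noteq> 0 \<and> f x = g x / h x}"

definition graded_topology :: "(nat \<Rightarrow> ('a \<Rightarrow> complex) set) \<Rightarrow> 'a set \<Rightarrow> 'a topology" where
  "graded_topology G P = topology_generated_by {{x \<in> P. g x \<noteq> 0} | g. \<exists>d. g \<in> G d}"

text \<open>
  The common form of all spaces below. A homogeneous element is a function on the points, so for a
  projective variety it includes the choice of a representative of each point. An affine
  variety has the same algebra in every degree.
\<close>

definition graded_fspace :: "(nat \<Rightarrow> ('a \<Rightarrow> complex) set) \<Rightarrow> 'a set \<Rightarrow> 'a fspace" where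
  "graded_fspace G P =
     \<lparr>ztop = graded_topology G P,
      regular = locally_on (graded_topology G P) (\<lambda>W f. f \<in> ratios G W)\<rparr>"

lemma ratiosI:
  "g \<in> G d \<Longrightarrow> h \<in> G d \<Longrightarrow> (\<And>x. x \<in> P \<Longrightarrow> h x \<noteq> 0 \<and> f x = g x / h x) \<Longrightarrow> f \<in> ratios G P"
  unfolding ratios_def by blast

lemma ratiosE:
  assumes "f \<in> ratios G P"
  obtains d g h where "g \<in> G d" "h \<in> G d" "\<And>x. x \<in> P \<Longrightarrow> h x \<noteq> 0 \<and> f x = g x / h x"
  using assms unfolding ratios_def by blast

lemma ratios_cong: "f \<in> ratios G P \<Longrightarrow> (\<And>x. x \<in> P \<Longrightarrow> f' x = f x) \<Longrightarrow> f' \<in> ratios G P"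
  unfolding ratios_def by simp

lemma ratios_mono: "f \<in> ratios G P \<Longrightarrow> Q \<subseteq> P \<Longrightarrow> f \<in> ratios G Q"
  unfolding ratios_def by blast

lemma open_nonvanishing_graded: "g \<in> G d \<Longrightarrow> openin (graded_topology G P) {x \<in> P. g x \<noteq> 0}"
  unfolding graded_topology_def by (rule topology_generated_by_Basis) blast

locale graded_algebra =
  fixes G :: "nat \<Rightarrow> ('a \<Rightarrow> complex) set"
  assumes const: "(\<lambda>_. c) \<in> G 0"
    and add: "f \<in> G d \<Longrightarrow> g \<in> G d \<Longrightarrow> (\<lambda>x. f x + g x) \<in> G d"
    and mult: "f \<in> G d \<Longrightarrow> g \<in> G e \<Longrightarrow> (\<lambda>x. f x * g x) \<in> G (d + e)"
begin

lemma ratios_const: "(\<lambda>_. c) \<in> ratios G P"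
  unfolding ratios_def
  by (intro CollectI exI[of _ 0] bexI[of _ "\<lambda>_. c"] bexI[of _ "\<lambda>_. 1"]) (auto intro: const)

lemma ratios_add:
  assumes "f \<in> ratios G P" "g \<in> ratios G P" shows "(\<lambda>x. f x + g x) \<in> ratios G P"
proof -
  obtain d f1 f2 where f: "f1 \<in> G d" "f2 \<in> G d" "\<And>x. x \<in> P \<Longrightarrow> f2 x \<noteq> 0 \<and> f x = f1 x / f2 x"
    using assms(1) by (elim ratiosE) blast
  obtain e g1 g2 where g: "g1 \<in> G e" "g2 \<in> G e" "\<And>x. x \<in> P \<Longrightarrow> g2 x \<noteq> 0 \<and> g x = g1 x / g2 x"
    using assms(2) by (elim ratiosE) blast
  have "(\<lambda>x. f1 x * g2 x + f2 x * g1 x) \<in> G (d + e)" "(\<lambda>x. f2 x * g2 x) \<in> G (d + e)"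
    by (intro add mult f g)+
  moreover have "f2 x * g2 x \<noteq> 0 \<and> f x + g x = (f1 x * g2 x + f2 x * g1 x) / (f2 x * g2 x)"
    if "x \<in> P" for x using f(3)[OF that] g(3)[OF that] by (simp add: field_simps)
  ultimately show ?thesis by (rule ratiosI)
qed

lemma ratios_mult:
  assumes "f \<in> ratios G P" "g \<in> ratios G P" shows "(\<lambda>x. f x * g x) \<in> ratios G P"
proof -
  obtain d f1 f2 where f: "f1 \<in> G d" "f2 \<in> G d" "\<And>x. x \<in> P \<Longrightarrow> f2 x \<noteq> 0 \<and> f x = f1 x / f2 x"
    using assms(1) by (elim ratiosE) blast
  obtain e g1 g2 where g: "g1 \<in> G e" "g2 \<in> G e" "\<And>x. x \<in> P \<Longrightarrow> g2 x \<noteq> 0 \<and> g x = g1 x / g2 x"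
    using assms(2) by (elim ratiosE) blast
  have "(\<lambda>x. f1 x * g1 x) \<in> G (d + e)" "(\<lambda>x. f2 x * g2 x) \<in> G (d + e)"
    by (intro mult f g)+
  moreover have "f2 x * g2 x \<noteq> 0 \<and> f x * g x = (f1 x * g1 x) / (f2 x * g2 x)"
    if "x \<in> P" for x using f(3)[OF that] g(3)[OF that] by (simp add: field_simps)
  ultimately show ?thesis by (rule ratiosI)
qed

lemma ratios_inverse:
  assumes "f \<in> ratios G P" "\<And>x. x \<in> P \<Longrightarrow> f x \<noteq> 0" shows "(\<lambda>x. inverse (f x)) \<in> ratios G P"
proof -
  obtain d f1 f2 where f: "f1 \<in> G d" "f2 \<in> G d" "\<And>x. x \<in> P \<Longrightarrow> f2 x \<noteq> 0 \<and> f x = f1 x / f2 x"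
    using assms(1) by (elim ratiosE) blast
  have "f1 x \<noteq> 0 \<and> inverse (f x) = f2 x / f1 x" if "x \<in> P" for x
    using f(3)[OF that] assms(2)[OF that] by auto
  with f show ?thesis by (intro ratiosI)
qed

lemma ratios_divide:
  assumes "f \<in> ratios G P" "g \<in> ratios G P" "\<And>x. x \<in> P \<Longrightarrow> g x \<noteq> 0"
  shows "(\<lambda>x. f x / g x) \<in> ratios G P"
  unfolding divide_inverse by (intro ratios_mult ratios_inverse assms)

lemma ratios_cmult: "f \<in> ratios G P \<Longrightarrow> (\<lambda>x. c * f x) \<in> ratios G P"
  by (intro ratios_mult ratios_const)

lemma ratios_uminus: "f \<in> ratios G P \<Longrightarrow> (\<lambda>x. - f x) \<in> ratios G P"
  using ratios_cmult[of f P "-1"] by simp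

lemma ratios_diff: "f \<in> ratios G P \<Longrightarrow> g \<in> ratios G P \<Longrightarrow> (\<lambda>x. f x - g x) \<in> ratios G P"
  using ratios_add[of f P "\<lambda>x. - g x"] ratios_uminus by simp

lemma ratios_sum: "(\<And>i. i \<in> A \<Longrightarrow> f i \<in> ratios G P) \<Longrightarrow> (\<lambda>x. \<Sum>i\<in>A. f i x) \<in> ratios G P"
  by (induction A rule: infinite_finite_induct) (auto intro: ratios_const ratios_add)

lemma ratios_prod: "(\<And>i. i \<in> A \<Longrightarrow> f i \<in> ratios G P) \<Longrightarrow> (\<lambda>x. \<Prod>i\<in>A. f i x) \<in> ratios G P"
  by (induction A rule: infinite_finite_induct) (auto intro: ratios_const ratios_mult)

text \<open>
  Non-vanishing loci form a base, and not only a subbase, because products of homogeneous elements are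
  homogeneous.
\<close>

lemma openin_graded_base:
  assumes "openin (graded_topology G P) W" "x \<in> W"
  shows "\<exists>d. \<exists>g \<in> G d. x \<in> P \<and> g x \<noteq> 0 \<and> {y \<in> P. g y \<noteq> 0} \<subseteq> W"
proof -
  let ?B = "{{x \<in> P. g x \<noteq> 0} | g. \<exists>d. g \<in> G d}"
  have "\<exists>B \<in> ?B. x \<in> B \<and> B \<subseteq> W"
  proof (rule topology_generated_by_base[OF _ _ assms[unfolded graded_topology_def]])
    fix A B x assume AB: "A \<in> ?B" "B \<in> ?B" "x \<in> A" "x \<in> B"
    obtain d f where f: "f \<in> G d" "A = {x \<in> P. f x \<noteq> 0}" using AB(1) by blast
    obtain e g where g: "g \<in> G e" "B = {x \<in> P. g x \<noteq> 0}" using AB(2) by blast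
    have "A \<inter> B = {x \<in> P. f x * g x \<noteq> 0}" using f g by auto
    with mult[OF f(1) g(1)] have "A \<inter> B \<in> ?B"
      by (intro CollectI exI[of _ "\<lambda>x. f x * g x"] conjI exI[of _ "d + e"])
    with AB(3,4) show "\<exists>D \<in> ?B. x \<in> D \<and> D \<subseteq> A \<inter> B" by (intro bexI[of _ "A \<inter> B"]) auto
  next
    fix A x assume "A \<in> ?B" "x \<in> A"
    then show "\<exists>B \<in> ?B. x \<in> B \<and> B \<subseteq> A" by (intro bexI[of _ A]) auto
  qed
  then show ?thesis by blast
qed

lemma topspace_graded_topology [simp]: "topspace (graded_topology G P) = P"
proof -
  have "openin (graded_topology G P) {x \<in> P. 1 \<noteq> (0::complex)}"
    using const[of 1] by (rule open_nonvanishing_graded)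
  then have "P \<subseteq> topspace (graded_topology G P)" by (simp add: openin_subset)
  then show ?thesis
    unfolding graded_topology_def topology_generated_by_topspace by auto
qed

lemma points_graded_fspace [simp]: "points (graded_fspace G P) = P"
  by (simp add: graded_fspace_def)

lemma ratios_regular:
  assumes "openin (graded_topology G P) W" "f \<in> ratios G W"
  shows "f \<in> regular (graded_fspace G P) W"
  using assms unfolding graded_fspace_def locally_on_def by auto

end

section \<open>Morphisms between spaces of fractions\<close>

lemma morphism_compose:
  assumes "morphism X Y f" "morphism Y Z g"
  shows "morphism X Z (\<lambda>x. g (f x))"
  unfolding morphism_def
proof (intro conjI allI ballI)
  show "continuous_map (ztop X) (ztop Z) (\<lambda>x. g (f x))"
    using assms continuous_map_compose[of "ztop X" "ztop Y" f "ztop Z" g]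
    by (simp add: morphism_def o_def)
  fix W h assume "h \<in> regular Z W"
  then have "h \<circ> g \<in> regular Y {x \<in> points Y. g x \<in> W}"
    using assms(2) by (simp add: morphism_def)
  then have "h \<circ> g \<circ> f \<in> regular X {x \<in> points X. f x \<in> {x \<in> points Y. g x \<in> W}}"
    using assms(1) unfolding morphism_def by blast
  moreover have "{x \<in> points X. f x \<in> {x \<in> points Y. g x \<in> W}} = {x \<in> points X. g (f x) \<in> W}"
    using assms(1) by (auto simp: morphism_def continuous_map_def)
  moreover have "h \<circ> g \<circ> f = h \<circ> (\<lambda>x. g (f x))" by auto
  ultimately show "h \<circ> (\<lambda>x. g (f x)) \<in> regular X {x \<in> points X. g (f x) \<in> W}"
    by simp
qed

lemma morphism_points: "morphism X Y f \<Longrightarrow> x \<in> points X \<Longrightarrow> f x \<in> points Y"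
  by (auto simp: morphism_def continuous_map_def)

lemma isomorphic_sym: "X \<cong>\<^sub>v Y \<Longrightarrow> Y \<cong>\<^sub>v X"
  unfolding isomorphic_def by blast

lemma isomorphic_trans:
  assumes "X \<cong>\<^sub>v Y" "Y \<cong>\<^sub>v Z" shows "X \<cong>\<^sub>v Z"
proof -
  obtain f f' where f: "morphism X Y f" "morphism Y X f'"
    "\<forall>x \<in> points X. f' (f x) = x" "\<forall>y \<in> points Y. f (f' y) = y"
    using assms(1) unfolding isomorphic_def by blast
  obtain g g' where g: "morphism Y Z g" "morphism Z Y g'"
    "\<forall>x \<in> points Y. g' (g x) = x" "\<forall>y \<in> points Z. g (g' y) = y"
    using assms(2) unfolding isomorphic_def by blast
  have "morphism X Z (\<lambda>x. g (f x))" "morphism Z X (\<lambda>x. f' (g' x))"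
    using morphism_compose f g by metis+
  moreover have "f' (g' (g (f x))) = x" if "x \<in> points X" for x
    using that f g morphism_points[OF f(1)] by metis
  moreover have "g (f (f' (g' x))) = x" if "x \<in> points Z" for x
    using that f g morphism_points[OF g(2)] by metis
  ultimately show ?thesis unfolding isomorphic_def by blast
qed

text \<open>
  Two presentations of the same variety on the same set of points. The presentations need not be equal:
  a regular function is a total function that matters on an open set only.
\<close>

definition same_structure :: "'a fspace \<Rightarrow> 'a fspace \<Rightarrow> bool" where
  "same_structure X Y \<longleftrightarrow> morphism X Y (\<lambda>x. x) \<and> morphism Y X (\<lambda>x. x)"

lemma same_structure_isomorphic: "same_structure X Y \<Longrightarrow> X \<cong>\<^sub>v Y"
  unfolding same_structure_def isomorphic_def by blast

lemma same_structure_points: "same_structure X Y \<Longrightarrow> points X = points Y"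
  using morphism_points[of X Y "\<lambda>x. x"] morphism_points[of Y X "\<lambda>x. x"]
  by (auto simp: same_structure_def)

lemma continuous_id_openin:
  assumes "continuous_map S T (\<lambda>x. x)" "topspace S = topspace T" "openin T U"
  shows "openin S U"
proof -
  have "openin S {x \<in> topspace S. x \<in> U}" using assms by (auto simp: continuous_map_def)
  moreover have "{x \<in> topspace S. x \<in> U} = U" using assms openin_subset by blast
  ultimately show ?thesis by simp
qed

lemma same_structure_ztop: 
  assumes "same_structure X Y" shows "ztop X = ztop Y"
proof -
  have "openin (ztop X) U = openin (ztop Y) U" for U
    using continuous_id_openin[of "ztop X" "ztop Y" U] continuous_id_openin[of "ztop Y" "ztop X" U]
      assms same_structure_points[OF assms] by (auto simp: same_structure_def morphism_def)
  then show ?thesis by (simp add: topology_eq)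
qed

lemma same_structure_zariski_locally_closed:
  "same_structure X Y \<Longrightarrow> zariski_locally_closed X Z = zariski_locally_closed Y Z"
  by (simp add: zariski_locally_closed_def same_structure_ztop)

lemma same_structure_regular:
  assumes "same_structure X Y" "f \<in> regular Y W" "W \<subseteq> points Y"
  shows "f \<in> regular X W"
proof -
  have "f \<circ> (\<lambda>x. x) \<in> regular X {x \<in> points X. x \<in> W}"
    using assms by (simp add: same_structure_def morphism_def)
  moreover have "{x \<in> points X. x \<in> W} = W" using assms same_structure_points by blast
  ultimately show ?thesis by (simp add: o_def)
qed

text \<open>
  Homogeneous elements of degree \<open>d\<close> pull back to fractions of one degree \<open>c\<close> times an arbitrary factor
  \<open>u\<close> without zeros. The factor is the change of representatives of the points; it cancels in fractions
  and leaves zero loci alone.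
\<close>

lemma morphism_gradedI:
  assumes "graded_algebra G" "graded_algebra H" and \<phi>: "\<And>x. x \<in> P \<Longrightarrow> \<phi> x \<in> Q"
    and *: "\<And>d. \<exists>u c. (\<forall>x \<in> P. u x \<noteq> 0) \<and> (\<forall>h \<in> H d. \<exists>e. \<exists>g \<in> G (e + c). \<exists>k \<in> G e.
               \<forall>x \<in> P. k x \<noteq> 0 \<and> h (\<phi> x) = u x * g x / k x)"
  shows "morphism (graded_fspace G P) (graded_fspace H Q) \<phi>"
proof -
  interpret G: graded_algebra G by fact
  interpret H: graded_algebra H by fact
  have nonvan: "openin (graded_topology G P) {x \<in> P. h (\<phi> x) \<noteq> 0}" if hh: "h \<in> H d" for h d
  proof -
    obtain u c where u: "\<forall>x \<in> P. u x \<noteq> 0" "\<forall>h \<in> H d. \<exists>e. \<exists>g \<in> G (e + c). \<exists>k \<in> G e.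
               \<forall>x \<in> P. k x \<noteq> 0 \<and> h (\<phi> x) = u x * g x / k x" using *[of d] by (elim exE conjE)
    obtain e g k where g: "g \<in> G (e + c)" "\<forall>x \<in> P. k x \<noteq> 0 \<and> h (\<phi> x) = u x * g x / k x"
      using bspec[OF u(2) hh] by (elim exE bexE) (rule that)
    then have "{x \<in> P. h (\<phi> x) \<noteq> 0} = {x \<in> P. g x \<noteq> 0}" using u by auto
    with g(1) open_nonvanishing_graded show ?thesis by metis
  qed
  have cont: "continuous_map (graded_topology G P) (graded_topology H Q) \<phi>"
    unfolding graded_topology_def[of H]
  proof (rule continuous_on_generated_topo)
    fix U assume "U \<in> {{x \<in> Q. g x \<noteq> 0} | g. \<exists>d. g \<in> H d}"
    then obtain h d where h: "h \<in> H d" "U = {x \<in> Q. h x \<noteq> 0}" by blast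
    have "\<phi> -` U \<inter> topspace (graded_topology G P) = {x \<in> P. h (\<phi> x) \<noteq> 0}" using \<phi> h by auto
    with nonvan h show "openin (graded_topology G P) (\<phi> -` U \<inter> topspace (graded_topology G P))" by simp
  next
    have "\<Union> {{x \<in> Q. g x \<noteq> 0} | g. \<exists>d. g \<in> H d} = topspace (graded_topology H Q)"
      unfolding graded_topology_def by (simp only: topology_generated_by_topspace)
    then show "\<phi> ` topspace (graded_topology G P) \<subseteq> \<Union> {{x \<in> Q. g x \<noteq> 0} | g. \<exists>d. g \<in> H d}"
      using \<phi> by auto
  qed
  show ?thesis
    unfolding morphism_def
  proof (intro conjI allI ballI)
    show "continuous_map (ztop (graded_fspace G P)) (ztop (graded_fspace H Q)) \<phi>"
      using cont by (simp add: graded_fspace_def)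
    fix W f assume f: "f \<in> regular (graded_fspace H Q) W"
    have preim: "openin (graded_topology G P) {x \<in> P. \<phi> x \<in> W'}" if "openin (graded_topology H Q) W'" for W'
      using that cont by (auto simp: continuous_map_def)
    have "\<exists>W'. openin (graded_topology G P) W' \<and> x \<in> W' \<and> W' \<subseteq> {x \<in> P. \<phi> x \<in> W} \<and> f \<circ> \<phi> \<in> ratios G W'"
      if x: "x \<in> P" "\<phi> x \<in> W" for x
    proof -
      obtain W' where W': "openin (graded_topology H Q) W'" "\<phi> x \<in> W'" "W' \<subseteq> W" "f \<in> ratios H W'"
        using f x unfolding graded_fspace_def locally_on_def by auto
      obtain d h1 h2 where h: "h1 \<in> H d" "h2 \<in> H d" "\<And>y. y \<in> W' \<Longrightarrow> h2 y \<noteq> 0 \<and> f y = h1 y / h2 y"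
        using W'(4) by (elim ratiosE) blast
      obtain u c where u: "\<forall>x \<in> P. u x \<noteq> 0" "\<forall>h \<in> H d. \<exists>e. \<exists>g \<in> G (e + c). \<exists>k \<in> G e.
               \<forall>x \<in> P. k x \<noteq> 0 \<and> h (\<phi> x) = u x * g x / k x" using *[of d] by (elim exE conjE)
      obtain e1 g1 k1 where 1: "g1 \<in> G (e1 + c)" "k1 \<in> G e1" "\<forall>x \<in> P. k1 x \<noteq> 0 \<and> h1 (\<phi> x) = u x * g1 x / k1 x"
        using bspec[OF u(2) h(1)] by (elim exE bexE) (rule that)
      obtain e2 g2 k2 where 2: "g2 \<in> G (e2 + c)" "k2 \<in> G e2" "\<forall>x \<in> P. k2 x \<noteq> 0 \<and> h2 (\<phi> x) = u x * g2 x / k2 x"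
        using bspec[OF u(2) h(2)] by (elim exE bexE) (rule that)
      let ?W = "{x \<in> P. \<phi> x \<in> W'}"
      have "(\<lambda>x. g1 x * k2 x) \<in> G (e1 + c + e2)" "(\<lambda>x. k1 x * g2 x) \<in> G (e1 + (e2 + c))"
        by (intro G.mult 1 2)+
      then have "(\<lambda>x. g1 x * k2 x) \<in> G (e1 + c + e2)" "(\<lambda>x. k1 x * g2 x) \<in> G (e1 + c + e2)"
        by (simp_all add: algebra_simps)
      moreover have "k1 y * g2 y \<noteq> 0 \<and> (f \<circ> \<phi>) y = (g1 y * k2 y) / (k1 y * g2 y)" if "y \<in> ?W" for y
      proof -
        have "h2 (\<phi> y) \<noteq> 0" "f (\<phi> y) = h1 (\<phi> y) / h2 (\<phi> y)" using h(3)[of "\<phi> y"] that by auto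
        then show ?thesis using 1(3) 2(3) u(1) that by (auto simp: field_simps)
      qed
      ultimately have "f \<circ> \<phi> \<in> ratios G ?W" by (rule ratiosI)
      with preim[OF W'(1)] x W' show ?thesis by blast
    qed
    moreover have "openin (graded_topology H Q) W"
      using f unfolding graded_fspace_def locally_on_def by auto
    ultimately show "f \<circ> \<phi> \<in> regular (graded_fspace G P) {x \<in> points (graded_fspace G P). \<phi> x \<in> W}"
      using preim unfolding G.points_graded_fspace by (auto simp: graded_fspace_def locally_on_def)
  qed
qed

text \<open>
  The case \<open>c = 0\<close>, for maps into an affine variety and for maps between normalized representatives.
\<close>

lemma morphism_graded_ratiosI:
  assumes "graded_algebra G" "graded_algebra H" and "\<And>x. x \<in> P \<Longrightarrow> \<phi> x \<in> Q"
    and *: "\<And>d. \<exists>u. (\<forall>x \<in> P. u x \<noteq> 0) \<and> (\<forall>h \<in> H d. \<exists>f \<in> ratios G P. \<forall>x \<in> P. h (\<phi> x) = u x * f x)"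
  shows "morphism (graded_fspace G P) (graded_fspace H Q) \<phi>"
proof (rule morphism_gradedI[OF assms(1-3)])
  fix d
  obtain u where u: "\<forall>x \<in> P. u x \<noteq> 0" "\<forall>h \<in> H d. \<exists>f \<in> ratios G P. \<forall>x \<in> P. h (\<phi> x) = u x * f x"
    using *[of d] by (elim exE conjE)
  have "\<exists>e. \<exists>g \<in> G (e + 0). \<exists>k \<in> G e. \<forall>x \<in> P. k x \<noteq> 0 \<and> h (\<phi> x) = u x * g x / k x" if h: "h \<in> H d" for h
  proof -
    obtain f where "f \<in> ratios G P" "\<forall>x \<in> P. h (\<phi> x) = u x * f x" using bspec[OF u(2) h] by (elim bexE)
    then obtain e g k where "g \<in> G e" "k \<in> G e" "\<And>x. x \<in> P \<Longrightarrow> k x \<noteq> 0 \<and> h (\<phi> x) = u x * g x / k x"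
      by (elim ratiosE) auto
    then show ?thesis by (intro exI[of _ e] bexI[of _ g] bexI[of _ k]) auto
  qed
  with u(1) show "\<exists>u c. (\<forall>x \<in> P. u x \<noteq> 0) \<and> (\<forall>h \<in> H d. \<exists>e. \<exists>g \<in> G (e + c). \<exists>k \<in> G e.
               \<forall>x \<in> P. k x \<noteq> 0 \<and> h (\<phi> x) = u x * g x / k x)" by blast
qed

text \<open>
  The case of a homomorphism of graded algebras, up to the change of representatives.
\<close>

lemma morphism_graded_directI:
  assumes "graded_algebra G" "graded_algebra H" and "\<And>x. x \<in> P \<Longrightarrow> \<phi> x \<in> Q"
    and *: "\<And>d. \<exists>u. (\<forall>x \<in> P. u x \<noteq> 0) \<and> (\<forall>h \<in> H d. \<exists>g \<in> G d. \<forall>x \<in> P. h (\<phi> x) = u x * g x)"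
  shows "morphism (graded_fspace G P) (graded_fspace H Q) \<phi>"
proof (rule morphism_gradedI[OF assms(1-3)])
  fix d
  obtain u where u: "\<forall>x \<in> P. u x \<noteq> 0" "\<forall>h \<in> H d. \<exists>g \<in> G d. \<forall>x \<in> P. h (\<phi> x) = u x * g x"
    using *[of d] by (elim exE conjE)
  have "\<exists>e. \<exists>g \<in> G (e + d). \<exists>k \<in> G e. \<forall>x \<in> P. k x \<noteq> 0 \<and> h (\<phi> x) = u x * g x / k x" if h: "h \<in> H d" for h
  proof -
    obtain g where "g \<in> G d" "\<forall>x \<in> P. h (\<phi> x) = u x * g x" using bspec[OF u(2) h] by (elim bexE)
    then show ?thesis
      by (intro exI[of _ 0] bexI[of _ g] bexI[of _ "\<lambda>_. 1"]) 
        (auto intro: graded_algebra.const[OF assms(1)])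
  qed
  with u(1) show "\<exists>u c. (\<forall>x \<in> P. u x \<noteq> 0) \<and> (\<forall>h \<in> H d. \<exists>e. \<exists>g \<in> G (e + c). \<exists>k \<in> G e.
               \<forall>x \<in> P. k x \<noteq> 0 \<and> h (\<phi> x) = u x * g x / k x)" by blast
qed

lemma ztop_induced_fspace: "ztop (induced_fspace A \<phi> X) = pullback_topology A \<phi> (ztop X)"
  by (simp add: induced_fspace_def Let_def)

lemma regular_induced_fspace:
  "regular (induced_fspace A \<phi> X) = locally_on (pullback_topology A \<phi> (ztop X))
     (\<lambda>W f. \<exists>V. \<exists>g \<in> regular X V. \<forall>x \<in> W. \<phi> x \<in> V \<and> f x = g (\<phi> x))"
  by (simp add: induced_fspace_def Let_def)

section \<open>Induced structures and locally closed subsets\<close>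

definition pulled_back :: "('a \<Rightarrow> 'b) \<Rightarrow> (nat \<Rightarrow> ('b \<Rightarrow> complex) set) \<Rightarrow> nat \<Rightarrow> ('a \<Rightarrow> complex) set" where
  "pulled_back \<phi> G d = (\<lambda>g x. g (\<phi> x)) ` G d"

lemma pulled_backI: "g \<in> G d \<Longrightarrow> (\<lambda>x. g (\<phi> x)) \<in> pulled_back \<phi> G d"
  unfolding pulled_back_def by (rule imageI)

lemma pulled_backE:
  assumes "f \<in> pulled_back \<phi> G d" obtains g where "g \<in> G d" "f = (\<lambda>x. g (\<phi> x))"
  using assms unfolding pulled_back_def by (elim imageE) (rule that)

lemma pulled_back_id: "pulled_back (\<lambda>x. x) G = G"
  by (simp add: pulled_back_def fun_eq_iff)

lemma (in graded_algebra) graded_algebra_pulled_back: "graded_algebra (pulled_back \<phi> G)"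
proof
  show "(\<lambda>_. c) \<in> pulled_back \<phi> G 0" for c
    using pulled_backI[of "\<lambda>_. c" G 0 \<phi>] const by simp
  show "(\<lambda>x. f x + g x) \<in> pulled_back \<phi> G d"
    if "f \<in> pulled_back \<phi> G d" "g \<in> pulled_back \<phi> G d" for f g d
    using that by (elim pulled_backE) (auto intro: pulled_backI[of "\<lambda>x. _ x + _ x"] add)
  show "(\<lambda>x. f x * g x) \<in> pulled_back \<phi> G (d + e)"
    if "f \<in> pulled_back \<phi> G d" "g \<in> pulled_back \<phi> G e" for f g d e
    using that by (elim pulled_backE) (auto intro: pulled_backI[of "\<lambda>x. _ x * _ x"] mult)
qed

text \<open>
  The structure induced by a map into a graded space is the graded space of the pulled back algebra.
  This covers both subvarieties and the Pluecker embedding.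
\<close>

lemma same_structure_induced:
  assumes X: "same_structure X (graded_fspace G P)" and G: "graded_algebra G" and A: "\<phi> ` A \<subseteq> P"
  shows "same_structure (induced_fspace A \<phi> X) (graded_fspace (pulled_back \<phi> G) A)"
proof -
  interpret G: graded_algebra G by fact
  let ?H = "pulled_back \<phi> G"
  have H: "graded_algebra ?H" by (rule G.graded_algebra_pulled_back)
  interpret H: graded_algebra ?H by fact
  have zt: "ztop X = graded_topology G P" using same_structure_ztop[OF X] by (simp add: graded_fspace_def)
  have ptsX: "points X = P" using zt by simp
  have pts: "points (induced_fspace A \<phi> X) = A" using A by (auto simp: points_induced_fspace ptsX)
  have "morphism (graded_fspace ?H A) (graded_fspace G P) \<phi>"
  proof (rule morphism_graded_directI[OF H G])
    show "\<phi> x \<in> P" if "x \<in> A" for x using that A by blast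
    show "\<exists>u. (\<forall>x \<in> A. u x \<noteq> 0) \<and> (\<forall>h \<in> G d. \<exists>g \<in> ?H d. \<forall>x \<in> A. h (\<phi> x) = u x * g x)" for d
      by (rule exI[of _ "\<lambda>_. 1"]) (auto intro!: bexI[OF _ pulled_backI])
  qed
  moreover have "morphism (graded_fspace G P) X (\<lambda>x. x)" using X by (simp add: same_structure_def)
  ultimately have m: "morphism (graded_fspace ?H A) X \<phi>" using morphism_compose by blast
  have A_open: "openin (graded_topology ?H A) {x \<in> A. \<phi> x \<in> V}" if "openin (ztop X) V" for V
  proof -
    have "openin (ztop (graded_fspace ?H A)) {x \<in> points (graded_fspace ?H A). \<phi> x \<in> V}"
      using m that unfolding morphism_def continuous_map_def by blast
    then show ?thesis unfolding H.points_graded_fspace by (simp add: graded_fspace_def)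
  qed
  have open1: "openin (graded_topology ?H A) W" if W: "openin (pullback_topology A \<phi> (ztop X)) W" for W
  proof -
    obtain V where V: "openin (ztop X) V" "W = \<phi> -` V \<inter> A"
      using W by (auto simp: openin_pullback_topology)
    have "W = {x \<in> A. \<phi> x \<in> V}" using V by blast
    with A_open[OF V(1)] show ?thesis by simp
  qed
  have open2: "openin (pullback_topology A \<phi> (ztop X)) W" if W: "openin (graded_topology ?H A) W" for W
  proof (subst openin_subopen, intro ballI)
    fix x assume "x \<in> W"
    then obtain d h where h: "h \<in> ?H d" "x \<in> A" "h x \<noteq> 0" "{y \<in> A. h y \<noteq> 0} \<subseteq> W"
      using H.openin_graded_base[OF W] by blast
    obtain g where g: "g \<in> G d" "h = (\<lambda>x. g (\<phi> x))" using h(1) by (rule pulled_backE)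
    have "openin (ztop X) {y \<in> P. g y \<noteq> 0}" using g(1) open_nonvanishing_graded zt by metis
    moreover have "{y \<in> A. h y \<noteq> 0} = \<phi> -` {y \<in> P. g y \<noteq> 0} \<inter> A" using A g by auto
    ultimately have "openin (pullback_topology A \<phi> (ztop X)) {y \<in> A. h y \<noteq> 0}"
      unfolding openin_pullback_topology by blast
    then show "\<exists>T. openin (pullback_topology A \<phi> (ztop X)) T \<and> x \<in> T \<and> T \<subseteq> W" using h by blast
  qed
  have top: "pullback_topology A \<phi> (ztop X) = graded_topology ?H A"
    using open1 open2 by (auto simp: topology_eq)
  have reg1: "f \<in> regular (graded_fspace ?H A) W" if f: "f \<in> regular (induced_fspace A \<phi> X) W" for f W
  proof -
    have W: "openin (graded_topology ?H A) W"
      using f by (simp add: regular_induced_fspace locally_on_def top)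
    have "\<exists>W''. openin (graded_topology ?H A) W'' \<and> x \<in> W'' \<and> W'' \<subseteq> W \<and> f \<in> ratios ?H W''" if x: "x \<in> W" for x
    proof -
      obtain W' V g where W': "openin (graded_topology ?H A) W'" "x \<in> W'" "W' \<subseteq> W"
        and g: "g \<in> regular X V" "\<forall>x \<in> W'. \<phi> x \<in> V \<and> f x = g (\<phi> x)"
        using f x by (auto simp: regular_induced_fspace locally_on_def top)
      have W'A: "W' \<subseteq> A" using openin_subset[OF W'(1)] by simp
      have "g \<circ> \<phi> \<in> regular (graded_fspace ?H A) {x \<in> points (graded_fspace ?H A). \<phi> x \<in> V}"
        using m g(1) by (simp add: morphism_def)
      then obtain W2 where W2: "openin (graded_topology ?H A) W2" "x \<in> W2" "g \<circ> \<phi> \<in> ratios ?H W2"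
        using W' W'A g(2) unfolding H.points_graded_fspace by (auto simp: graded_fspace_def locally_on_def)
      have "f \<in> ratios ?H (W' \<inter> W2)"
        by (rule ratios_cong[OF ratios_mono[OF W2(3)]]) (use g(2) in auto)
      then show ?thesis using W' W2 openin_Int by blast
    qed
    with W show ?thesis by (auto simp: graded_fspace_def locally_on_def)
  qed
  have reg2: "f \<in> regular (induced_fspace A \<phi> X) W" if f: "f \<in> regular (graded_fspace ?H A) W" for f W
  proof -
    have W: "openin (graded_topology ?H A) W"
      using f by (simp add: graded_fspace_def locally_on_def)
    have "\<exists>W'. openin (graded_topology ?H A) W' \<and> x \<in> W' \<and> W' \<subseteq> W \<and>
        (\<exists>V. \<exists>g \<in> regular X V. \<forall>x \<in> W'. \<phi> x \<in> V \<and> f x = g (\<phi> x))" if x: "x \<in> W" for x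
    proof -
      obtain W' where W': "openin (graded_topology ?H A) W'" "x \<in> W'" "W' \<subseteq> W" "f \<in> ratios ?H W'"
        using f x by (auto simp: graded_fspace_def locally_on_def)
      have W'A: "W' \<subseteq> A" using openin_subset[OF W'(1)] by simp
      obtain d h1 h2 where h: "h1 \<in> ?H d" "h2 \<in> ?H d" "\<And>y. y \<in> W' \<Longrightarrow> h2 y \<noteq> 0 \<and> f y = h1 y / h2 y"
        using W'(4) by (elim ratiosE) blast
      obtain g1 g2 where g: "g1 \<in> G d" "g2 \<in> G d" "h1 = (\<lambda>x. g1 (\<phi> x))" "h2 = (\<lambda>x. g2 (\<phi> x))"
        using h(1,2) by (elim pulled_backE) (rule that)
      let ?V = "{y \<in> P. g2 y \<noteq> 0}"
      have V: "openin (graded_topology G P) ?V" using g(2) by (rule open_nonvanishing_graded)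
      have "(\<lambda>y. g1 y / g2 y) \<in> ratios G ?V" using g(1,2) by (rule ratiosI) auto
      then have "(\<lambda>y. g1 y / g2 y) \<in> regular (graded_fspace G P) ?V"
        using V by (intro G.ratios_regular)
      then have "(\<lambda>y. g1 y / g2 y) \<in> regular X ?V"
        using X by (rule_tac same_structure_regular[of X "graded_fspace G P"]) auto
      moreover have "\<forall>x \<in> W'. \<phi> x \<in> ?V \<and> f x = (\<lambda>y. g1 y / g2 y) (\<phi> x)"
        using h(3) g(3,4) W'A A by auto
      ultimately show ?thesis using W'(1-3) by (intro exI[of _ W'] conjI exI[of _ ?V] bexI)
    qed
    with W show ?thesis by (auto simp: regular_induced_fspace locally_on_def top)
  qed
  have sub: "{x \<in> A. x \<in> W} = W" if "openin (graded_topology ?H A) W" for W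
    using openin_subset[OF that] by auto
  show "same_structure (induced_fspace A \<phi> X) (graded_fspace ?H A)"
    unfolding same_structure_def morphism_def pts H.points_graded_fspace
  proof (intro conjI allI ballI)
    have e: "ztop (induced_fspace A \<phi> X) = ztop (graded_fspace ?H A)"
      by (simp add: ztop_induced_fspace top graded_fspace_def)
    show "continuous_map (ztop (induced_fspace A \<phi> X)) (ztop (graded_fspace ?H A)) (\<lambda>x. x)"
      "continuous_map (ztop (graded_fspace ?H A)) (ztop (induced_fspace A \<phi> X)) (\<lambda>x. x)"
      by (simp_all add: e)
    fix W f
    { assume f: "f \<in> regular (graded_fspace ?H A) W"
      then have "openin (graded_topology ?H A) W" by (simp add: graded_fspace_def locally_on_def)
      with reg2[OF f] sub show "f \<circ> (\<lambda>x. x) \<in> regular (induced_fspace A \<phi> X) {x \<in> A. x \<in> W}"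
        by (simp add: o_def) }
    { assume f: "f \<in> regular (induced_fspace A \<phi> X) W"
      then have "openin (graded_topology ?H A) W" by (simp add: regular_induced_fspace locally_on_def top)
      with reg1[OF f] sub show "f \<circ> (\<lambda>x. x) \<in> regular (graded_fspace ?H A) {x \<in> A. x \<in> W}"
        by (simp add: o_def) }
  qed
qed

lemma same_structure_refl: "graded_algebra G \<Longrightarrow> same_structure (graded_fspace G P) (graded_fspace G P)"
  by (auto simp: same_structure_def intro!: morphism_graded_directI exI[of _ "\<lambda>_. 1"])

lemma same_structure_subvariety:
  assumes "same_structure X (graded_fspace G P)" "graded_algebra G" "Z \<subseteq> P"
  shows "same_structure (subvariety X Z) (graded_fspace G Z)"
  using same_structure_induced[of X G P "\<lambda>x. x" Z] assms by (simp add: pulled_back_id)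

context graded_algebra
begin

definition loc_closed :: "'a set \<Rightarrow> 'a set \<Rightarrow> bool" where
  "loc_closed P Z \<longleftrightarrow> zariski_locally_closed (graded_fspace G P) Z"

lemma ztop_graded_fspace [simp]: "ztop (graded_fspace G P) = graded_topology G P"
  by (simp add: graded_fspace_def)

lemma loc_closed_subset: "loc_closed P Z \<Longrightarrow> Z \<subseteq> P"
  unfolding loc_closed_def zariski_locally_closed_def using openin_subset by fastforce

lemma loc_closed_refl: "loc_closed P P"
proof -
  have "openin (graded_topology G P) P" "closedin (graded_topology G P) P"
    using openin_topspace[of "graded_topology G P"] closedin_topspace[of "graded_topology G P"] by simp_all
  then show ?thesis unfolding loc_closed_def zariski_locally_closed_def by auto
qed

lemma loc_closed_Int:
  assumes "loc_closed P Y" "loc_closed P Z" shows "loc_closed P (Y \<inter> Z)"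
proof -
  let ?T = "graded_topology G P"
  obtain A B where Y: "openin ?T A" "closedin ?T B" "Y = A \<inter> B"
    using assms(1) unfolding loc_closed_def zariski_locally_closed_def by auto
  obtain C D where Z: "openin ?T C" "closedin ?T D" "Z = C \<inter> D"
    using assms(2) unfolding loc_closed_def zariski_locally_closed_def by auto
  have "openin ?T (A \<inter> C)" "closedin ?T (B \<inter> D)" "Y \<inter> Z = (A \<inter> C) \<inter> (B \<inter> D)" using Y Z by auto
  then show ?thesis unfolding loc_closed_def zariski_locally_closed_def by auto
qed

lemma loc_closed_homogeneous_nonzero:
  assumes "f \<in> G d" shows "loc_closed P {x \<in> P. f x \<noteq> 0}"
proof -
  have "closedin (graded_topology G P) P" using closedin_topspace[of "graded_topology G P"] by simp
  moreover have "openin (graded_topology G P) {x \<in> P. f x \<noteq> 0}"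
    using assms by (rule open_nonvanishing_graded)
  ultimately show ?thesis
    unfolding loc_closed_def zariski_locally_closed_def ztop_graded_fspace by blast
qed

lemma loc_closed_homogeneous_zeros:
  assumes "\<And>i. i \<in> I \<Longrightarrow> f i \<in> G (d i)" shows "loc_closed P {x \<in> P. \<forall>i \<in> I. f i x = 0}"
proof -
  have op: "openin (graded_topology G P) P" using openin_topspace[of "graded_topology G P"] by simp
  have "openin (graded_topology G P) {x \<in> P. f i x \<noteq> 0}" if "i \<in> I" for i
    using assms[OF that] by (rule open_nonvanishing_graded)
  then have "openin (graded_topology G P) (\<Union>i\<in>I. {x \<in> P. f i x \<noteq> 0})"
    by (intro openin_Union) blast
  then have "closedin (graded_topology G P) (P - (\<Union>i\<in>I. {x \<in> P. f i x \<noteq> 0}))"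
    using closedin_topspace[of "graded_topology G P"] by (intro closedin_diff) simp_all
  moreover have "P - (\<Union>i\<in>I. {x \<in> P. f i x \<noteq> 0}) = {x \<in> P. \<forall>i \<in> I. f i x = 0}" by blast
  ultimately show ?thesis
    unfolding loc_closed_def zariski_locally_closed_def ztop_graded_fspace using op by blast
qed

lemma loc_closed_nonzero:
  assumes "loc_closed P Z" "f \<in> ratios G Z" shows "loc_closed P {x \<in> Z. f x \<noteq> 0}"
proof -
  obtain d f1 f2 where f: "f1 \<in> G d" "f2 \<in> G d" "\<And>x. x \<in> Z \<Longrightarrow> f2 x \<noteq> 0 \<and> f x = f1 x / f2 x"
    using assms(2) by (elim ratiosE) blast
  have "{x \<in> Z. f x \<noteq> 0} = Z \<inter> {x \<in> P. f1 x \<noteq> 0}"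
    using f(3) loc_closed_subset[OF assms(1)] by auto
  then show ?thesis using loc_closed_Int[OF assms(1) loc_closed_homogeneous_nonzero[OF f(1)]] by simp
qed

lemma loc_closed_zeros:
  assumes "loc_closed P Z" "\<And>i. i \<in> I \<Longrightarrow> f i \<in> ratios G Z"
  shows "loc_closed P {x \<in> Z. \<forall>i \<in> I. f i x = 0}"
proof -
  have "\<exists>g d. g \<in> G d \<and> (\<forall>x \<in> Z. f i x = 0 \<longleftrightarrow> g x = 0)" if "i \<in> I" for i
    using assms(2)[OF that] by (elim ratiosE) fastforce
  then obtain g d where g: "\<And>i. i \<in> I \<Longrightarrow> g i \<in> G (d i)" "\<And>i x. i \<in> I \<Longrightarrow> x \<in> Z \<Longrightarrow> f i x = 0 \<longleftrightarrow> g i x = 0"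
    by metis
  have "{x \<in> Z. \<forall>i \<in> I. f i x = 0} = Z \<inter> {x \<in> P. \<forall>i \<in> I. g i x = 0}"
    using g(2) loc_closed_subset[OF assms(1)] by blast
  then show ?thesis using loc_closed_Int[OF assms(1) loc_closed_homogeneous_zeros[of I g d]] g(1) by simp
qed

lemma loc_closed_trans:
  assumes U: "loc_closed P U" and Z: "loc_closed U Z" shows "loc_closed P Z"
proof -
  have UP: "U \<subseteq> P" using loc_closed_subset[OF U] .
  have "same_structure (subvariety (graded_fspace G P) U) (graded_fspace G U)"
    by (rule same_structure_subvariety[OF same_structure_refl[OF graded_algebra_axioms] graded_algebra_axioms UP])
  from same_structure_ztop[OF this]
  have top: "pullback_topology U (\<lambda>x. x) (graded_topology G P) = graded_topology G U"
    by (simp add: ztop_induced_fspace)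
  have op: "\<exists>V. openin (graded_topology G P) V \<and> W = V \<inter> U" if "openin (graded_topology G U) W" for W
    using that unfolding top[symmetric] openin_pullback_topology by auto
  obtain A C where AC: "openin (graded_topology G U) A" "closedin (graded_topology G U) C" "Z = A \<inter> C"
    using Z unfolding loc_closed_def zariski_locally_closed_def by auto
  obtain A' where A': "openin (graded_topology G P) A'" "A = A' \<inter> U" using op[OF AC(1)] by blast
  have "openin (graded_topology G U) (U - C)" using AC(2) by (simp add: closedin_def)
  then obtain C' where C': "openin (graded_topology G P) C'" "U - C = C' \<inter> U" using op by blast
  have "C \<subseteq> U" using AC(2) closedin_subset by fastforce
  then have Zeq: "Z = (A' \<inter> (P - C')) \<inter> U" using AC(3) A' C' UP by auto
  have "closedin (graded_topology G P) (P - C')"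
    using C'(1) closedin_topspace[of "graded_topology G P"] by (intro closedin_diff) simp_all
  with A' have "loc_closed P (A' \<inter> (P - C'))"
    unfolding loc_closed_def zariski_locally_closed_def by auto
  then show ?thesis unfolding Zeq using U by (rule loc_closed_Int)
qed

end

lemma loc_closed_preimage:
  assumes "graded_algebra G" "graded_algebra H"
    and "morphism (graded_fspace G P) (graded_fspace H Q) \<phi>" "graded_algebra.loc_closed H Q Z"
  shows "graded_algebra.loc_closed G P {x \<in> P. \<phi> x \<in> Z}"
proof -
  interpret G: graded_algebra G by fact
  interpret H: graded_algebra H by fact
  obtain A C where AC: "openin (graded_topology H Q) A" "closedin (graded_topology H Q) C" "Z = A \<inter> C"
    using assms(4) unfolding H.loc_closed_def zariski_locally_closed_def by auto
  have cont: "continuous_map (graded_topology G P) (graded_topology H Q) \<phi>"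
    using assms(3) by (simp add: morphism_def)
  have "openin (graded_topology G P) {x \<in> P. \<phi> x \<in> A}"
    using openin_continuous_map_preimage[OF cont AC(1)] by simp
  moreover have "closedin (graded_topology G P) {x \<in> P. \<phi> x \<in> C}"
    using closedin_continuous_map_preimage[OF cont AC(2)] by simp
  moreover have "{x \<in> P. \<phi> x \<in> Z} = {x \<in> P. \<phi> x \<in> A} \<inter> {x \<in> P. \<phi> x \<in> C}" using AC by auto
  ultimately show ?thesis unfolding G.loc_closed_def zariski_locally_closed_def G.ztop_graded_fspace by blast
qed

lemma graded_isomorphicI:
  assumes G: "graded_algebra G" and H: "graded_algebra H"
    and \<phi>: "\<And>x. x \<in> P \<Longrightarrow> \<phi> x \<in> Q \<and> \<psi> (\<phi> x) = x" and \<psi>: "\<And>y. y \<in> Q \<Longrightarrow> \<psi> y \<in> P \<and> \<phi> (\<psi> y) = y"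
    and 1: "morphism (graded_fspace G P) (graded_fspace H Q) \<phi>"
    and 2: "morphism (graded_fspace H Q) (graded_fspace G P) \<psi>"
  shows "graded_fspace G P \<cong>\<^sub>v graded_fspace H Q"
  unfolding isomorphic_def using assms
  by (auto simp: graded_algebra.points_graded_fspace intro!: exI[of _ \<phi>] exI[of _ \<psi>])

section \<open>Projective space\<close>

lemma homogeneous_scale: "homogeneous I d p \<Longrightarrow> p (scale_fun c v) = c ^ d * p v"
  by (induction rule: homogeneous.induct) (auto simp: scale_fun_def algebra_simps power_add)

lemma line_generator:
  assumes "L \<in> linear_subspaces 1 I" "v \<in> L" "v \<noteq> 0"
  shows "L = range (\<lambda>c. scale_fun c v)"
proof -
  have L: "cfun.subspace L" "cfun.dim L = 1" using assms(1) by (auto simp: linear_subspaces_def)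
  have ind: "cfun.independent {v}" using assms(3) by simp
  have "L \<subseteq> cfun.span {v}"
  proof
    fix w assume w: "w \<in> L"
    show "w \<in> cfun.span {v}"
    proof (rule ccontr)
      assume nw: "w \<notin> cfun.span {v}"
      then have i2: "cfun.independent {w, v}" using ind cfun.independent_insertI by blast
      obtain B where B: "B \<subseteq> L" "cfun.independent B" "L \<subseteq> cfun.span B" "card B = cfun.dim L"
        using cfun.basis_exists by blast
      have "finite B" using B(4) L(2) card_ge_0_finite by force
      moreover have "{w, v} \<subseteq> cfun.span B" using w assms(2) B(3) by blast
      ultimately have "card {w, v} \<le> card B" using cfun.independent_span_bound i2 by blast
      moreover have "w \<noteq> v" using nw cfun.span_base by auto
      ultimately show False using B(4) L(2) by simp
    qed
  qed
  moreover have "cfun.span {v} \<subseteq> L" using L(1) assms(2) by (intro cfun.span_minimal) auto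
  ultimately show ?thesis by (auto simp: cfun.span_singleton)
qed

abbreviation homog :: "'i set \<Rightarrow> nat \<Rightarrow> (('i \<Rightarrow> complex) \<Rightarrow> complex) set" where
  "homog I d \<equiv> {p. homogeneous I d p}"

lemma graded_algebra_homog: "graded_algebra (homog I)"
  by unfold_locales (auto intro: homogeneous.intros)

text \<open>
  A homogeneous polynomial vanishes at one generator of a line if and only if it vanishes at all, and a
  quotient of equal degrees takes the same value at all; so one generator of each line suffices.
\<close>

lemma projective_space_graded:
  assumes \<rho>: "\<And>L. L \<in> linear_subspaces 1 I \<Longrightarrow> \<rho> L \<in> L - {0}"
  shows "projective_space I = graded_fspace (pulled_back \<rho> (homog I)) (linear_subspaces 1 I)"
proof -
  have key: "(\<forall>v \<in> L - {0}. q v \<noteq> 0 \<and> y = p v / q v) \<longleftrightarrow> q (\<rho> L) \<noteq> 0 \<and> y = p (\<rho> L) / q (\<rho> L)"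
    if L: "L \<in> linear_subspaces 1 I" and pq: "homogeneous I d p" "homogeneous I d q" for L d p q y
  proof
    assume *: "q (\<rho> L) \<noteq> 0 \<and> y = p (\<rho> L) / q (\<rho> L)"
    show "\<forall>v \<in> L - {0}. q v \<noteq> 0 \<and> y = p v / q v"
    proof
      fix v assume v: "v \<in> L - {0}"
      then obtain c where c: "v = scale_fun c (\<rho> L)" using line_generator[OF L, of "\<rho> L"] \<rho>[OF L] by blast
      with v have "c \<noteq> 0" by (auto simp: scale_fun_def)
      then show "q v \<noteq> 0 \<and> y = p v / q v" using * pq by (simp add: c homogeneous_scale)
    qed
  qed (use \<rho>[OF L] in blast)
  have sets: "{{L \<in> linear_subspaces 1 I. \<forall>v \<in> L - {0}. p v \<noteq> 0} | p. \<exists>d. homogeneous I d p} =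
      {{x \<in> linear_subspaces 1 I. g x \<noteq> 0} | g. \<exists>d. g \<in> pulled_back \<rho> (homog I) d}" (is "?A = ?B")
  proof -
    have e: "{L \<in> linear_subspaces 1 I. \<forall>v \<in> L - {0}. p v \<noteq> 0} = {L \<in> linear_subspaces 1 I. p (\<rho> L) \<noteq> 0}"
      if "homogeneous I d p" for p d proof -
      have "(\<forall>v \<in> L - {0}. p v \<noteq> 0) \<longleftrightarrow> p (\<rho> L) \<noteq> 0" if "L \<in> linear_subspaces 1 I" for L
        using key[OF that homogeneous.zero \<open>homogeneous I d p\<close>, of 0] by simp
      then show ?thesis by blast
    qed
    show ?thesis
    proof
      show "?A \<subseteq> ?B"
      proof
        fix X assume "X \<in> ?A"
        then obtain p d where p: "homogeneous I d p" "X = {L \<in> linear_subspaces 1 I. p (\<rho> L) \<noteq> 0}" using e by blast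
        then show "X \<in> ?B"
          by (intro CollectI exI[of _ "\<lambda>x. p (\<rho> x)"]) (auto simp: pulled_back_def)
      qed
      show "?B \<subseteq> ?A"
      proof
        fix X assume "X \<in> ?B"
        then obtain p d where p: "homogeneous I d p" "X = {L \<in> linear_subspaces 1 I. p (\<rho> L) \<noteq> 0}"
          by (auto simp: pulled_back_def)
        then show "X \<in> ?A" using e[OF p(1)] by blast
      qed
    qed
  qed
  let ?T = "graded_topology (pulled_back \<rho> (homog I)) (linear_subspaces 1 I)"
  have reg: "(\<exists>d p q. homogeneous I d p \<and> homogeneous I d q \<and> (\<forall>L \<in> W. \<forall>v \<in> L - {0}. q v \<noteq> 0 \<and> f L = p v / q v))
     \<longleftrightarrow> f \<in> ratios (pulled_back \<rho> (homog I)) W" (is "?L \<longleftrightarrow> ?R") if "openin ?T W" for W f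
  proof -
    have W: "W \<subseteq> linear_subspaces 1 I"
      using openin_subset[OF that] by (simp add: graded_algebra.topspace_graded_topology[OF graded_algebra.graded_algebra_pulled_back[OF graded_algebra_homog]])
    show ?thesis
    proof
      assume ?L
      then obtain d p q where pq: "homogeneous I d p" "homogeneous I d q" "\<forall>L \<in> W. \<forall>v \<in> L - {0}. q v \<noteq> 0 \<and> f L = p v / q v"
        by blast
      show ?R by (rule ratiosI[of "\<lambda>x. p (\<rho> x)" _ d "\<lambda>x. q (\<rho> x)"])
          (use pq W \<rho> in \<open>auto simp: pulled_back_def subset_iff\<close>)
    next
      assume ?R
      then obtain d p q where pq: "homogeneous I d p" "homogeneous I d q" "\<And>L. L \<in> W \<Longrightarrow> q (\<rho> L) \<noteq> 0 \<and> f L = p (\<rho> L) / q (\<rho> L)"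
        by (elim ratiosE) (auto simp: pulled_back_def)
      have "\<forall>L \<in> W. \<forall>v \<in> L - {0}. q v \<noteq> 0 \<and> f L = p v / q v"
        using key[OF _ pq(1,2)] pq(3) W by blast
      then show ?L using pq(1,2) by blast
    qed
  qed
  have "locally_on ?T (\<lambda>W f. \<exists>d p q. homogeneous I d p \<and> homogeneous I d q \<and>
         (\<forall>L \<in> W. \<forall>v \<in> L - {0}. q v \<noteq> 0 \<and> f L = p v / q v)) W =
      locally_on ?T (\<lambda>W f. f \<in> ratios (pulled_back \<rho> (homog I)) W) W" for W
    unfolding locally_on_def by (intro Collect_cong conj_cong ball_cong ex_cong1 refl) (use reg in blast)
  moreover have "topology_generated_by {{L \<in> linear_subspaces 1 I. \<forall>v \<in> L - {0}. p v \<noteq> 0} | p. \<exists>d. homogeneous I d p} = ?T"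
    unfolding graded_topology_def sets ..
  ultimately show ?thesis
    unfolding projective_space_def graded_fspace_def Let_def by auto
qed

section \<open>Symmetric functions of multisets\<close>

inductive_set subalg :: "('a \<Rightarrow> complex) set \<Rightarrow> ('a \<Rightarrow> complex) set" for G :: "('a \<Rightarrow> complex) set" where
  gen: "g \<in> G \<Longrightarrow> g \<in> subalg G"
| const: "(\<lambda>_. c) \<in> subalg G"
| add: "f \<in> subalg G \<Longrightarrow> g \<in> subalg G \<Longrightarrow> (\<lambda>x. f x + g x) \<in> subalg G"
| mult: "f \<in> subalg G \<Longrightarrow> g \<in> subalg G \<Longrightarrow> (\<lambda>x. f x * g x) \<in> subalg G"

lemma graded_algebra_subalg: "graded_algebra (\<lambda>_. subalg G)"
  by unfold_locales (auto intro: subalg.intros)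

lemma subalg_cmult: "f \<in> subalg G \<Longrightarrow> (\<lambda>x. c * f x) \<in> subalg G"
  by (intro subalg.mult subalg.const)

lemma subalg_diff: "f \<in> subalg G \<Longrightarrow> g \<in> subalg G \<Longrightarrow> (\<lambda>x. f x - g x) \<in> subalg G"
  using subalg.add[OF _ subalg_cmult[of g G "-1"], of f] by simp

lemma subalg_sum: "(\<And>i. i \<in> A \<Longrightarrow> f i \<in> subalg G) \<Longrightarrow> (\<lambda>x. \<Sum>i\<in>A. f i x) \<in> subalg G"
  by (induction A rule: infinite_finite_induct) (auto intro: subalg.intros)

lemma subalg_power: "f \<in> subalg G \<Longrightarrow> (\<lambda>x. f x ^ n) \<in> subalg G"
  by (induction n) (auto intro: subalg.intros)

lemma subalg_prod: "(\<And>i. i \<in> A \<Longrightarrow> f i \<in> subalg G) \<Longrightarrow> (\<lambda>x. \<Prod>i\<in>A. f i x) \<in> subalg G"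
  by (induction A rule: infinite_finite_induct) (auto intro: subalg.intros)

definition polys :: "'i set \<Rightarrow> (('i \<Rightarrow> complex) \<Rightarrow> complex) set" where
  "polys I = subalg ((\<lambda>i v. v i) ` I)"

lemma polys_var: "i \<in> I \<Longrightarrow> (\<lambda>v. v i) \<in> polys I"
  unfolding polys_def by (rule subalg.gen) (rule imageI)

lemma polys_intros:
  "(\<lambda>_. c) \<in> polys I"
  "f \<in> polys I \<Longrightarrow> g \<in> polys I \<Longrightarrow> (\<lambda>x. f x + g x) \<in> polys I"
  "f \<in> polys I \<Longrightarrow> g \<in> polys I \<Longrightarrow> (\<lambda>x. f x * g x) \<in> polys I"
  unfolding polys_def by (auto intro: subalg.intros)

definition tprod :: "('v \<Rightarrow> complex) list \<Rightarrow> 'v list \<Rightarrow> complex" where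
  "tprod gs ys = prod_list (map2 (\<lambda>g y. g y) gs ys)"

lemma tprod_simps [simp]:
  "tprod [] ys = 1" "tprod gs [] = 1" "tprod (g # gs) (y # ys) = g y * tprod gs ys"
  by (simp_all add: tprod_def)

lemma tprod_append: "length gs = length ys \<Longrightarrow> tprod (gs @ hs) (ys @ zs) = tprod gs ys * tprod hs zs"
  by (simp add: tprod_def)

lemma tprod_conv_prod: "length gs = length ys \<Longrightarrow> tprod gs ys = (\<Prod>k<length ys. (gs ! k) (ys ! k))"
  by (induction gs ys rule: list_induct2) (simp_all add: prod.lessThan_Suc_shift del: prod.lessThan_Suc)

text \<open>
  The functions on \<open>'v list\<close> that are multilinear in the sense of a tensor product: sums of products
  of one function from each member of \<open>As\<close>. With homogeneous polynomials they are the multihomogeneous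
  polynomials. Only the values on lists of length \<open>length As\<close> matter.
\<close>

inductive tensors :: "('v \<Rightarrow> complex) set list \<Rightarrow> ('v list \<Rightarrow> complex) \<Rightarrow> bool" for As where
  zero: "tensors As (\<lambda>_. 0)"
| tprod: "list_all2 (\<in>) gs As \<Longrightarrow> tensors As (tprod gs)"
| scale: "tensors As f \<Longrightarrow> tensors As (\<lambda>ys. c * f ys)"
| add: "tensors As f \<Longrightarrow> tensors As g \<Longrightarrow> tensors As (\<lambda>ys. f ys + g ys)"
| cong: "tensors As f \<Longrightarrow> (\<And>ys. length ys = length As \<Longrightarrow> f ys = g ys) \<Longrightarrow> tensors As g"

lemma tensors_sum: "(\<And>i. i \<in> A \<Longrightarrow> tensors As (f i)) \<Longrightarrow> tensors As (\<lambda>ys. \<Sum>i\<in>A. f i ys)"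
  by (induction A rule: infinite_finite_induct) (auto intro: tensors.zero tensors.add)

lemma tensors_mult:
  assumes fg: "tensors As f" "tensors Bs g"
    and len: "length As = length Cs" "length Bs = length Cs"
    and *: "\<And>k a b. k < length Cs \<Longrightarrow> a \<in> As ! k \<Longrightarrow> b \<in> Bs ! k \<Longrightarrow> (\<lambda>x. a x * b x) \<in> Cs ! k"
  shows "tensors Cs (\<lambda>ys. f ys * g ys)"
  using fg(1)
proof (induction rule: tensors.induct)
  case (tprod gs)
  note gs = this
  show ?case using fg(2)
  proof (induction rule: tensors.induct)
    case (tprod hs)
    let ?gs = "map2 (\<lambda>a b x. a x * b x) gs hs"
    have lens: "length gs = length Cs" "length hs = length Cs"
      using gs tprod len by (auto dest: list_all2_lengthD)
    have "list_all2 (\<in>) ?gs Cs"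
      using gs tprod * lens len by (auto simp: list_all2_conv_all_nth)
    then have "tensors Cs (tprod ?gs)" by (rule tensors.tprod)
    then show ?case
      by (rule tensors.cong) (use lens in \<open>simp add: tprod_conv_prod prod.distrib\<close>)
  next
    case (scale f c)
    from tensors.scale[OF scale.IH, of c] show ?case by (simp add: algebra_simps)
  next
    case (add f g)
    from tensors.add[OF add.IH] show ?case by (simp add: algebra_simps)
  next
    case (cong f g)
    from cong.IH show ?case by (rule tensors.cong) (use cong len in auto)
  qed (simp add: tensors.zero)
next
  case (scale f c)
  from tensors.scale[OF scale.IH, of c] show ?case by (simp add: algebra_simps)
next
  case (add f g)
  from tensors.add[OF add.IH] show ?case by (simp add: algebra_simps)
next
  case (cong f g)
  from cong.IH show ?case by (rule tensors.cong) (use cong len in auto)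
qed (simp add: tensors.zero)

lemma tensors_one:
  assumes "\<And>k. k < length As \<Longrightarrow> (\<lambda>_. 1) \<in> As ! k" shows "tensors As (\<lambda>_. 1)"
proof -
  have "tensors As (tprod (replicate (length As) (\<lambda>_. 1)))"
    using assms by (intro tensors.tprod) (auto simp: list_all2_conv_all_nth)
  then show ?thesis by (rule tensors.cong) (simp add: tprod_conv_prod)
qed

lemma tensors_coord:
  assumes "\<And>k. k < length As \<Longrightarrow> k \<noteq> a \<Longrightarrow> (\<lambda>_. 1) \<in> As ! k" "a < length As" "g \<in> As ! a"
  shows "tensors As (\<lambda>ys. g (ys ! a))"
proof -
  have "tensors As (tprod ((replicate (length As) (\<lambda>_. 1))[a := g]))"
    using assms by (intro tensors.tprod) (auto simp: list_all2_conv_all_nth nth_list_update)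
  moreover have "(\<Prod>k<length As. ((replicate (length As) (\<lambda>_. 1))[a := g] ! k) (ys ! k)) = g (ys ! a)" for ys :: "'a list"
  proof -
    have "(\<Prod>k<length As. ((replicate (length As) (\<lambda>_. 1))[a := g] ! k) (ys ! k)) = (\<Prod>k<length As. if k = a then g (ys ! a) else 1)"
      by (intro prod.cong) (auto simp: nth_list_update)
    then show ?thesis using assms(2) by simp
  qed
  ultimately show ?thesis by (elim tensors.cong) (simp add: tprod_conv_prod)
qed

lemma sum_mset_sum_commute: "(\<Sum>v\<in>#M. \<Sum>i\<in>A. f i v) = (\<Sum>i\<in>A. \<Sum>v\<in>#M. f i v)"
  by (induction M) (auto simp: sum.distrib)

lemma sum_mset_cmult: "(\<Sum>v\<in>#M. c * f v) = (c :: 'c :: comm_semiring_1) * (\<Sum>v\<in>#M. f v)"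
  by (induction M) (auto simp: algebra_simps)

lemma sum_mset_mult_const: "(\<Sum>v\<in>#M. f v * c) = (\<Sum>v\<in>#M. f v) * (c :: 'c :: comm_semiring_1)"
  by (induction M) (auto simp: algebra_simps)

lemma submset_size_eq: "M \<subseteq># N \<Longrightarrow> size M = size N \<Longrightarrow> M = N"
  by (metis less_irrefl mset_subset_size subset_mset.le_neq_trans)

text \<open>
  The sum of \<open>f\<close> over all ways to draw \<open>k\<close> elements of \<open>M\<close> in order, without replacement and counting
  equal elements as different. For \<open>k = size M\<close> it is the symmetrization of \<open>f\<close>. The recursion makes
  it a function of the multiset, with no choice of an enumeration.
\<close>

fun msum :: "nat \<Rightarrow> ('v list \<Rightarrow> 'c::comm_monoid_add) \<Rightarrow> 'v multiset \<Rightarrow> 'c" where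
  "msum 0 f M = f []"
| "msum (Suc k) f M = (\<Sum>v\<in>#M. msum k (\<lambda>ys. f (v # ys)) (M - {#v#}))"

lemma msum_cong:
  assumes "\<And>ys. length ys = k \<Longrightarrow> mset ys \<subseteq># M \<Longrightarrow> f ys = g ys"
  shows "msum k f M = msum k g M"
  using assms
proof (induction k arbitrary: f g M)
  case (Suc k)
  have "msum k (\<lambda>ys. f (v # ys)) (M - {#v#}) = msum k (\<lambda>ys. g (v # ys)) (M - {#v#})" if "v \<in># M" for v
  proof (rule Suc.IH)
    fix ys assume "length ys = k" "mset ys \<subseteq># M - {#v#}"
    then show "f (v # ys) = g (v # ys)"
      using that by (intro Suc.prems) (auto simp: insert_subset_eq_iff)
  qed
  then show ?case by (auto intro!: arg_cong[of _ _ sum_mset] image_mset_cong)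
qed simp

lemma msum_zero [simp]: "msum k (\<lambda>_. 0) M = 0"
  by (induction k arbitrary: M) auto

lemma msum_add: "msum k (\<lambda>ys. f ys + g ys) M = msum k f M + msum k g M"
  by (induction k arbitrary: f g M) (auto simp: sum_mset.distrib)

lemma msum_cmult: "msum k (\<lambda>ys. c * f ys) M = (c :: 'c :: comm_semiring_1) * msum k f M"
  by (induction k arbitrary: f M) (simp_all only: msum.simps sum_mset_cmult)

lemma msum_of_nat: "msum k (\<lambda>ys. of_nat (f ys)) M = (of_nat (msum k f M) :: 'c :: comm_semiring_1)"
  by (induction k arbitrary: f M) (auto simp: of_nat_sum_mset image_mset.compositionality o_def)

lemma msum_pos: 
  assumes "length ys = k" "mset ys \<subseteq># M" "f ys > (0::nat)" shows "msum k f M > 0"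
  using assms
proof (induction k arbitrary: f M ys)
  case (Suc k)
  then obtain v zs where ys: "ys = v # zs" by (cases ys) auto
  with Suc.prems have v: "v \<in># M" "mset zs \<subseteq># M - {#v#}"
    by (auto simp: insert_subset_eq_iff)
  have "msum k (\<lambda>ys. f (v # ys)) (M - {#v#}) > 0"
    by (rule Suc.IH[of zs]) (use Suc.prems ys v in auto)
  with v(1) show ?case by (auto simp: sum_mset_0_iff simp flip: neq0_conv)
qed simp

lemma msum_tprod_Cons:
  "msum (length (g # gs)) (tprod (g # gs)) M = (\<Sum>v\<in>#M. g v * msum (length gs) (tprod gs) (M - {#v#}))"
  by (simp add: msum_cmult)

abbreviation drop_nth :: "nat \<Rightarrow> 'b list \<Rightarrow> 'b list" where
  "drop_nth i xs \<equiv> take i xs @ drop (Suc i) xs"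

lemma mset_drop_nth: "i < length xs \<Longrightarrow> mset (drop_nth i xs) = mset xs - {#xs ! i#}"
proof -
  assume i: "i < length xs"
  have "mset xs = mset (take i xs @ xs ! i # drop (Suc i) xs)" using i by (simp add: id_take_nth_drop[symmetric])
  then show ?thesis by simp
qed

text \<open>
  Either the new element \<open>v\<close> is not drawn, or it is drawn in exactly one position.
\<close>

lemma msum_tprod_add_mset:
  "msum (length gs) (tprod gs) (add_mset v M) =
    msum (length gs) (tprod gs) M +
    (\<Sum>i<length gs. (gs ! i) v * msum (length gs - 1) (tprod (drop_nth i gs)) M)"
proof (induction gs arbitrary: M)
  case (Cons g gs)
  let ?T = "\<lambda>gs. msum (length gs) (tprod gs)"
  have a: "?T (g # gs) (add_mset v M) = g v * ?T gs M + (\<Sum>w\<in>#M. g w * ?T gs (add_mset v M - {#w#}))"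
    by (simp only: msum_tprod_Cons image_mset_add_mset sum_mset.add_mset add_mset_remove_trivial)
  have "(\<Sum>w\<in>#M. g w * ?T gs (add_mset v M - {#w#})) =
     (\<Sum>w\<in>#M. g w * ?T gs (M - {#w#}) +
        (\<Sum>i<length gs. (gs ! i) v * (g w * msum (length gs - 1) (tprod (drop_nth i gs)) (M - {#w#}))))"
  proof (intro arg_cong[of _ _ sum_mset] image_mset_cong)
    fix w assume "w \<in># M"
    then have "add_mset v M - {#w#} = add_mset v (M - {#w#})"
      by (metis add_mset_commute add_mset_remove_trivial multi_member_split)
    then show "g w * ?T gs (add_mset v M - {#w#}) = g w * ?T gs (M - {#w#}) +
        (\<Sum>i<length gs. (gs ! i) v * (g w * msum (length gs - 1) (tprod (drop_nth i gs)) (M - {#w#})))"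
      by (simp only: Cons.IH) (simp add: algebra_simps sum_distrib_left)
  qed
  also have "\<dots> = ?T (g # gs) M + (\<Sum>i<length gs. \<Sum>w\<in>#M. (gs ! i) v * (g w * msum (length gs - 1) (tprod (drop_nth i gs)) (M - {#w#})))"
    by (simp only: sum_mset.distrib msum_tprod_Cons) (simp add: sum_mset_sum_commute)
  also have "(\<Sum>i<length gs. \<Sum>w\<in>#M. (gs ! i) v * (g w * msum (length gs - 1) (tprod (drop_nth i gs)) (M - {#w#}))) =
     (\<Sum>i<length gs. (gs ! i) v * ?T (g # drop_nth i gs) M)"
  proof (intro sum.cong refl)
    fix i assume "i \<in> {..<length gs}"
    then have "length (drop_nth i gs) = length gs - 1" by auto
    then show "(\<Sum>w\<in>#M. (gs ! i) v * (g w * msum (length gs - 1) (tprod (drop_nth i gs)) (M - {#w#}))) = (gs ! i) v * ?T (g # drop_nth i gs) M"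
      unfolding msum_tprod_Cons by (simp only: sum_mset_cmult length_Cons diff_Suc_1)
  qed
  finally have b: "(\<Sum>w\<in>#M. g w * ?T gs (add_mset v M - {#w#})) = ?T (g # gs) M + (\<Sum>i<length gs. (gs ! i) v * ?T (g # drop_nth i gs) M)" .
  have "(\<Sum>i<length (g # gs). ((g # gs) ! i) v * msum (length (g # gs) - 1) (tprod (drop_nth i (g # gs))) M) =
     g v * ?T gs M + (\<Sum>i<length gs. (gs ! i) v * ?T (g # drop_nth i gs) M)"
  proof -
    have "msum (length gs) (tprod (g # drop_nth i gs)) M = ?T (g # drop_nth i gs) M" if "i < length gs" for i
    proof -
      have "length (g # drop_nth i gs) = length gs" using that by auto
      then show ?thesis by metis
    qed
    then show ?thesis by (simp add: sum.lessThan_Suc_shift del: sum.lessThan_Suc msum.simps)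
  qed
  with a b show ?case by simp
qed simp

definition power_sums :: "('v \<Rightarrow> complex) set \<Rightarrow> ('v multiset \<Rightarrow> complex) set" where
  "power_sums A = (\<lambda>g M. \<Sum>v\<in>#M. g v) ` A"

text \<open>
  Symmetric polynomials are polynomials in power sums. Multiply the power sum of \<open>g\<close> with
  the symmetrization of the remaining factors: either the element for \<open>g\<close> differs from all others,
  which gives the wanted term, or it coincides with the one in position \<open>i\<close>, which gives a shorter
  symmetrization where \<open>g\<close> has been absorbed into the factor \<open>i\<close>.
\<close>

lemma msum_tprod_subalg:
  assumes A: "\<And>f g. f \<in> A \<Longrightarrow> g \<in> A \<Longrightarrow> (\<lambda>x. f x * g x) \<in> A"
  shows "set gs \<subseteq> A \<Longrightarrow> (\<lambda>M. msum (length gs) (tprod gs) M) \<in> subalg (power_sums A)"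
proof (induction "length gs" arbitrary: gs rule: less_induct)
  case less
  show ?case
  proof (cases gs)
    case Nil
    then have "(\<lambda>M. msum (length gs) (tprod gs) M) = (\<lambda>_. 1)" by (simp add: fun_eq_iff)
    then show ?thesis by (simp only: subalg.const)
  next
    case (Cons g hs)
    let ?T = "\<lambda>gs. msum (length gs) (tprod gs)"
    let ?g = "\<lambda>i x. g x * (hs ! i) x"
    have eq: "?T gs M = (\<Sum>v\<in>#M. g v) * ?T hs M - (\<Sum>i<length hs. ?T (?g i # drop_nth i hs) M)" for M
    proof -
      have "(\<Sum>v\<in>#M. g v) * ?T hs M = (\<Sum>v\<in>#M. g v * ?T hs (add_mset v (M - {#v#})))"
        unfolding sum_mset_mult_const[symmetric]
        by (intro arg_cong[of _ _ sum_mset] image_mset_cong) simp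
      also have "\<dots> = (\<Sum>v\<in>#M. g v * ?T hs (M - {#v#}) + (\<Sum>i<length hs. ?g i v * msum (length hs - 1) (tprod (drop_nth i hs)) (M - {#v#})))"
        by (simp only: msum_tprod_add_mset) (simp add: algebra_simps sum_distrib_left)
      also have "\<dots> = ?T gs M + (\<Sum>i<length hs. \<Sum>v\<in>#M. ?g i v * msum (length hs - 1) (tprod (drop_nth i hs)) (M - {#v#}))"
        unfolding Cons msum_tprod_Cons by (simp add: sum_mset.distrib sum_mset_sum_commute)
      also have "(\<Sum>i<length hs. \<Sum>v\<in>#M. ?g i v * msum (length hs - 1) (tprod (drop_nth i hs)) (M - {#v#})) =
          (\<Sum>i<length hs. ?T (?g i # drop_nth i hs) M)"
      proof (intro sum.cong refl)
        fix i assume "i \<in> {..<length hs}"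
        then have "length (drop_nth i hs) = length hs - 1" by auto
        then show "(\<Sum>v\<in>#M. ?g i v * msum (length hs - 1) (tprod (drop_nth i hs)) (M - {#v#})) = ?T (?g i # drop_nth i hs) M"
          unfolding msum_tprod_Cons by simp
      qed
      finally show ?thesis by simp
    qed
    have "(\<lambda>M. (\<Sum>v\<in>#M. g v) * ?T hs M - (\<Sum>i<length hs. ?T (?g i # drop_nth i hs) M)) \<in> subalg (power_sums A)"
    proof (intro subalg_diff subalg.mult subalg_sum)
      show "(\<lambda>M. \<Sum>v\<in>#M. g v) \<in> subalg (power_sums A)"
        using less.prems Cons by (intro subalg.gen) (auto simp: power_sums_def)
      show "?T hs \<in> subalg (power_sums A)" using less Cons by auto
      fix i assume i: "i \<in> {..<length hs}"
      have "set (drop_nth i hs) \<subseteq> set hs" using set_take_subset set_drop_subset by fastforce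
      moreover have "?g i \<in> A" using i less.prems Cons by (intro A) auto
      ultimately show "?T (?g i # drop_nth i hs) \<in> subalg (power_sums A)"
        using i less.prems Cons by (intro less.hyps) auto
    qed
    then show ?thesis unfolding eq[abs_def] .
  qed
qed

lemma msum_tensors_subalg:
  assumes A: "\<And>f g. f \<in> A \<Longrightarrow> g \<in> A \<Longrightarrow> (\<lambda>x. f x * g x) \<in> A"
    and f: "tensors (replicate k A) f"
  shows "msum k f \<in> subalg (power_sums A)"
  using f
proof (induction rule: tensors.induct)
  case (tprod gs)
  then have "length gs = k" "set gs \<subseteq> A"
    by (auto dest!: list_all2_lengthD simp: list_all2_conv_all_nth in_set_conv_nth)
  with msum_tprod_subalg[OF A, where gs = gs] show ?case by metis
next
  case (cong f g)
  have "msum k g M = msum k f M" for M by (rule msum_cong) (use cong in simp)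
  with cong show ?case by presburger
qed (auto simp: msum_add msum_cmult intro: subalg.intros)

text \<open>
  As a function of an enumeration of the multiset, a symmetrization is again multihomogeneous of the
  same degrees: the factor for the position \<open>i\<close> can be split off.
\<close>

lemma msum_tensors:
  assumes f: "tensors (replicate k A) f"
  shows "tensors (replicate k A) (\<lambda>xs. msum k f (mset xs))"
proof -
  have base: "tensors (replicate (length gs) A) (\<lambda>xs. msum (length gs) (tprod gs) (mset xs))"
    if "set gs \<subseteq> A" for gs using that
  proof (induction gs)
    case Nil
    have "tensors (replicate (length []) A) (tprod [])" by (rule tensors.tprod) simp
    then show ?case by (rule tensors.cong) simp
  next
    case (Cons g gs)
    have ins: "tensors (replicate (Suc (length gs)) A) (\<lambda>xs. g (xs ! i) * f (drop_nth i xs))"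
      if "tensors (replicate (length gs) A) f" "i \<le> length gs" for f i
      using that(1)
    proof (induction rule: tensors.induct)
      case (tprod hs)
      have lh: "length hs = length gs" using tprod by (auto dest: list_all2_lengthD)
      have "set hs \<subseteq> A" using tprod by (auto simp: list_all2_conv_all_nth in_set_conv_nth)
      then have "set (take i hs @ g # drop i hs) \<subseteq> A"
        using Cons.prems set_take_subset[of i hs] set_drop_subset[of i hs] by auto
      then have "list_all2 (\<in>) (take i hs @ g # drop i hs) (replicate (Suc (length gs)) A)"
        using lh that(2) unfolding list_all2_conv_all_nth
        by (auto simp del: replicate_Suc take_append drop_append intro!: subsetD[OF _ nth_mem])
      then have "tensors (replicate (Suc (length gs)) A) (tprod (take i hs @ g # drop i hs))"
        by (rule tensors.tprod)
      then show ?case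
      proof (rule tensors.cong)
        fix ys :: "'a list" assume "length ys = length (replicate (Suc (length gs)) A)"
        then have ly: "length ys = Suc (length gs)" by simp
        have "ys = take i ys @ ys ! i # drop (Suc i) ys" using ly that(2) by (simp add: id_take_nth_drop)
        then have "tprod (take i hs @ g # drop i hs) ys = tprod (take i hs @ g # drop i hs) (take i ys @ ys ! i # drop (Suc i) ys)"
          by simp
        also have "\<dots> = g (ys ! i) * (tprod (take i hs) (take i ys) * tprod (drop i hs) (drop (Suc i) ys))"
          using lh ly that(2) by (subst tprod_append) auto
        also have "tprod (take i hs) (take i ys) * tprod (drop i hs) (drop (Suc i) ys) = tprod (take i hs @ drop i hs) (drop_nth i ys)"
          using lh ly that(2) by (subst tprod_append) auto
        finally show "tprod (take i hs @ g # drop i hs) ys = g (ys ! i) * tprod hs (drop_nth i ys)" by simp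
      qed
    next
      case (scale f c)
      from tensors.scale[OF scale.IH, of c] show ?case by (simp add: algebra_simps)
    next
      case (add f g)
      from tensors.add[OF add.IH] show ?case by (simp add: algebra_simps)
    next
      case (cong f g)
      from cong.IH show ?case by (rule tensors.cong) (use cong that(2) in auto)
    qed (simp add: tensors.zero)
    have "tensors (replicate (Suc (length gs)) A)
        (\<lambda>xs. \<Sum>i<Suc (length gs). g (xs ! i) * msum (length gs) (tprod gs) (mset (drop_nth i xs)))"
      using Cons by (intro tensors_sum ins) auto
    then show ?case unfolding length_Cons replicate_Suc[symmetric]
    proof (rule tensors.cong)
      fix xs :: "'a list" assume "length xs = length (replicate (Suc (length gs)) A)"
      then have l: "length xs = Suc (length gs)" by simp
      have "msum (length (g # gs)) (tprod (g # gs)) (mset xs) = (\<Sum>v\<leftarrow>xs. g v * msum (length gs) (tprod gs) (mset xs - {#v#}))"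
        unfolding msum_tprod_Cons
        by (simp only: mset_map[symmetric] sum_mset_sum_list)
      also have "\<dots> = (\<Sum>i<length xs. g (xs ! i) * msum (length gs) (tprod gs) (mset xs - {#xs ! i#}))"
        by (simp add: sum_list_sum_nth atLeast0LessThan)
      also have "\<dots> = (\<Sum>i<Suc (length gs). g (xs ! i) * msum (length gs) (tprod gs) (mset (drop_nth i xs)))"
        unfolding l by (intro sum.cong refl) (simp add: mset_drop_nth l del: mset_append)
      finally show "(\<Sum>i<Suc (length gs). g (xs ! i) * msum (length gs) (tprod gs) (mset (drop_nth i xs)))
          = msum (Suc (length gs)) (tprod (g # gs)) (mset xs)" by simp
    qed
  qed
  show ?thesis using f
  proof (induction rule: tensors.induct)
    case (tprod gs)
    then have "length gs = k" "set gs \<subseteq> A"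
      by (auto dest!: list_all2_lengthD simp: list_all2_conv_all_nth in_set_conv_nth)
    with base[of gs] show ?case by metis
  next
    case (cong f g)
    have "msum k g M = msum k f M" for M by (rule msum_cong) (use cong in simp)
    with cong show ?case by simp
  qed (auto simp: msum_add msum_cmult intro: tensors.intros)
qed

section \<open>Symmetric powers of projective spaces\<close>

lemma msum_one: "size M = k \<Longrightarrow> msum k (\<lambda>_. 1) M = (fact k :: nat)"
proof (induction k arbitrary: M)
  case (Suc k)
  have "(\<Sum>v\<in>#M. msum k (\<lambda>_. 1) (M - {#v#})) = (\<Sum>v\<in>#M. (fact k :: nat))"
    using Suc by (intro arg_cong[of _ _ sum_mset] image_mset_cong) (auto simp: size_Diff_singleton)
  then show ?case using Suc.prems by simp
qed simp

text \<open>
  A rearrangement of an image list is the image of a rearrangement.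
\<close>

lemma mset_eq_map_imp_map:
  assumes "mset ys = mset (map f xs)" shows "\<exists>zs. mset zs = mset xs \<and> ys = map f zs"
  using assms
proof (induction xs arbitrary: ys)
  case (Cons x xs)
  then have "f x \<in> set ys" by (metis list.set_intros(1) list.simps(9) mset_eq_setD)
  then obtain as bs where ys: "ys = as @ f x # bs" by (meson split_list)
  with Cons.prems have "mset (as @ bs) = mset (map f xs)" by simp
  from Cons.IH[OF this] obtain zs where zs: "mset zs = mset xs" "as @ bs = map f zs" by blast
  then obtain zs1 zs2 where "zs = zs1 @ zs2" "as = map f zs1" "bs = map f zs2"
    by (auto simp: append_eq_map_conv)
  with zs ys show ?case by (intro exI[of _ "zs1 @ x # zs2"]) auto
qed simp

text \<open>
  The choice \<open>\<rho>\<close> of a generator of each line is left open here; below it is the normalized generator.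
\<close>

locale projective_reps =
  fixes I :: "'i set" and \<rho> :: "('i \<Rightarrow> complex) set \<Rightarrow> 'i \<Rightarrow> complex" and m :: nat
  assumes rep: "L \<in> linear_subspaces 1 I \<Longrightarrow> \<rho> L \<in> L - {0}"
begin

abbreviation "lns \<equiv> linear_subspaces 1 I"
abbreviation "X \<equiv> projective_space I"
abbreviation "pts \<equiv> {xs. length xs = m \<and> set xs \<subseteq> lns}"

definition mhom :: "nat list \<Rightarrow> (('i \<Rightarrow> complex) list \<Rightarrow> complex) \<Rightarrow> bool" where
  "mhom ds = tensors (map (homog I) ds)"

lemma mhom_add: "mhom ds f \<Longrightarrow> mhom ds g \<Longrightarrow> mhom ds (\<lambda>ys. f ys + g ys)"
  unfolding mhom_def by (rule tensors.add)

lemma mhom_scale: "mhom ds f \<Longrightarrow> mhom ds (\<lambda>ys. c * f ys)"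
  unfolding mhom_def by (rule tensors.scale)

lemma X_graded: "X = graded_fspace (pulled_back \<rho> (homog I)) lns"
  by (rule projective_space_graded[OF rep])

sublocale L: graded_algebra "pulled_back \<rho> (homog I)"
  by (rule graded_algebra.graded_algebra_pulled_back[OF graded_algebra_homog])

lemma open_X_local:
  assumes "openin (ztop X) U" "x \<in> U"
  obtains d p where "homogeneous I d p" "p (\<rho> x) \<noteq> 0" "\<And>y. y \<in> lns \<Longrightarrow> p (\<rho> y) \<noteq> 0 \<Longrightarrow> y \<in> U"
proof -
  have "openin (graded_topology (pulled_back \<rho> (homog I)) lns) U"
    using assms(1) by (simp add: X_graded)
  from L.openin_graded_base[OF this assms(2)] obtain d g
    where g: "g \<in> pulled_back \<rho> (homog I) d" "g x \<noteq> 0" "{y \<in> lns. g y \<noteq> 0} \<subseteq> U" by blast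
  from g(1) obtain p where "homogeneous I d p" "g = (\<lambda>x. p (\<rho> x))" by (auto elim: pulled_backE)
  with g that[of d p] show ?thesis by auto
qed

lemma regular_X_local:
  assumes "f \<in> regular X U" "x \<in> U"
  obtains d p q where "homogeneous I d p" "homogeneous I d q" "q (\<rho> x) \<noteq> 0"
    "\<And>y. y \<in> lns \<Longrightarrow> q (\<rho> y) \<noteq> 0 \<Longrightarrow> f y = p (\<rho> y) / q (\<rho> y)"
proof -
  obtain W where W: "openin (ztop X) W" "x \<in> W" "f \<in> ratios (pulled_back \<rho> (homog I)) W"
    using assms by (auto simp: X_graded graded_fspace_def locally_on_def)
  from W(1,2) obtain e r where r: "homogeneous I e r" "r (\<rho> x) \<noteq> 0" "\<And>y. y \<in> lns \<Longrightarrow> r (\<rho> y) \<noteq> 0 \<Longrightarrow> y \<in> W"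
    by (rule open_X_local) blast
  obtain d g h where "g \<in> pulled_back \<rho> (homog I) d" "h \<in> pulled_back \<rho> (homog I) d"
    "\<And>y. y \<in> W \<Longrightarrow> h y \<noteq> 0 \<and> f y = g y / h y" using W(3) by (elim ratiosE) blast
  then obtain p q where pq: "homogeneous I d p" "homogeneous I d q"
    "\<And>y. y \<in> W \<Longrightarrow> q (\<rho> y) \<noteq> 0 \<and> f y = p (\<rho> y) / q (\<rho> y)" by (auto elim!: pulled_backE)
  show ?thesis
  proof (rule that)
    show "homogeneous I (d + e) (\<lambda>v. p v * r v)" "homogeneous I (d + e) (\<lambda>v. q v * r v)"
      by (intro homogeneous.mult pq r)+
    show "q (\<rho> x) * r (\<rho> x) \<noteq> 0" using pq W r by simp
    show "f y = p (\<rho> y) * r (\<rho> y) / (q (\<rho> y) * r (\<rho> y))"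
      if "y \<in> lns" "q (\<rho> y) * r (\<rho> y) \<noteq> 0" for y
      using pq(3)[OF r(3)[of y]] that by simp
  qed
qed

lemma mhom_mult:
  assumes "length ds = length es" "mhom ds f" "mhom es g"
  shows "mhom (map2 (+) ds es) (\<lambda>ys. f ys * g ys)"
  using assms(1) unfolding mhom_def by (intro tensors_mult[OF assms(2,3)[unfolded mhom_def]]) (auto intro: homogeneous.mult)

lemma mhom_coord: "k < m \<Longrightarrow> homogeneous I d p \<Longrightarrow> mhom ((replicate m 0)[k := d]) (\<lambda>ys. p (ys ! k))"
  unfolding mhom_def by (intro tensors_coord) (auto intro: homogeneous.const simp del: map_replicate simp: nth_list_update)

lemma mhom_box:
  assumes Us: "Us \<in> open_boxes m X" and xs: "xs \<in> listset Us"
  shows "\<exists>ds H. length ds = m \<and> mhom ds H \<and> H (map \<rho> xs) \<noteq> 0 \<and>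
     (\<forall>ys \<in> pts. H (map \<rho> ys) \<noteq> 0 \<longrightarrow> ys \<in> listset Us)"
proof -
  have l: "length Us = m" "length xs = m" using Us xs
    by (auto simp: open_boxes_def in_listset_iff list_all2_lengthD)
  have "\<exists>d p. homogeneous I d p \<and> p (\<rho> (xs ! k)) \<noteq> 0 \<and> (\<forall>y \<in> lns. p (\<rho> y) \<noteq> 0 \<longrightarrow> y \<in> Us ! k)" if "k < m" for k
  proof -
    have "openin (ztop X) (Us ! k)" "xs ! k \<in> Us ! k"
      using that Us xs l by (auto simp: open_boxes_def in_listset_iff list_all2_conv_all_nth)
    then show ?thesis by (rule open_X_local) blast
  qed
  then obtain d p where dp: "\<And>k. k < m \<Longrightarrow> homogeneous I (d k) (p k)"
    "\<And>k. k < m \<Longrightarrow> p k (\<rho> (xs ! k)) \<noteq> 0" "\<And>k y. k < m \<Longrightarrow> y \<in> lns \<Longrightarrow> p k (\<rho> y) \<noteq> 0 \<Longrightarrow> y \<in> Us ! k" by metis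
  let ?ds = "map d [0..<m]" and ?gs = "map p [0..<m]"
  have "mhom ?ds (tprod ?gs)"
    unfolding mhom_def using dp by (intro tensors.tprod) (auto simp: list_all2_conv_all_nth)
  moreover have "tprod ?gs (map \<rho> xs) \<noteq> 0" using dp l by (simp add: tprod_conv_prod)
  moreover have "ys \<in> listset Us" if "ys \<in> pts" "tprod ?gs (map \<rho> ys) \<noteq> 0" for ys
  proof -
    have "length ys = m" using that by simp
    with that(2) have "p k (\<rho> (ys ! k)) \<noteq> 0" if "k < m" for k using that by (simp add: tprod_conv_prod)
    then show ?thesis using dp(3) that l by (auto simp: in_listset_iff list_all2_conv_all_nth subset_iff)
  qed
  ultimately show ?thesis by (intro exI[of _ ?ds] exI[of _ "tprod ?gs"]) auto
qed

text \<open>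
  Near a point each of the finitely many regular functions that occur in \<open>h\<close> is a fraction of
  homogeneous polynomials, and the box itself contains the non-vanishing locus of a product of
  homogeneous polynomials.
\<close>

lemma box_algebra_local:
  assumes h: "h \<in> box_algebra X Us" and Us: "Us \<in> open_boxes m X" and xs: "xs \<in> listset Us"
  shows "\<exists>ds G H. length ds = m \<and> mhom ds G \<and> mhom ds H \<and> H (map \<rho> xs) \<noteq> 0 \<and>
     (\<forall>ys \<in> pts. H (map \<rho> ys) \<noteq> 0 \<longrightarrow> ys \<in> listset Us \<and> h ys = G (map \<rho> ys) / H (map \<rho> ys))"
  using h
proof (induction rule: box_algebra.induct)
  case (const c)
  obtain ds H where H: "length ds = m" "mhom ds H" "H (map \<rho> xs) \<noteq> 0"
     "\<forall>ys \<in> pts. H (map \<rho> ys) \<noteq> 0 \<longrightarrow> ys \<in> listset Us" using mhom_box[OF Us xs] by blast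
  then show ?case
    by (intro exI[of _ ds] exI[of _ "\<lambda>ys. c * H ys"] exI[of _ H]) (auto intro: mhom_scale)
next
  case (coord k f)
  obtain ds H where H: "length ds = m" "mhom ds H" "H (map \<rho> xs) \<noteq> 0"
     "\<forall>ys \<in> pts. H (map \<rho> ys) \<noteq> 0 \<longrightarrow> ys \<in> listset Us" using mhom_box[OF Us xs] by blast
  have k: "k < m" "length xs = m" "xs ! k \<in> Us ! k" using coord Us xs
    by (auto simp: open_boxes_def in_listset_iff list_all2_conv_all_nth)
  from coord(2) k(3) obtain d p q where pq: "homogeneous I d p" "homogeneous I d q" "q (\<rho> (xs ! k)) \<noteq> 0"
    "\<And>y. y \<in> lns \<Longrightarrow> q (\<rho> y) \<noteq> 0 \<Longrightarrow> f y = p (\<rho> y) / q (\<rho> y)" by (rule regular_X_local) blast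
  let ?es = "(replicate m 0)[k := d]"
  have "mhom (map2 (+) ds ?es) (\<lambda>ys. H ys * p (ys ! k))" "mhom (map2 (+) ds ?es) (\<lambda>ys. H ys * q (ys ! k))"
    by (rule mhom_mult[OF _ H(2) mhom_coord[OF k(1) pq(1)]], simp add: H(1))
      (rule mhom_mult[OF _ H(2) mhom_coord[OF k(1) pq(2)]], simp add: H(1))
  then show ?case using H pq(3,4) k
    by (intro exI[of _ "map2 (+) ds ?es"] exI[of _ "\<lambda>ys. H ys * p (ys ! k)"] exI[of _ "\<lambda>ys. H ys * q (ys ! k)"])
      (auto simp: subset_iff)
next
  case (add f g)
  obtain ds G H where 1: "length ds = m" "mhom ds G" "mhom ds H" "H (map \<rho> xs) \<noteq> 0"
     "\<forall>ys \<in> pts. H (map \<rho> ys) \<noteq> 0 \<longrightarrow> ys \<in> listset Us \<and> f ys = G (map \<rho> ys) / H (map \<rho> ys)" using add.IH(1) by blast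
  obtain es A B where 2: "length es = m" "mhom es A" "mhom es B" "B (map \<rho> xs) \<noteq> 0"
     "\<forall>ys \<in> pts. B (map \<rho> ys) \<noteq> 0 \<longrightarrow> ys \<in> listset Us \<and> g ys = A (map \<rho> ys) / B (map \<rho> ys)" using add.IH(2) by blast
  let ?e = "map2 (+) ds es"
  have "mhom ?e (\<lambda>ys. G ys * B ys + H ys * A ys)" "mhom ?e (\<lambda>ys. H ys * B ys)"
    using 1 2 by (auto intro!: mhom_add mhom_mult)
  moreover have "f ys + g ys = (G (map \<rho> ys) * B (map \<rho> ys) + H (map \<rho> ys) * A (map \<rho> ys)) / (H (map \<rho> ys) * B (map \<rho> ys))"
    if "ys \<in> pts" "H (map \<rho> ys) * B (map \<rho> ys) \<noteq> 0" for ys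
  proof -
    have "H (map \<rho> ys) \<noteq> 0" "B (map \<rho> ys) \<noteq> 0" using that by auto
    moreover from this have "f ys = G (map \<rho> ys) / H (map \<rho> ys)" "g ys = A (map \<rho> ys) / B (map \<rho> ys)"
      using bspec[OF 1(5) that(1)] bspec[OF 2(5) that(1)] by blast+
    ultimately show ?thesis by (simp add: field_simps)
  qed
  ultimately show ?case using 1 2
    by (intro exI[of _ ?e] exI[of _ "\<lambda>ys. G ys * B ys + H ys * A ys"] exI[of _ "\<lambda>ys. H ys * B ys"]) auto
next
  case (mult f g)
  obtain ds G H where 1: "length ds = m" "mhom ds G" "mhom ds H" "H (map \<rho> xs) \<noteq> 0"
     "\<forall>ys \<in> pts. H (map \<rho> ys) \<noteq> 0 \<longrightarrow> ys \<in> listset Us \<and> f ys = G (map \<rho> ys) / H (map \<rho> ys)" using mult.IH(1) by blast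
  obtain es A B where 2: "length es = m" "mhom es A" "mhom es B" "B (map \<rho> xs) \<noteq> 0"
     "\<forall>ys \<in> pts. B (map \<rho> ys) \<noteq> 0 \<longrightarrow> ys \<in> listset Us \<and> g ys = A (map \<rho> ys) / B (map \<rho> ys)" using mult.IH(2) by blast
  let ?e = "map2 (+) ds es"
  have "mhom ?e (\<lambda>ys. G ys * A ys)" "mhom ?e (\<lambda>ys. H ys * B ys)"
    using 1 2 by (auto intro!: mhom_mult)
  then show ?case using 1 2
    by (intro exI[of _ ?e] exI[of _ "\<lambda>ys. G ys * A ys"] exI[of _ "\<lambda>ys. H ys * B ys"]) auto
qed

lemma open_power_local:
  assumes W: "openin (ztop (power_fspace m X)) W" and xs: "xs \<in> W"
  shows "\<exists>ds H. length ds = m \<and> mhom ds H \<and> xs \<in> pts \<and> H (map \<rho> xs) \<noteq> 0 \<and>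
     (\<forall>ys \<in> pts. H (map \<rho> ys) \<noteq> 0 \<longrightarrow> ys \<in> W)"
proof -
  let ?S = "{nonvanishing Us h | Us h. Us \<in> open_boxes m X \<and> h \<in> box_algebra X Us}"
  let ?B = "{{ys \<in> pts. H (map \<rho> ys) \<noteq> 0} | H. \<exists>ds. length ds = m \<and> mhom ds H}"
  have "\<exists>B \<in> ?B. xs \<in> B \<and> B \<subseteq> W"
  proof (rule topology_generated_by_base[OF _ _ _ xs])
    show "openin (topology_generated_by ?S) W" using W by (simp add: power_fspace_def Let_def)
  next
    fix A x assume A: "A \<in> ?S" "x \<in> A"
    then obtain Us h where Uh: "A = nonvanishing Us h" "Us \<in> open_boxes m X" "h \<in> box_algebra X Us" by blast
    with A have x: "x \<in> listset Us" "h x \<noteq> 0" by (auto simp: nonvanishing_def)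
    obtain ds G H where *: "length ds = m" "mhom ds G" "mhom ds H" "H (map \<rho> x) \<noteq> 0"
     "\<forall>ys \<in> pts. H (map \<rho> ys) \<noteq> 0 \<longrightarrow> ys \<in> listset Us \<and> h ys = G (map \<rho> ys) / H (map \<rho> ys)"
      using box_algebra_local[OF Uh(3,2) x(1)] by blast
    have "\<Union>(set Us) \<subseteq> lns" using Uh(2) openin_subset
      by (fastforce simp: open_boxes_def points_projective_space)
    then have xp: "x \<in> pts" using x(1) Uh(2)
      by (fastforce simp: in_listset_iff open_boxes_def list_all2_conv_all_nth in_set_conv_nth)
    let ?K = "\<lambda>ys. G ys * H ys"
    have "mhom (map2 (+) ds ds) ?K" using * by (intro mhom_mult) auto
    moreover have "{ys \<in> pts. ?K (map \<rho> ys) \<noteq> 0} \<subseteq> A" using *(5) by (auto simp: Uh(1) nonvanishing_def)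
    moreover have "?K (map \<rho> x) \<noteq> 0" using *(4,5) xp x(2) by auto
    ultimately show "\<exists>B \<in> ?B. x \<in> B \<and> B \<subseteq> A" using xp *(1)
      by (intro bexI[of _ "{ys \<in> pts. ?K (map \<rho> ys) \<noteq> 0}"] CollectI exI[of _ ?K] conjI exI[of _ "map2 (+) ds ds"] refl) auto
  next
    fix B C x assume BC: "B \<in> ?B" "C \<in> ?B" "x \<in> B" "x \<in> C"
    from BC(1) obtain ds F where 1: "B = {ys \<in> pts. F (map \<rho> ys) \<noteq> 0}" "length ds = m" "mhom ds F" by blast
    from BC(2) obtain es H where 2: "C = {ys \<in> pts. H (map \<rho> ys) \<noteq> 0}" "length es = m" "mhom es H" by blast
    let ?K = "\<lambda>ys. F ys * H ys"
    have "mhom (map2 (+) ds es) ?K" using 1 2 by (intro mhom_mult) auto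
    moreover have "B \<inter> C = {ys \<in> pts. ?K (map \<rho> ys) \<noteq> 0}" using 1 2 by auto
    ultimately have "B \<inter> C \<in> ?B" using 1(2) 2(2)
      by (intro CollectI exI[of _ ?K] conjI exI[of _ "map2 (+) ds es"]) auto
    with BC(3,4) show "\<exists>D \<in> ?B. x \<in> D \<and> D \<subseteq> B \<inter> C" by (intro bexI[of _ "B \<inter> C"]) auto
  qed
  then show ?thesis by blast
qed

lemma regular_power_local:
  assumes f: "f \<in> regular (power_fspace m X) W" and xs: "xs \<in> W"
  shows "\<exists>ds G H. length ds = m \<and> mhom ds G \<and> mhom ds H \<and> H (map \<rho> xs) \<noteq> 0 \<and>
     (\<forall>ys \<in> pts. H (map \<rho> ys) \<noteq> 0 \<longrightarrow> ys \<in> W \<and> f ys = G (map \<rho> ys) / H (map \<rho> ys))"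
proof -
  obtain W' Us g h where W': "openin (ztop (power_fspace m X)) W'" "xs \<in> W'" "W' \<subseteq> W"
    and gh: "Us \<in> open_boxes m X" "g \<in> box_algebra X Us" "h \<in> box_algebra X Us"
      "W' \<subseteq> nonvanishing Us h" "\<forall>xs \<in> W'. f xs = g xs / h xs"
    using f xs unfolding power_fspace_def Let_def locally_on_def by auto
  have x: "xs \<in> listset Us" "h xs \<noteq> 0" using gh W' by (auto simp: nonvanishing_def)
  obtain ds K where K: "length ds = m" "mhom ds K" "xs \<in> pts" "K (map \<rho> xs) \<noteq> 0"
     "\<forall>ys \<in> pts. K (map \<rho> ys) \<noteq> 0 \<longrightarrow> ys \<in> W'" using open_power_local[OF W'(1,2)] by blast
  obtain es A B where 1: "length es = m" "mhom es A" "mhom es B" "B (map \<rho> xs) \<noteq> 0"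
     "\<forall>ys \<in> pts. B (map \<rho> ys) \<noteq> 0 \<longrightarrow> ys \<in> listset Us \<and> g ys = A (map \<rho> ys) / B (map \<rho> ys)"
    using box_algebra_local[OF gh(2,1) x(1)] by blast
  obtain fs C D where 2: "length fs = m" "mhom fs C" "mhom fs D" "D (map \<rho> xs) \<noteq> 0"
     "\<forall>ys \<in> pts. D (map \<rho> ys) \<noteq> 0 \<longrightarrow> ys \<in> listset Us \<and> h ys = C (map \<rho> ys) / D (map \<rho> ys)"
    using box_algebra_local[OF gh(3,1) x(1)] by blast
  let ?ds = "map2 (+) (map2 (+) ds fs) (map2 (+) es fs)"
  let ?G = "\<lambda>ys. K ys * D ys * (A ys * D ys)" and ?H = "\<lambda>ys. K ys * D ys * (B ys * C ys)"
  have "mhom ?ds ?G" "mhom ?ds ?H" using K 1 2 by (auto intro!: mhom_mult)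
  moreover have "C (map \<rho> xs) \<noteq> 0" using bspec[OF 2(5) K(3)] 2(4) x by auto
  then have "?H (map \<rho> xs) \<noteq> 0" using K 1 2 by simp
  moreover have "ys \<in> W \<and> f ys = ?G (map \<rho> ys) / ?H (map \<rho> ys)" if ys: "ys \<in> pts" "?H (map \<rho> ys) \<noteq> 0" for ys
  proof -
    have nz: "K (map \<rho> ys) \<noteq> 0" "B (map \<rho> ys) \<noteq> 0" "C (map \<rho> ys) \<noteq> 0" "D (map \<rho> ys) \<noteq> 0" using ys by auto
    have yW: "ys \<in> W'" using K ys nz by blast
    moreover have "g ys = A (map \<rho> ys) / B (map \<rho> ys)" "h ys = C (map \<rho> ys) / D (map \<rho> ys)"
      using bspec[OF 1(5) ys(1)] bspec[OF 2(5) ys(1)] nz by blast+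
    moreover from this have "f ys = (A (map \<rho> ys) / B (map \<rho> ys)) / (C (map \<rho> ys) / D (map \<rho> ys))"
      using bspec[OF gh(5) yW] by simp
    ultimately show ?thesis using W' nz by (auto simp: divide_simps)
  qed
  ultimately show ?thesis using K(1) 1(1) 2(1)
    by (intro exI[of _ ?ds] exI[of _ ?G] exI[of _ ?H]) auto
qed

text \<open>
  Different lines have generators with a non-zero \<open>2 \<times> 2\<close> minor; fix one argument of that minor.
\<close>

lemma separating_form:
  assumes xy: "x \<in> lns" "y \<in> lns" "x \<noteq> y"
  shows "\<exists>q. homogeneous I 1 q \<and> q (\<rho> x) \<noteq> 0 \<and> q (\<rho> y) = 0"
proof -
  let ?x = "\<rho> x" and ?y = "\<rho> y"
  have nz: "?x \<noteq> 0" "?y \<noteq> 0" "?x \<in> x" "?y \<in> y" using rep xy by blast+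
  have sup: "v i = 0" if "L \<in> lns" "v \<in> L" "i \<notin> I" for L v i
    using that by (auto simp: linear_subspaces_def coord_space_def)
  obtain j where j: "?y j \<noteq> 0" using nz by (auto simp: fun_eq_iff)
  have jI: "j \<in> I" using sup[OF xy(2) nz(4)] j by blast
  have "\<exists>i\<in>I. ?x i * ?y j \<noteq> ?x j * ?y i"
  proof (rule ccontr)
    assume "\<not> ?thesis"
    then have "?x i = (?x j / ?y j) * ?y i" for i
      using j sup[OF xy(1) nz(3)] sup[OF xy(2) nz(4)] by (cases "i \<in> I") (auto simp: field_simps)
    then have e: "?x = scale_fun (?x j / ?y j) ?y" unfolding scale_fun_def by (rule ext)
    then have "?x \<in> y" using line_generator[OF xy(2) nz(4,2)] by blast
    then have "y = range (\<lambda>c. scale_fun c ?x)" using line_generator[OF xy(2)] nz by blast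
    moreover have "x = range (\<lambda>c. scale_fun c ?x)" using line_generator[OF xy(1)] nz by blast
    ultimately show False using xy(3) by simp
  qed
  then obtain i where i: "i \<in> I" "?x i * ?y j \<noteq> ?x j * ?y i" by blast
  let ?q = "\<lambda>v. ?y j * v i + (- ?y i) * v j"
  have "homogeneous I (0 + 1) ?q"
    by (intro homogeneous.add homogeneous.mult homogeneous.const homogeneous.var i jI)
  then show ?thesis using i by (intro exI[of _ ?q]) (auto simp: algebra_simps)
qed

lemma separating_form_set:
  assumes "finite Y" "Y \<subseteq> lns" "x \<in> lns" "x \<notin> Y" "n \<ge> card Y"
  shows "\<exists>q. homogeneous I n q \<and> q (\<rho> x) \<noteq> 0 \<and> (\<forall>y \<in> Y. q (\<rho> y) = 0)"
  using assms
proof (induction arbitrary: n rule: finite_induct)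
  case empty
  obtain i where i: "\<rho> x i \<noteq> 0" using rep[OF empty(2)] by (auto simp: fun_eq_iff)
  have iI: "i \<in> I" using i rep[OF empty(2)] empty(2) by (auto simp: linear_subspaces_def coord_space_def)
  have "homogeneous I n (\<lambda>v. v i ^ n)"
  proof (induction n)
    case (Suc n)
    from homogeneous.mult[OF homogeneous.var[OF iI] Suc] show ?case by simp
  qed (simp add: homogeneous.const)
  with i show ?case by (intro exI[of _ "\<lambda>v. v i ^ n"]) auto
next
  case (insert y Y)
  obtain q where q: "homogeneous I 1 q" "q (\<rho> x) \<noteq> 0" "q (\<rho> y) = 0"
    using separating_form[of x y] insert.prems by (metis insert_iff insert_subset)
  obtain r where r: "homogeneous I (n - 1) r" "r (\<rho> x) \<noteq> 0" "\<forall>y \<in> Y. r (\<rho> y) = 0"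
  proof -
    have "card Y \<le> n - 1" "Y \<subseteq> lns" "x \<notin> Y" using insert.prems insert.hyps by simp_all
    then show ?thesis using insert.IH[of "n - 1"] insert.prems(2) that by blast
  qed
  have "homogeneous I (1 + (n - 1)) (\<lambda>v. q v * r v)" by (intro homogeneous.mult q r)
  moreover have "1 + (n - 1) = n" using insert.prems insert.hyps by simp
  ultimately show ?case using q r by (intro exI[of _ "\<lambda>v. q v * r v"]) auto
qed

text \<open>
  A function \<open>f\<close> on multisets that is a fraction \<open>G / H\<close> near one enumeration \<open>xs\<close> is a fraction of
  symmetric functions near \<open>mset xs\<close>. The equation \<open>f \<cdot> H = G\<close> survives symmetrization because \<open>f\<close> is
  invariant, but the symmetrization of \<open>H\<close> could vanish at \<open>xs\<close>. Therefore \<open>H\<close> is first multiplied by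
  a product \<open>Q\<close> of separating forms that vanishes at all rearrangements of \<open>xs\<close> other than \<open>xs\<close>;
  then all non-zero terms of the symmetrization at \<open>xs\<close> are equal.
\<close>

lemma symmetric_local:
  assumes ds: "length ds = m" "mhom ds G" "mhom ds H" "H (map \<rho> xs) \<noteq> 0" and xs: "xs \<in> pts"
    and *: "\<And>ys. ys \<in> pts \<Longrightarrow> H (map \<rho> ys) \<noteq> 0 \<Longrightarrow> mset ys \<in> W \<and> f (mset ys) = G (map \<rho> ys) / H (map \<rho> ys)"
  shows "\<exists>d G' H'. tensors (replicate m (homog I d)) G' \<and> tensors (replicate m (homog I d)) H' \<and>
     msum m H' (image_mset \<rho> (mset xs)) \<noteq> 0 \<and>
     (\<forall>ys \<in> pts. msum m H' (image_mset \<rho> (mset ys)) \<noteq> 0 \<longrightarrow> mset ys \<in> W \<and>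
        f (mset ys) = msum m G' (image_mset \<rho> (mset ys)) / msum m H' (image_mset \<rho> (mset ys)))"
proof -
  \<comment> \<open>A common degree that leaves room for \<open>H\<^sup>2\<close> and for up to \<open>m\<close> separating forms in each position.\<close>
  define D where "D = 2 * sum_list ds + m"
  have D: "D - 2 * ds ! k \<ge> m \<and> 2 * ds ! k \<le> D" if "k < m" for k
    using member_le_sum_list[of "ds ! k" ds] that ds(1) by (auto simp: D_def)
  have "\<exists>q. homogeneous I (D - 2 * ds ! k) q \<and> q (\<rho> (xs ! k)) \<noteq> 0 \<and> (\<forall>y \<in> set xs - {xs ! k}. q (\<rho> y) = 0)"
    if k: "k < m" for k
  proof (rule separating_form_set)
    have "card (set xs - {xs ! k}) \<le> card (set xs)" by (intro card_mono) auto
    also have "\<dots> \<le> m" using card_length[of xs] xs by simp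
    finally show "card (set xs - {xs ! k}) \<le> D - 2 * ds ! k" using D[OF k] by linarith
  qed (use xs k in \<open>auto simp: subset_iff\<close>)
  then obtain q where q: "\<And>k. k < m \<Longrightarrow> homogeneous I (D - 2 * ds ! k) (q k)"
    "\<And>k. k < m \<Longrightarrow> q k (\<rho> (xs ! k)) \<noteq> 0" "\<And>k y. k < m \<Longrightarrow> y \<in> set xs \<Longrightarrow> y \<noteq> xs ! k \<Longrightarrow> q k (\<rho> y) = 0" by (metis DiffI singletonD)
  let ?Q = "tprod (map q [0..<m])"
  let ?es = "map (\<lambda>k. D - 2 * ds ! k) [0..<m]"
  have Q: "mhom ?es ?Q"
    unfolding mhom_def using q by (intro tensors.tprod) (auto simp: list_all2_conv_all_nth)
  have deg: "map2 (+) (map2 (+) ds ds) ?es = replicate m D"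
    using ds(1) D by (intro nth_equalityI) auto
  have deg': "tensors (replicate m (homog I D)) F" if "mhom (replicate m D) F" for F
    using that by (simp add: mhom_def)
  \<comment> \<open>The additional factor \<open>H\<close> makes \<open>f \<cdot> H' = G'\<close> hold also where \<open>H\<close> vanishes.\<close>
  define G' where "G' ys = G ys * H ys * ?Q ys" for ys
  define H' where "H' ys = H ys * H ys * ?Q ys" for ys
  have "mhom (replicate m D) G'" "mhom (replicate m D) H'"
    unfolding G'_def H'_def deg[symmetric] using ds Q by (auto intro!: mhom_mult)
  then have GH': "tensors (replicate m (homog I D)) G'" "tensors (replicate m (homog I D)) H'"
    by (auto intro: deg')
  have arr: "\<exists>zs. mset zs = mset ys \<and> vs = map \<rho> zs \<and> zs \<in> pts"
    if "length vs = m" "mset vs \<subseteq># image_mset \<rho> (mset ys)" "ys \<in> pts" for vs ys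
  proof -
    have "mset vs = image_mset \<rho> (mset ys)"
      using that by (intro submset_size_eq) auto
    then obtain zs where zs: "mset zs = mset ys" "vs = map \<rho> zs"
      using mset_eq_map_imp_map[of vs \<rho> ys] by auto
    have "zs \<in> pts" using that(3) mset_eq_setD[OF zs(1)] mset_eq_length[OF zs(1)] by simp
    with zs show ?thesis by blast
  qed
  have Qxs: "?Q (map \<rho> xs) \<noteq> 0" using q xs by (simp add: tprod_conv_prod)
  have "msum m H' (image_mset \<rho> (mset xs)) =
      msum m (\<lambda>vs. H' (map \<rho> xs) * of_nat (if vs = map \<rho> xs then 1 else 0)) (image_mset \<rho> (mset xs))"
  proof (rule msum_cong)
    fix vs assume "length vs = m" "mset vs \<subseteq># image_mset \<rho> (mset xs)"
    then obtain zs where zs: "mset zs = mset xs" "vs = map \<rho> zs" "zs \<in> pts" using arr xs by blast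
    show "H' vs = H' (map \<rho> xs) * of_nat (if vs = map \<rho> xs then 1 else 0)"
    proof (cases "vs = map \<rho> xs")
      case False
      then have "zs \<noteq> xs" using zs by blast
      then obtain k where k: "k < m" "zs ! k \<noteq> xs ! k" using zs(3) xs
        by (auto simp: list_eq_iff_nth_eq)
      have "zs ! k \<in> set xs" using zs k by (metis (mono_tags, lifting) mem_Collect_eq mset_eq_setD nth_mem)
      then have "q k (\<rho> (zs ! k)) = 0" using q(3) k by blast
      then have "?Q vs = 0" using k zs(2,3) by (auto simp: tprod_conv_prod)
      with False show ?thesis by (simp add: H'_def)
    qed simp
  qed
  also have "\<dots> = H' (map \<rho> xs) * of_nat (msum m (\<lambda>vs. if vs = map \<rho> xs then 1 else 0) (image_mset \<rho> (mset xs)))"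
    by (simp only: msum_cmult msum_of_nat)
  also have "\<dots> \<noteq> 0"
  proof -
    have "msum m (\<lambda>vs. if vs = map \<rho> xs then 1 else (0::nat)) (image_mset \<rho> (mset xs)) > 0"
      by (rule msum_pos[of "map \<rho> xs"]) (use xs in auto)
    then show ?thesis using ds(4) Qxs by (simp add: H'_def)
  qed
  finally have nz: "msum m H' (image_mset \<rho> (mset xs)) \<noteq> 0" .
  have main: "mset ys \<in> W \<and> f (mset ys) = msum m G' (image_mset \<rho> (mset ys)) / msum m H' (image_mset \<rho> (mset ys))"
    if ys: "ys \<in> pts" "msum m H' (image_mset \<rho> (mset ys)) \<noteq> 0" for ys
  proof -
    have "\<exists>zs. mset zs = mset ys \<and> zs \<in> pts \<and> H (map \<rho> zs) \<noteq> 0"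
    proof (rule ccontr)
      assume no: "\<not> ?thesis"
      have "msum m H' (image_mset \<rho> (mset ys)) = msum m (\<lambda>_. 0) (image_mset \<rho> (mset ys))"
      proof (rule msum_cong)
        fix vs assume "length vs = m" "mset vs \<subseteq># image_mset \<rho> (mset ys)"
        then obtain zs where zs: "mset zs = mset ys" "vs = map \<rho> zs" "zs \<in> pts" using arr ys by blast
        with no have "H vs = 0" by blast
        then show "H' vs = 0" by (simp add: H'_def)
      qed
      with ys show False by simp
    qed
    then obtain zs where "mset zs = mset ys" "zs \<in> pts" "H (map \<rho> zs) \<noteq> 0" by (elim exE conjE)
    with *[of zs] have W: "mset ys \<in> W" by simp
    have "msum m G' (image_mset \<rho> (mset ys)) = msum m (\<lambda>vs. f (mset ys) * H' vs) (image_mset \<rho> (mset ys))"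
    proof (rule msum_cong)
      fix vs assume "length vs = m" "mset vs \<subseteq># image_mset \<rho> (mset ys)"
      then obtain zs where zs: "mset zs = mset ys" "vs = map \<rho> zs" "zs \<in> pts" using arr ys by blast
      show "G' vs = f (mset ys) * H' vs"
      proof (cases "H vs = 0")
        case False
        then have "f (mset ys) = G vs / H vs" using *[OF zs(3)] zs by auto
        then show ?thesis using False by (simp add: G'_def H'_def)
      qed (simp add: G'_def H'_def)
    qed
    then show ?thesis using W ys(2) by (simp add: msum_cmult)
  qed
  show ?thesis
    by (intro exI[of _ D] exI[of _ G'] exI[of _ H'] conjI ballI impI GH' nz) (use main in blast)+
qed

text \<open>
  Dividing by powers of coordinates that do not vanish on the box turns a multihomogeneous polynomial
  into an element of the algebra generated by regular functions of the single points.
\<close>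

lemma mhom_box_algebra:
  assumes H: "mhom ds H" and ds: "length ds = m"
    and i: "\<And>k. k < m \<Longrightarrow> i k \<in> I"
  defines "Us \<equiv> map (\<lambda>k. {L \<in> lns. \<rho> L (i k) \<noteq> 0}) [0..<m]"
  shows "\<exists>F \<in> box_algebra X Us. \<forall>ys. length ys = m \<longrightarrow>
     F ys = H (map \<rho> ys) / (\<Prod>k<m. \<rho> (ys ! k) (i k) ^ (ds ! k))"
  using H unfolding mhom_def
proof (induction rule: tensors.induct)
  case zero
  then show ?case by (intro bexI[OF _ box_algebra.const[of 0]]) auto
next
  case (tprod gs)
  then have gs: "length gs = m" "\<And>k. k < m \<Longrightarrow> homogeneous I (ds ! k) (gs ! k)"
    using ds by (auto dest: list_all2_lengthD simp: list_all2_conv_all_nth)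
  let ?f = "\<lambda>k L. (gs ! k) (\<rho> L) / \<rho> L (i k) ^ (ds ! k)"
  have pw: "homogeneous I n (\<lambda>v. v (i k) ^ n)" if "k < m" for k n
  proof (induction n)
    case (Suc n)
    from homogeneous.mult[OF homogeneous.var[OF i[OF that]] Suc] show ?case by simp
  qed (simp add: homogeneous.const)
  have reg: "?f k \<in> regular X (Us ! k)" if k: "k < m" for k
  proof -
    have "openin (graded_topology (pulled_back \<rho> (homog I)) lns) {L \<in> lns. (\<lambda>L. \<rho> L (i k)) L \<noteq> 0}"
      by (intro open_nonvanishing_graded[where d = 1] pulled_backI CollectI homogeneous.var i[OF k])
    moreover have "?f k \<in> ratios (pulled_back \<rho> (homog I)) {L \<in> lns. \<rho> L (i k) \<noteq> 0}"
      by (rule ratiosI[of "\<lambda>L. (gs ! k) (\<rho> L)" _ "ds ! k" "\<lambda>L. \<rho> L (i k) ^ (ds ! k)"])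
        (use gs(2) pw k in \<open>auto simp: pulled_back_def\<close>)
    ultimately show ?thesis using k unfolding X_graded by (simp add: Us_def L.ratios_regular)
  qed
  have "(\<lambda>ys. \<Prod>k<n. ?f k (ys ! k)) \<in> box_algebra X Us" if "n \<le> m" for n
    using that
  proof (induction n)
    case 0
    then show ?case by (simp add: box_algebra.const)
  next
    case (Suc n)
    then have "(\<lambda>ys. ?f n (ys ! n)) \<in> box_algebra X Us"
      using reg[of n] by (intro box_algebra.coord) (auto simp: Us_def)
    moreover have "(\<lambda>ys. \<Prod>k<n. ?f k (ys ! k)) \<in> box_algebra X Us" using Suc by simp
    ultimately show ?case unfolding prod.lessThan_Suc by (intro box_algebra.mult)
  qed
  from this[of m] show ?case
    by (rule bexI[rotated]) (use gs(1) in \<open>auto simp: tprod_conv_prod prod_dividef\<close>)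
next
  case (scale f c)
  then obtain F where "F \<in> box_algebra X Us" "\<forall>ys. length ys = m \<longrightarrow>
     F ys = f (map \<rho> ys) / (\<Prod>k<m. \<rho> (ys ! k) (i k) ^ (ds ! k))" by blast
  then show ?case by (intro bexI[OF _ box_algebra.mult[OF box_algebra.const[of c]]]) auto
next
  case (add f g)
  obtain F where F: "F \<in> box_algebra X Us" "\<forall>ys. length ys = m \<longrightarrow>
     F ys = f (map \<rho> ys) / (\<Prod>k<m. \<rho> (ys ! k) (i k) ^ (ds ! k))" using add.IH(1) by blast
  obtain K where K: "K \<in> box_algebra X Us" "\<forall>ys. length ys = m \<longrightarrow>
     K ys = g (map \<rho> ys) / (\<Prod>k<m. \<rho> (ys ! k) (i k) ^ (ds ! k))" using add.IH(2) by blast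
  show ?case by (rule bexI[OF _ box_algebra.add[OF F(1) K(1)]]) (use F K in \<open>auto simp: add_divide_distrib\<close>)
next
  case (cong f g)
  then obtain F where F: "F \<in> box_algebra X Us" "\<forall>ys. length ys = m \<longrightarrow>
     F ys = f (map \<rho> ys) / (\<Prod>k<m. \<rho> (ys ! k) (i k) ^ (ds ! k))" by blast
  have "f (map \<rho> ys) = g (map \<rho> ys)" if "length ys = m" for ys using cong(2)[of "map \<rho> ys"] that ds by simp
  with F show ?case by (intro bexI[of _ F]) auto
qed

lemma mhom_ratio_local:
  assumes ds: "length ds = m" "mhom ds G" "mhom ds H" and xs: "xs \<in> pts" "H (map \<rho> xs) \<noteq> 0"
  shows "\<exists>W Us. \<exists>g \<in> box_algebra X Us. \<exists>h \<in> box_algebra X Us. Us \<in> open_boxes m X \<and>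
     openin (ztop (power_fspace m X)) W \<and> xs \<in> W \<and> W \<subseteq> nonvanishing Us h \<and>
     (\<forall>ys \<in> W. ys \<in> pts \<and> H (map \<rho> ys) \<noteq> 0 \<and> G (map \<rho> ys) / H (map \<rho> ys) = g ys / h ys)"
proof -
  have "\<exists>i \<in> I. \<rho> (xs ! k) i \<noteq> 0" if "k < m" for k
  proof -
    have "xs ! k \<in> lns" using xs(1) that by auto
    then show ?thesis using rep[of "xs ! k"] by (fastforce simp: linear_subspaces_def coord_space_def fun_eq_iff)
  qed
  then obtain i where i: "\<And>k. k < m \<Longrightarrow> i k \<in> I" "\<And>k. k < m \<Longrightarrow> \<rho> (xs ! k) (i k) \<noteq> 0" by metis
  define Us where "Us = map (\<lambda>k. {L \<in> lns. \<rho> L (i k) \<noteq> 0}) [0..<m]"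
  let ?p = "\<lambda>ys. \<Prod>k<m. \<rho> (ys ! k) (i k) ^ (ds ! k)"
  obtain g where g: "g \<in> box_algebra X Us" "\<And>ys. length ys = m \<Longrightarrow> g ys = G (map \<rho> ys) / ?p ys"
    using mhom_box_algebra[OF ds(2,1), of i] i(1) unfolding Us_def by blast
  obtain h where h: "h \<in> box_algebra X Us" "\<And>ys. length ys = m \<Longrightarrow> h ys = H (map \<rho> ys) / ?p ys"
    using mhom_box_algebra[OF ds(3,1), of i] i(1) unfolding Us_def by blast
  have "openin (ztop X) {L \<in> lns. \<rho> L (i k) \<noteq> 0}" if "k < m" for k
  proof -
    have "(\<lambda>L. \<rho> L (i k)) \<in> pulled_back \<rho> (homog I) 1"
      using i(1)[OF that] pulled_backI[of "\<lambda>v. v (i k)" "homog I" 1 \<rho>] by (simp add: homogeneous.var[unfolded One_nat_def])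
    then have "openin (graded_topology (pulled_back \<rho> (homog I)) lns) {L \<in> lns. \<rho> L (i k) \<noteq> 0}"
      by (rule open_nonvanishing_graded)
    then show ?thesis by (simp add: X_graded)
  qed
  then have Us: "Us \<in> open_boxes m X" by (auto simp: open_boxes_def Us_def)
  have mem: "ys \<in> listset Us \<longleftrightarrow> ys \<in> pts \<and> (\<forall>k<m. \<rho> (ys ! k) (i k) \<noteq> 0)" for ys
    by (auto simp: in_listset_iff Us_def list_all2_conv_all_nth in_set_conv_nth)
      (meson nth_mem subsetD)
  let ?W = "nonvanishing Us h"
  have "openin (ztop (power_fspace m X)) ?W"
    unfolding power_fspace_def Let_def using Us h(1) by (auto intro!: topology_generated_by_Basis)
  moreover have "xs \<in> ?W" using xs i h(2) by (auto simp: nonvanishing_def mem)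
  moreover have "ys \<in> pts \<and> H (map \<rho> ys) \<noteq> 0 \<and> G (map \<rho> ys) / H (map \<rho> ys) = g ys / h ys" if "ys \<in> ?W" for ys
    using that g(2)[of ys] h(2)[of ys] by (auto simp: nonvanishing_def mem)
  ultimately show ?thesis using g(1) h(1) Us
    by (intro exI[of _ ?W] exI[of _ Us] bexI[of _ g] bexI[of _ h] conjI ballI) auto
qed

text \<open>
  The symmetrizations of multihomogeneous polynomials of degree \<open>(d, \<dots>, d)\<close>. Agreement is required on
  multisets of size \<open>m\<close> only, so that the constants belong to degree \<open>0\<close> and the family is an algebra.
\<close>

definition sym_graded :: "nat \<Rightarrow> (('i \<Rightarrow> complex) multiset \<Rightarrow> complex) set" where
  "sym_graded d = {g. \<exists>f. tensors (replicate m (homog I d)) f \<and> (\<forall>M. size M = m \<longrightarrow> g M = msum m f M)}"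

text \<open>
  A symmetrization is constant on the rearrangements of a multiset, so it can be moved under another
  one: this is why products stay in the family.
\<close>

lemma graded_algebra_sym_graded: "graded_algebra sym_graded"
proof
  fix c :: complex
  have "tensors (replicate m (homog I 0)) (\<lambda>_. 1)"
    by (intro tensors_one) (auto intro: homogeneous.const)
  from tensors.scale[OF this, of "c / fact m"]
  have t: "tensors (replicate m (homog I 0)) (\<lambda>_. c / fact m * 1)" .
  have "msum m (\<lambda>_. c / fact m * 1) M = c" if "size M = m" for M :: "('i \<Rightarrow> complex) multiset"
  proof -
    have "msum m (\<lambda>_. 1 :: complex) M = of_nat (msum m (\<lambda>_. 1 :: nat) M)"
      using msum_of_nat[of m "\<lambda>_. 1" M, where ?'c = complex] by simp
    then show ?thesis using msum_one[OF that] by (simp only: msum_cmult) simp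
  qed
  with t show "(\<lambda>_. c) \<in> sym_graded 0" unfolding sym_graded_def by fastforce
next
  fix f g d assume "f \<in> sym_graded d" "g \<in> sym_graded d"
  then obtain f' g' where "tensors (replicate m (homog I d)) f'" "\<And>M. size M = m \<Longrightarrow> f M = msum m f' M"
    "tensors (replicate m (homog I d)) g'" "\<And>M. size M = m \<Longrightarrow> g M = msum m g' M"
    unfolding sym_graded_def by blast
  then show "(\<lambda>x. f x + g x) \<in> sym_graded d"
    unfolding sym_graded_def
    by (intro CollectI exI[of _ "\<lambda>ys. f' ys + g' ys"]) (auto intro: tensors.add simp: msum_add)
next
  fix f g d e assume "f \<in> sym_graded d" "g \<in> sym_graded e"
  then obtain f' g' where fg: "tensors (replicate m (homog I d)) f'" "\<And>M. size M = m \<Longrightarrow> f M = msum m f' M"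
    "tensors (replicate m (homog I e)) g'" "\<And>M. size M = m \<Longrightarrow> g M = msum m g' M"
    unfolding sym_graded_def by blast
  let ?h = "\<lambda>ys. f' ys * msum m g' (mset ys)"
  have "tensors (replicate m (homog I (d + e))) ?h"
    by (rule tensors_mult[OF fg(1) msum_tensors[OF fg(3)]]) (auto intro: homogeneous.mult)
  moreover have "f M * g M = msum m ?h M" if "size M = m" for M
  proof -
    have "msum m ?h M = msum m (\<lambda>ys. msum m g' M * f' ys) M"
    proof (rule msum_cong)
      fix ys assume "length ys = m" "mset ys \<subseteq># M"
      then have "mset ys = M" using that by (intro submset_size_eq) auto
      then show "?h ys = msum m g' M * f' ys" by simp
    qed
    then show ?thesis using fg that by (simp add: msum_cmult)
  qed
  ultimately show "(\<lambda>x. f x * g x) \<in> sym_graded (d + e)"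
    unfolding sym_graded_def by blast
qed

abbreviation "mpts \<equiv> {M. size M = m \<and> set_mset M \<subseteq> lns}"
abbreviation "SG \<equiv> pulled_back (image_mset \<rho>) sym_graded"

sublocale SG: graded_algebra SG
  by (rule graded_algebra.graded_algebra_pulled_back[OF graded_algebra_sym_graded])

lemma SG_cases:
  assumes "g \<in> SG d"
  obtains f where "tensors (replicate m (homog I d)) f" "\<And>ys. ys \<in> pts \<Longrightarrow> g (mset ys) = msum m f (mset (map \<rho> ys))"
  using assms
proof (rule pulled_backE)
  fix h assume h: "h \<in> sym_graded d" "g = (\<lambda>x. h (image_mset \<rho> x))"
  then obtain f where f: "tensors (replicate m (homog I d)) f" "\<And>M. size M = m \<Longrightarrow> h M = msum m f M"
    unfolding sym_graded_def by blast
  show ?thesis by (rule that[OF f(1)]) (use h f in auto)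
qed

lemma SG_I:
  assumes "tensors (replicate m (homog I d)) f"
  shows "(\<lambda>M. msum m f (image_mset \<rho> M)) \<in> SG d"
  by (rule pulled_backI) (use assms in \<open>auto simp: sym_graded_def\<close>)

lemma pts_power: "points (power_fspace m X) = pts"
  by (simp add: points_power_fspace points_projective_space)

lemma symmetric_power_open:
  "openin (ztop (symmetric_power m X)) W \<longleftrightarrow>
     W \<subseteq> mset ` pts \<and> openin (ztop (power_fspace m X)) {xs \<in> pts. mset xs \<in> W}"
  by (simp add: symmetric_power_def quotient_fspace_def openin_quotient_topology pts_power)

lemma mset_pts: "mset ` pts = mpts"
proof
  show "mpts \<subseteq> mset ` pts"
  proof
    fix M assume M: "M \<in> mpts"
    obtain xs where "mset xs = M" using ex_mset by blast
    with M show "M \<in> mset ` pts" by (intro image_eqI[of _ _ xs]) auto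
  qed
qed auto

lemma mpts_E: "M \<in> mpts \<Longrightarrow> (\<And>ys. ys \<in> pts \<Longrightarrow> M = mset ys \<Longrightarrow> thesis) \<Longrightarrow> thesis"
  unfolding mset_pts[symmetric] by (elim imageE)

lemma SG_ratio_local:
  assumes g: "g \<in> SG d" "h \<in> SG d" and xs: "xs \<in> pts" "h (mset xs) \<noteq> 0"
  shows "\<exists>W Us. \<exists>g' \<in> box_algebra X Us. \<exists>h' \<in> box_algebra X Us. Us \<in> open_boxes m X \<and>
     openin (ztop (power_fspace m X)) W \<and> xs \<in> W \<and> W \<subseteq> nonvanishing Us h' \<and>
     (\<forall>ys \<in> W. ys \<in> pts \<and> h (mset ys) \<noteq> 0 \<and> g (mset ys) / h (mset ys) = g' ys / h' ys)"
proof -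
  obtain G where G: "tensors (replicate m (homog I d)) G" "\<And>ys. ys \<in> pts \<Longrightarrow> g (mset ys) = msum m G (mset (map \<rho> ys))"
    using SG_cases[OF g(1)] by blast
  obtain H where H: "tensors (replicate m (homog I d)) H" "\<And>ys. ys \<in> pts \<Longrightarrow> h (mset ys) = msum m H (mset (map \<rho> ys))"
    using SG_cases[OF g(2)] by blast
  have "mhom (replicate m d) (\<lambda>ys. msum m G (mset ys))" "mhom (replicate m d) (\<lambda>ys. msum m H (mset ys))"
    using msum_tensors[OF G(1)] msum_tensors[OF H(1)] by (simp_all add: mhom_def)
  from mhom_ratio_local[OF _ this xs(1)] xs H(2)[OF xs(1)]
  obtain W Us g' h' where *: "g' \<in> box_algebra X Us" "h' \<in> box_algebra X Us" "Us \<in> open_boxes m X"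
     "openin (ztop (power_fspace m X)) W" "xs \<in> W" "W \<subseteq> nonvanishing Us h'"
     "\<forall>ys \<in> W. ys \<in> pts \<and> msum m H (mset (map \<rho> ys)) \<noteq> 0 \<and> msum m G (mset (map \<rho> ys)) / msum m H (mset (map \<rho> ys)) = g' ys / h' ys"
    by auto
  have "\<forall>ys \<in> W. ys \<in> pts \<and> h (mset ys) \<noteq> 0 \<and> g (mset ys) / h (mset ys) = g' ys / h' ys"
  proof
    fix ys assume "ys \<in> W"
    then show "ys \<in> pts \<and> h (mset ys) \<noteq> 0 \<and> g (mset ys) / h (mset ys) = g' ys / h' ys"
      using bspec[OF *(7), of ys] G(2)[of ys] H(2)[of ys] by auto
  qed
  with *(1-6) show ?thesis by blast
qed

lemma ztop_symmetric_power: "ztop (symmetric_power m X) = graded_topology SG mpts"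
proof -
  have "openin (graded_topology SG mpts) W" if W: "openin (ztop (symmetric_power m X)) W" for W
  proof (subst openin_subopen, intro ballI)
    fix M assume M: "M \<in> W"
    with W obtain xs where xs: "M = mset xs" "xs \<in> pts" by (auto simp: symmetric_power_open)
    let ?W = "{xs \<in> pts. mset xs \<in> W}"
    have "openin (ztop (power_fspace m X)) ?W" "xs \<in> ?W" using W xs M by (auto simp: symmetric_power_open)
    from open_power_local[OF this] obtain ds H where H: "length ds = m" "mhom ds H" "H (map \<rho> xs) \<noteq> 0"
     "\<forall>ys \<in> pts. H (map \<rho> ys) \<noteq> 0 \<longrightarrow> ys \<in> ?W" by blast
    have "mhom ds (\<lambda>ys. 0 * H ys)" using H by (intro mhom_scale)
    from symmetric_local[OF H(1) this H(2,3) xs(2), where W = W and f = "\<lambda>_. 0"] H(4)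
    obtain d H' where *: "tensors (replicate m (homog I d)) H'" "msum m H' (image_mset \<rho> (mset xs)) \<noteq> 0"
      "\<forall>ys \<in> pts. msum m H' (image_mset \<rho> (mset ys)) \<noteq> 0 \<longrightarrow> mset ys \<in> W" by auto
    let ?V = "{M \<in> mpts. (\<lambda>M. msum m H' (image_mset \<rho> M)) M \<noteq> 0}"
    have "openin (graded_topology SG mpts) ?V" using SG_I[OF *(1)] by (rule open_nonvanishing_graded)
    moreover have "M \<in> ?V" using xs *(2) by auto
    moreover have "?V \<subseteq> W"
    proof
      fix M' assume M': "M' \<in> ?V"
      then obtain ys where ys: "ys \<in> pts" "M' = mset ys" using mset_pts by blast
      with *(3) M' show "M' \<in> W" by blast
    qed
    ultimately show "\<exists>T. openin (graded_topology SG mpts) T \<and> M \<in> T \<and> T \<subseteq> W" by blast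
  qed
  moreover have "openin (ztop (symmetric_power m X)) W" if W: "openin (graded_topology SG mpts) W" for W
    unfolding symmetric_power_open mset_pts
  proof
    show "W \<subseteq> mpts" using openin_subset[OF W] by simp
    show "openin (ztop (power_fspace m X)) {xs \<in> pts. mset xs \<in> W}"
    proof (subst openin_subopen, intro ballI)
      fix xs assume xs: "xs \<in> {xs \<in> pts. mset xs \<in> W}"
      then obtain d g where g: "g \<in> SG d" "g (mset xs) \<noteq> 0" "{y \<in> mpts. g y \<noteq> 0} \<subseteq> W"
        using SG.openin_graded_base[OF W, of "mset xs"] by blast
      obtain V where V: "openin (ztop (power_fspace m X)) V" "xs \<in> V" "\<forall>ys \<in> V. ys \<in> pts \<and> g (mset ys) \<noteq> 0"
        using SG_ratio_local[OF g(1,1) _ g(2)] xs by blast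
      have "V \<subseteq> {xs \<in> pts. mset xs \<in> W}" using V(3) g(3) mset_pts by blast
      with V show "\<exists>T. openin (ztop (power_fspace m X)) T \<and> xs \<in> T \<and> T \<subseteq> {xs \<in> pts. mset xs \<in> W}" by blast
    qed
  qed
  ultimately show ?thesis by (auto simp: topology_eq)
qed

lemma regular_symmetric_power:
  "f \<in> regular (symmetric_power m X) W \<longleftrightarrow> openin (graded_topology SG mpts) W \<and>
     f \<circ> mset \<in> regular (power_fspace m X) {xs \<in> pts. mset xs \<in> W}"
proof -
  have "quotient_topology mset (ztop (power_fspace m X)) = graded_topology SG mpts"
    using ztop_symmetric_power by (simp add: symmetric_power_def quotient_fspace_def)
  then show ?thesis by (simp add: symmetric_power_def quotient_fspace_def pts_power)
qed

text \<open>
  The quotient structure is given by symmetric multihomogeneous fractions: \<open>symmetric_local\<close> turns the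
  local fractions on the power into symmetric ones, and \<open>SG_ratio_local\<close> is the converse.
\<close>

theorem symmetric_power_graded: "same_structure (symmetric_power m X) (graded_fspace SG mpts)"
proof -
  have zt: "ztop (symmetric_power m X) = ztop (graded_fspace SG mpts)"
    by (simp add: ztop_symmetric_power)
  have reg1: "f \<in> regular (graded_fspace SG mpts) W" if f: "f \<in> regular (symmetric_power m X) W" for f W
  proof -
    have W: "openin (graded_topology SG mpts) W" using f by (simp add: regular_symmetric_power)
    let ?W = "{xs \<in> pts. mset xs \<in> W}"
    have fr: "f \<circ> mset \<in> regular (power_fspace m X) ?W" using f by (simp add: regular_symmetric_power)
    have "\<exists>V. openin (graded_topology SG mpts) V \<and> M \<in> V \<and> V \<subseteq> W \<and> f \<in> ratios SG V" if M: "M \<in> W" for M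
    proof -
      have "M \<in> mpts" using openin_subset[OF W] M by auto
      then obtain xs where xs: "xs \<in> pts" "M = mset xs" using mset_pts by blast
      with M have "xs \<in> ?W" by auto
      from regular_power_local[OF fr this] obtain ds G H where GH: "length ds = m" "mhom ds G" "mhom ds H" "H (map \<rho> xs) \<noteq> 0"
        "\<forall>ys \<in> pts. H (map \<rho> ys) \<noteq> 0 \<longrightarrow> ys \<in> ?W \<and> (f \<circ> mset) ys = G (map \<rho> ys) / H (map \<rho> ys)" by blast
      from symmetric_local[OF GH(1-4) xs(1), of W f] GH(5)
      obtain d G' H' where *: "tensors (replicate m (homog I d)) G'" "tensors (replicate m (homog I d)) H'"
        "msum m H' (image_mset \<rho> (mset xs)) \<noteq> 0"
        "\<forall>ys \<in> pts. msum m H' (image_mset \<rho> (mset ys)) \<noteq> 0 \<longrightarrow> mset ys \<in> W \<and>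
          f (mset ys) = msum m G' (image_mset \<rho> (mset ys)) / msum m H' (image_mset \<rho> (mset ys))" by auto
      let ?V = "{M \<in> mpts. (\<lambda>M. msum m H' (image_mset \<rho> M)) M \<noteq> 0}"
      have V: "mset ys \<in> W \<and> f (mset ys) = msum m G' (image_mset \<rho> (mset ys)) / msum m H' (image_mset \<rho> (mset ys))"
        if "ys \<in> pts" "mset ys \<in> ?V" for ys using that *(4) by blast
      have "openin (graded_topology SG mpts) ?V" using SG_I[OF *(2)] by (rule open_nonvanishing_graded)
      moreover have "M \<in> ?V" using xs *(3) by auto
      moreover have V': "N \<in> W \<and> f N = msum m G' (image_mset \<rho> N) / msum m H' (image_mset \<rho> N)" if "N \<in> ?V" for N
      proof -
        have "N \<in> mpts" using that by simp
        then obtain ys where ys: "ys \<in> pts" "N = mset ys" by (rule mpts_E)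
        then show ?thesis using V[of ys] that by simp
      qed
      moreover have "f \<in> ratios SG ?V"
        using SG_I[OF *(1)] SG_I[OF *(2)] by (rule ratiosI) (use V' in auto)
      ultimately show ?thesis by blast
    qed
    with W show ?thesis by (auto simp: graded_fspace_def locally_on_def)
  qed
  have reg2: "f \<in> regular (symmetric_power m X) W" if f: "f \<in> regular (graded_fspace SG mpts) W" for f W
  proof -
    have W: "openin (graded_topology SG mpts) W" using f by (simp add: graded_fspace_def locally_on_def)
    let ?W = "{xs \<in> pts. mset xs \<in> W}"
    have pre: "openin (ztop (power_fspace m X)) {xs \<in> pts. mset xs \<in> V}" if "openin (graded_topology SG mpts) V" for V
      using that unfolding ztop_symmetric_power[symmetric] symmetric_power_open by blast
    have "\<exists>W'. openin (ztop (power_fspace m X)) W' \<and> xs \<in> W' \<and> W' \<subseteq> ?W \<and>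
      (\<exists>Us \<in> open_boxes m X. \<exists>g \<in> box_algebra X Us. \<exists>h \<in> box_algebra X Us.
         W' \<subseteq> nonvanishing Us h \<and> (\<forall>xs \<in> W'. (f \<circ> mset) xs = g xs / h xs))" if xs: "xs \<in> ?W" for xs
    proof -
      obtain V where V: "openin (graded_topology SG mpts) V" "mset xs \<in> V" "V \<subseteq> W" "f \<in> ratios SG V"
        using f xs by (auto simp: graded_fspace_def locally_on_def)
      obtain d g h where gh: "g \<in> SG d" "h \<in> SG d" "\<And>y. y \<in> V \<Longrightarrow> h y \<noteq> 0 \<and> f y = g y / h y"
        using V(4) by (elim ratiosE) blast
      obtain W1 Us g' h' where *: "g' \<in> box_algebra X Us" "h' \<in> box_algebra X Us" "Us \<in> open_boxes m X"
         "openin (ztop (power_fspace m X)) W1" "xs \<in> W1" "W1 \<subseteq> nonvanishing Us h'"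
         "\<forall>ys \<in> W1. ys \<in> pts \<and> h (mset ys) \<noteq> 0 \<and> g (mset ys) / h (mset ys) = g' ys / h' ys"
        using SG_ratio_local[OF gh(1,2), of xs] xs gh(3)[OF V(2)] by blast
      let ?W1 = "W1 \<inter> {xs \<in> pts. mset xs \<in> V}"
      have "openin (ztop (power_fspace m X)) ?W1" "xs \<in> ?W1" "?W1 \<subseteq> ?W"
        using *(4,5) pre[OF V(1)] V xs by auto
      moreover have "(f \<circ> mset) ys = g' ys / h' ys" if "ys \<in> ?W1" for ys
        using that *(7) gh(3)[of "mset ys"] by auto
      ultimately show ?thesis using *(1-3,6)
        by (intro exI[of _ ?W1] conjI bexI[of _ Us] bexI[of _ g'] bexI[of _ h']) auto
    qed
    with pre[OF W] have "f \<circ> mset \<in> regular (power_fspace m X) ?W"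
      by (simp add: power_fspace_def Let_def locally_on_def)
    with W show ?thesis by (simp add: regular_symmetric_power)
  qed
  have p1: "points (symmetric_power m X) = mpts" using zt by simp
  have sub: "{x \<in> mpts. x \<in> W} = W" if "openin (graded_topology SG mpts) W" for W
    using openin_subset[OF that] by auto
  show ?thesis
    unfolding same_structure_def morphism_def p1 SG.points_graded_fspace
  proof (intro conjI allI ballI)
    show "continuous_map (ztop (symmetric_power m X)) (ztop (graded_fspace SG mpts)) (\<lambda>x. x)"
      "continuous_map (ztop (graded_fspace SG mpts)) (ztop (symmetric_power m X)) (\<lambda>x. x)"
      by (simp_all add: zt)
    fix W f
    { assume f: "f \<in> regular (graded_fspace SG mpts) W"
      then have "openin (graded_topology SG mpts) W" by (simp add: graded_fspace_def locally_on_def)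
      with reg2[OF f] show "f \<circ> (\<lambda>x. x) \<in> regular (symmetric_power m X) {x \<in> mpts. x \<in> W}"
        by (simp only: sub o_def) }
    { assume f: "f \<in> regular (symmetric_power m X) W"
      then have "openin (graded_topology SG mpts) W" by (simp add: regular_symmetric_power)
      with reg1[OF f] show "f \<circ> (\<lambda>x. x) \<in> regular (graded_fspace SG mpts) {x \<in> mpts. x \<in> W}"
        by (simp only: sub o_def) }
  qed
qed

end

section \<open>Interpolation on moving finite sets\<close>

text \<open>
  Lagrange interpolation in the values of \<open>l\<close>.
\<close>

lemma interp_exists:
  fixes l :: "'v \<Rightarrow> complex"
  assumes S: "finite S" "inj_on l S"
  shows "\<exists>c. \<forall>s \<in> S. h s = (\<Sum>b<card S. c b * l s ^ b)"
proof -
  define L where "L s = (\<Prod>u\<in>S-{s}. [:- l u, 1:])" for s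
  define p where "p = (\<Sum>s\<in>S. smult (h s / poly (L s) (l s)) (L s))"
  have Lz: "poly (L s) (l u) = 0" if "u \<in> S" "u \<noteq> s" for s u
    using that S by (auto simp: L_def poly_prod)
  have Ln: "poly (L s) (l s) \<noteq> 0" if "s \<in> S" for s
    using that S by (auto simp: L_def poly_prod inj_on_def)
  have pv: "poly p (l s) = h s" if "s \<in> S" for s
  proof -
    have "poly p (l s) = (\<Sum>u\<in>S. h u / poly (L u) (l u) * poly (L u) (l s))"
      by (simp add: p_def poly_sum)
    also have "\<dots> = (\<Sum>u\<in>S. if u = s then h s else 0)"
      using that Lz Ln by (intro sum.cong) auto
    finally show ?thesis using that S by simp
  qed
  have deg: "coeff p n = 0" if n: "n \<ge> card S" for n
  proof -
    have "coeff (L s) n = 0" if "s \<in> S" for s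
    proof -
      have "degree (L s) \<le> (\<Sum>u\<in>S-{s}. degree [:- l u, 1:])"
        unfolding L_def by (rule order_trans[OF degree_prod_sum_le]) (use S in \<open>auto\<close>)
      also have "\<dots> = card (S - {s})" by simp
      also have "\<dots> < card S" using that S by (intro psubset_card_mono) auto
      finally show ?thesis using n by (intro coeff_eq_0) auto
    qed
    then show ?thesis by (simp add: p_def coeff_sum)
  qed
  have "poly p y = (\<Sum>b<card S. coeff p b * y ^ b)" for y
  proof (cases "p = 0")
    case False
    then have "degree p < card S" using deg[of "degree p"] by (metis leading_coeff_0_iff not_le)
    then have "(\<Sum>b\<le>degree p. coeff p b * y ^ b) = (\<Sum>b<card S. coeff p b * y ^ b)"
      by (intro sum.mono_neutral_left) (auto simp: coeff_eq_0)
    then show ?thesis by (simp add: poly_altdef)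
  qed simp
  with pv show ?thesis by (intro exI[of _ "coeff p"]) auto
qed

lemma interp_zero:
  fixes l :: "'v \<Rightarrow> complex"
  assumes S: "finite S" "inj_on l S" and z: "\<And>s. s \<in> S \<Longrightarrow> (\<Sum>b<card S. c b * l s ^ b) = 0" and b: "b < card S"
  shows "c b = 0"
proof -
  define p where "p = (\<Sum>b<card S. monom (c b) b)"
  have cp: "coeff p b = (if b < card S then c b else 0)" for b
    by (simp add: p_def coeff_sum)
  have ev: "poly p y = (\<Sum>b<card S. c b * y ^ b)" for y by (simp add: p_def poly_sum poly_monom)
  have "p = 0"
  proof (rule ccontr)
    assume p: "p \<noteq> 0"
    then have "degree p < card S" using cp by (metis leading_coeff_0_iff)
    moreover have "card (l ` S) \<le> card {y. poly p y = 0}"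
      using z p by (intro card_mono poly_roots_finite) (auto simp: ev)
    moreover have "card {y. poly p y = 0} \<le> degree p" using p by (rule card_poly_roots_bound)
    moreover have "card (l ` S) = card S" using S by (simp add: card_image)
    ultimately show False by simp
  qed
  then show ?thesis using cp[of b] b by simp
qed

lemma interp_unique:
  fixes l :: "'v \<Rightarrow> complex"
  assumes S: "finite S" "inj_on l S"
    and z: "\<And>s. s \<in> S \<Longrightarrow> (\<Sum>b<card S. c b * l s ^ b) = (\<Sum>b<card S. d b * l s ^ b)" and b: "b < card S"
  shows "c b = d b"
proof -
  have "c b - d b = 0"
    by (rule interp_zero[OF S _ b, of "\<lambda>b. c b - d b"]) (simp add: algebra_simps sum_subtractf z)
  then show ?thesis by simp
qed

text \<open>
  For \<open>n = card S\<close> this is \<open>V\<^sup>T V\<close> with the Vandermonde matrix \<open>V\<close> of the values of \<open>l\<close>, so it is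
  invertible if \<open>l\<close> separates \<open>S\<close>. Its entries are power sums, while those of \<open>V\<close> depend on an
  enumeration of \<open>S\<close>.
\<close>

definition hankel :: "'v set \<Rightarrow> ('v \<Rightarrow> complex) \<Rightarrow> nat \<Rightarrow> complex mat" where
  "hankel S l n = mat n n (\<lambda>(i, j). \<Sum>s\<in>S. l s ^ (i + j))"

text \<open>
  A vector in the kernel is a polynomial \<open>C\<close> of degree less than \<open>card S\<close> in \<open>l\<close> that is orthogonal to
  all powers of \<open>l\<close>, hence to the interpolated indicator function of each point; so \<open>C\<close> vanishes on \<open>S\<close>.
\<close>

lemma det_hankel_nonzero:
  assumes S: "finite S" "inj_on l S" shows "det (hankel S l (card S)) \<noteq> 0"
proof
  let ?n = "card S"
  assume "det (hankel S l ?n) = 0"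
  moreover have H: "hankel S l ?n \<in> carrier_mat ?n ?n" by (simp add: hankel_def)
  ultimately obtain v where v: "v \<in> carrier_vec ?n" "v \<noteq> 0\<^sub>v ?n" "hankel S l ?n *\<^sub>v v = 0\<^sub>v ?n"
    using det_0_iff_vec_prod_zero_field[OF H] by auto
  let ?C = "\<lambda>s. \<Sum>j<?n. v $ j * l s ^ j"
  have 1: "(\<Sum>s\<in>S. l s ^ i * ?C s) = 0" if i: "i < ?n" for i
  proof -
    have "0 = (hankel S l ?n *\<^sub>v v) $ i" using v(3) i by simp
    also have "\<dots> = (\<Sum>j<?n. (\<Sum>s\<in>S. l s ^ (i + j)) * v $ j)"
      using i v(1) by (simp add: hankel_def scalar_prod_def atLeast0LessThan)
    also have "\<dots> = (\<Sum>j<?n. \<Sum>s\<in>S. l s ^ i * (v $ j * l s ^ j))"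
      by (intro sum.cong refl) (simp add: sum_distrib_left sum_distrib_right power_add algebra_simps)
    also have "\<dots> = (\<Sum>s\<in>S. l s ^ i * ?C s)"
      by (subst sum.swap) (simp add: sum_distrib_left)
    finally show ?thesis by simp
  qed
  have 2: "?C s0 = 0" if s0: "s0 \<in> S" for s0
  proof -
    obtain c where c: "\<forall>s \<in> S. (if s = s0 then 1 else 0) = (\<Sum>b<?n. c b * l s ^ b)"
      using interp_exists[OF S, of "\<lambda>s. if s = s0 then 1 else 0"] by blast
    have "?C s0 = (\<Sum>s\<in>S. (if s = s0 then 1 else 0) * ?C s)" using s0 S by (simp add: if_distrib[of "\<lambda>x. x * _"] cong: if_cong)
    also have "\<dots> = (\<Sum>s\<in>S. (\<Sum>b<?n. c b * l s ^ b) * ?C s)" using c by (intro sum.cong) auto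
    also have "\<dots> = (\<Sum>b<?n. c b * (\<Sum>s\<in>S. l s ^ b * ?C s))"
      by (simp only: sum_distrib_right sum_distrib_left[of "c _"] mult.assoc) (rule sum.swap)
    also have "\<dots> = 0" using 1 by simp
    finally show ?thesis .
  qed
  have "v = 0\<^sub>v ?n"
    using v(1) interp_zero[OF S 2] by (intro eq_vecI) auto
  with v(2) show False by simp
qed

context graded_algebra
begin

lemma det_ratios:
  assumes "\<And>i j. i < n \<Longrightarrow> j < n \<Longrightarrow> (\<lambda>x. A x i j) \<in> ratios G P"
  shows "(\<lambda>x. det (mat n n (\<lambda>(i, j). A x i j))) \<in> ratios G P"
proof -
  have "(\<lambda>x. \<Sum>p\<in>{p. p permutes {0..<n}}. signof p * (\<Prod>i\<in>{0..<n}. A x i (p i))) \<in> ratios G P"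
    using assms by (intro ratios_sum ratios_mult ratios_const ratios_prod) (auto simp: permutes_in_image)
  then show ?thesis
    by (rule ratios_cong) (auto simp: det_def intro!: sum.cong prod.cong simp: permutes_in_image)
qed

text \<open>
  Cramer's rule: the solution of an invertible linear system with regular entries is regular.
\<close>

lemma linear_system_ratios:
  assumes A: "\<And>i j. i < n \<Longrightarrow> j < n \<Longrightarrow> (\<lambda>x. A x i j) \<in> ratios G P"
    and b: "\<And>i. i < n \<Longrightarrow> (\<lambda>x. b x i) \<in> ratios G P"
    and eq: "\<And>x i. x \<in> P \<Longrightarrow> i < n \<Longrightarrow> (\<Sum>j<n. A x i j * c j x) = b x i"
    and det: "\<And>x. x \<in> P \<Longrightarrow> det (mat n n (\<lambda>(i, j). A x i j)) \<noteq> 0"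
    and k: "k < n"
  shows "c k \<in> ratios G P"
proof -
  let ?M = "\<lambda>x. mat n n (\<lambda>(i, j). A x i j)"
  let ?N = "\<lambda>x. mat n n (\<lambda>(i, j). if j = k then b x i else A x i j)"
  have "(\<lambda>x. if j = k then b x i else A x i j) \<in> ratios G P" if "i < n" "j < n" for i j
    using that A b by (cases "j = k") auto
  then have "(\<lambda>x. det (?N x) / det (?M x)) \<in> ratios G P"
    by (intro ratios_divide det_ratios A det) auto
  then have *: "(\<lambda>x. det (?N x) / det (?M x)) \<in> ratios G P" .
  have "det (?N x) / det (?M x) = c k x" if x: "x \<in> P" for x
  proof -
    let ?v = "vec n (\<lambda>j. c j x)"
    have "det (replace_col (?M x) (?M x *\<^sub>v ?v) k) = ?v $ k * det (?M x)"
      by (rule cramer_lemma_mat[of _ n]) (use k in auto)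
    moreover have "replace_col (?M x) (?M x *\<^sub>v ?v) k = ?N x"
      by (rule eq_matI) (use eq[OF x] in \<open>auto simp: replace_col_def scalar_prod_def atLeast0LessThan\<close>)
    ultimately show ?thesis using det[OF x] k by simp
  qed
  then show ?thesis by (intro ratios_cong[OF *]) simp
qed

end

section \<open>Supports of multisets\<close>

text \<open>
  The linear form \<open>\<Sum>i. v i t\<^sup>i\<close> for a natural number \<open>t\<close>. For vectors \<open>u \<noteq> w\<close> the polynomial
  \<open>\<Sum>i. (u i - w i) t\<^sup>i\<close> has finitely many roots, so some \<open>t\<close> separates any finite set.
\<close>

definition lform :: "nat \<Rightarrow> nat \<Rightarrow> (nat \<Rightarrow> complex) \<Rightarrow> complex" where
  "lform N t v = (\<Sum>i\<le>N. v i * of_nat t ^ i)"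

lemma lform_polys: "lform N t \<in> polys UNIV"
  unfolding lform_def[abs_def] polys_def
  by (intro subalg_sum subalg.mult subalg.const subalg.gen) auto

lemma separating_lform:
  assumes S: "finite S" "S \<subseteq> coord_space {..N}"
  shows "\<exists>t. inj_on (lform N t) S"
proof -
  define d where "d u w = (\<Sum>i\<le>N. monom (u i - w i) i :: complex poly)" for u w
  have dz: "d u w \<noteq> 0" if "u \<in> S" "w \<in> S" "u \<noteq> w" for u w
  proof -
    obtain i where i: "u i \<noteq> w i" using \<open>u \<noteq> w\<close> by auto
    have "u \<in> coord_space {..N}" "w \<in> coord_space {..N}" using that S by auto
    with i have "i \<le> N" unfolding coord_space_def by (metis (mono_tags, lifting) atMost_iff mem_Collect_eq)
    then have "coeff (d u w) i = u i - w i" by (simp add: d_def coeff_sum)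
    with i show ?thesis by auto
  qed
  have ev: "poly (d u w) (of_nat t) = lform N t u - lform N t w" for u w t
    by (simp add: d_def poly_sum poly_monom lform_def sum_subtractf algebra_simps)
  let ?B = "\<Union>(u, w) \<in> {(u, w) \<in> S \<times> S. u \<noteq> w}. {t::nat. poly (d u w) (of_nat t) = 0}"
  have "finite {t::nat. poly (d u w) (of_nat t) = 0}" if "u \<in> S" "w \<in> S" "u \<noteq> w" for u w
  proof -
    have "finite ((of_nat :: nat \<Rightarrow> complex) -` {y. poly (d u w) y = 0})"
      by (intro finite_vimageI poly_roots_finite dz that) (simp add: inj_on_def)
    then show ?thesis by (simp add: vimage_def)
  qed
  moreover have "finite {(u, w) \<in> S \<times> S. u \<noteq> w}" using S by (auto intro: finite_subset[of _ "S \<times> S"])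
  ultimately have "finite ?B" by auto
  then obtain t where t: "t \<notin> ?B" using ex_new_if_finite infinite_UNIV_nat by blast
  have "inj_on (lform N t) S"
  proof (rule inj_onI, rule ccontr)
    fix u w assume "u \<in> S" "w \<in> S" "lform N t u = lform N t w" "u \<noteq> w"
    with t ev[of u w t] show False by auto
  qed
  then show ?thesis ..
qed

text \<open>
  The discriminant of the values of \<open>l\<close> up to sign. The product runs over all ordered pairs, so it does
  not depend on the order of the list.
\<close>

definition difprod :: "('v \<Rightarrow> complex) \<Rightarrow> 'v list \<Rightarrow> complex" where
  "difprod l ys = (\<Prod>a<length ys. \<Prod>b\<in>{..<length ys}-{a}. l (ys ! a) - l (ys ! b))"

lemma tensors_polys_coord:
  "a < k \<Longrightarrow> g \<in> polys I \<Longrightarrow> tensors (replicate k (polys I)) (\<lambda>ys. g (ys ! a))"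
  by (intro tensors_coord) (auto intro: polys_intros)

lemma tensors_polys_mult:
  "tensors (replicate k (polys I)) f \<Longrightarrow> tensors (replicate k (polys I)) g \<Longrightarrow>
    tensors (replicate k (polys I)) (\<lambda>ys. f ys * g ys)"
  by (rule tensors_mult) (auto intro: polys_intros)

lemma tensors_polys_prod:
  "(\<And>i. i \<in> A \<Longrightarrow> tensors (replicate k (polys I)) (f i)) \<Longrightarrow> tensors (replicate k (polys I)) (\<lambda>ys. \<Prod>i\<in>A. f i ys)"
proof (induction A rule: infinite_finite_induct)
  case (insert x F)
  then show ?case by (simp add: tensors_polys_mult)
qed (auto intro!: tensors_one polys_intros)

lemma tensors_difprod:
  assumes "l \<in> polys I" shows "tensors (replicate k (polys I)) (difprod l)"
proof -
  have "tensors (replicate k (polys I)) (\<lambda>ys. l (ys ! a) + (-1) * l (ys ! b))" if "a < k" "b < k" for a b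
    using that assms by (intro tensors.add tensors.scale tensors_polys_coord)
  then have "tensors (replicate k (polys I)) (\<lambda>ys. \<Prod>a<k. \<Prod>b\<in>{..<k}-{a}. l (ys ! a) + (-1) * l (ys ! b))"
    by (intro tensors_polys_prod) auto
  then show ?thesis by (rule tensors.cong) (simp add: difprod_def)
qed

lemma difprod_nonzero: "difprod l ys \<noteq> 0 \<longleftrightarrow> distinct (map l ys)"
  by (auto simp: difprod_def distinct_conv_nth)

lemma difprod_distinct:
  assumes "distinct (map l ys)"
  shows "difprod l ys = (\<Prod>u\<in>l ` set ys. \<Prod>w\<in>l ` set ys - {u}. u - w)"
proof -
  let ?n = "length ys" and ?f = "\<lambda>a. l (ys ! a)"
  have bij: "bij_betw ?f {..<?n} (l ` set ys)"
    using assms by (auto simp: bij_betw_def inj_on_def distinct_conv_nth in_set_conv_nth image_iff intro: bexI[OF refl nth_mem])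
  have "(\<Prod>w\<in>l ` set ys - {?f a}. ?f a - w) = (\<Prod>b\<in>{..<?n}-{a}. ?f a - ?f b)" if "a < ?n" for a
  proof -
    have "bij_betw ?f ({..<?n} - {a}) (l ` set ys - {?f a})"
      using bij that by (intro bij_betw_DiffI) (auto intro: bij_betw_singletonI)
    then show ?thesis by (rule prod.reindex_bij_betw[symmetric])
  qed
  then have "difprod l ys = (\<Prod>a<?n. (\<lambda>u. \<Prod>w\<in>l ` set ys - {u}. u - w) (?f a))"
    unfolding difprod_def by (intro prod.cong) auto
  also have "\<dots> = (\<Prod>u\<in>l ` set ys. \<Prod>w\<in>l ` set ys - {u}. u - w)" by (rule prod.reindex_bij_betw[OF bij])
  finally show ?thesis .
qed

lemma distinct_set_subset_mset: "distinct ys \<Longrightarrow> set ys \<subseteq> set_mset M \<Longrightarrow> mset ys \<subseteq># M"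
  by (intro mset_subset_eqI) (auto simp: distinct_count_atmost_1 count_mset_0_iff count_greater_zero_iff Suc_le_eq
     count_inI split: if_splits)

lemma set_subset_of_mset: "mset ys \<subseteq># M \<Longrightarrow> set ys \<subseteq> set_mset M"
  by (metis set_mset_mono set_mset_mset)

lemma subdisc_zero:
  assumes "card (l ` set_mset M) < n" shows "msum n (difprod l) M = 0"
proof -
  have "msum n (difprod l) M = msum n (\<lambda>_. 0) M"
  proof (rule msum_cong)
    fix ys assume ys: "length ys = n" "mset ys \<subseteq># M"
    then have "set (map l ys) \<subseteq> l ` set_mset M" using set_subset_of_mset by fastforce
    then have "card (set (map l ys)) < length (map l ys)"
      using assms ys(1) by (auto dest!: card_mono[rotated] simp del: set_map)
    then have "\<not> distinct (map l ys)" using distinct_card[of "map l ys"] by linarith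
    then show "difprod l ys = 0" using difprod_nonzero by blast
  qed
  then show ?thesis by simp
qed

text \<open>
  The symmetrized discriminant of \<open>n\<close> points detects whether \<open>l\<close> takes at least \<open>n\<close> values: with fewer
  values every term vanishes, and with exactly \<open>n\<close> values all non-zero terms are equal.
\<close>

lemma subdisc_nonzero:
  assumes "card (l ` set_mset M) = n" shows "msum n (difprod l) M \<noteq> 0"
proof -
  let ?L = "l ` set_mset M"
  let ?A = "\<Prod>u\<in>?L. \<Prod>w\<in>?L - {u}. u - w"
  obtain us where us: "set us = ?L" "distinct us" using finite_distinct_list[of ?L] by auto
  define ys where "ys = map (inv_into (set_mset M) l) us"
  have lys: "map l ys = us" unfolding ys_def using us(1)
    by (auto intro!: map_idI simp: f_inv_into_f)
  have ys: "length ys = n" "distinct (map l ys)" "set ys \<subseteq> set_mset M"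
    using us assms distinct_card[OF us(2)] by (auto simp: lys) (auto simp: ys_def us inv_into_into)
  have "msum n (difprod l) M = msum n (\<lambda>ys. ?A * of_nat (if distinct (map l ys) then 1 else 0)) M"
  proof (rule msum_cong)
    fix zs assume zs: "length zs = n" "mset zs \<subseteq># M"
    show "difprod l zs = ?A * of_nat (if distinct (map l zs) then 1 else 0)"
    proof (cases "distinct (map l zs)")
      case True
      have "l ` set zs = ?L"
      proof (rule card_seteq)
        show "l ` set zs \<subseteq> ?L" using set_subset_of_mset[OF zs(2)] by blast
        have "card (l ` set zs) = n" using distinct_card[OF True] zs(1) by simp
        then show "card ?L \<le> card (l ` set zs)" using assms by simp
      qed simp
      with difprod_distinct[OF True] True show ?thesis by simp
    qed (use difprod_nonzero in auto)
  qed
  also have "\<dots> = ?A * of_nat (msum n (\<lambda>ys. if distinct (map l ys) then 1 else 0) M)"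
    by (simp only: msum_cmult msum_of_nat)
  finally have eq: "msum n (difprod l) M = \<dots>" .
  have "msum n (\<lambda>ys. if distinct (map l ys) then 1 else (0::nat)) M > 0"
    by (rule msum_pos[of ys]) (use ys in \<open>auto intro!: distinct_set_subset_mset simp: distinct_map\<close>)
  moreover have "?A \<noteq> 0" by (auto simp: prod_zero_iff)
  ultimately show ?thesis unfolding eq by simp
qed

definition sept :: "nat \<Rightarrow> (nat \<Rightarrow> complex) multiset \<Rightarrow> nat" where
  "sept N M = (LEAST t. inj_on (lform N t) (set_mset M))"

text \<open>
  The number of points of the support is the largest number of values of a linear form, and the first
  separating form is the first one that attains it. Both are read off from the vanishing of the
  symmetrized discriminants, which are symmetric polynomials.
\<close>

lemma support_type_iff:
  assumes M: "set_mset M \<subseteq> coord_space {..N}"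
  shows "card (set_mset M) = r \<and> sept N M = t \<longleftrightarrow>
    (\<forall>(t', n) \<in> {(t', n). r < n} \<union> {(t', n). t' < t \<and> n = r}. msum n (difprod (lform N t')) M = 0) \<and>
    msum r (difprod (lform N t)) M \<noteq> 0" (is "?L \<longleftrightarrow> ?R")
proof -
  let ?S = "set_mset M"
  have le: "card (lform N t ` ?S) \<le> card ?S" for t by (intro card_image_le) simp
  have inj: "inj_on (lform N t) ?S \<longleftrightarrow> card (lform N t ` ?S) = card ?S" for t
    by (auto simp: card_image intro: eq_card_imp_inj_on)
  obtain t0 where t0: "inj_on (lform N t0) ?S" using separating_lform[OF _ M] by auto
  have sep: "inj_on (lform N (sept N M)) ?S" unfolding sept_def by (rule LeastI[of _ t0]) (rule t0)
  have least: "\<not> inj_on (lform N t') ?S" if "t' < sept N M" for t' using that unfolding sept_def by (rule not_less_Least)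
  show ?thesis
  proof
    assume L: ?L
    have "msum n (difprod (lform N t')) M = 0" if "r < n" for t' n
      using le[of t'] L that by (intro subdisc_zero) auto
    moreover have "msum r (difprod (lform N t')) M = 0" if "t' < t" for t'
    proof -
      have "card (lform N t' ` ?S) \<noteq> card ?S" using least that L inj by blast
      then show ?thesis using le[of t'] L by (intro subdisc_zero) auto
    qed
    moreover have "msum r (difprod (lform N t)) M \<noteq> 0"
      using sep L inj by (intro subdisc_nonzero) auto
    ultimately show ?R by auto
  next
    assume R: ?R
    have a: "card (lform N t' ` ?S) \<le> r" for t'
    proof (rule ccontr)
      assume "\<not> ?thesis"
      then have "msum (card (lform N t' ` ?S)) (difprod (lform N t')) M = 0" using R by auto
      then show False using subdisc_nonzero by blast
    qed
    have b: "r \<le> card (lform N t ` ?S)"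
    proof (rule ccontr)
      assume "\<not> ?thesis"
      then have "msum r (difprod (lform N t)) M = 0" by (intro subdisc_zero) simp
      with R show False by blast
    qed
    have c: "card ?S = r" using a[of t0] inj[of t0] t0 b le[of t] by simp
    have d: "inj_on (lform N t) ?S" using inj c a b by (metis le_antisym)
    have "sept N M \<le> t" unfolding sept_def using d by (rule Least_le)
    moreover have "\<not> sept N M < t"
    proof
      assume "sept N M < t"
      then have "msum r (difprod (lform N (sept N M))) M = 0" using R by auto
      moreover have "msum r (difprod (lform N (sept N M))) M \<noteq> 0"
        using sep inj c by (intro subdisc_nonzero) auto
      ultimately show False by blast
    qed
    ultimately show ?L using c by simp
  qed
qed

section \<open>Families of multisets with regular power sums\<close>

lemma sum_mset_filter: "(\<Sum>v\<in>#filter_mset Q M. f v) = (\<Sum>v\<in>#M. if Q v then f v else 0)"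
  by (induction M) auto

lemma sum_mset_fibres:
  "(\<Sum>v\<in>#M. f v) = (\<Sum>s\<in>set_mset (image_mset k M). \<Sum>v\<in>#filter_mset (\<lambda>v. k v = s) M. f v)"
proof -
  have "(\<Sum>v\<in>#M. f v) = (\<Sum>v\<in>#M. \<Sum>s\<in>set_mset (image_mset k M). if k v = s then f v else 0)"
    by (intro arg_cong[of _ _ sum_mset] image_mset_cong) auto
  then show ?thesis by (simp only: sum_mset_sum_commute sum_mset_filter)
qed

lemma sum_mset_sum_count: "(\<Sum>v\<in>#M. f v) = (\<Sum>s\<in>set_mset M. of_nat (count M s) * (f s :: complex))"
proof -
  have "(\<Sum>v\<in>#M. f v) = (\<Sum>s\<in>set_mset (image_mset (\<lambda>x. x) M). \<Sum>v\<in>#filter_mset (\<lambda>v. v = s) M. f v)"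
    by (rule sum_mset_fibres)
  then show ?thesis by (simp add: filter_eq_replicate_mset)
qed

definition mult_part :: "(nat \<Rightarrow> complex) multiset \<Rightarrow> nat \<Rightarrow> (nat \<Rightarrow> complex) set" where
  "mult_part M c = {s \<in> set_mset M. s \<noteq> 0 \<and> count M s = c}"

text \<open>
  A map from \<open>P\<close> to multisets of vectors whose power sums are regular, which is how a morphism to a
  symmetric power of an affine space is expressed here.
\<close>

locale multiset_family = graded_algebra G
  for G :: "nat \<Rightarrow> ('a \<Rightarrow> complex) set" +
  fixes P :: "'a set" and M :: "'a \<Rightarrow> (nat \<Rightarrow> complex) multiset" and m N :: nat
  assumes size: "x \<in> P \<Longrightarrow> size (M x) = m"
    and supp: "x \<in> P \<Longrightarrow> set_mset (M x) \<subseteq> coord_space {..N}"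
    and power_sum: "g \<in> polys UNIV \<Longrightarrow> (\<lambda>x. \<Sum>v\<in>#M x. g v) \<in> ratios G P"
begin

lemma msum_ratio:
  assumes "tensors (replicate k (polys UNIV)) f" shows "(\<lambda>x. msum k f (M x)) \<in> ratios G P"
proof -
  have "msum k f \<in> subalg (power_sums (polys UNIV))"
    by (rule msum_tensors_subalg[OF _ assms]) (rule polys_intros)
  then show ?thesis
  proof (induction rule: subalg.induct)
    case (gen g)
    then show ?case by (auto simp: power_sums_def power_sum)
  qed (auto intro: ratios_const ratios_add ratios_mult)
qed

lemma loc_closed_support_type:
  assumes "loc_closed P0 P"
  shows "loc_closed P0 {x \<in> P. card (set_mset (M x)) = r \<and> sept N (M x) = t}"
proof -
  let ?D = "\<lambda>t n x. msum n (difprod (lform N t)) (M x)"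
  \<comment> \<open>Infinitely many equations, one for each larger number of values and each earlier form.\<close>
  let ?I = "{(t', n). r < n} \<union> {(t', n). t' < t \<and> n = r}"
  have D: "?D t n \<in> ratios G P" for t n
    by (intro msum_ratio tensors_difprod lform_polys)
  have 1: "loc_closed P0 {x \<in> P. \<forall>i \<in> ?I. ?D (fst i) (snd i) x = 0}"
    by (rule loc_closed_zeros[OF assms]) (use D in auto)
  have "loc_closed P0 {x \<in> {x \<in> P. \<forall>i \<in> ?I. ?D (fst i) (snd i) x = 0}. ?D t r x \<noteq> 0}"
    by (rule loc_closed_nonzero[OF 1 ratios_mono[OF D]]) auto
  moreover have "{x \<in> {x \<in> P. \<forall>i \<in> ?I. ?D (fst i) (snd i) x = 0}. ?D t r x \<noteq> 0} =
      {x \<in> P. card (set_mset (M x)) = r \<and> sept N (M x) = t}"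
    using support_type_iff[OF supp, of _ r t] by (auto simp: Ball_def)
  ultimately show ?thesis by simp
qed

lemma multiset_family_subset: "Q \<subseteq> P \<Longrightarrow> multiset_family G Q M m N"
  using size supp power_sum ratios_mono by unfold_locales blast+

end

text \<open>
  The number of points is constant, and one linear form separates the points throughout.
\<close>

locale uniform_family = multiset_family G P M m N
  for G :: "nat \<Rightarrow> ('a \<Rightarrow> complex) set" and P M m N +
  fixes r t :: nat and z :: bool
  assumes card_supp: "x \<in> P \<Longrightarrow> card (set_mset (M x)) = r"
    and inj_supp: "x \<in> P \<Longrightarrow> inj_on (lform N t) (set_mset (M x))"
    and zero_supp: "x \<in> P \<Longrightarrow> 0 \<in># M x \<longleftrightarrow> z"
begin

abbreviation "l \<equiv> lform N t"
abbreviation "S x \<equiv> set_mset (M x)"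

text \<open>
  The functions \<open>h x s\<close> of a parameter \<open>x\<close> and a point \<open>s\<close> of the multiset \<open>M x\<close> that are polynomials in
  \<open>s\<close> with regular coefficients: the regular functions on the total space of the moving finite set.
\<close>

inductive fam :: "('a \<Rightarrow> (nat \<Rightarrow> complex) \<Rightarrow> complex) \<Rightarrow> bool" where
  base: "f \<in> ratios G P \<Longrightarrow> g \<in> polys UNIV \<Longrightarrow> fam (\<lambda>x s. f x * g s)"
| add: "fam h \<Longrightarrow> fam k \<Longrightarrow> fam (\<lambda>x s. h x s + k x s)"
| agree: "fam h \<Longrightarrow> (\<And>x s. x \<in> P \<Longrightarrow> s \<in> S x \<Longrightarrow> h x s = k x s) \<Longrightarrow> fam k"

lemma fam_ratio: "f \<in> ratios G P \<Longrightarrow> fam (\<lambda>x s. f x)"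
  using fam.base[of f "\<lambda>_. 1"] by (simp add: polys_intros)

lemma fam_poly: "g \<in> polys UNIV \<Longrightarrow> fam (\<lambda>x s. g s)"
  using fam.base[of "\<lambda>_. 1" g] by (simp add: ratios_const)

lemma fam_const: "fam (\<lambda>x s. c)"
  by (intro fam_ratio ratios_const)

lemma fam_mult:
  assumes "fam h" "fam k" shows "fam (\<lambda>x s. h x s * k x s)"
  using assms(1)
proof (induction rule: fam.induct)
  case (base f g)
  note fg = base
  show ?case using assms(2)
  proof (induction rule: fam.induct)
    case (base f' g')
    have "fam (\<lambda>x s. (f x * f' x) * (g s * g' s))"
      using fg base by (intro fam.base ratios_mult polys_intros)
    then show ?case by (simp add: algebra_simps)
  next
    case (add h k)
    from fam.add[OF add.IH] show ?case by (simp add: algebra_simps)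
  next
    case (agree h k)
    from agree(3) show ?case by (rule fam.agree) (use agree(2) in auto)
  qed
next
  case (add h k)
  from fam.add[OF add.IH] show ?case by (simp add: algebra_simps)
next
  case (agree h k)
  from agree(3) show ?case by (rule fam.agree) (use agree(2) in auto)
qed

lemma fam_sum: "(\<And>i. i \<in> A \<Longrightarrow> fam (h i)) \<Longrightarrow> fam (\<lambda>x s. \<Sum>i\<in>A. h i x s)"
  by (induction A rule: infinite_finite_induct) (auto intro: fam_const fam.add)

lemma fam_prod: "(\<And>i. i \<in> A \<Longrightarrow> fam (h i)) \<Longrightarrow> fam (\<lambda>x s. \<Prod>i\<in>A. h i x s)"
  by (induction A rule: infinite_finite_induct) (auto intro: fam_const fam_mult)

lemma fam_diff: "fam h \<Longrightarrow> fam k \<Longrightarrow> fam (\<lambda>x s. h x s - k x s)"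
  using fam.add[OF _ fam_mult[OF fam_const[of "-1"]], of h k] by simp

lemma fam_l: "fam (\<lambda>x. l)"
  by (intro fam_poly lform_polys)

lemma fam_power: "fam h \<Longrightarrow> fam (\<lambda>x s. h x s ^ n)"
  by (induction n) (auto intro: fam_const fam_mult)

text \<open>
  The sum over the support without multiplicities. In the symmetrization of \<open>difprod l\<close> only the
  enumerations of the support contribute, and for each of them the sum of \<open>g\<close> over the list is the sum
  over the support; so this sum is the quotient of two symmetrizations.
\<close>

lemma poly_trace:
  assumes g: "g \<in> polys UNIV" shows "(\<lambda>x. \<Sum>s\<in>S x. g s) \<in> ratios G P"
proof -
  let ?f = "\<lambda>ys. difprod l ys * (\<Sum>a<r. g (ys ! a))"
  have "tensors (replicate r (polys UNIV)) ?f"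
    using g by (intro tensors_polys_mult tensors_difprod lform_polys tensors_sum tensors_polys_coord) auto
  then have "(\<lambda>x. msum r ?f (M x) / msum r (difprod l) (M x)) \<in> ratios G P"
  proof (intro ratios_divide msum_ratio tensors_difprod lform_polys)
    fix x assume x: "x \<in> P"
    have "card (l ` S x) = r" using card_image[OF inj_supp[OF x]] card_supp[OF x] by simp
    then show "msum r (difprod l) (M x) \<noteq> 0" by (rule subdisc_nonzero)
  qed
  then show ?thesis
  proof (rule ratios_cong)
    fix x assume x: "x \<in> P"
    have nz: "msum r (difprod l) (M x) \<noteq> 0"
      using card_image[OF inj_supp[OF x]] card_supp[OF x] by (intro subdisc_nonzero) simp
    have "msum r ?f (M x) = msum r (\<lambda>ys. (\<Sum>s\<in>S x. g s) * difprod l ys) (M x)"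
    proof (rule msum_cong)
      fix ys assume ys: "length ys = r" "mset ys \<subseteq># M x"
      show "?f ys = (\<Sum>s\<in>S x. g s) * difprod l ys"
      proof (cases "difprod l ys = 0")
        case False
        then have d: "distinct ys" by (simp add: difprod_nonzero distinct_map)
        have "set ys = S x"
          using set_subset_of_mset[OF ys(2)] distinct_card[OF d] ys(1) card_supp[OF x]
          by (intro card_seteq) auto
        then have "(\<Sum>s\<in>S x. g s) = (\<Sum>s\<leftarrow>ys. g s)" using d by (simp add: sum_list_distinct_conv_sum_set)
        also have "\<dots> = (\<Sum>a<r. g (ys ! a))" using ys(1) by (simp add: sum_list_sum_nth atLeast0LessThan)
        finally show ?thesis by simp
      qed simp
    qed
    then show "(\<Sum>s\<in>S x. g s) = msum r ?f (M x) / msum r (difprod l) (M x)"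
      using nz by (simp add: msum_cmult)
  qed
qed

lemma fam_trace: "fam h \<Longrightarrow> (\<lambda>x. \<Sum>s\<in>S x. h x s) \<in> ratios G P"
proof (induction rule: fam.induct)
  case (base f g)
  then show ?case by (simp add: sum_distrib_left[symmetric] ratios_mult poly_trace)
next
  case (add h k)
  then show ?case by (simp add: sum.distrib ratios_add)
next
  case (agree h k)
  from agree(3) show ?case by (rule ratios_cong) (use agree(2) in \<open>auto intro!: sum.cong\<close>)
qed

definition fam_subset :: "('a \<Rightarrow> (nat \<Rightarrow> complex) set) \<Rightarrow> bool" where
  "fam_subset T \<longleftrightarrow> (\<forall>x \<in> P. T x \<subseteq> S x) \<and> fam (\<lambda>x s. if s \<in> T x then 1 else 0)"

lemma fam_subset_trace:
  assumes "fam_subset T" "fam h" shows "(\<lambda>x. \<Sum>s\<in>T x. h x s) \<in> ratios G P"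
proof -
  have "(\<lambda>x. \<Sum>s\<in>S x. (if s \<in> T x then 1 else 0) * h x s) \<in> ratios G P"
    using assms unfolding fam_subset_def by (intro fam_trace fam_mult) auto
  then show ?thesis
  proof (rule ratios_cong)
    fix x assume "x \<in> P"
    then have "T x \<subseteq> S x" using assms(1) by (simp add: fam_subset_def)
    have "(\<Sum>s\<in>S x. (if s \<in> T x then 1 else 0) * h x s) = (\<Sum>s\<in>S x. if s \<in> T x then h x s else 0)"
      by (intro sum.cong) auto
    also have "\<dots> = (\<Sum>s\<in>S x \<inter> T x. h x s)" by (simp add: sum.inter_restrict)
    finally show "(\<Sum>s\<in>T x. h x s) = (\<Sum>s\<in>S x. (if s \<in> T x then 1 else 0) * h x s)"
      using \<open>T x \<subseteq> S x\<close> by (simp add: Int_absorb1)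
  qed
qed

lemma fam_subset_S: "fam_subset S"
  unfolding fam_subset_def by (auto intro: fam.agree[OF fam_const[of 1]])

text \<open>
  Interpolation coefficients solve the linear system with the Hankel matrix, the right-hand side of
  which consists of the moments \<open>mom\<close>.
\<close>

lemma coefficient_ratio:
  assumes T: "fam_subset T" and n: "\<And>x. x \<in> P \<Longrightarrow> card (T x) = n"
    and c: "\<And>x s. x \<in> P \<Longrightarrow> s \<in> T x \<Longrightarrow> h x s = (\<Sum>b<n. c b x * l s ^ b)"
    and mom: "\<And>a. a < n \<Longrightarrow> (\<lambda>x. \<Sum>s\<in>T x. h x s * l s ^ a) \<in> ratios G P"
    and b: "b < n"
  shows "c b \<in> ratios G P"
proof (rule linear_system_ratios[of n "\<lambda>x i j. \<Sum>s\<in>T x. l s ^ (i + j)" P "\<lambda>x i. \<Sum>s\<in>T x. h x s * l s ^ i"])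
  show "(\<lambda>x. \<Sum>s\<in>T x. l s ^ (i + j)) \<in> ratios G P" for i j
    by (intro fam_subset_trace T fam_power fam_l)
  show "(\<Sum>j<n. (\<Sum>s\<in>T x. l s ^ (i + j)) * c j x) = (\<Sum>s\<in>T x. h x s * l s ^ i)" if x: "x \<in> P" for x i
  proof -
    have "(\<Sum>s\<in>T x. h x s * l s ^ i) = (\<Sum>s\<in>T x. (\<Sum>b<n. c b x * l s ^ b) * l s ^ i)"
      by (intro sum.cong) (auto simp: c[OF x])
    also have "\<dots> = (\<Sum>s\<in>T x. \<Sum>j<n. l s ^ (i + j) * c j x)"
      by (intro sum.cong refl) (simp add: sum_distrib_right sum_distrib_left power_add algebra_simps)
    also have "\<dots> = (\<Sum>j<n. (\<Sum>s\<in>T x. l s ^ (i + j)) * c j x)"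
      by (subst sum.swap) (simp add: sum_distrib_right)
    finally show ?thesis by simp
  qed
  show "det (mat n n (\<lambda>(i, j). \<Sum>s\<in>T x. l s ^ (i + j))) \<noteq> 0" if x: "x \<in> P" for x
  proof -
    have sub: "T x \<subseteq> S x" using T x by (simp add: fam_subset_def)
    then have "finite (T x)" "inj_on l (T x)"
      using finite_subset inj_on_subset[OF inj_supp[OF x]] by auto
    from det_hankel_nonzero[OF this] show ?thesis by (simp add: hankel_def n[OF x])
  qed
qed (use mom b in auto)

text \<open>
  A function on the moving set is regular as soon as its moments are.
\<close>

lemma fam_of_moments:
  assumes mom: "\<And>a. (\<lambda>x. \<Sum>s\<in>S x. h x s * l s ^ a) \<in> ratios G P"
  shows "fam h"
proof -
  have "\<exists>c. \<forall>s \<in> S x. h x s = (\<Sum>b<r. c b * l s ^ b)" if "x \<in> P" for x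
    using interp_exists[OF _ inj_supp[OF that], of "h x"] card_supp[OF that] by auto
  then obtain c where c: "\<And>x s. x \<in> P \<Longrightarrow> s \<in> S x \<Longrightarrow> h x s = (\<Sum>b<r. c x b * l s ^ b)" by metis
  have "(\<lambda>x. c x b) \<in> ratios G P" if "b < r" for b
    by (rule coefficient_ratio[OF fam_subset_S card_supp, where h = h and c = "\<lambda>b x. c x b"]) (use c mom that in auto)
  then have "fam (\<lambda>x s. \<Sum>b<r. c x b * l s ^ b)"
    by (intro fam_sum fam_mult fam_ratio fam_power fam_l) auto
  then show ?thesis by (rule fam.agree) (use c in auto)
qed

lemma fam_of_pushforward:
  assumes mom: "\<And>a. (\<lambda>x. \<Sum>v\<in>#M x. h x v * l v ^ a) \<in> ratios G P"
  shows "fam (\<lambda>x s. of_nat (count (M x) s) * h x s)"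
proof (rule fam_of_moments)
  fix a
  show "(\<lambda>x. \<Sum>s\<in>S x. of_nat (count (M x) s) * h x s * l s ^ a) \<in> ratios G P"
    using mom[of a] by (simp add: sum_mset_sum_count mult.assoc)
qed

text \<open>
  The moments of the multiplicity are power sums with multiplicities, which are regular by assumption.
\<close>

lemma fam_count: "fam (\<lambda>x s. of_nat (count (M x) s))"
proof -
  have "(\<lambda>v. 1 * l v ^ a) \<in> polys UNIV" for a
    using lform_polys[of N t] by (simp add: polys_def subalg_power)
  then have "(\<lambda>x. \<Sum>v\<in>#M x. 1 * l v ^ a) \<in> ratios G P" for a by (rule power_sum)
  from fam_of_pushforward[of "\<lambda>_ _. 1", OF this] show ?thesis by simp
qed

text \<open>
  Multiplicities take finitely many values, so the indicator function of one value is a polynomial in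
  the multiplicity.
\<close>

lemma fam_count_eq:
  assumes "c \<le> m" shows "fam (\<lambda>x s. if count (M x) s = c then 1 else 0)"
proof -
  have "fam (\<lambda>x s. \<Prod>d\<in>{..m}-{c}. (of_nat (count (M x) s) - of_nat d) * (1 / (of_nat c - of_nat d)))"
    by (intro fam_prod fam_mult fam_diff fam_count fam_const)
  then show ?thesis
  proof (rule fam.agree)
    fix x s assume x: "x \<in> P"
    have k: "count (M x) s \<le> m" using size[OF x] count_le_size by metis
    show "(\<Prod>d\<in>{..m}-{c}. (of_nat (count (M x) s) - of_nat d) * (1 / (of_nat c - of_nat d)))
      = (if count (M x) s = c then 1 else (0::complex))"
      using k by (auto simp: prod_zero_iff intro!: prod.neutral)
  qed
qed

lemma fam_nonzero: "fam (\<lambda>x s. if s = 0 then 0 else 1)"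
proof (rule fam_of_moments)
  fix a
  have "(\<lambda>x. (\<Sum>s\<in>S x. l s ^ a) - (if z then l 0 ^ a else 0)) \<in> ratios G P"
    by (intro ratios_diff ratios_const fam_trace fam_power fam_l)
  then show "(\<lambda>x. \<Sum>s\<in>S x. (if s = 0 then 0 else 1) * l s ^ a) \<in> ratios G P"
  proof (rule ratios_cong)
    fix x assume x: "x \<in> P"
    have "(\<Sum>s\<in>S x. (if s = 0 then 0 else 1) * l s ^ a) = (\<Sum>s\<in>S x. l s ^ a) - (\<Sum>s\<in>S x. if s = 0 then l 0 ^ a else 0)"
      by (simp only: sum_subtractf[symmetric]) (auto intro!: sum.cong)
    also have "(\<Sum>s\<in>S x. if s = 0 then l 0 ^ a else 0) = (if z then l 0 ^ a else 0)"
      using zero_supp[OF x] by simp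
    finally show "(\<Sum>s\<in>S x. (if s = 0 then 0 else 1) * l s ^ a) = (\<Sum>s\<in>S x. l s ^ a) - (if z then l 0 ^ a else 0)" .
  qed
qed

lemma fam_subset_mult_part:
  assumes "c \<le> m" shows "fam_subset (\<lambda>x. mult_part (M x) c)"
proof -
  have "fam (\<lambda>x s. (if s = 0 then 0 else 1) * (if count (M x) s = c then 1 else 0))"
    using assms by (intro fam_mult fam_nonzero fam_count_eq)
  then have "fam (\<lambda>x s. if s \<in> mult_part (M x) c then 1 else 0)"
    by (rule fam.agree) (auto simp: mult_part_def)
  then show ?thesis by (auto simp: fam_subset_def mult_part_def)
qed

lemma loc_closed_mult_parts:
  assumes "loc_closed P0 P"
  shows "loc_closed P0 {x \<in> P. \<forall>c \<in> {..m}. card (mult_part (M x) c) = rc c}"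
proof -
  have "loc_closed P0 {x \<in> P. \<forall>c \<in> {..m}. (\<lambda>x. (\<Sum>s\<in>mult_part (M x) c. 1) - of_nat (rc c)) x = (0::complex)}"
    by (intro loc_closed_zeros[OF assms] ratios_diff ratios_const fam_subset_trace fam_subset_mult_part fam_const) auto
  then show ?thesis by simp
qed

end

text \<open>
  The discrete data of one step of the tower: number of points, first separating linear form, and number
  of non-zero points of each multiplicity.
\<close>

definition supp_type :: "nat \<Rightarrow> (nat \<Rightarrow> complex) multiset \<Rightarrow> nat \<times> nat \<times> nat list" where
  "supp_type N M = (card (set_mset M), sept N M, map (\<lambda>c. card (mult_part M c)) [0..<Suc (size M)])"

lemma inj_on_sept:
  assumes "set_mset M \<subseteq> coord_space {..N}" shows "inj_on (lform N (sept N M)) (set_mset M)"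
  unfolding sept_def using separating_lform[OF _ assms] by (metis LeastI finite_set_mset)

context multiset_family
begin

lemma uniform_familyI:
  assumes "\<And>x. x \<in> Q \<Longrightarrow> card (set_mset (M x)) = r \<and> sept N (M x) = t" "Q \<subseteq> P"
    "\<And>x. x \<in> Q \<Longrightarrow> 0 \<in># M x \<longleftrightarrow> z"
  shows "uniform_family G Q M m N r t z"
proof -
  interpret Q: multiset_family G Q M m N using multiset_family_subset assms(2) .
  show ?thesis by unfold_locales (use assms inj_on_sept[OF Q.supp] in auto)
qed

lemma loc_closed_supp_type:
  assumes P: "loc_closed P0 P" and z: "\<And>x. x \<in> P \<Longrightarrow> 0 \<in># M x \<longleftrightarrow> z"
  shows "loc_closed P0 {x \<in> P. supp_type N (M x) = \<tau>}"
proof -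
  obtain r t rs where \<tau>: "\<tau> = (r, t, rs)" by (cases \<tau>)
  let ?Q = "{x \<in> P. card (set_mset (M x)) = r \<and> sept N (M x) = t}"
  interpret Q: uniform_family G ?Q M m N r t z by (rule uniform_familyI) (use z in auto)
  have Q: "loc_closed P0 ?Q" by (rule loc_closed_support_type[OF P])
  show ?thesis
  proof (cases "length rs = Suc m")
    case True
    have "loc_closed P0 {x \<in> ?Q. \<forall>c \<in> {..m}. card (mult_part (M x) c) = rs ! c}"
      by (rule Q.loc_closed_mult_parts[OF Q])
    moreover have "{x \<in> ?Q. \<forall>c \<in> {..m}. card (mult_part (M x) c) = rs ! c} = {x \<in> P. supp_type N (M x) = \<tau>}"
      using True by (auto simp: supp_type_def \<tau> size list_eq_iff_nth_eq less_Suc_eq_le simp del: upt_Suc)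
    ultimately show ?thesis by simp
  next
    case False
    then have "{x \<in> P. supp_type N (M x) = \<tau>} = {x \<in> P. \<forall>i \<in> {0::nat}. (\<lambda>_. 1) x = (0::complex)}"
      by (auto simp: supp_type_def \<tau> size)
    also have "loc_closed P0 \<dots>" by (rule loc_closed_zeros[OF P]) (rule ratios_const)
    finally show ?thesis .
  qed
qed

end

section \<open>Multisets of numbers and elementary symmetric functions\<close>

text \<open>
  The signed elementary symmetric functions. They are read off from \<open>\<Prod>(1 - y X)\<close> and not from
  \<open>\<Prod>(X - y)\<close>, so that the index does not depend on the size of the multiset.
\<close>

definition ecoef :: "nat \<Rightarrow> complex multiset \<Rightarrow> complex" where
  "ecoef a Y = coeff (\<Prod>y\<in>#Y. [:1, - y:]) a"

lemma ecoef_empty: "ecoef a {#} = (if a = 0 then 1 else 0)"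
  by (simp add: ecoef_def)

lemma ecoef_add: "ecoef a (add_mset y Y) = ecoef a Y - (if a = 0 then 0 else y * ecoef (a - 1) Y)"
  by (cases a) (simp_all add: ecoef_def coeff_pCons)

lemma ecoef_0 [simp]: "ecoef 0 Y = 1"
  by (induction Y) (simp_all add: ecoef_empty ecoef_add)

lemma ecoef_big: "size Y < a \<Longrightarrow> ecoef a Y = 0"
  by (induction Y arbitrary: a) (auto simp: ecoef_empty ecoef_add)

lemma sum_shift_product:
  "(\<Sum>i<Suc k. if i = 0 then 0 else y * e (i - 1) * p (Suc k - i)) = (y :: complex) * (\<Sum>i<k. e i * p (k - i))"
  by (subst sum.lessThan_Suc_shift) (simp add: sum_distrib_left mult.assoc)

text \<open>
  Newton's identities. In characteristic zero they determine power sums and coefficients from each other,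
  recursively and by polynomial formulas that do not involve the size of \<open>Y\<close>. On adding \<open>y\<close> the mixed
  terms telescope.
\<close>

lemma newton_identity:
  "of_nat n * ecoef n Y = - (\<Sum>i<n. ecoef i Y * (\<Sum>y\<in>#Y. y ^ (n - i)))"
proof (induction Y arbitrary: n)
  case empty
  then show ?case by (simp add: ecoef_empty)
next
  case (add y Y)
  let ?e = "\<lambda>i. ecoef i Y" and ?p = "\<lambda>k. \<Sum>y\<in>#Y. y ^ k"
  show ?case
  proof (cases n)
    case (Suc k)
    \<comment> \<open>The telescoping sequence of the mixed terms.\<close>
    define f where "f i = (if i = 0 then 0 else ?e (i - 1) * y ^ (Suc n - i))" for i
    have "(\<Sum>i<n. ecoef i (add_mset y Y) * (\<Sum>z\<in>#add_mset y Y. z ^ (n - i))) =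
       (\<Sum>i<n. ?e i * ?p (n - i) - (if i = 0 then 0 else y * ?e (i - 1) * ?p (n - i)) + (f (Suc i) - f i))"
    proof (intro sum.cong refl)
      fix i assume "i \<in> {..<n}"
      then have "y ^ (Suc n - i) = y * y ^ (n - i)" by (simp add: Suc_diff_le)
      then show "ecoef i (add_mset y Y) * (\<Sum>z\<in>#add_mset y Y. z ^ (n - i)) =
         ?e i * ?p (n - i) - (if i = 0 then 0 else y * ?e (i - 1) * ?p (n - i)) + (f (Suc i) - f i)"
        by (auto simp: ecoef_add f_def algebra_simps)
    qed
    also have "\<dots> = (\<Sum>i<n. ?e i * ?p (n - i)) - (\<Sum>i<n. if i = 0 then 0 else y * ?e (i - 1) * ?p (n - i)) + (f n - f 0)"
      by (simp only: sum.distrib sum_lessThan_telescope) (simp only: sum_subtractf)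
    also have "(\<Sum>i<n. if i = 0 then 0 else y * ?e (i - 1) * ?p (n - i)) = y * (\<Sum>i<k. ?e i * ?p (k - i))"
      unfolding Suc by (rule sum_shift_product)
    also have "f n - f 0 = y * ?e k" by (simp add: f_def Suc)
    also have "(\<Sum>i<n. ?e i * ?p (n - i)) = - (of_nat n * ?e n)" using add.IH[of n] by simp
    also have "(\<Sum>i<k. ?e i * ?p (k - i)) = - (of_nat k * ?e k)" using add.IH[of k] by simp
    finally show ?thesis by (simp add: Suc ecoef_add algebra_simps)
  qed simp
qed

lemma coeff_linear_mult: "coeff ([:- y, 1:] * p) (Suc n) = coeff p n - y * coeff p (Suc n)" for y :: complex
  by (simp add: coeff_pCons)

lemma coeff_root_product:
  "a \<le> size Y \<Longrightarrow> coeff (\<Prod>y\<in>#Y. [:- y, 1:]) (size Y - a) = ecoef a Y"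
  "size Y < n \<Longrightarrow> coeff (\<Prod>y\<in>#Y. [:- y, 1:]) n = 0"
proof (induction Y arbitrary: a n)
  case empty
  { case 1 then show ?case by (simp add: ecoef_empty) }
  { case 2 then show ?case by simp }
next
  case (add y Y)
  { case 1
    show ?case
    proof (cases "a \<le> size Y")
      case True
      then have e: "size (add_mset y Y) - a = Suc (size Y - a)" by (simp add: Suc_diff_le)
      show ?thesis
      proof (cases a)
        case 0
        then show ?thesis using add(1)[of 0] add(2)[of "Suc (size Y)"] by (simp add: coeff_pCons)
      next
        case (Suc b)
        then have "Suc (size Y - a) = size Y - b" using True by simp
        then show ?thesis using add(1)[of a] add(1)[of b] True Suc
          unfolding e image_mset_add_mset prod_mset.add_mset coeff_linear_mult by (simp add: ecoef_add)
      qed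
    next
      case False
      then have "a = Suc (size Y)" using 1 by simp
      then show ?thesis using add(1)[of "size Y"] ecoef_big[of Y a] by (simp add: ecoef_add)
    qed }
  { case (2 n)
    then show ?case using add(2)[of n] add(2)[of "n - 1"] by (cases n) (auto simp: coeff_pCons) }
qed

lemma ecoef_unique:
  assumes "size Y = size Z" "\<And>a. 1 \<le> a \<Longrightarrow> a \<le> size Y \<Longrightarrow> ecoef a Y = ecoef a Z"
  shows "Y = Z"
proof -
  have "(\<Prod>y\<in>#Y. [:- y, 1:]) = (\<Prod>y\<in>#Z. [:- y, 1:])"
  proof (rule poly_eqI)
    fix n
    show "coeff (\<Prod>y\<in>#Y. [:- y, 1:]) n = coeff (\<Prod>y\<in>#Z. [:- y, 1:]) n"
    proof (cases "n \<le> size Y")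
      case True
      have "ecoef (size Y - n) Y = ecoef (size Y - n) Z"
        using assms(2)[of "size Y - n"] by (cases "size Y - n = 0") auto
      then show ?thesis
        using True assms(1) coeff_root_product(1)[of "size Y - n" Y] coeff_root_product(1)[of "size Y - n" Z] by simp
    qed (use coeff_root_product(2)[of _ n] assms(1) in auto)
  qed
  then have "proots (\<Prod>y\<in>#Y. [:- y, 1:]) = proots (\<Prod>y\<in>#Z. [:- y, 1:])" by simp
  moreover have "proots (\<Prod>y\<in>#W. [:- y, 1:]) = W" for W :: "complex multiset"
  proof (induction W)
    case (add w W)
    have "(\<Prod>y\<in>#W. [:- y, 1:]) \<noteq> 0" by (auto simp: prod_mset_zero_iff)
    then show ?case using add by (simp add: proots_mult del: mult_pCons_left)
  qed simp
  ultimately show ?thesis by simp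
qed

lemma ecoef_exists: "\<exists>Y. size Y = c \<and> (\<forall>a \<in> {1..c}. ecoef a Y = f a)"
proof -
  define p where "p = monom 1 c + (\<Sum>a\<in>{1..c}. monom (f a) (c - a))"
  have cp: "coeff p (c - a) = f a" if "a \<in> {1..c}" for a
  proof -
    have "(\<Sum>b\<in>{1..c}. coeff (monom (f b) (c - b)) (c - a)) = (\<Sum>b\<in>{1..c}. if b = a then f a else 0)"
      using that by (intro sum.cong) auto
    then show ?thesis using that by (auto simp: p_def coeff_sum)
  qed
  have top: "coeff p c = 1"
    by (auto simp: p_def coeff_sum intro!: sum.neutral)
  have big: "coeff p n = 0" if "c < n" for n using that by (auto simp: p_def coeff_sum intro!: sum.neutral)
  have deg: "degree p = c"
    using top big by (intro antisym degree_le le_degree) auto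
  have "p = smult (lead_coeff p) (\<Prod>x\<in>#proots p. [:- x, 1:])"
    by (rule complex_poly_decompose_multiset[symmetric])
  then have dec: "p = (\<Prod>x\<in>#proots p. [:- x, 1:])" using deg top by simp
  have sz: "size (proots p) = c"
  proof -
    have "coeff (\<Prod>x\<in>#proots p. [:- x, 1:]) (size (proots p)) = 1"
      using coeff_root_product(1)[of 0 "proots p"] by simp
    then have "size (proots p) \<le> c" using dec deg le_degree[of p "size (proots p)"] by simp
    moreover have "\<not> size (proots p) < c"
      using coeff_root_product(2)[of "proots p" c] dec top by auto
    ultimately show ?thesis by simp
  qed
  have "ecoef a (proots p) = f a" if "a \<in> {1..c}" for a
    using coeff_root_product(1)[of a "proots p"] dec cp[OF that] that by (simp add: sz)
  with sz show ?thesis by blast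
qed

section \<open>The tower of coordinate projections\<close>

text \<open>
  Truncation keeps the coordinates with index at least \<open>j\<close> in place, so that the stages of the tower are
  multisets of vectors of one type.
\<close>

definition trunc :: "nat \<Rightarrow> (nat \<Rightarrow> complex) \<Rightarrow> nat \<Rightarrow> complex" where
  "trunc j v = (\<lambda>i. if j \<le> i then v i else 0)"

definition truncm :: "nat \<Rightarrow> (nat \<Rightarrow> complex) multiset \<Rightarrow> (nat \<Rightarrow> complex) multiset" where
  "truncm j M = image_mset (trunc j) M"

text \<open>
  The values of the coordinate \<open>j\<close>, with multiplicity, at the points that agree with \<open>s\<close> above \<open>j\<close>.
\<close>

definition fibre :: "nat \<Rightarrow> (nat \<Rightarrow> complex) multiset \<Rightarrow> (nat \<Rightarrow> complex) \<Rightarrow> complex multiset" where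
  "fibre j M s = image_mset (\<lambda>v. v j) (filter_mset (\<lambda>v. trunc (Suc j) v = s) M)"

lemma count_image_mset_size: "count (image_mset f M) s = size (filter_mset (\<lambda>v. f v = s) M)"
  by (induction M) auto

lemma trunc_trunc: "i \<le> j \<Longrightarrow> trunc j (trunc i v) = trunc j v"
  by (auto simp: trunc_def)

lemma trunc_0 [simp]: "trunc 0 = (\<lambda>v. v)"
  by (simp add: trunc_def fun_eq_iff)

lemma truncm_0 [simp]: "truncm 0 M = M"
  by (simp add: truncm_def)

lemma truncm_truncm: "i \<le> j \<Longrightarrow> truncm j (truncm i M) = truncm j M"
  by (simp add: truncm_def image_mset.compositionality o_def trunc_trunc)

lemma size_truncm [simp]: "size (truncm j M) = size M"
  by (simp add: truncm_def)

lemma fibre_truncm: "i \<le> j \<Longrightarrow> fibre j (truncm i M) s = fibre j M s"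
  by (simp add: fibre_def truncm_def filter_mset_image_mset image_mset.compositionality o_def trunc_trunc)
    (simp add: trunc_def)

lemma size_fibre: "size (fibre j M s) = count (truncm (Suc j) M) s"
  by (simp add: fibre_def truncm_def count_image_mset_size)

lemma trunc_fun_upd: "trunc j v = (trunc (Suc j) v)(j := v j)"
  by (auto simp: trunc_def fun_eq_iff)

lemma truncm_eqI:
  assumes "\<And>s. fibre j M s = fibre j M' s"
  shows "truncm j M = truncm j M'"
proof -
  have "count (truncm j M) w = (if trunc j w = w then count (fibre j M (trunc (Suc j) w)) (w j) else 0)" for M w
  proof -
    have *: "trunc j v = w \<longleftrightarrow> trunc j w = w \<and> trunc (Suc j) v = trunc (Suc j) w \<and> v j = w j" for v
      by (metis trunc_fun_upd trunc_trunc le_refl Suc_n_not_le_n nat_le_linear fun_upd_same)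
    show ?thesis
    proof (cases "trunc j w = w")
      case True
      then have "trunc j v = w \<longleftrightarrow> v j = w j \<and> trunc (Suc j) v = trunc (Suc j) w" for v using *[of v] by blast
      then show ?thesis using True
        by (simp add: truncm_def fibre_def count_image_mset_size filter_filter_mset conj_commute)
    next
      case False
      then have "trunc j v \<noteq> w" for v using *[of v] by blast
      then show ?thesis using False by (simp add: truncm_def count_image_mset_size)
    qed
  qed
  then show ?thesis using assms by (intro multiset_eqI) simp
qed

definition lead :: "(nat \<Rightarrow> complex) \<Rightarrow> nat" where
  "lead v = (LEAST i. \<forall>j>i. v j = 0)"

definition normalized :: "(nat \<Rightarrow> complex) \<Rightarrow> bool" where
  "normalized v \<longleftrightarrow> v (lead v) = 1 \<and> (\<forall>j>lead v. v j = 0)"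

lemma lead_eqI:
  assumes "v i \<noteq> 0" "\<And>j. i < j \<Longrightarrow> v j = 0" shows "lead v = i"
  unfolding lead_def using assms by (intro Least_equality) (auto simp: not_less[symmetric])

lemma normalizedI: "v i = 1 \<Longrightarrow> (\<And>j. i < j \<Longrightarrow> v j = 0) \<Longrightarrow> normalized v \<and> lead v = i"
  using lead_eqI[of v i] by (auto simp: normalized_def)

definition cell :: "nat list \<Rightarrow> (nat \<Rightarrow> complex) multiset set" where
  "cell ks = {M. (\<forall>v \<in># M. normalized v) \<and> image_mset lead M = mset ks}"

lemma size_cell: "M \<in> cell ks \<Longrightarrow> size M = length ks"
  unfolding cell_def by (metis (mono_tags, lifting) mem_Collect_eq size_image_mset size_mset)

lemma lead_cell: "M \<in> cell ks \<Longrightarrow> v \<in># M \<Longrightarrow> lead v \<in> set ks"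
  unfolding cell_def by (metis (mono_tags, lifting) image_eqI mem_Collect_eq set_image_mset set_mset_mset)

lemma trunc_eq_0: "normalized v \<Longrightarrow> trunc (Suc j) v = 0 \<longleftrightarrow> lead v \<le> j"
proof
  assume v: "normalized v" "trunc (Suc j) v = 0"
  show "lead v \<le> j"
  proof (rule ccontr)
    assume "\<not> ?thesis"
    then have "trunc (Suc j) v (lead v) = 1" using v(1) by (simp add: trunc_def normalized_def)
    with v show False by simp
  qed
qed (auto simp: trunc_def normalized_def fun_eq_iff)

text \<open>
  Above the truncated point \<open>0\<close> there is no choice: a vector with leading position \<open>j\<close> has the coordinate
  \<open>1\<close>, and one with a smaller leading position has the coordinate \<open>0\<close>.
\<close>

lemma fibre_zero:
  assumes "M \<in> cell ks"
  shows "fibre j M 0 = image_mset (\<lambda>i. if i = j then 1 else 0) (filter_mset (\<lambda>i. i \<le> j) (mset ks))"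
proof -
  have n: "\<And>v. v \<in># M \<Longrightarrow> normalized v" and k: "mset ks = image_mset lead M"
    using assms by (auto simp: cell_def)
  have "filter_mset (\<lambda>v. trunc (Suc j) v = 0) M = filter_mset (\<lambda>v. lead v \<le> j) M"
    using n trunc_eq_0 by (intro filter_mset_cong) auto
  then have "fibre j M 0 = image_mset (\<lambda>v. v j) (filter_mset (\<lambda>v. lead v \<le> j) M)" by (simp add: fibre_def)
  also have "\<dots> = image_mset (\<lambda>v. if lead v = j then 1 else 0) (filter_mset (\<lambda>v. lead v \<le> j) M)"
    using n by (intro image_mset_cong) (auto simp: normalized_def)
  finally show ?thesis by (simp add: k filter_mset_image_mset image_mset.compositionality o_def)
qed

lemma zero_truncm: "M \<in> cell ks \<Longrightarrow> 0 \<in># truncm (Suc j) M \<longleftrightarrow> (\<exists>i \<in> set ks. i \<le> j)"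
proof -
  assume M: "M \<in> cell ks"
  then have ks: "set ks = lead ` set_mset M" unfolding cell_def
    by (metis (mono_tags, lifting) mem_Collect_eq set_image_mset set_mset_mset)
  have "0 \<in># truncm (Suc j) M \<longleftrightarrow> (\<exists>v \<in># M. trunc (Suc j) v = 0)" by (auto simp: truncm_def image_iff)
  also have "\<dots> \<longleftrightarrow> (\<exists>v \<in># M. lead v \<le> j)" using M trunc_eq_0 by (auto simp: cell_def)
  finally show ?thesis by (auto simp: ks)
qed

lemma cell_coord_space:
  assumes "M \<in> cell ks" "\<And>k. k \<in> set ks \<Longrightarrow> k \<le> N"
  shows "set_mset (truncm j M) \<subseteq> coord_space {..N}"
proof
  fix w assume "w \<in># truncm j M"
  then obtain v where v: "v \<in># M" "w = trunc j v" by (auto simp: truncm_def)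
  then have "normalized v" "lead v \<le> N" using assms lead_cell by (auto simp: cell_def)
  then show "w \<in> coord_space {..N}" by (auto simp: coord_space_def v trunc_def normalized_def)
qed

text \<open>
  The index set for the new coordinates in level \<open>j\<close>. The slots \<open>l\<close> with \<open>j < ks ! l\<close> are as many as the
  points with a free coordinate \<open>j\<close>, and the pairs \<open>(j, l)\<close> form the Young diagram of \<open>ks\<close>.
\<close>

definition level_slots :: "nat list \<Rightarrow> nat \<Rightarrow> nat set" where
  "level_slots ks j = {l. l < length ks \<and> j < ks ! l}"

definition cell_index :: "nat list \<Rightarrow> (nat \<times> nat) set" where
  "cell_index ks = {(j, l). l \<in> level_slots ks j}"

text \<open>
  The numbers to be stored in one level: for each multiplicity \<open>c\<close> and each of the \<open>c\<close> coefficients \<open>a\<close>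
  the \<open>rc c\<close> interpolation coefficients.
\<close>

definition coef_index :: "nat \<Rightarrow> (nat \<Rightarrow> nat) \<Rightarrow> (nat \<times> nat \<times> nat) set" where
  "coef_index m rc = {(c, a, b). 1 \<le> a \<and> a \<le> c \<and> c \<le> m \<and> b < rc c}"

text \<open>
  \<open>\<Sum>c. c \<cdot> rc c\<close> counts the non-zero truncated points with multiplicity. This equality of dimensions is
  what makes the strata match with affine spaces.
\<close>

lemma card_coef_index:
  assumes M: "M \<in> cell ks"
  shows "card (coef_index (length ks) (\<lambda>c. card (mult_part (truncm (Suc j) M) c))) = card (level_slots ks j)"
    and "finite (coef_index (length ks) (\<lambda>c. card (mult_part (truncm (Suc j) M) c)))"
proof -
  let ?A = "truncm (Suc j) M" and ?m = "length ks"
  have fin: "finite (mult_part ?A c)" for c by (simp add: mult_part_def)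
  have eq: "coef_index ?m (\<lambda>c. card (mult_part ?A c)) = (SIGMA c:{..?m}. {1..c} \<times> {..<card (mult_part ?A c)})"
    by (auto simp: coef_index_def)
  then show "finite (coef_index ?m (\<lambda>c. card (mult_part ?A c)))" by simp
  have "card (coef_index ?m (\<lambda>c. card (mult_part ?A c))) = (\<Sum>c\<le>?m. c * card (mult_part ?A c))"
    by (simp add: eq card_cartesian_product)
  also have "\<dots> = (\<Sum>c\<le>?m. \<Sum>s\<in>mult_part ?A c. count ?A s)"
    by (intro sum.cong) (auto simp: mult_part_def)
  also have "\<dots> = (\<Sum>s\<in>(\<Union>c\<in>{..?m}. mult_part ?A c). count ?A s)"
    by (intro sum.UNION_disjoint[symmetric]) (auto simp: mult_part_def)
  also have "(\<Union>c\<in>{..?m}. mult_part ?A c) = set_mset (filter_mset (\<lambda>s. s \<noteq> 0) ?A)"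
    using size_cell[OF M] count_le_size[of ?A] by (auto simp: mult_part_def)
  also have "(\<Sum>s\<in>set_mset (filter_mset (\<lambda>s. s \<noteq> 0) ?A). count ?A s) = size (filter_mset (\<lambda>s. s \<noteq> 0) ?A)"
    unfolding size_multiset_overloaded_eq by (intro sum.cong) auto
  also have "filter_mset (\<lambda>s. s \<noteq> 0) ?A = image_mset (trunc (Suc j)) (filter_mset (\<lambda>v. j < lead v) M)"
  proof -
    have "filter_mset (\<lambda>v. trunc (Suc j) v \<noteq> 0) M = filter_mset (\<lambda>v. j < lead v) M"
      using M trunc_eq_0[of _ j] by (intro filter_mset_cong) (auto simp: cell_def)
    then show ?thesis by (simp add: truncm_def filter_mset_image_mset)
  qed
  also have "size \<dots> = size (filter_mset (\<lambda>i. j < i) (image_mset lead M))"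
    by (simp add: filter_mset_image_mset)
  also have "image_mset lead M = mset ks" using M by (simp add: cell_def)
  also have "size (filter_mset (\<lambda>i. j < i) (mset ks)) = length (filter (\<lambda>i. j < i) ks)"
    by (metis mset_filter size_mset)
  also have "\<dots> = card (level_slots ks j)" by (simp add: length_filter_conv_card level_slots_def)
  finally show "card (coef_index ?m (\<lambda>c. card (mult_part ?A c))) = card (level_slots ks j)" .
qed

text \<open>
  Any bijection will do, as long as it depends on nothing but the discrete data.
\<close>

definition slot :: "nat list \<Rightarrow> nat \<Rightarrow> (nat \<Rightarrow> nat) \<Rightarrow> nat \<times> nat \<times> nat \<Rightarrow> nat" where
  "slot ks j rc = (SOME f. bij_betw f (coef_index (length ks) rc) (level_slots ks j))"

lemma bij_slot:
  fixes j :: nat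
  assumes "M \<in> cell ks"
  defines "rc \<equiv> \<lambda>c. card (mult_part (truncm (Suc j) M) c)"
  shows "bij_betw (slot ks j rc) (coef_index (length ks) rc) (level_slots ks j)"
proof -
  have "finite (level_slots ks j)" by (auto simp: level_slots_def)
  then have "\<exists>f. bij_betw f (coef_index (length ks) rc) (level_slots ks j)"
    using card_coef_index[OF assms(1), of j] by (intro finite_same_card_bij) (auto simp: rc_def)
  then show ?thesis unfolding slot_def by (rule someI_ex)
qed

text \<open>
  The numbers \<open>x (j, _)\<close> are the coordinates of \<open>M\<close> in level \<open>j\<close>: each coefficient of the polynomial in
  the fibre over \<open>s\<close> is given by its interpolation polynomial.
\<close>

definition coordinates_at :: "nat list \<Rightarrow> nat \<Rightarrow> nat \<Rightarrow> (nat \<times> nat \<Rightarrow> complex) \<Rightarrow> (nat \<Rightarrow> complex) multiset \<Rightarrow> bool" where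
  "coordinates_at ks N j x M \<longleftrightarrow>
     (let A = truncm (Suc j) M; rc = (\<lambda>c. card (mult_part A c)) in
      \<forall>c a. \<forall>s \<in> mult_part A c. 1 \<le> a \<and> a \<le> c \<and> c \<le> length ks \<longrightarrow>
        ecoef a (fibre j M s) = (\<Sum>b<rc c. x (j, slot ks j rc (c, a, b)) * lform N (sept N A) s ^ b))"

lemma coordinates_atD:
  assumes "coordinates_at ks N j x M" "s \<in> mult_part (truncm (Suc j) M) c" "1 \<le> a" "a \<le> c" "c \<le> length ks"
  shows "ecoef a (fibre j M s) = (\<Sum>b<card (mult_part (truncm (Suc j) M) c).
     x (j, slot ks j (\<lambda>c. card (mult_part (truncm (Suc j) M) c)) (c, a, b)) * lform N (sept N (truncm (Suc j) M)) s ^ b)"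
  using assms by (simp add: coordinates_at_def Let_def)

lemma coordinates_at_truncm: "i \<le> j \<Longrightarrow> coordinates_at ks N j x (truncm i M) = coordinates_at ks N j x M"
  by (simp add: coordinates_at_def truncm_truncm fibre_truncm)

locale cell_bound =
  fixes ks :: "nat list" and N :: nat
  assumes bound: "k \<in> set ks \<Longrightarrow> k \<le> N"
begin

abbreviation "coords \<equiv> coord_space (cell_index ks)"

lemma inj_mult_part:
  assumes "M \<in> cell ks"
  shows "finite (mult_part (truncm j M) c)" "inj_on (lform N (sept N (truncm j M))) (mult_part (truncm j M) c)"
  using inj_on_sept[OF cell_coord_space[OF assms bound], of j]
  by (auto simp: mult_part_def intro: inj_on_subset)

lemma coordinates_exist:
  assumes M: "M \<in> cell ks"
  shows "\<exists>x \<in> coords. \<forall>j. coordinates_at ks N j x M"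
proof -
  let ?A = "\<lambda>j. truncm (Suc j) M"
  let ?rc = "\<lambda>j c. card (mult_part (?A j) c)"
  have "\<exists>d. \<forall>s \<in> mult_part (?A j) c. ecoef a (fibre j M s) = (\<Sum>b<?rc j c. d b * lform N (sept N (?A j)) s ^ b)" for j c a
    by (rule interp_exists[OF inj_mult_part[OF M]])
  then obtain d where d: "\<And>j c a s. s \<in> mult_part (?A j) c \<Longrightarrow>
      ecoef a (fibre j M s) = (\<Sum>b<?rc j c. d j c a b * lform N (sept N (?A j)) s ^ b)" by metis
  \<comment> \<open>Outside the index set the value is \<open>0\<close>, as required for a point of the coordinate space.\<close>
  define x where "x = (\<lambda>(j, l). if l \<in> level_slots ks j then
      (case inv_into (coef_index (length ks) (?rc j)) (slot ks j (?rc j)) l of (c, a, b) \<Rightarrow> d j c a b) else 0)"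
  have "x \<in> coords" by (auto simp: coord_space_def x_def cell_index_def)
  moreover have "x (j, slot ks j (?rc j) (c, a, b)) = d j c a b" if "(c, a, b) \<in> coef_index (length ks) (?rc j)" for j c a b
    using that bij_slot[OF M, of j] bij_betw_apply[OF bij_slot[OF M, of j] that]
    by (simp add: x_def bij_betw_def)
  then have "coordinates_at ks N j x M" for j
    unfolding coordinates_at_def Let_def using d by (auto simp: coef_index_def intro!: sum.cong)
  ultimately show ?thesis by blast
qed

lemma coordinates_unique:
  assumes M: "M \<in> cell ks" and x: "x \<in> coords" "y \<in> coords"
    and *: "\<And>j. coordinates_at ks N j x M" "\<And>j. coordinates_at ks N j y M"
  shows "x = y"
proof (rule ext, clarify)
  fix j l
  let ?A = "truncm (Suc j) M"
  let ?rc = "\<lambda>c. card (mult_part ?A c)"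
  show "x (j, l) = y (j, l)"
  proof (cases "l \<in> level_slots ks j")
    case True
    then obtain c a b where cab: "(c, a, b) \<in> coef_index (length ks) ?rc" "l = slot ks j ?rc (c, a, b)"
      using bij_slot[OF M, of j] unfolding bij_betw_def by (metis (no_types, lifting) imageE prod_cases3)
    then have i: "1 \<le> a" "a \<le> c" "c \<le> length ks" "b < ?rc c" by (auto simp: coef_index_def)
    have "x (j, slot ks j ?rc (c, a, b)) = y (j, slot ks j ?rc (c, a, b))"
    proof (rule interp_unique[OF inj_mult_part[OF M], of "Suc j" c
        "\<lambda>b. x (j, slot ks j ?rc (c, a, b))" "\<lambda>b. y (j, slot ks j ?rc (c, a, b))" b])
      fix s assume "s \<in> mult_part ?A c"
      then show "(\<Sum>b<?rc c. x (j, slot ks j ?rc (c, a, b)) * lform N (sept N ?A) s ^ b) =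
         (\<Sum>b<?rc c. y (j, slot ks j ?rc (c, a, b)) * lform N (sept N ?A) s ^ b)"
        using coordinates_atD[OF *(1)[of j], of s c a] coordinates_atD[OF *(2)[of j], of s c a] i by simp
    qed (use i in auto)
    then show ?thesis using cab by simp
  next
    case False
    then show ?thesis using x by (auto simp: coord_space_def cell_index_def)
  qed
qed

lemma truncm_above: "M \<in> cell ks \<Longrightarrow> N < j \<Longrightarrow> truncm j M = replicate_mset (length ks) 0"
proof -
  assume M: "M \<in> cell ks" and j: "N < j"
  have "trunc j v = 0" if "v \<in># M" for v
  proof -
    have "normalized v" "lead v \<le> N" using that M lead_cell[OF M that] bound by (auto simp: cell_def)
    then show ?thesis using j by (auto simp: trunc_def normalized_def fun_eq_iff)
  qed
  then have "truncm j M = image_mset (\<lambda>_. 0) M" unfolding truncm_def by (intro image_mset_cong)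
  then show ?thesis using size_cell[OF M] by (simp add: image_mset_const_eq)
qed

text \<open>
  From the top level downwards, the coordinates determine the fibre over each non-zero truncated point,
  and \<open>fibre_zero\<close> determines the fibre over \<open>0\<close>.
\<close>

lemma multiset_unique:
  assumes M: "M \<in> cell ks" "M' \<in> cell ks"
    and *: "\<And>j. coordinates_at ks N j x M" "\<And>j. coordinates_at ks N j x M'"
  shows "M = M'"
proof -
  have "truncm (Suc N - n) M = truncm (Suc N - n) M'" for n
  proof (induction n)
    case 0
    then show ?case using M truncm_above by simp
  next
    case (Suc n)
    show ?case
    proof (cases "n \<le> N")
      case True
      define j where "j = Suc N - Suc n"
      have sj: "Suc N - n = Suc j" using True by (simp add: j_def)
      have IH: "truncm (Suc j) M = truncm (Suc j) M'" using Suc sj by simp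
      have "truncm j M = truncm j M'"
      proof (rule truncm_eqI)
        fix s
        show "fibre j M s = fibre j M' s"
        proof (cases "s = 0")
          case True
          then show ?thesis using fibre_zero M by simp
        next
          case False
          let ?A = "truncm (Suc j) M"
          let ?c = "count ?A s"
          have sz: "size (fibre j M s) = ?c" "size (fibre j M' s) = ?c" by (simp_all add: size_fibre IH)
          show ?thesis
          proof (rule ecoef_unique)
            show "size (fibre j M s) = size (fibre j M' s)" using sz by simp
            fix a assume a: "1 \<le> a" "a \<le> size (fibre j M s)"
            then have s: "s \<in> mult_part ?A ?c" using False sz by (auto simp: mult_part_def intro: count_inI)
            have "?c \<le> length ks" using count_le_size[of ?A s] size_cell[OF M(1)] by simp
            then show "ecoef a (fibre j M s) = ecoef a (fibre j M' s)"
              using coordinates_atD[OF *(1)[of j] s, of a] coordinates_atD[OF *(2)[of j], of s ?c a] a s sz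
              by (simp add: IH)
          qed
        qed
      qed
      then show ?thesis by (simp add: j_def)
    next
      case False
      then have "Suc N - Suc n = Suc N - n" by simp
      with Suc show ?thesis by simp
    qed
  qed
  from this[of "Suc N"] show ?thesis by simp
qed

text \<open>
  Prescribed coordinates in level \<open>j\<close> are realized by exchanging the coordinate \<open>j\<close> of the points that do
  not vanish above \<open>j\<close>. The lower coordinates of these points may be reset to \<open>0\<close>: they belong to later
  levels.
\<close>

lemma multiset_step:
  assumes M: "M \<in> cell ks"
  shows "\<exists>M' \<in> cell ks. truncm (Suc j) M' = truncm (Suc j) M \<and> coordinates_at ks N j x M'"
proof -
  let ?A = "truncm (Suc j) M"
  let ?rc = "\<lambda>c. card (mult_part ?A c)"
  let ?l = "lform N (sept N ?A)"
  have n: "\<And>v. v \<in># M \<Longrightarrow> normalized v" using M by (auto simp: cell_def)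
  have "\<exists>Y. \<forall>s. size (Y s) = count ?A s \<and> (\<forall>a \<in> {1..count ?A s}. ecoef a (Y s) = (\<Sum>b<?rc (count ?A s). x (j, slot ks j ?rc (count ?A s, a, b)) * ?l s ^ b))"
    by (rule choice, rule allI, rule ecoef_exists)
  then obtain Y where Y0: "\<forall>s. size (Y s) = count ?A s \<and> (\<forall>a \<in> {1..count ?A s}. ecoef a (Y s) = (\<Sum>b<?rc (count ?A s). x (j, slot ks j ?rc (count ?A s, a, b)) * ?l s ^ b))" ..
  then have Y: "\<And>s. size (Y s) = count ?A s"
    "\<And>s a. a \<in> {1..count ?A s} \<Longrightarrow> ecoef a (Y s) = (\<Sum>b<?rc (count ?A s). x (j, slot ks j ?rc (count ?A s, a, b)) * ?l s ^ b)"
    by (simp, blast)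
  let ?S = "set_mset ?A - {0}"
  define Z where "Z = filter_mset (\<lambda>v. trunc (Suc j) v = 0) M"
  define M' where "M' = (\<Sum>s\<in>?S. image_mset (\<lambda>y. s(j := y)) (Y s)) + Z"
  have s: "trunc (Suc j) (s(j := y)) = s" "normalized (s(j := y))" "lead (s(j := y)) = lead s"
    if "s \<in> ?S" for s y
  proof -
    obtain v where v: "v \<in># M" "s = trunc (Suc j) v" using \<open>s \<in> ?S\<close> by (auto simp: truncm_def)
    then have lv: "j < lead v" using n[OF v(1)] trunc_eq_0[of v j] that by auto
    show "trunc (Suc j) (s(j := y)) = s" by (auto simp: v trunc_def fun_eq_iff)
    have 1: "normalized (s(j := y)) \<and> lead (s(j := y)) = lead v"
      using n[OF v(1)] lv by (intro normalizedI) (auto simp: v trunc_def normalized_def)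
    have 2: "normalized s \<and> lead s = lead v"
      using n[OF v(1)] lv by (intro normalizedI) (auto simp: v trunc_def normalized_def)
    from 1 2 show "normalized (s(j := y))" "lead (s(j := y)) = lead s" by simp_all
  qed
  have im: "image_mset f (\<Sum>s\<in>?S. image_mset (\<lambda>y. s(j := y)) (Y s)) = image_mset g (filter_mset (\<lambda>s. s \<noteq> 0) ?A)"
    if fg: "\<And>s y. s \<in> ?S \<Longrightarrow> f (s(j := y)) = g s" for f :: "(nat \<Rightarrow> complex) \<Rightarrow> 'z" and g
  proof -
    have img: "image_mset f (\<Sum>s\<in>T. h s) = (\<Sum>s\<in>T. image_mset f (h s))" for T :: "(nat \<Rightarrow> complex) set" and h
      by (induction T rule: infinite_finite_induct) auto
    have "image_mset f (\<Sum>s\<in>?S. image_mset (\<lambda>y. s(j := y)) (Y s)) = (\<Sum>s\<in>?S. replicate_mset (count ?A s) (g s))"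
      unfolding img
    proof (intro sum.cong refl)
      fix s assume "s \<in> ?S"
      then have "image_mset f (image_mset (\<lambda>y. s(j := y)) (Y s)) = image_mset (\<lambda>_. g s) (Y s)"
        by (simp add: image_mset.compositionality o_def fg)
      then show "image_mset f (image_mset (\<lambda>y. s(j := y)) (Y s)) = replicate_mset (count ?A s) (g s)"
        by (simp add: image_mset_const_eq Y)
    qed
    also have "\<dots> = image_mset g (\<Sum>s\<in>?S. replicate_mset (count ?A s) s)"
    proof -
      have img': "image_mset g (\<Sum>s\<in>T. h s) = (\<Sum>s\<in>T. image_mset g (h s))" for T :: "(nat \<Rightarrow> complex) set" and h
        by (induction T rule: infinite_finite_induct) auto
      show ?thesis by (simp add: img')
    qed
    also have "(\<Sum>s\<in>?S. replicate_mset (count ?A s) s) = filter_mset (\<lambda>s. s \<noteq> 0) ?A"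
    proof (rule multiset_eqI)
      fix w
      have "count (\<Sum>s\<in>?S. replicate_mset (count ?A s) s) w = (\<Sum>s\<in>?S. if s = w then count ?A w else 0)"
        unfolding count_sum by (intro sum.cong) auto
      then show "count (\<Sum>s\<in>?S. replicate_mset (count ?A s) s) w = count (filter_mset (\<lambda>s. s \<noteq> 0) ?A) w"
        by (auto simp: not_in_iff)
    qed
    finally show ?thesis .
  qed
  have Z0: "truncm (Suc j) Z = filter_mset (\<lambda>s. s = 0) ?A"
    by (simp add: Z_def truncm_def filter_mset_image_mset)
  have tr: "truncm (Suc j) M' = ?A"
  proof -
    have "truncm (Suc j) M' = filter_mset (\<lambda>s. s \<noteq> 0) ?A + filter_mset (\<lambda>s. s = 0) ?A"
      using im[of "trunc (Suc j)" "\<lambda>s. s"] s(1) Z0 by (simp add: M'_def truncm_def)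
    then show ?thesis using multiset_partition[of ?A "\<lambda>s. s \<noteq> 0"] by simp
  qed
  have memM': "v \<in># Z \<or> (\<exists>s \<in> ?S. \<exists>y. v = s(j := y))" if "v \<in># M'" for v
    using that by (auto simp: M'_def set_mset_sum)
  have "M' \<in> cell ks"
    unfolding cell_def
  proof (intro CollectI conjI ballI)
    fix v assume "v \<in># M'"
    then show "normalized v" using memM' s n by (fastforce simp: Z_def)
  next
    have l: "lead v = lead (trunc (Suc j) v)" if "v \<in># M" "trunc (Suc j) v \<noteq> 0" for v
    proof -
      have "trunc (Suc j) v \<in> ?S" using that by (auto simp: truncm_def)
      from s(3)[OF this, of "v j"] s(2)[OF this, of "v j"] have "lead (trunc j v) = lead (trunc (Suc j) v)"
        by (simp only: trunc_fun_upd[of j v])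
      moreover have "lead (trunc j v) = lead v"
        using n[OF that(1)] trunc_eq_0[OF n[OF that(1)], of j] that(2) 
        by (intro lead_eqI) (auto simp: trunc_def normalized_def)
      ultimately show ?thesis by simp
    qed
    have "image_mset lead M' = image_mset lead (filter_mset (\<lambda>s. s \<noteq> 0) ?A) + image_mset lead Z"
      using im[of lead lead] s(3) by (simp add: M'_def)
    also have "filter_mset (\<lambda>s. s \<noteq> 0) ?A = image_mset (trunc (Suc j)) (filter_mset (\<lambda>v. trunc (Suc j) v \<noteq> 0) M)"
      by (simp add: truncm_def filter_mset_image_mset)
    also have "image_mset lead (image_mset (trunc (Suc j)) (filter_mset (\<lambda>v. trunc (Suc j) v \<noteq> 0) M)) =
        image_mset lead (filter_mset (\<lambda>v. trunc (Suc j) v \<noteq> 0) M)"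
      unfolding image_mset.compositionality o_def by (intro image_mset_cong) (use l in auto)
    also have "\<dots> + image_mset lead Z = image_mset lead M"
      using multiset_partition[of M "\<lambda>v. trunc (Suc j) v \<noteq> 0"] unfolding Z_def image_mset_union[symmetric] by simp
    finally show "image_mset lead M' = mset ks" using M by (simp add: cell_def)
  qed
  moreover have "coordinates_at ks N j x M'"
    unfolding coordinates_at_def Let_def tr
  proof (intro allI ballI impI)
    fix c a s assume s0: "s \<in> mult_part ?A c" and a: "1 \<le> a \<and> a \<le> c \<and> c \<le> length ks"
    then have sS: "s \<in> ?S" and c: "c = count ?A s" by (auto simp: mult_part_def)
    have fl: "filter_mset Q (\<Sum>u\<in>T. h u) = (\<Sum>u\<in>T. filter_mset Q (h u))" for T :: "(nat \<Rightarrow> complex) set" and h and Q :: "(nat \<Rightarrow> complex) \<Rightarrow> bool"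
      by (induction T rule: infinite_finite_induct) auto
    have "filter_mset (\<lambda>v. trunc (Suc j) v = s) M' =
        (\<Sum>u\<in>?S. if u = s then image_mset (\<lambda>y. s(j := y)) (Y s) else {#}) + filter_mset (\<lambda>v. trunc (Suc j) v = s) Z"
    proof -
      have "filter_mset (\<lambda>v. trunc (Suc j) v = s) (image_mset (\<lambda>y. u(j := y)) (Y u)) =
          (if u = s then image_mset (\<lambda>y. s(j := y)) (Y s) else {#})" if "u \<in> ?S" for u
        using s(1)[OF that] by (auto simp: filter_mset_image_mset)
      then show ?thesis by (simp add: M'_def fl)
    qed
    also have "(\<Sum>u\<in>?S. if u = s then image_mset (\<lambda>y. s(j := y)) (Y s) else {#}) = image_mset (\<lambda>y. s(j := y)) (Y s)"
      using sS by simp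
    also have "filter_mset (\<lambda>v. trunc (Suc j) v = s) Z = {#}"
      using sS by (auto simp: Z_def filter_filter_mset split: if_splits)
    finally have "fibre j M' s = Y s" by (simp add: fibre_def image_mset.compositionality o_def)
    then show "ecoef a (fibre j M' s) = (\<Sum>b<?rc c. x (j, slot ks j ?rc (c, a, b)) * ?l s ^ b)"
      using Y(2)[of a s] a c by simp
  qed
  ultimately show ?thesis using tr by blast
qed

lemma coordinates_at_above:
  assumes "M \<in> cell ks" "N \<le> j" shows "coordinates_at ks N j x M"
proof -
  have "mult_part (truncm (Suc j) M) c = {}" for c
    using truncm_above[OF assms(1), of "Suc j"] assms(2) by (auto simp: mult_part_def split: if_splits)
  then show ?thesis by (simp add: coordinates_at_def Let_def)
qed

lemma multiset_exists: "\<exists>M \<in> cell ks. \<forall>j. coordinates_at ks N j x M"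
proof -
  have "\<exists>M \<in> cell ks. \<forall>j \<ge> N - n. coordinates_at ks N j x M" for n
  proof (induction n)
    case 0
    define e where "e i = (\<lambda>j. if j = i then 1 else (0 :: complex))" for i :: nat
    have "normalized (e i) \<and> lead (e i) = i" for i by (rule normalizedI) (auto simp: e_def)
    then have "image_mset e (mset ks) \<in> cell ks"
      by (auto simp: cell_def image_mset.compositionality o_def)
    then show ?case using coordinates_at_above by auto
  next
    case (Suc n)
    then obtain M where M: "M \<in> cell ks" "\<And>j. N - n \<le> j \<Longrightarrow> coordinates_at ks N j x M" by blast
    show ?case
    proof (cases "n < N")
      case True
      define j where "j = N - Suc n"
      have j: "Suc j = N - n" using True by (simp add: j_def)
      obtain M' where M': "M' \<in> cell ks" "truncm (Suc j) M' = truncm (Suc j) M" "coordinates_at ks N j x M'"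
        using multiset_step[OF M(1), of j x] by blast
      have "coordinates_at ks N i x M'" if "N - Suc n \<le> i" for i
      proof (cases "i = j")
        case False
        then have i: "Suc j \<le> i" using that by (simp add: j_def)
        have "coordinates_at ks N i x (truncm (Suc j) M)" using M(2)[of i] i j coordinates_at_truncm[OF i] by simp
        then show ?thesis using M'(2) coordinates_at_truncm[OF i] by metis
      qed (use M' in simp)
      with M' show ?thesis by blast
    next
      case False
      then have "N - Suc n = N - n" by simp
      with M show ?thesis by metis
    qed
  qed
  from this[of N] show ?thesis by simp
qed

definition coordinates :: "(nat \<Rightarrow> complex) multiset \<Rightarrow> nat \<times> nat \<Rightarrow> complex" where
  "coordinates M = (THE x. x \<in> coords \<and> (\<forall>j. coordinates_at ks N j x M))"

lemma coordinates_spec: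
  assumes "M \<in> cell ks" shows "coordinates M \<in> coords" "coordinates_at ks N j (coordinates M) M"
proof -
  have "\<exists>!x. x \<in> coords \<and> (\<forall>j. coordinates_at ks N j x M)"
    using coordinates_exist[OF assms] coordinates_unique[OF assms] by blast
  from theI'[OF this] show "coordinates M \<in> coords" "coordinates_at ks N j (coordinates M) M"
    unfolding coordinates_def by blast+
qed

text \<open>
  Iterating \<open>multiset_step\<close> from the top level downwards gives surjectivity, and \<open>multiset_unique\<close>
  gives injectivity.
\<close>

theorem bij_coordinates: "bij_betw coordinates (cell ks) coords"
  unfolding bij_betw_def
proof
  show "inj_on coordinates (cell ks)"
    by (rule inj_onI) (metis coordinates_spec(2) multiset_unique)
  show "coordinates ` cell ks = coords"
  proof
    show "coords \<subseteq> coordinates ` cell ks"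
    proof
      fix x assume x: "x \<in> coords"
      obtain M where M: "M \<in> cell ks" "\<And>j. coordinates_at ks N j x M" using multiset_exists by blast
      then have "coordinates M = x" using coordinates_spec[OF M(1)] coordinates_unique[OF M(1)] x by blast
      with M show "x \<in> coordinates ` cell ks" by blast
    qed
  qed (use coordinates_spec in blast)
qed

end

lemma polys_trunc: "g \<in> polys UNIV \<Longrightarrow> (\<lambda>v. g (trunc j v)) \<in> polys UNIV"
  unfolding polys_def
proof (induction rule: subalg.induct)
  case (gen g)
  then obtain i where i: "g = (\<lambda>v. v i)" by blast
  show ?case
    by (cases "j \<le> i") (auto simp: i trunc_def intro!: subalg.const subalg.gen)
qed (auto intro: subalg.intros)

text \<open>
  Polynomials in a vector \<open>s\<close> and one further number \<open>y\<close>, sorted by powers of \<open>y\<close>.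
\<close>

inductive slice_poly :: "nat \<Rightarrow> ((nat \<Rightarrow> complex) \<Rightarrow> complex \<Rightarrow> complex) \<Rightarrow> bool" for j where
  monom: "g \<in> polys UNIV \<Longrightarrow> slice_poly j (\<lambda>s y. g s * y ^ n)"
| add: "slice_poly j f \<Longrightarrow> slice_poly j g \<Longrightarrow> slice_poly j (\<lambda>s y. f s y + g s y)"

lemma slice_poly_mult:
  assumes "slice_poly j f" "slice_poly j g" shows "slice_poly j (\<lambda>s y. f s y * g s y)"
  using assms(1)
proof (induction rule: slice_poly.induct)
  case (monom p n)
  show ?case using assms(2)
  proof (induction rule: slice_poly.induct)
    case (monom q k)
    have "slice_poly j (\<lambda>s y. (p s * q s) * y ^ (n + k))"
      using \<open>p \<in> polys UNIV\<close> monom by (intro slice_poly.monom polys_intros)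
    then show ?case by (simp add: power_add algebra_simps)
  next
    case (add f g)
    from slice_poly.add[OF add.IH] show ?case by (simp add: algebra_simps)
  qed
next
  case (add f g)
  from slice_poly.add[OF add.IH] show ?case by (simp add: algebra_simps)
qed

lemma slice_poly_of_poly: "g \<in> polys UNIV \<Longrightarrow> slice_poly j (\<lambda>s y. g (s(j := y)))"
  unfolding polys_def
proof (induction rule: subalg.induct)
  case (gen g)
  then obtain i where i: "g = (\<lambda>v. v i)" by blast
  show ?case
  proof (cases "i = j")
    case True
    then show ?thesis using slice_poly.monom[OF polys_intros(1)[of 1], of j 1] by (simp add: i)
  next
    case False
    then show ?thesis using slice_poly.monom[OF polys_var[of i], of j 0] by (simp add: i)
  qed
next
  case (const c)
  then show ?case using slice_poly.monom[OF polys_intros(1)[of c], of j 0] by simp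
qed (auto intro: slice_poly.add slice_poly_mult)

text \<open>
  One level of the tower over a set on which the discrete data of the truncated multiset are constant.
  The power sums of the truncated multiset are regular; those of the full multiset are a
  hypothesis in one direction and the conclusion in the other.
\<close>

locale cell_family = graded_algebra G + cell_bound ks N
  for G :: "nat \<Rightarrow> ('a \<Rightarrow> complex) set" and ks N +
  fixes P :: "'a set" and M :: "'a \<Rightarrow> (nat \<Rightarrow> complex) multiset" and j :: nat and \<tau> :: "nat \<times> nat \<times> nat list"
  assumes cell: "x \<in> P \<Longrightarrow> M x \<in> cell ks"
    and psum_above: "g \<in> polys UNIV \<Longrightarrow> (\<lambda>x. \<Sum>v\<in>#truncm (Suc j) (M x). g v) \<in> ratios G P"
    and type_above: "x \<in> P \<Longrightarrow> supp_type N (truncm (Suc j) (M x)) = \<tau>"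
begin

abbreviation "A x \<equiv> truncm (Suc j) (M x)"
definition "rc = (\<lambda>c. snd (snd \<tau>) ! c)"

sublocale A: multiset_family G P A "length ks" N
  by unfold_locales
    (use cell size_cell cell_coord_space[OF cell bound] psum_above in \<open>auto simp del: set_image_mset\<close>)

sublocale A: uniform_family G P A "length ks" N "fst \<tau>" "fst (snd \<tau>)" "\<exists>i \<in> set ks. i \<le> j"
  by (rule A.uniform_familyI) (use zero_truncm[OF cell] in \<open>auto simp: type_above[symmetric] supp_type_def\<close>)

lemma rc:
  assumes x: "x \<in> P" and c: "c \<le> length ks" shows "card (mult_part (A x) c) = rc c"
proof -
  have "snd (snd \<tau>) = map (\<lambda>c. card (mult_part (A x) c)) [0..<Suc (length ks)]"
    using size_cell[OF cell[OF x]] type_above[OF x] by (auto simp: supp_type_def simp del: upt_Suc)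
  with c show ?thesis by (simp add: rc_def less_Suc_eq_le del: upt_Suc)
qed

lemma sept_A: "x \<in> P \<Longrightarrow> sept N (A x) = fst (snd \<tau>)"
  by (simp add: type_above[symmetric] supp_type_def)

lemma slot_eq: "x \<in> P \<Longrightarrow> slot ks j (\<lambda>c. card (mult_part (A x) c)) = slot ks j rc"
  and coef_index_eq: "x \<in> P \<Longrightarrow> coef_index (length ks) (\<lambda>c. card (mult_part (A x) c)) = coef_index (length ks) rc"
proof -
  assume x: "x \<in> P"
  show 1: "coef_index (length ks) (\<lambda>c. card (mult_part (A x) c)) = coef_index (length ks) rc"
    using rc[OF x] by (auto simp: coef_index_def)
  show "slot ks j (\<lambda>c. card (mult_part (A x) c)) = slot ks j rc"
    by (simp add: slot_def 1)
qed

lemma coordinates_at_iff: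
  assumes x: "x \<in> P" and "coordinates_at ks N j y (M x)" "s \<in> mult_part (A x) c" "1 \<le> a" "a \<le> c" "c \<le> length ks"
  shows "ecoef a (fibre j (M x) s) = (\<Sum>b<rc c. y (j, slot ks j rc (c, a, b)) * A.l s ^ b)"
  using coordinates_atD[OF assms(2-6)] rc[OF x assms(6)] by (simp add: slot_eq[OF x] sept_A[OF x])

text \<open>
  The power sums of the fibres have regular moments, since these are power sums of the whole multiset.
  Hence they are regular functions of the point, by Newton's identities so are the coefficients, and
  the coordinates are interpolation coefficients of the latter.
\<close>

lemma coordinates_ratio:
  assumes psum: "\<And>g. g \<in> polys UNIV \<Longrightarrow> (\<lambda>x. \<Sum>v\<in>#M x. g v) \<in> ratios G P"
    and y: "\<And>x. x \<in> P \<Longrightarrow> coordinates_at ks N j (y x) (M x)"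
    and slot: "k \<in> level_slots ks j"
  shows "(\<lambda>x. y x (j, k)) \<in> ratios G P"
proof (cases "P = {}")
  case True
  then show ?thesis using ratios_cong[OF ratios_const, of P] by simp
next
  case False
  then obtain x0 where x0: "x0 \<in> P" by blast
  let ?F = "\<lambda>x s. fibre j (M x) s"
  have q: "A.fam (\<lambda>x s. \<Sum>y\<in>#?F x s. y ^ n)" for n
  proof (rule A.fam_of_moments)
    fix a
    have "(\<lambda>v. v j ^ n * A.l (trunc (Suc j) v) ^ a) \<in> polys UNIV"
      using polys_trunc[OF lform_polys[of N "fst (snd \<tau>)"], of "Suc j"] polys_var[of j UNIV]
      unfolding polys_def by (intro subalg.mult subalg_power) auto
    then have "(\<lambda>x. \<Sum>v\<in>#M x. v j ^ n * A.l (trunc (Suc j) v) ^ a) \<in> ratios G P" by (rule psum)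
    then show "(\<lambda>x. \<Sum>s\<in>set_mset (A x). (\<Sum>y\<in>#?F x s. y ^ n) * A.l s ^ a) \<in> ratios G P"
    proof (rule ratios_cong)
      fix x
      have "(\<Sum>v\<in>#M x. v j ^ n * A.l (trunc (Suc j) v) ^ a) =
          (\<Sum>s\<in>set_mset (A x). \<Sum>v\<in>#filter_mset (\<lambda>v. trunc (Suc j) v = s) (M x). v j ^ n * A.l (trunc (Suc j) v) ^ a)"
        unfolding truncm_def by (rule sum_mset_fibres)
      also have "\<dots> = (\<Sum>s\<in>set_mset (A x). (\<Sum>y\<in>#?F x s. y ^ n) * A.l s ^ a)"
      proof (intro sum.cong refl)
        fix s
        have "(\<Sum>v\<in>#filter_mset (\<lambda>v. trunc (Suc j) v = s) (M x). v j ^ n * A.l (trunc (Suc j) v) ^ a) =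
           (\<Sum>v\<in>#filter_mset (\<lambda>v. trunc (Suc j) v = s) (M x). v j ^ n * A.l s ^ a)"
          by (intro arg_cong[of _ _ sum_mset] image_mset_cong) auto
        then show "(\<Sum>v\<in>#filter_mset (\<lambda>v. trunc (Suc j) v = s) (M x). v j ^ n * A.l (trunc (Suc j) v) ^ a) =
           (\<Sum>y\<in>#?F x s. y ^ n) * A.l s ^ a"
          by (simp add: fibre_def image_mset.compositionality o_def sum_mset_mult_const)
      qed
      finally show "(\<Sum>s\<in>set_mset (A x). (\<Sum>y\<in>#?F x s. y ^ n) * A.l s ^ a) =
         (\<Sum>v\<in>#M x. v j ^ n * A.l (trunc (Suc j) v) ^ a)" by simp
    qed
  qed
  have e: "A.fam (\<lambda>x s. ecoef n (?F x s))" for n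
  proof (induction n rule: less_induct)
    case (less n)
    show ?case
    proof (cases "n = 0")
      case False
      have "A.fam (\<lambda>x s. (- 1 / of_nat n) * (\<Sum>i<n. ecoef i (?F x s) * (\<Sum>y\<in>#?F x s. y ^ (n - i))))"
        using less by (intro A.fam_mult A.fam_const A.fam_sum q) auto
      moreover have "ecoef n (?F x s) = (- 1 / of_nat n) * (\<Sum>i<n. ecoef i (?F x s) * (\<Sum>y\<in>#?F x s. y ^ (n - i)))" for x s
        using newton_identity[of n "?F x s"] False by (simp add: field_simps)
      ultimately show ?thesis by (simp only:)
    qed (simp add: A.fam_const)
  qed
  obtain c a b where cab: "(c, a, b) \<in> coef_index (length ks) rc" "k = slot ks j rc (c, a, b)"
    using bij_slot[OF cell[OF x0], of j] slot unfolding slot_eq[OF x0] coef_index_eq[OF x0] bij_betw_def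
    by (metis (no_types, lifting) imageE prod_cases3)
  then have i: "1 \<le> a" "a \<le> c" "c \<le> length ks" "b < rc c" by (auto simp: coef_index_def)
  have "(\<lambda>x. y x (j, slot ks j rc (c, a, b))) \<in> ratios G P"
  proof (rule A.coefficient_ratio[OF A.fam_subset_mult_part[OF i(3)], where n = "rc c" and
        h = "\<lambda>x s. ecoef a (?F x s)" and c = "\<lambda>b x. y x (j, slot ks j rc (c, a, b))"])
    show "(\<lambda>x. \<Sum>s\<in>mult_part (A x) c. ecoef a (?F x s) * A.l s ^ d) \<in> ratios G P" for d
      by (intro A.fam_subset_trace A.fam_subset_mult_part i A.fam_mult e A.fam_power A.fam_l)
  qed (use rc i coordinates_at_iff[OF _ y] in auto)
  then show ?thesis by (simp add: cab(2))
qed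

text \<open>
  The coordinates give the coefficients in the fibres over the non-zero points as regular functions of
  the point, with the help of the indicator functions of the multiplicities. Newton's identities
  give the power sums of the fibres, and a power sum of the multiset is a trace of these.
  The fibre over \<open>0\<close> contributes a constant.
\<close>

lemma power_sum_step:
  assumes y: "\<And>x. x \<in> P \<Longrightarrow> coordinates_at ks N j (y x) (M x)"
    and yr: "\<And>k. k \<in> level_slots ks j \<Longrightarrow> (\<lambda>x. y x (j, k)) \<in> ratios G P"
    and g: "g \<in> polys UNIV"
  shows "(\<lambda>x. \<Sum>v\<in>#truncm j (M x). g v) \<in> ratios G P"
proof (cases "P = {}")
  case True
  then show ?thesis using ratios_cong[OF ratios_const, of P] by simp
next
  case False
  then obtain x0 where x0: "x0 \<in> P" by blast
  let ?F = "\<lambda>x s. fibre j (M x) s"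
  let ?nz = "\<lambda>s::nat \<Rightarrow> complex. if s = 0 then 0 else (1::complex)"
  have sl: "slot ks j rc cab \<in> level_slots ks j" if "cab \<in> coef_index (length ks) rc" for cab
    using bij_betw_apply[OF bij_slot[OF cell[OF x0], of j]] that unfolding slot_eq[OF x0] coef_index_eq[OF x0] by blast
  \<comment> \<open>The coefficient \<open>a\<close> in the fibre over \<open>s\<close>: only the summand with \<open>c = count (A x) s\<close> is non-zero, and
    none is if \<open>a\<close> exceeds the size of the fibre.\<close>
  define h where "h a x s = (\<Sum>c\<in>{a..length ks}. (if s \<in> mult_part (A x) c then 1 else 0) *
      (\<Sum>b<rc c. y x (j, slot ks j rc (c, a, b)) * A.l s ^ b))" for a x s
  have hf: "A.fam (h a)" if "1 \<le> a" for a
    unfolding h_def using that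
    by (intro A.fam_sum A.fam_mult A.fam_ratio A.fam_power A.fam_l yr sl)
      (auto simp: coef_index_def intro: A.fam_subset_mult_part[unfolded A.fam_subset_def, THEN conjunct2])
  have he: "h a x s = ecoef a (?F x s)" if x: "x \<in> P" and s: "s \<in># A x" "s \<noteq> 0" and a: "1 \<le> a" for a x s
  proof -
    let ?c = "count (A x) s"
    have c: "?c \<le> length ks" using count_le_size[of "A x" s] size_cell[OF cell[OF x]] by simp
    have "h a x s = (\<Sum>c\<in>{a..length ks}. if c = ?c then (\<Sum>b<rc c. y x (j, slot ks j rc (c, a, b)) * A.l s ^ b) else 0)"
      unfolding h_def using s by (intro sum.cong) (auto simp: mult_part_def)
    also have "\<dots> = (if a \<le> ?c then (\<Sum>b<rc ?c. y x (j, slot ks j rc (?c, a, b)) * A.l s ^ b) else 0)"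
      using c by (simp add: sum.delta)
    also have "\<dots> = ecoef a (?F x s)"
    proof (cases "a \<le> ?c")
      case True
      have "s \<in> mult_part (A x) ?c" using s by (simp add: mult_part_def)
      from coordinates_at_iff[OF x y[OF x] this a True c] True show ?thesis by simp
    next
      case False
      then show ?thesis using ecoef_big[of "?F x s" a] by (simp add: size_fibre)
    qed
    finally show ?thesis .
  qed
  define p where "p n x s = (\<Sum>z\<in>#?F x s. z ^ n)" for n x s
  have p0: "p 0 x s = of_nat (count (A x) s)" for x s by (simp add: p_def size_fibre)
  have newton: "of_nat n * ecoef n (?F x s) = - (\<Sum>i<n. ecoef i (?F x s) * p (n - i) x s)" for n x s
    unfolding p_def by (rule newton_identity)
  have q: "A.fam (\<lambda>x s. ?nz s * p n x s)" for n
  proof (induction n rule: less_induct)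
    case (less n)
    show ?case
    proof (cases "n = 0")
      case True
      have "A.fam (\<lambda>x s. ?nz s * of_nat (count (A x) s))" by (intro A.fam_mult A.fam_nonzero A.fam_count)
      then show ?thesis by (simp only: True p0)
    next
      case False
      have "A.fam (\<lambda>x s. (- of_nat n * (?nz s * h n x s)) - (\<Sum>i\<in>{1..<n}. h i x s * (?nz s * p (n - i) x s)))"
      proof (intro A.fam_diff A.fam_sum)
        show "A.fam (\<lambda>x s. - of_nat n * (?nz s * h n x s))"
          using False by (intro A.fam_mult[of "\<lambda>_ _. - of_nat n"] A.fam_mult[of "\<lambda>_. ?nz"] A.fam_const A.fam_nonzero hf) auto
        show "A.fam (\<lambda>x s. h i x s * (?nz s * p (n - i) x s))" if "i \<in> {1..<n}" for i
          using that by (intro A.fam_mult[of "h i"] hf less) auto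
      qed
      then show ?thesis
      proof (rule A.fam.agree)
        fix x s assume x: "x \<in> P" "s \<in># A x"
        show "(- of_nat n * (?nz s * h n x s)) - (\<Sum>i\<in>{1..<n}. h i x s * (?nz s * p (n - i) x s)) = ?nz s * p n x s"
        proof (cases "s = 0")
          case s0: False
          have "(\<Sum>i<n. ecoef i (?F x s) * p (n - i) x s) = p n x s + (\<Sum>i\<in>{1..<n}. ecoef i (?F x s) * p (n - i) x s)"
          proof -
            have "{..<n} = insert 0 {1..<n}" using False by auto
            then show ?thesis by simp
          qed
          also have "(\<Sum>i\<in>{1..<n}. ecoef i (?F x s) * p (n - i) x s) = (\<Sum>i\<in>{1..<n}. h i x s * (?nz s * p (n - i) x s))"
            using he[OF x s0] s0 by (intro sum.cong) auto
          finally have "of_nat n * h n x s = - (p n x s + (\<Sum>i\<in>{1..<n}. h i x s * (?nz s * p (n - i) x s)))"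
            using newton[of n x s] he[OF x s0, of n] False by simp
          then show ?thesis using s0 by simp
        qed simp
      qed
    qed
  qed
  have sp: "(\<lambda>x. \<Sum>s\<in>set_mset (A x). ?nz s * (\<Sum>z\<in>#?F x s. f s z)) \<in> ratios G P" if "slice_poly j f" for f
    using that
  proof (induction rule: slice_poly.induct)
    case (monom g n)
    have "(\<lambda>x. \<Sum>s\<in>set_mset (A x). g s * (?nz s * p n x s)) \<in> ratios G P"
      by (intro A.fam_trace A.fam_mult[of "\<lambda>_. g"] A.fam_poly monom q)
    then show ?case by (simp only: p_def sum_mset_cmult mult.left_commute)
  next
    case (add f g)
    from ratios_add[OF add.IH] show ?case by (simp add: sum_mset.distrib sum.distrib algebra_simps)
  qed
  define F0 where "F0 = image_mset (\<lambda>i. if i = j then 1 else (0::complex)) (filter_mset (\<lambda>i. i \<le> j) (mset ks))"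
  have "(\<lambda>x. (\<Sum>s\<in>set_mset (A x). ?nz s * (\<Sum>z\<in>#?F x s. g (s(j := z)))) + (\<Sum>z\<in>#F0. g ((0::nat \<Rightarrow> complex)(j := z)))) \<in> ratios G P"
    by (intro ratios_add ratios_const sp slice_poly_of_poly g)
  then show ?thesis
  proof (rule ratios_cong)
    fix x assume x: "x \<in> P"
    have "(\<Sum>v\<in>#truncm j (M x). g v) = (\<Sum>v\<in>#M x. g (trunc j v))"
      by (simp add: truncm_def image_mset.compositionality o_def)
    also have "\<dots> = (\<Sum>s\<in>set_mset (A x). \<Sum>v\<in>#filter_mset (\<lambda>v. trunc (Suc j) v = s) (M x). g (trunc j v))"
      unfolding truncm_def by (rule sum_mset_fibres)
    also have "\<dots> = (\<Sum>s\<in>set_mset (A x). \<Sum>z\<in>#?F x s. g (s(j := z)))"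
    proof (intro sum.cong refl)
      fix s
      have "(\<Sum>v\<in>#filter_mset (\<lambda>v. trunc (Suc j) v = s) (M x). g (trunc j v)) =
          (\<Sum>v\<in>#filter_mset (\<lambda>v. trunc (Suc j) v = s) (M x). g (s(j := v j)))"
        by (intro arg_cong[of _ _ sum_mset] image_mset_cong) (auto simp: trunc_fun_upd[of j])
      then show "(\<Sum>v\<in>#filter_mset (\<lambda>v. trunc (Suc j) v = s) (M x). g (trunc j v)) = (\<Sum>z\<in>#?F x s. g (s(j := z)))"
        by (simp add: fibre_def image_mset.compositionality o_def)
    qed
    also have "\<dots> = (\<Sum>s\<in>set_mset (A x). ?nz s * (\<Sum>z\<in>#?F x s. g (s(j := z))) + (if s = 0 then (\<Sum>z\<in>#?F x 0. g ((0::nat \<Rightarrow> complex)(j := z))) else 0))"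
      by (intro sum.cong) auto
    also have "\<dots> = (\<Sum>s\<in>set_mset (A x). ?nz s * (\<Sum>z\<in>#?F x s. g (s(j := z)))) + (if 0 \<in># A x then (\<Sum>z\<in>#?F x 0. g ((0::nat \<Rightarrow> complex)(j := z))) else 0)"
      by (simp add: sum.distrib)
    also have "(if 0 \<in># A x then (\<Sum>z\<in>#?F x 0. g ((0::nat \<Rightarrow> complex)(j := z))) else 0) = (\<Sum>z\<in>#?F x 0. g ((0::nat \<Rightarrow> complex)(j := z)))"
    proof (cases "0 \<in># A x")
      case False
      then have "?F x 0 = {#}" using size_fibre[of j "M x" 0] by (simp add: not_in_iff)
      then show ?thesis by simp
    qed simp
    also have "?F x 0 = F0" unfolding F0_def by (rule fibre_zero[OF cell[OF x]])
    finally show "(\<Sum>v\<in>#truncm j (M x). g v) = (\<Sum>s\<in>set_mset (A x). ?nz s * (\<Sum>z\<in>#?F x s. g (s(j := z)))) + (\<Sum>z\<in>#F0. g ((0::nat \<Rightarrow> complex)(j := z)))" .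
  qed
qed

end

section \<open>Pieces of the cells and of affine space\<close>

abbreviation affine_graded :: "'i set \<Rightarrow> nat \<Rightarrow> (('i \<Rightarrow> complex) \<Rightarrow> complex) set" where
  "affine_graded I \<equiv> (\<lambda>_. polys I)"

lemma graded_algebra_affine: "graded_algebra (affine_graded I)"
  unfolding polys_def by (rule graded_algebra_subalg)

context cell_bound
begin

definition types :: "(nat \<Rightarrow> complex) multiset \<Rightarrow> (nat \<times> nat \<times> nat list) list" where
  "types M = map (\<lambda>j. supp_type N (truncm (Suc j) M)) [0..<Suc N]"

lemma types_nth: "j \<le> N \<Longrightarrow> types M ! j = supp_type N (truncm (Suc j) M)"
  by (simp add: types_def less_Suc_eq_le del: upt_Suc)

lemma level_slots_bound: "k \<in> level_slots ks j \<Longrightarrow> j < N"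
  using bound[of "ks ! k"] by (auto simp: level_slots_def)

end

text \<open>
  The situation of a stratum of a symmetric power: all power sums are regular from the start, so the
  discrete data of all levels can be fixed at once.
\<close>

locale regular_cell = graded_algebra G + cell_bound ks N
  for G :: "nat \<Rightarrow> ('a \<Rightarrow> complex) set" and ks N +
  fixes P0 P :: "'a set" and M :: "'a \<Rightarrow> (nat \<Rightarrow> complex) multiset"
  assumes loc_closed_P: "loc_closed P0 P"
    and cell: "x \<in> P \<Longrightarrow> M x \<in> cell ks"
    and psum: "g \<in> polys UNIV \<Longrightarrow> (\<lambda>x. \<Sum>v\<in>#M x. g v) \<in> ratios G P"
begin

lemma psum_truncm: "g \<in> polys UNIV \<Longrightarrow> (\<lambda>x. \<Sum>v\<in>#truncm j (M x). g v) \<in> ratios G P"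
  using psum[OF polys_trunc[of g j]] by (simp add: truncm_def image_mset.compositionality o_def)

lemma loc_closed_piece: "loc_closed P0 {x \<in> P. types (M x) = ts}"
proof (cases "length ts = Suc N")
  case True
  have "loc_closed P0 {x \<in> P. \<forall>j<n. supp_type N (truncm (Suc j) (M x)) = ts ! j}" for n
  proof (induction n)
    case 0
    then show ?case using loc_closed_P by simp
  next
    case (Suc n)
    let ?Q = "{x \<in> P. \<forall>j<n. supp_type N (truncm (Suc j) (M x)) = ts ! j}"
    have "?Q \<subseteq> P" by blast
    then interpret Q: multiset_family G ?Q "\<lambda>x. truncm (Suc n) (M x)" "length ks" N
      by unfold_locales
        (use cell size_cell cell_coord_space[OF cell bound] ratios_mono[OF psum_truncm] in \<open>auto simp del: set_image_mset\<close>)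
    have "loc_closed P0 {x \<in> ?Q. supp_type N (truncm (Suc n) (M x)) = ts ! n}"
      by (rule Q.loc_closed_supp_type[OF Suc zero_truncm[OF cell]]) auto
    moreover have "{x \<in> ?Q. supp_type N (truncm (Suc n) (M x)) = ts ! n} =
        {x \<in> P. \<forall>j<Suc n. supp_type N (truncm (Suc j) (M x)) = ts ! j}"
      by (auto simp: less_Suc_eq)
    ultimately show ?case by simp
  qed
  moreover have "{x \<in> P. types (M x) = ts} = {x \<in> P. \<forall>j<Suc N. supp_type N (truncm (Suc j) (M x)) = ts ! j}"
    using True by (auto simp: types_def list_eq_iff_nth_eq simp del: upt_Suc)
  ultimately show ?thesis by simp
next
  case False
  then have "{x \<in> P. types (M x) = ts} = {x \<in> P. \<forall>i \<in> {0::nat}. (\<lambda>_. 1) x = (0::complex)}"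
    by (auto simp: types_def)
  also have "loc_closed P0 \<dots>" by (rule loc_closed_zeros[OF loc_closed_P]) (rule ratios_const)
  finally show ?thesis .
qed

lemma coordinates_regular:
  assumes i: "i \<in> cell_index ks"
  shows "(\<lambda>x. coordinates (M x) i) \<in> ratios G {x \<in> P. types (M x) = ts}"
proof -
  obtain j k where jk: "i = (j, k)" "k \<in> level_slots ks j" using i by (auto simp: cell_index_def)
  have jN: "j \<le> N" using level_slots_bound[OF jk(2)] by simp
  let ?Q = "{x \<in> P. types (M x) = ts}"
  have Q: "?Q \<subseteq> P" by blast
  interpret C: cell_family G ks N ?Q M j "ts ! j"
    by unfold_locales (use cell ratios_mono[OF psum_truncm Q] types_nth[OF jN] in auto)
  show ?thesis unfolding jk
    by (rule C.coordinates_ratio[where y = "\<lambda>x. coordinates (M x)"])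
      (use ratios_mono[OF psum Q] coordinates_spec(2) cell jk in auto)
qed

end

context cell_bound
begin

definition multiset_of :: "(nat \<times> nat \<Rightarrow> complex) \<Rightarrow> (nat \<Rightarrow> complex) multiset" where
  "multiset_of = inv_into (cell ks) coordinates"

lemma multiset_of: "x \<in> coords \<Longrightarrow> multiset_of x \<in> cell ks" "x \<in> coords \<Longrightarrow> coordinates (multiset_of x) = x"
  "M \<in> cell ks \<Longrightarrow> multiset_of (coordinates M) = M"
  using bij_coordinates unfolding multiset_of_def bij_betw_def
  by (auto simp: inv_into_into f_inv_into_f)

text \<open>
  On the affine side the power sums are known to be regular only where the types of the levels above
  are fixed, so the conditions have to be imposed one level after the other.
\<close>

definition upper_piece :: "(nat \<times> nat \<times> nat list) list \<Rightarrow> nat \<Rightarrow> (nat \<times> nat \<Rightarrow> complex) set" where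
  "upper_piece ts j = {x \<in> coords. \<forall>i. j \<le> i \<and> i \<le> N \<longrightarrow> supp_type N (truncm (Suc i) (multiset_of x)) = ts ! i}"

lemma upper_piece:
  assumes "n \<le> Suc N"
  shows "graded_algebra.loc_closed (affine_graded (cell_index ks)) coords (upper_piece ts (Suc N - n))"
    "\<And>g. g \<in> polys UNIV \<Longrightarrow> (\<lambda>x. \<Sum>v\<in>#truncm (Suc N - n) (multiset_of x). g v)
       \<in> ratios (affine_graded (cell_index ks)) (upper_piece ts (Suc N - n))"
  using assms
proof (induction n)
  interpret graded_algebra "affine_graded (cell_index ks)" by (rule graded_algebra_affine)
  case 0
  { case 1
    have "upper_piece ts (Suc N - 0) = coords" by (auto simp: upper_piece_def)
    then show ?case using loc_closed_refl by simp }
  { case (2 g)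
    have "(\<lambda>x. (\<Sum>v\<in>#replicate_mset (length ks) 0. g v)) \<in> ratios (affine_graded (cell_index ks)) (upper_piece ts (Suc N - 0))"
      by (rule ratios_const)
    then show ?case
      by (rule ratios_cong) (use truncm_above multiset_of(1) in \<open>auto simp: upper_piece_def\<close>) }
next
  interpret graded_algebra "affine_graded (cell_index ks)" by (rule graded_algebra_affine)
  case (Suc n)
  define j where "j = Suc N - Suc n"
  have j: "Suc N - n = Suc j" "j \<le> N" if "Suc n \<le> Suc N" using that by (auto simp: j_def)
  have sub: "upper_piece ts j \<subseteq> upper_piece ts (Suc j)" by (auto simp: upper_piece_def)
  { case 1
    note IH = Suc.IH[unfolded j(1)[OF 1]] 
    have sn: "n \<le> Suc N" using 1 by simp
    interpret Q: multiset_family "affine_graded (cell_index ks)" "upper_piece ts (Suc j)" "\<lambda>x. truncm (Suc j) (multiset_of x)" "length ks" N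
      by unfold_locales
        (use multiset_of(1) size_cell cell_coord_space[OF multiset_of(1) bound] IH(2)[OF _ sn] in \<open>auto simp: upper_piece_def simp del: set_image_mset\<close>)
    have "loc_closed coords {x \<in> upper_piece ts (Suc j). supp_type N (truncm (Suc j) (multiset_of x)) = ts ! j}"
      by (rule Q.loc_closed_supp_type[OF IH(1)[OF sn] zero_truncm[OF multiset_of(1)]]) (auto simp: upper_piece_def)
    moreover have "{x \<in> upper_piece ts (Suc j). supp_type N (truncm (Suc j) (multiset_of x)) = ts ! j} = upper_piece ts j"
      using j(2)[OF 1] by (auto simp: upper_piece_def) (metis le_antisym not_less_eq_eq)
    ultimately show ?case by (simp add: j_def) }
  { case (2 g)
    note IH = Suc.IH[unfolded j(1)[OF 2(2)]] 
    have sn: "n \<le> Suc N" using 2 by simp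
    interpret C: cell_family "affine_graded (cell_index ks)" ks N "upper_piece ts j" multiset_of j "ts ! j"
      by unfold_locales
        (use multiset_of(1) ratios_mono[OF IH(2)[OF _ sn] sub] j(2)[OF 2(2)] in \<open>auto simp: upper_piece_def\<close>)
    have "(\<lambda>x. \<Sum>v\<in>#truncm j (multiset_of x). g v) \<in> ratios (affine_graded (cell_index ks)) (upper_piece ts j)"
    proof (rule C.power_sum_step[OF _ _ 2(1), where y = "\<lambda>x. x"])
      show "coordinates_at ks N j x (multiset_of x)" if "x \<in> upper_piece ts j" for x
        using coordinates_spec(2)[OF multiset_of(1)[of x], of j] multiset_of(2)[of x] that by (simp add: upper_piece_def)
      show "(\<lambda>x. x (j, k)) \<in> ratios (affine_graded (cell_index ks)) (upper_piece ts j)" if "k \<in> level_slots ks j" for k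
      proof (rule ratiosI[of _ _ 0])
        show "(\<lambda>x. x (j, k)) \<in> polys (cell_index ks)" using that by (intro polys_var) (simp add: cell_index_def)
        show "(\<lambda>_. 1) \<in> polys (cell_index ks)" by (rule polys_intros)
      qed simp
    qed
    then show ?case by (simp add: j_def) }
qed

definition affine_piece :: "(nat \<times> nat \<times> nat list) list \<Rightarrow> (nat \<times> nat \<Rightarrow> complex) set" where
  "affine_piece ts = {x \<in> coords. types (multiset_of x) = ts}"

lemma affine_piece_eq: "length ts = Suc N \<Longrightarrow> affine_piece ts = upper_piece ts 0"
  by (auto simp: affine_piece_def upper_piece_def types_def list_eq_iff_nth_eq less_Suc_eq_le simp del: upt_Suc)

lemma affine_piece_empty: "length ts \<noteq> Suc N \<Longrightarrow> affine_piece ts = {}"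
  by (auto simp: affine_piece_def types_def)

lemma loc_closed_affine_piece:
  "graded_algebra.loc_closed (affine_graded (cell_index ks)) coords (affine_piece ts)"
proof (cases "length ts = Suc N")
  case True
  then show ?thesis using upper_piece(1)[of "Suc N" ts] by (simp add: affine_piece_eq)
next
  case False
  interpret graded_algebra "affine_graded (cell_index ks)" by (rule graded_algebra_affine)
  have "affine_piece ts = {x \<in> coords. \<forall>i \<in> {0::nat}. (\<lambda>_. 1) x = (0::complex)}"
    using affine_piece_empty[OF False] by auto
  also have "loc_closed coords \<dots>" by (rule loc_closed_zeros[OF loc_closed_refl]) (rule ratios_const)
  finally show ?thesis .
qed

lemma affine_piece_psum:
  assumes g: "g \<in> polys UNIV"
  shows "(\<lambda>x. \<Sum>v\<in>#multiset_of x. g v) \<in> ratios (affine_graded (cell_index ks)) (affine_piece ts)"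
proof (cases "length ts = Suc N")
  case True
  then show ?thesis using upper_piece(2)[OF _ g, of "Suc N" ts] by (simp add: affine_piece_eq)
next
  case False
  interpret graded_algebra "affine_graded (cell_index ks)" by (rule graded_algebra_affine)
  show ?thesis by (rule ratios_cong[OF ratios_const]) (use affine_piece_empty[OF False] in auto)
qed

end

section \<open>Normalized generators of lines\<close>

definition line :: "('i \<Rightarrow> complex) \<Rightarrow> ('i \<Rightarrow> complex) set" where
  "line v = range (\<lambda>c. scale_fun c v)"

definition nrm :: "(nat \<Rightarrow> complex) set \<Rightarrow> nat \<Rightarrow> complex" where
  "nrm L = (THE v. v \<in> L \<and> normalized v)"

lemma normalized_nonzero: "normalized v \<Longrightarrow> v \<noteq> 0"
  by (auto simp: normalized_def)

lemma nrm_line: assumes "normalized v" shows "nrm (line v) = v"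
  unfolding nrm_def
proof (rule the_equality)
  have "v = scale_fun 1 v" by (simp add: scale_fun_def)
  then show "v \<in> line v \<and> normalized v" using assms unfolding line_def by blast
  fix w assume w: "w \<in> line v \<and> normalized w"
  then obtain c where c: "w = scale_fun c v" by (auto simp: line_def)
  have "c \<noteq> 0"
  proof
    assume "c = 0"
    then have "w = 0" by (simp add: c scale_fun_def zero_fun_def)
    with w normalized_nonzero[of w] show False by simp
  qed
  then have "lead w = lead v" using assms by (intro lead_eqI) (auto simp: c scale_fun_def normalized_def)
  then have "c = 1" using w assms by (auto simp: c scale_fun_def normalized_def)
  then show "w = v" by (simp add: c scale_fun_def)
qed

lemma line_in_linear_subspaces:
  assumes "v \<in> coord_space I" "v \<noteq> 0" shows "line v \<in> linear_subspaces 1 I"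
proof -
  have l: "line v = cfun.span {v}" by (simp add: line_def cfun.span_singleton)
  have "cfun.dim (cfun.span {v}) = 1"
    using cfun.dim_span_eq_card_independent[of "{v}"] assms(2) by simp
  moreover have "line v \<subseteq> coord_space I" using assms(1) by (auto simp: line_def coord_space_def scale_fun_def)
  ultimately show ?thesis by (simp add: linear_subspaces_def l)
qed

lemma line_nrm:
  assumes L: "L \<in> linear_subspaces 1 {..N}"
  shows "normalized (nrm L)" "line (nrm L) = L" "lead (nrm L) \<le> N" "nrm L \<in> L"
proof -
  have sub: "cfun.subspace L" "L \<subseteq> coord_space {..N}" "cfun.dim L = 1"
    using L by (auto simp: linear_subspaces_def)
  have "\<not> L \<subseteq> {0}" using sub(3) cfun.dim_le_card[of L "{}"] by auto
  then obtain v where v: "v \<in> L" "v \<noteq> 0" by blast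
  have vN: "v i = 0" if "\<not> i \<le> N" for i using v sub(2) that by (auto simp: coord_space_def)
  obtain i0 where i0: "v i0 \<noteq> 0" using v by (auto simp: fun_eq_iff)
  let ?i = "GREATEST i. v i \<noteq> 0"
  have i: "v ?i \<noteq> 0" using GreatestI_nat[of "\<lambda>i. v i \<noteq> 0" i0 N] i0 vN by blast
  have above: "v j = 0" if "?i < j" for j
    using Greatest_le_nat[of "\<lambda>i. v i \<noteq> 0" j N] vN that by force
  define w where "w = scale_fun (1 / v ?i) v"
  have w: "normalized w \<and> lead w = ?i"
    by (rule normalizedI) (use i above in \<open>auto simp: w_def scale_fun_def\<close>)
  have wL: "w \<in> L" using v sub(1) by (simp add: w_def cfun.subspace_scale)
  have eq: "L = line w" unfolding line_def
    by (rule line_generator[OF L wL]) (use w normalized_nonzero in blast)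
  have "nrm L = w" unfolding eq by (rule nrm_line) (use w in blast)
  moreover have "?i \<le> N" using i vN by blast
  ultimately show "normalized (nrm L)" "line (nrm L) = L" "lead (nrm L) \<le> N" "nrm L \<in> L"
    using w eq wL by auto
qed

lemma normalized_coord_space: "normalized v \<Longrightarrow> lead v \<le> N \<Longrightarrow> v \<in> coord_space {..N}"
  by (auto simp: coord_space_def normalized_def)

lemma line_normalized: "normalized v \<Longrightarrow> lead v \<le> N \<Longrightarrow> line v \<in> linear_subspaces 1 {..N}"
  using normalized_coord_space normalized_nonzero by (intro line_in_linear_subspaces) auto

lemma homogeneous_power: "i \<in> I \<Longrightarrow> homogeneous I n (\<lambda>v. v i ^ n)"
proof (induction n)
  case (Suc n)
  from homogeneous.mult[OF homogeneous.var[OF Suc.prems] Suc.IH[OF Suc.prems]] show ?case by simp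
qed (simp add: homogeneous.const)

lemma homogeneous_polys: "homogeneous I d p \<Longrightarrow> p \<in> polys I"
  by (induction rule: homogeneous.induct) (auto intro: polys_intros polys_var)

lemma polys_mono: "p \<in> polys I \<Longrightarrow> I \<subseteq> K \<Longrightarrow> p \<in> polys K"
  unfolding polys_def by (induction rule: subalg.induct) (auto intro: subalg.intros)

text \<open>
  Any sufficiently large degree is possible, which allows a common degree for several polynomials.
\<close>

lemma homogenization:
  assumes "g \<in> polys UNIV" "i \<in> I"
  shows "\<exists>D. \<forall>d\<ge>D. \<exists>q. homogeneous I d q \<and> (\<forall>v \<in> coord_space I. v i = 1 \<longrightarrow> q v = g v)"
  using assms(1) unfolding polys_def
proof (induction rule: subalg.induct)
  case (gen g)
  then obtain k where k: "g = (\<lambda>v. v k)" by blast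
  have "\<exists>q. homogeneous I d q \<and> (\<forall>v \<in> coord_space I. v i = 1 \<longrightarrow> q v = g v)" if "1 \<le> d" for d
  proof (cases "k \<in> I")
    case True
    have "homogeneous I (1 + (d - 1)) (\<lambda>v. v k * v i ^ (d - 1))"
      using True assms(2) by (intro homogeneous.mult homogeneous.var homogeneous_power)
    then show ?thesis using that by (intro exI[of _ "\<lambda>v. v k * v i ^ (d - 1)"]) (auto simp: k)
  next
    case False
    then show ?thesis by (intro exI[of _ "\<lambda>_. 0"]) (auto simp: k coord_space_def intro: homogeneous.zero)
  qed
  then show ?case by blast
next
  case (const c)
  have "homogeneous I (0 + d) (\<lambda>v. c * v i ^ d)" for d
    using assms(2) by (intro homogeneous.mult homogeneous.const homogeneous_power)
  then show ?case by (intro exI[of _ 0] allI impI exI[of _ "\<lambda>v. c * v i ^ _"]) auto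
next
  case (add f g)
  obtain D E where D: "\<And>d. d \<ge> D \<Longrightarrow> \<exists>q. homogeneous I d q \<and> (\<forall>v \<in> coord_space I. v i = 1 \<longrightarrow> q v = f v)"
    and E: "\<And>d. d \<ge> E \<Longrightarrow> \<exists>q. homogeneous I d q \<and> (\<forall>v \<in> coord_space I. v i = 1 \<longrightarrow> q v = g v)"
    using add.IH by blast
  have "\<exists>q. homogeneous I d q \<and> (\<forall>v \<in> coord_space I. v i = 1 \<longrightarrow> q v = f v + g v)" if d: "d \<ge> max D E" for d
  proof -
    obtain p q where p: "homogeneous I d p" "\<And>v. v \<in> coord_space I \<Longrightarrow> v i = 1 \<Longrightarrow> p v = f v"
      and q: "homogeneous I d q" "\<And>v. v \<in> coord_space I \<Longrightarrow> v i = 1 \<Longrightarrow> q v = g v"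
    proof -
      have "D \<le> d" "E \<le> d" using d by auto
      from D[OF this(1)] E[OF this(2)] show ?thesis using that by blast
    qed
    show ?thesis by (rule exI[of _ "\<lambda>v. p v + q v"]) (use p q in \<open>auto intro: homogeneous.add\<close>)
  qed
  then show ?case by blast
next
  case (mult f g)
  obtain D E where D: "\<And>d. d \<ge> D \<Longrightarrow> \<exists>q. homogeneous I d q \<and> (\<forall>v \<in> coord_space I. v i = 1 \<longrightarrow> q v = f v)"
    and E: "\<And>d. d \<ge> E \<Longrightarrow> \<exists>q. homogeneous I d q \<and> (\<forall>v \<in> coord_space I. v i = 1 \<longrightarrow> q v = g v)"
    using mult.IH by blast
  have "\<exists>q. homogeneous I d q \<and> (\<forall>v \<in> coord_space I. v i = 1 \<longrightarrow> q v = f v * g v)" if d: "d \<ge> D + E" for d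
  proof -
    obtain p q where p: "homogeneous I D p" "\<And>v. v \<in> coord_space I \<Longrightarrow> v i = 1 \<Longrightarrow> p v = f v"
      and q: "homogeneous I (d - D) q" "\<And>v. v \<in> coord_space I \<Longrightarrow> v i = 1 \<Longrightarrow> q v = g v"
    proof -
      have "E \<le> d - D" using d by auto
      from D[OF order_refl] E[OF this] show ?thesis using that by blast
    qed
    have "homogeneous I (D + (d - D)) (\<lambda>v. p v * q v)" by (intro homogeneous.mult p q)
    then show ?thesis using d by (intro exI[of _ "\<lambda>v. p v * q v"]) (auto simp: p q)
  qed
  then show ?case by blast
qed

section \<open>Strata of the symmetric powers\<close>

text \<open>
  Strata and Schubert cells are both separated by monomials in the last non-zero positions. Dominance of
  one sequence by another is detected by the sums, with equality only for equal sequences; so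
  one comparison of numbers replaces the comparison of sequences.
\<close>

lemma leading_positions_dominate:
  fixes ks :: "nat list"
  assumes len: "length ys = length ks"
    and nz: "\<And>k. k < length ks \<Longrightarrow> ks ! k \<le> p (ys ! k)"
  shows "sum_list ks \<le> sum_list (map p ys)" "sum_list ks = sum_list (map p ys) \<Longrightarrow> map p ys = ks"
proof -
  have s: "sum_list ks = (\<Sum>k<length ks. ks ! k)" "sum_list (map p ys) = (\<Sum>k<length ks. p (ys ! k))"
    using len by (simp_all add: sum_list_sum_nth atLeast0LessThan)
  show "sum_list ks \<le> sum_list (map p ys)" unfolding s by (intro sum_mono) (use nz in auto)
  show "map p ys = ks" if "sum_list ks = sum_list (map p ys)"
  proof (rule nth_equalityI)
    fix k assume "k < length (map p ys)"
    then have k: "k < length ks" using len by simp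
    have "p (ys ! k) = ks ! k"
    proof (rule ccontr)
      assume "p (ys ! k) \<noteq> ks ! k"
      then have "(\<Sum>k<length ks. ks ! k) < (\<Sum>k<length ks. p (ys ! k))"
        using nz k by (intro sum_strict_mono_ex1) (auto intro!: bexI[of _ k] simp: le_neq_implies_less)
      with that s show False by simp
    qed
    then show "map p ys ! k = ks ! k" using k len by simp
  qed (use len in simp)
qed

locale symmetric_stratum =
  fixes N :: nat and ks :: "nat list"
  assumes ks_bound: "k \<in> set ks \<Longrightarrow> k \<le> N"
begin

abbreviation "m \<equiv> length ks"

sublocale projective_reps "{..N}" nrm m
proof
  fix L :: "(nat \<Rightarrow> complex) set" assume L: "L \<in> linear_subspaces 1 {..N}"
  show "nrm L \<in> L - {0}" using line_nrm(4)[OF L] normalized_nonzero[OF line_nrm(1)[OF L]] by simp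
qed

sublocale cell_bound ks N
  by unfold_locales (rule ks_bound)

definition stratum :: "(nat \<Rightarrow> complex) set multiset set" where
  "stratum = {M \<in> mpts. image_mset nrm M \<in> cell ks}"

lemma vectors:
  assumes "M \<in> mpts" "v \<in># image_mset nrm M"
  shows "normalized v" "lead v \<le> N" "v \<in> coord_space {..N}"
proof -
  obtain L where L: "L \<in># M" "v = nrm L" using assms(2) by auto
  then have "L \<in> linear_subspaces 1 {..N}" using assms(1) by auto
  from line_nrm[OF this] L show "normalized v" "lead v \<le> N" "v \<in> coord_space {..N}"
    using normalized_coord_space by auto
qed

definition lead_form :: "nat list \<Rightarrow> nat \<Rightarrow> (nat \<Rightarrow> complex) list \<Rightarrow> complex" where
  "lead_form js d = tprod (map (\<lambda>k v. v k ^ d) js)"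

lemma lead_form: "length ys = length js \<Longrightarrow> lead_form js d ys = (\<Prod>k<length js. (ys ! k) (js ! k) ^ d)"
  by (simp add: lead_form_def tprod_conv_prod)

lemma lead_form_SG:
  assumes "length js = m" "set js \<subseteq> {..N}"
  shows "(\<lambda>M. msum m (lead_form js d) (image_mset nrm M)) \<in> SG d"
proof (rule SG_I)
  show "tensors (replicate m (homog {..N} d)) (lead_form js d)"
    unfolding lead_form_def
    by (rule tensors.tprod)
      (use assms in \<open>auto simp: list_all2_conv_all_nth intro!: homogeneous_power dest: subsetD[OF _ nth_mem]\<close>)
qed

lemma arrangement:
  assumes "M \<in> mpts" "length ys = m" "mset ys \<subseteq># image_mset nrm M"
  shows "mset ys = image_mset nrm M" "k < m \<Longrightarrow> normalized (ys ! k)" "k < m \<Longrightarrow> ys ! k \<in> coord_space {..N}"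
    "image_mset lead (image_mset nrm M) = mset (map lead ys)"
proof -
  show 1: "mset ys = image_mset nrm M" using assms by (intro submset_size_eq) auto
  have "k < m \<Longrightarrow> ys ! k \<in># image_mset nrm M" for k using assms(2) by (auto simp flip: 1)
  then show "k < m \<Longrightarrow> normalized (ys ! k)" "k < m \<Longrightarrow> ys ! k \<in> coord_space {..N}"
    using vectors[OF assms(1)] by blast+
  show "image_mset lead (image_mset nrm M) = mset (map lead ys)" by (simp flip: 1)
qed

lemma lead_form_nonzero_imp:
  assumes M: "M \<in> mpts" and ys: "length ys = m" "mset ys \<subseteq># image_mset nrm M"
    and js: "length js = m" and nz: "\<And>k. k < m \<Longrightarrow> (ys ! k) (js ! k) \<noteq> 0"
  shows "sum_list js \<le> sum_mset (image_mset lead (image_mset nrm M))"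
    and "sum_list js = sum_mset (image_mset lead (image_mset nrm M)) \<Longrightarrow> map lead ys = js"
proof -
  have dom: "js ! k \<le> lead (ys ! k)" if "k < length js" for k
  proof (rule ccontr)
    assume "\<not> ?thesis"
    then have "(ys ! k) (js ! k) = 0"
      using arrangement(2)[OF M ys, of k] that js by (auto simp: normalized_def)
    with nz that js show False by auto
  qed
  have s: "sum_mset (image_mset lead (image_mset nrm M)) = sum_list (map lead ys)"
    unfolding arrangement(4)[OF M ys] by (rule sum_mset_sum_list)
  show "sum_list js \<le> sum_mset (image_mset lead (image_mset nrm M))"
    "sum_list js = sum_mset (image_mset lead (image_mset nrm M)) \<Longrightarrow> map lead ys = js"
    unfolding s using leading_positions_dominate[of ys js lead] dom ys js by auto
qed

text \<open>
  At normalized vectors with leading positions \<open>js\<close> each term of the symmetrization of \<open>\<Prod>k. v\<^sub>k (js ! k)\<close>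
  is \<open>0\<close> or \<open>1\<close>, and the term of a matching enumeration is \<open>1\<close>.
\<close>

lemma lead_form_sum_nonzero:
  assumes M: "M \<in> mpts" and js: "image_mset lead (image_mset nrm M) = mset js"
  shows "msum m (lead_form js d) (image_mset nrm M) \<noteq> 0"
proof -
  have len: "length js = m" using M js by (metis (mono_tags, lifting) mem_Collect_eq size_image_mset size_mset)
  obtain xs where xs: "mset xs = image_mset nrm M" using ex_mset by blast
  then have "mset js = mset (map lead xs)" using js by simp
  then obtain zs where zs: "mset zs = mset xs" "js = map lead zs" using mset_eq_map_imp_map by blast
  have "msum m (lead_form js d) (image_mset nrm M) =
     msum m (\<lambda>ys. of_nat (if \<forall>k<m. (ys ! k) (js ! k) ^ d \<noteq> 0 then 1 else 0)) (image_mset nrm M)"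
  proof (rule msum_cong)
    fix ys assume ys: "length ys = m" "mset ys \<subseteq># image_mset nrm M"
    show "lead_form js d ys = of_nat (if \<forall>k<m. (ys ! k) (js ! k) ^ d \<noteq> 0 then 1 else 0)"
    proof (cases "\<forall>k<m. (ys ! k) (js ! k) ^ d \<noteq> 0")
      case True
      have "(ys ! k) (js ! k) ^ d = 1" if k: "k < m" for k
      proof (cases "d = 0")
        case False
        have "map lead ys = js"
          by (rule lead_form_nonzero_imp(2)[OF M ys len]) (use True False js in \<open>auto simp: sum_mset_sum_list power_0_left\<close>)
        then have "js ! k = lead (ys ! k)" using k ys(1) by auto
        then show ?thesis using arrangement(2)[OF M ys k] by (simp add: normalized_def)
      qed simp
      then show ?thesis using True ys(1) len by (simp add: lead_form)
    next
      case False
      then have "lead_form js d ys = 0" using ys(1) len by (auto simp: lead_form)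
      then show ?thesis using False by simp
    qed
  qed
  also have "\<dots> = of_nat (msum m (\<lambda>ys. if \<forall>k<m. (ys ! k) (js ! k) ^ d \<noteq> 0 then 1 else 0) (image_mset nrm M))"
    by (rule msum_of_nat)
  also have "\<dots> \<noteq> 0"
  proof -
    have "msum m (\<lambda>ys. if \<forall>k<m. (ys ! k) (js ! k) ^ d \<noteq> 0 then 1 else (0::nat)) (image_mset nrm M) > 0"
    proof (rule msum_pos[of zs])
      show zl: "length zs = m" "mset zs \<subseteq># image_mset nrm M" using zs xs len by auto
      have "(zs ! k) (js ! k) = 1" if "k < m" for k
        using arrangement(2)[OF M zl that] zs(2) zl(1) that by (simp add: normalized_def)
      then show "0 < (if \<forall>k<m. (zs ! k) (js ! k) ^ d \<noteq> 0 then 1 else (0::nat))" by simp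
    qed
    then show ?thesis by simp
  qed
  finally show ?thesis .
qed

text \<open>
  The symmetrized monomial of \<open>js\<close> vanishes unless \<open>js\<close> is dominated by the leading positions, and it does
  not vanish if \<open>js\<close> lists them. So the stratum is where the monomial of \<open>ks\<close> does not vanish, while all
  other monomials with at least the same sum of indices do.
\<close>

lemma loc_closed_stratum: "SG.loc_closed mpts stratum"
proof -
  let ?H = "\<lambda>js M. msum m (lead_form js 1) (image_mset nrm M)"
  let ?J = "{js. length js = m \<and> set js \<subseteq> {..N} \<and> sum_list ks \<le> sum_list js \<and> mset js \<noteq> mset ks}"
  have imp: "sum_list js \<le> sum_mset (image_mset lead (image_mset nrm M)) \<and>
      (sum_list js = sum_mset (image_mset lead (image_mset nrm M)) \<longrightarrow> image_mset lead (image_mset nrm M) = mset js)"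
    if M: "M \<in> mpts" and js: "length js = m" and nz: "?H js M \<noteq> 0" for M js
  proof -
    have "\<exists>ys. length ys = m \<and> mset ys \<subseteq># image_mset nrm M \<and> lead_form js 1 ys \<noteq> 0"
    proof (rule ccontr)
      assume "\<not> ?thesis"
      then have "?H js M = msum m (\<lambda>_. 0) (image_mset nrm M)" by (intro msum_cong) blast
      with nz show False by simp
    qed
    then obtain ys where ys: "length ys = m" "mset ys \<subseteq># image_mset nrm M" "lead_form js 1 ys \<noteq> 0" by blast
    have "(ys ! k) (js ! k) \<noteq> 0" if "k < m" for k using ys(1,3) js that by (auto simp: lead_form)
    note * = lead_form_nonzero_imp[OF M ys(1,2) js this]
    show ?thesis using *(1) *(2) unfolding arrangement(4)[OF M ys(1,2)] by blast
  qed
  have "stratum = {M \<in> mpts. \<forall>js \<in> ?J. ?H js M = 0} \<inter> {M \<in> mpts. ?H ks M \<noteq> 0}" (is "_ = ?R")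
  proof
    show "stratum \<subseteq> ?R"
    proof
      fix M assume "M \<in> stratum"
      then have M: "M \<in> mpts" "image_mset lead (image_mset nrm M) = mset ks" by (auto simp: stratum_def cell_def)
      have "?H js M = 0" if js: "js \<in> ?J" for js
      proof (rule ccontr)
        assume nz: "?H js M \<noteq> 0"
        have j: "length js = m" "sum_list ks \<le> sum_list js" "mset js \<noteq> mset ks" using js by auto
        from imp[OF M(1) j(1) nz] have "sum_list js \<le> sum_list ks" "sum_list js = sum_list ks \<longrightarrow> mset ks = mset js"
          unfolding M(2) sum_mset_sum_list by blast+
        with j show False by simp
      qed
      then show "M \<in> ?R" using M lead_form_sum_nonzero[OF M, of 1] by blast
    qed
    show "?R \<subseteq> stratum"
    proof
      fix M assume R: "M \<in> ?R"
      then have M: "M \<in> mpts" "?H ks M \<noteq> 0" by auto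
      obtain xs where xs: "mset xs = image_mset nrm M" using ex_mset by blast
      let ?js = "map lead xs"
      have js: "image_mset lead (image_mset nrm M) = mset ?js" by (simp flip: xs)
      have le: "sum_list ks \<le> sum_list ?js"
        using imp[OF M(1) _ M(2)] unfolding js sum_mset_sum_list by blast
      have "length ?js = m" using M(1) by (metis (mono_tags, lifting) js mem_Collect_eq size_image_mset size_mset)
      moreover have "set ?js \<subseteq> {..N}"
        using vectors(2)[OF M(1)] xs by (auto simp flip: set_mset_mset)
      moreover have "?H ?js M \<noteq> 0" by (rule lead_form_sum_nonzero[OF M(1) js])
      ultimately have "mset ?js = mset ks" using R le by blast
      then show "M \<in> stratum" using M(1) js vectors(1)[OF M(1)] by (auto simp: stratum_def cell_def)
    qed
  qed
  moreover have "SG.loc_closed mpts {M \<in> mpts. \<forall>js \<in> ?J. ?H js M = 0}"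
    by (rule SG.loc_closed_homogeneous_zeros[where d = "\<lambda>_. 1"]) (use lead_form_SG in auto)
  moreover have "SG.loc_closed mpts {M \<in> mpts. ?H ks M \<noteq> 0}"
    by (rule SG.loc_closed_homogeneous_nonzero[where d = 1]) (use lead_form_SG[of ks 1] ks_bound in auto)
  ultimately show ?thesis using SG.loc_closed_Int by simp
qed

text \<open>
  The power sum of the normalized vectors is not a symmetric multihomogeneous fraction everywhere, since
  the normalization depends on the cell. On the stratum the enumerations that contribute to
  the denominator are those with leading positions \<open>ks\<close>, so the vector in position \<open>l\<close> is
  normalized by its coordinate \<open>ks ! l\<close>; homogenizing \<open>g\<close> accordingly in each position gives the numerator.
\<close>

lemma stratum_psum:
  assumes g: "g \<in> polys UNIV"
  shows "(\<lambda>M. \<Sum>v\<in>#image_mset nrm M. g v) \<in> ratios SG stratum"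
proof -
  have "\<exists>D. \<forall>d\<ge>D. \<exists>q. homogeneous {..N} d q \<and> (\<forall>v \<in> coord_space {..N}. v k = 1 \<longrightarrow> q v = g v)" if "k \<le> N" for k
    by (rule homogenization[OF g]) (use that in auto)
  then obtain D where D: "\<And>k d. k \<le> N \<Longrightarrow> D k \<le> d \<Longrightarrow> \<exists>q. homogeneous {..N} d q \<and> (\<forall>v \<in> coord_space {..N}. v k = 1 \<longrightarrow> q v = g v)"
    by metis
  \<comment> \<open>The extra degree in \<open>?d\<close> below forces every term with a vanishing coordinate \<open>ks ! l\<close> to be \<open>0\<close>.\<close>
  define E where "E = Max (D ` {..N})"
  have "D k \<le> E" if "k \<le> N" for k unfolding E_def using that by (intro Max_ge) auto
  then obtain q where q: "\<And>k. k \<le> N \<Longrightarrow> homogeneous {..N} E (q k)"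
    "\<And>k v. k \<le> N \<Longrightarrow> v \<in> coord_space {..N} \<Longrightarrow> v k = 1 \<Longrightarrow> q k v = g v" using D[of _ E] by metis
  let ?d = "Suc E"
  \<comment> \<open>In position \<open>l\<close> the homogenized \<open>g\<close>, in all others the power of the leading coordinate.\<close>
  define gs where "gs l = map (\<lambda>k v. if k = l then v (ks ! k) * q (ks ! k) v else v (ks ! k) ^ ?d) [0..<m]" for l
  define F where "F ys = (\<Sum>l<m. tprod (gs l) ys)" for ys
  have kN: "ks ! k \<le> N" if "k < m" for k using ks_bound that by auto
  have "tensors (replicate m (homog {..N} ?d)) (tprod (gs l))" if "l < m" for l
  proof (rule tensors.tprod)
    have "homogeneous {..N} ?d (\<lambda>v. if k = l then v (ks ! k) * q (ks ! k) v else v (ks ! k) ^ ?d)" if "k < m" for k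
      using homogeneous.mult[OF homogeneous.var q(1)[OF kN[OF that]], of "ks ! k"]
        homogeneous_power[of "ks ! k" "{..N}" ?d] kN[OF that] by (cases "k = l") auto
    then show "list_all2 (\<in>) (gs l) (replicate m (homog {..N} ?d))"
      by (auto simp: list_all2_conv_all_nth gs_def cong: if_cong)
  qed
  then have F: "tensors (replicate m (homog {..N} ?d)) F"
    unfolding F_def by (intro tensors_sum) auto
  show ?thesis
  proof (rule ratiosI)
    show "(\<lambda>M. msum m F (image_mset nrm M)) \<in> SG ?d" by (rule SG_I[OF F])
    show "(\<lambda>M. msum m (lead_form ks ?d) (image_mset nrm M)) \<in> SG ?d"
      by (rule lead_form_SG) (use ks_bound in auto)
    fix M assume "M \<in> stratum"
    then have M: "M \<in> mpts" "image_mset lead (image_mset nrm M) = mset ks" by (auto simp: stratum_def cell_def)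
    let ?p = "\<Sum>v\<in>#image_mset nrm M. g v"
    have nz: "msum m (lead_form ks ?d) (image_mset nrm M) \<noteq> 0" by (rule lead_form_sum_nonzero[OF M])
    have "msum m F (image_mset nrm M) = msum m (\<lambda>ys. ?p * lead_form ks ?d ys) (image_mset nrm M)"
    proof (rule msum_cong)
      fix ys assume ys: "length ys = m" "mset ys \<subseteq># image_mset nrm M"
      have t: "tprod (gs l) ys = (\<Prod>k<m. if k = l then (ys ! k) (ks ! k) * q (ks ! k) (ys ! k) else (ys ! k) (ks ! k) ^ ?d)" for l
        using ys(1) by (simp add: tprod_conv_prod gs_def cong: if_cong)
      show "F ys = ?p * lead_form ks ?d ys"
      proof (cases "\<forall>k<m. (ys ! k) (ks ! k) \<noteq> 0")
        case True
        have "map lead ys = ks"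
          by (rule lead_form_nonzero_imp(2)[OF M(1) ys]) (use True M(2) in \<open>auto simp: sum_mset_sum_list\<close>)
        then have "ks ! k = lead (ys ! k)" if "k < m" for k using ys(1) that by (metis nth_map)
        then have one: "(ys ! k) (ks ! k) = 1" if "k < m" for k
          using arrangement(2)[OF M(1) ys that] that by (simp add: normalized_def)
        have qg: "q (ks ! k) (ys ! k) = g (ys ! k)" if "k < m" for k
          using q(2)[OF kN[OF that] arrangement(3)[OF M(1) ys that]] one[OF that] by simp
        have "tprod (gs l) ys = (\<Prod>k<m. if k = l then g (ys ! k) else 1)" for l
          unfolding t using one qg by (intro prod.cong) auto
        then have "F ys = (\<Sum>l<m. g (ys ! l))" by (simp add: F_def)
        also have "\<dots> = (\<Sum>v\<leftarrow>ys. g v)" using ys(1) by (simp add: sum_list_sum_nth atLeast0LessThan)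
        also have "\<dots> = (\<Sum>v\<in>#mset ys. g v)" by (simp flip: mset_map sum_mset_sum_list)
        also have "mset ys = image_mset nrm M" by (rule arrangement(1)[OF M(1) ys])
        finally show ?thesis using one ys(1) by (simp add: lead_form)
      next
        case False
        then obtain k where k: "k < m" "(ys ! k) (ks ! k) = 0" by blast
        have "lead_form ks ?d ys = 0" using k ys(1) by (auto simp: lead_form)
        moreover have "tprod (gs l) ys = 0" for l
          unfolding t using k by (intro prod_zero) (auto intro!: bexI[of _ k])
        ultimately show ?thesis by (simp add: F_def)
      qed
    qed
    then show "msum m (lead_form ks ?d) (image_mset nrm M) \<noteq> 0 \<and>
        ?p = msum m F (image_mset nrm M) / msum m (lead_form ks ?d) (image_mset nrm M)"
      using nz by (simp add: msum_cmult)
  qed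
qed

sublocale R: regular_cell SG ks N mpts stratum "image_mset nrm"
  by unfold_locales (use loc_closed_stratum stratum_psum in \<open>auto simp: stratum_def\<close>)

definition piece :: "(nat \<times> nat \<times> nat list) list \<Rightarrow> (nat \<Rightarrow> complex) set multiset set" where
  "piece ts = {M \<in> stratum. types (image_mset nrm M) = ts}"

lemma lines_of_cell:
  assumes "V \<in> cell ks"
  shows "image_mset line V \<in> stratum" "image_mset nrm (image_mset line V) = V"
proof -
  have "nrm (line v) = v" if "v \<in># V" for v using assms that nrm_line by (auto simp: cell_def)
  then show e: "image_mset nrm (image_mset line V) = V"
    by (simp add: image_mset.compositionality o_def cong: image_mset_cong)
  have "line v \<in> linear_subspaces 1 {..N}" if "v \<in># V" for v
    using assms that lead_cell[OF assms that] ks_bound by (intro line_normalized) (auto simp: cell_def)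
  then show "image_mset line V \<in> stratum"
    using e assms size_cell[OF assms] by (auto simp: stratum_def)
qed

lemma lines_of_vectors: "M \<in> mpts \<Longrightarrow> image_mset line (image_mset nrm M) = M"
proof -
  assume "M \<in> mpts"
  then have "line (nrm L) = L" if "L \<in># M" for L using that line_nrm(2)[of L N] by auto
  then show ?thesis by (simp add: image_mset.compositionality o_def cong: image_mset_cong)
qed

lemma tensors_mono: "tensors (replicate k A) f \<Longrightarrow> A \<subseteq> B \<Longrightarrow> tensors (replicate k B) f"
proof (induction rule: tensors.induct)
  case (tprod gs)
  then show ?case by (intro tensors.tprod) (auto simp: list_all2_conv_all_nth)
next
  case (cong f g)
  then show ?case by (auto intro: tensors.cong)
qed (auto intro: tensors.intros)

text \<open>
  Both directions have been reduced to power sums: the coordinates are regular on the piece, and a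
  symmetric multihomogeneous function of normalized vectors is a polynomial in power sums.
\<close>

theorem piece_isomorphic:
  "graded_fspace SG (piece ts) \<cong>\<^sub>v graded_fspace (affine_graded (cell_index ks)) (affine_piece ts)"
proof (rule graded_isomorphicI[OF SG.graded_algebra_axioms graded_algebra_affine,
      where \<phi> = "\<lambda>M. coordinates (image_mset nrm M)" and \<psi> = "\<lambda>x. image_mset line (multiset_of x)"])
  interpret A: graded_algebra "affine_graded (cell_index ks)" by (rule graded_algebra_affine)
  show 1: "coordinates (image_mset nrm M) \<in> affine_piece ts \<and>
      image_mset line (multiset_of (coordinates (image_mset nrm M))) = M" if "M \<in> piece ts" for M
    using that multiset_of(3)[of "image_mset nrm M"] coordinates_spec(1)[of "image_mset nrm M"] lines_of_vectors[of M]
    by (auto simp: piece_def stratum_def affine_piece_def)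
  show 2: "image_mset line (multiset_of x) \<in> piece ts \<and> coordinates (image_mset nrm (image_mset line (multiset_of x))) = x"
    if "x \<in> affine_piece ts" for x
    using that lines_of_cell[OF multiset_of(1)[of x]] multiset_of(2)[of x]
    by (auto simp: piece_def affine_piece_def)
  show "morphism (graded_fspace SG (piece ts)) (graded_fspace (affine_graded (cell_index ks)) (affine_piece ts))
      (\<lambda>M. coordinates (image_mset nrm M))"
  proof (rule morphism_graded_ratiosI[OF SG.graded_algebra_axioms graded_algebra_affine])
    have "(\<lambda>M. h (coordinates (image_mset nrm M))) \<in> ratios SG (piece ts)" if "h \<in> polys (cell_index ks)" for h
      using that unfolding polys_def
    proof (induction rule: subalg.induct)
      case (gen g)
      then obtain i where i: "i \<in> cell_index ks" "g = (\<lambda>v. v i)" by blast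
      from R.coordinates_regular[OF i(1), of ts] show ?case by (simp add: i(2) piece_def)
    qed (auto intro: SG.ratios_const SG.ratios_add SG.ratios_mult)
    then show "\<exists>u. (\<forall>x \<in> piece ts. u x \<noteq> 0) \<and> (\<forall>h \<in> affine_graded (cell_index ks) d. \<exists>f \<in> ratios SG (piece ts).
        \<forall>x \<in> piece ts. h (coordinates (image_mset nrm x)) = u x * f x)" for d
      by (intro exI[of _ "\<lambda>_. 1"]) auto
  qed (use 1 in blast)
  show "morphism (graded_fspace (affine_graded (cell_index ks)) (affine_piece ts)) (graded_fspace SG (piece ts))
      (\<lambda>x. image_mset line (multiset_of x))"
  proof (rule morphism_graded_ratiosI[OF graded_algebra_affine SG.graded_algebra_axioms])
    interpret F: multiset_family "affine_graded (cell_index ks)" "affine_piece ts" multiset_of m N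
      using affine_piece_psum multiset_of(1) size_cell cell_coord_space[OF multiset_of(1) bound, of _ 0]
      by unfold_locales (auto simp: affine_piece_def)
    have "\<exists>f \<in> ratios (affine_graded (cell_index ks)) (affine_piece ts). \<forall>x \<in> affine_piece ts. h (image_mset line (multiset_of x)) = 1 * f x"
      if h: "h \<in> SG d" for h d
      using h
    proof (rule pulled_backE)
      fix k assume k: "k \<in> sym_graded d" "h = (\<lambda>x. k (image_mset nrm x))"
      then obtain f where f: "tensors (replicate m (homog {..N} d)) f" "\<And>M. size M = m \<Longrightarrow> k M = msum m f M"
        unfolding sym_graded_def by blast
      have "homog {..N} d \<subseteq> polys UNIV" using homogeneous_polys polys_mono by blast
      then have "(\<lambda>x. msum m f (multiset_of x)) \<in> ratios (affine_graded (cell_index ks)) (affine_piece ts)"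
        by (intro F.msum_ratio[OF tensors_mono[OF f(1)]])
      moreover have "h (image_mset line (multiset_of x)) = 1 * msum m f (multiset_of x)" if "x \<in> affine_piece ts" for x
        using that multiset_of(1)[of x] lines_of_cell(2)[of "multiset_of x"] f(2)[of "multiset_of x"] size_cell
        by (auto simp: affine_piece_def k(2))
      ultimately show ?thesis by (intro bexI[of _ "\<lambda>x. msum m f (multiset_of x)"]) auto
    qed
    then show "\<exists>u. (\<forall>x \<in> affine_piece ts. u x \<noteq> 0) \<and> (\<forall>h \<in> SG d. \<exists>f \<in> ratios (affine_graded (cell_index ks)) (affine_piece ts).
        \<forall>x \<in> affine_piece ts. h (image_mset line (multiset_of x)) = u x * f x)" for d
      by (intro exI[of _ "\<lambda>_. 1"]) auto
  qed (use 2 in blast)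
qed

end

section \<open>Locally closed subsets of affine space are quasi-projective\<close>

lemma quasi_projective_isomorphic: "X \<cong>\<^sub>v Y \<Longrightarrow> quasi_projective Y \<Longrightarrow> quasi_projective X"
  unfolding quasi_projective_def using isomorphic_trans by blast

text \<open>
  The affine chart of projective space where the last coordinate does not vanish.
\<close>

lemma quasi_projective_affine:
  assumes I: "finite I" and Z: "graded_algebra.loc_closed (affine_graded I) (coord_space I) Z"
  shows "quasi_projective (graded_fspace (affine_graded I) Z)"
proof -
  interpret A: graded_algebra "affine_graded I" by (rule graded_algebra_affine)
  define n where "n = card I"
  obtain h where h: "bij_betw h {..<n} I"
    using ex_bij_betw_nat_finite[OF I] by (auto simp: n_def atLeast0LessThan)
  define g where "g = inv_into {..<n} h"
  have gh: "g k < n" "h (g k) = k" if "k \<in> I" for k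
    using h that by (auto simp: g_def bij_betw_def inv_into_into f_inv_into_f intro: inv_into_into[of k h "{..<n}", simplified])
  have hg: "h i \<in> I" "g (h i) = i" if "i < n" for i
    using h that by (auto simp: g_def bij_betw_def)
  interpret projective_reps "{..n}" nrm 0
    by unfold_locales (use line_nrm(4) normalized_nonzero line_nrm(1) in \<open>metis DiffI singletonD\<close>)
  let ?C = "pulled_back nrm (homog {..n})"
  let ?U = "{L \<in> lns. nrm L n \<noteq> 0}"
  have CP: "CP n = graded_fspace ?C lns" unfolding CP_def by (rule X_graded)
  have nC: "(\<lambda>L. nrm L i) \<in> ?C 1" if "i \<le> n" for i
    using pulled_backI[of "\<lambda>v. v i" "homog {..n}" 1 nrm] homogeneous.var[of i "{..n}"] that by simp
  have U: "L.loc_closed lns ?U"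
    by (rule L.loc_closed_homogeneous_nonzero[OF nC]) simp
  have U1: "nrm L n = 1" if "L \<in> ?U" for L
  proof -
    have L: "L \<in> linear_subspaces 1 {..n}" "nrm L n \<noteq> 0" using that by auto
    have "lead (nrm L) = n"
      using line_nrm(1,3)[OF L(1)] L(2) by (meson le_less normalized_def)
    then show ?thesis using line_nrm(1)[OF L(1)] by (simp add: normalized_def)
  qed
  \<comment> \<open>The point with affine coordinates \<open>x\<close> in the chart, as a normalized vector with leading position \<open>n\<close>.\<close>
  define w where "w x = (\<lambda>i. if i < n then x (h i) else if i = n then 1 else (0::complex))" for x
  define \<psi> where "\<psi> L = (\<lambda>k. if k \<in> I then nrm L (g k) / nrm L n else 0)" for L
  have w: "normalized (w x)" "lead (w x) = n" for x
    using normalizedI[of "w x" n] by (auto simp: w_def)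
  have \<phi>U: "line (w x) \<in> ?U" "nrm (line (w x)) = w x" for x
    using line_normalized[OF w(1), of x n] w nrm_line[OF w(1)] by (auto simp: w_def)
  have \<psi>\<phi>: "\<psi> (line (w x)) = x" if "x \<in> coord_space I" for x
  proof
    fix k show "\<psi> (line (w x)) k = x k"
      using that gh[of k] by (auto simp: \<psi>_def \<phi>U(2)) (auto simp: w_def coord_space_def)
  qed
  have \<psi>I: "\<psi> L \<in> coord_space I" for L by (simp add: \<psi>_def coord_space_def)
  have \<phi>\<psi>: "line (w (\<psi> L)) = L" if L: "L \<in> ?U" for L
  proof -
    have Ll: "L \<in> linear_subspaces 1 {..n}" using L by simp
    have "w (\<psi> L) = nrm L"
    proof
      fix i
      consider "i < n" | "i = n" | "i > n" by linarith
      then show "w (\<psi> L) i = nrm L i"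
      proof cases
        case 3
        then show ?thesis using line_nrm(1,3)[OF Ll] by (simp add: w_def normalized_def)
      qed (use U1[OF L] hg in \<open>auto simp: w_def \<psi>_def\<close>)
    qed
    then show ?thesis using line_nrm(2)[OF Ll] by simp
  qed
  have m1: "morphism (graded_fspace (affine_graded I) Y) (graded_fspace ?C {L \<in> ?U. \<psi> L \<in> Y}) (\<lambda>x. line (w x))"
    if Y: "Y \<subseteq> coord_space I" for Y
  proof (rule morphism_graded_directI[OF graded_algebra_affine L.graded_algebra_axioms])
    show "line (w x) \<in> {L \<in> ?U. \<psi> L \<in> Y}" if "x \<in> Y" for x using \<phi>U \<psi>\<phi>[of x] that Y by auto
    have "(\<lambda>x. p (w x)) \<in> polys I" if "homogeneous {..n} d p" for p d
      using that
    proof (induction rule: homogeneous.induct)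
      case (var i)
      show ?case using hg by (cases "i < n") (auto simp: w_def intro: polys_intros polys_var)
    qed (auto intro: polys_intros)
    then show "\<exists>u. (\<forall>x \<in> Y. u x \<noteq> 0) \<and> (\<forall>h \<in> ?C d. \<exists>g \<in> affine_graded I d. \<forall>x \<in> Y. h (line (w x)) = u x * g x)" for d
      by (intro exI[of _ "\<lambda>_. 1"]) (auto elim!: pulled_backE simp: \<phi>U(2))
  qed
  have m2: "morphism (graded_fspace ?C {L \<in> ?U. \<psi> L \<in> Y}) (graded_fspace (affine_graded I) Y) \<psi>" for Y
  proof (rule morphism_graded_ratiosI[OF L.graded_algebra_axioms graded_algebra_affine])
    have "(\<lambda>L. p (\<psi> L)) \<in> ratios ?C {L \<in> ?U. \<psi> L \<in> Y}" if "p \<in> polys I" for p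
      using that unfolding polys_def
    proof (induction rule: subalg.induct)
      case (gen p)
      then obtain k where k: "k \<in> I" "p = (\<lambda>v. v k)" by blast
      have "(\<lambda>L. nrm L (g k)) \<in> ?C 1" "(\<lambda>L. nrm L n) \<in> ?C 1" using nC gh[OF k(1)] by auto
      then show ?case by (rule ratiosI) (use k in \<open>auto simp: \<psi>_def\<close>)
    qed (auto intro: L.ratios_const L.ratios_add L.ratios_mult)
    then show "\<exists>u. (\<forall>L \<in> {L \<in> ?U. \<psi> L \<in> Y}. u L \<noteq> 0) \<and> (\<forall>p \<in> affine_graded I d. \<exists>f \<in> ratios ?C {L \<in> ?U. \<psi> L \<in> Y}.
        \<forall>L \<in> {L \<in> ?U. \<psi> L \<in> Y}. p (\<psi> L) = u L * f L)" for d
      by (intro exI[of _ "\<lambda>_. 1"]) auto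
  qed simp
  let ?Z = "{L \<in> ?U. \<psi> L \<in> Z}"
  have ZI: "Z \<subseteq> coord_space I" by (rule A.loc_closed_subset[OF Z])
  have "{L \<in> ?U. \<psi> L \<in> coord_space I} = ?U" using \<psi>I by auto
  with m2[of "coord_space I"] have "L.loc_closed ?U ?Z"
    using Z by (intro loc_closed_preimage[OF L.graded_algebra_axioms graded_algebra_affine]) simp_all
  then have Zc: "L.loc_closed lns ?Z" by (rule L.loc_closed_trans[OF U])
  have "same_structure (subvariety (CP n) ?Z) (graded_fspace ?C ?Z)"
    unfolding CP
    by (rule same_structure_subvariety[OF same_structure_refl[OF L.graded_algebra_axioms] L.graded_algebra_axioms]) auto
  moreover have "graded_fspace (affine_graded I) Z \<cong>\<^sub>v graded_fspace ?C ?Z"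
  proof (rule graded_isomorphicI[OF graded_algebra_affine L.graded_algebra_axioms _ _ m1[OF ZI] m2])
    show "line (w x) \<in> ?Z \<and> \<psi> (line (w x)) = x" if "x \<in> Z" for x
      using that ZI \<phi>U(1)[of x] \<psi>\<phi>[of x] by auto
    show "\<psi> L \<in> Z \<and> line (w (\<psi> L)) = L" if "L \<in> ?Z" for L
      using that \<phi>\<psi>[of L] by auto
  qed
  ultimately have "graded_fspace (affine_graded I) Z \<cong>\<^sub>v subvariety (CP n) ?Z"
    using isomorphic_trans isomorphic_sym same_structure_isomorphic by blast
  moreover have "zariski_locally_closed (CP n) ?Z" using Zc by (simp add: L.loc_closed_def CP)
  ultimately show ?thesis unfolding quasi_projective_def by blast
qed

section \<open>Schubert cells\<close>

lemma sum_fun_apply: "(\<Sum>i\<in>A. f i) x = (\<Sum>i\<in>A. f i x)"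
  by (induction A rule: infinite_finite_induct) auto

text \<open>
  Vectors dual to the evaluations at \<open>P\<close> form a basis of a subspace on which these evaluations are
  jointly injective.
\<close>

lemma echelon_basis:
  fixes w :: "nat \<Rightarrow> nat \<Rightarrow> complex"
  assumes W: "cfun.subspace W" and P: "finite P"
    and w: "\<And>i. i \<in> P \<Longrightarrow> w i \<in> W" "\<And>i j. i \<in> P \<Longrightarrow> j \<in> P \<Longrightarrow> w i j = (if i = j then 1 else 0)"
    and zero: "\<And>v. v \<in> W \<Longrightarrow> (\<And>j. j \<in> P \<Longrightarrow> v j = 0) \<Longrightarrow> v = 0"
  shows "cfun.dim W = card P" and "v \<in> W \<Longrightarrow> v c = (\<Sum>i\<in>P. v i * w i c)"
proof -
  have expand: "v = (\<Sum>i\<in>P. scale_fun (v i) (w i))" if v: "v \<in> W" for v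
  proof -
    let ?u = "v - (\<Sum>i\<in>P. scale_fun (v i) (w i))"
    have "?u \<in> W"
      using W v w(1) by (intro cfun.subspace_diff cfun.subspace_sum cfun.subspace_scale)
    moreover have "?u j = 0" if j: "j \<in> P" for j
    proof -
      have "(\<Sum>i\<in>P. scale_fun (v i) (w i)) j = (\<Sum>i\<in>P. if i = j then v i else 0)"
        unfolding sum_fun_apply scale_fun_def using w(2) j by (intro sum.cong) auto
      then show ?thesis using P j by simp
    qed
    ultimately have "?u = 0" by (rule zero)
    then show ?thesis by simp
  qed
  show "v c = (\<Sum>i\<in>P. v i * w i c)" if "v \<in> W"
    using arg_cong[OF expand[OF that], of "\<lambda>f. f c"] by (simp add: sum_fun_apply scale_fun_def)
  have inj: "inj_on w P"
  proof (rule inj_onI)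
    fix i j assume "i \<in> P" "j \<in> P" "w i = w j"
    then show "i = j" using w(2)[of i i] w(2)[of j i] by (metis zero_neq_one)
  qed
  show "cfun.dim W = card P"
  proof (rule cfun.dim_unique[of "w ` P"])
    show "w ` P \<subseteq> W" using w(1) by blast
    show "W \<subseteq> cfun.span (w ` P)"
    proof
      fix v assume "v \<in> W"
      then have "v = (\<Sum>i\<in>P. scale_fun (v i) (w i))" by (rule expand)
      also have "\<dots> \<in> cfun.span (w ` P)"
        by (intro cfun.span_sum cfun.span_scale cfun.span_base) auto
      finally show "v \<in> cfun.span (w ` P)" .
    qed
    show "cfun.independent (w ` P)"
    proof
      assume "cfun.dependent (w ` P)"
      then obtain u where u: "\<exists>v\<in>w ` P. u v \<noteq> 0" "(\<Sum>v\<in>w ` P. scale_fun (u v) v) = 0"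
        using cfun.dependent_finite[of "w ` P"] P by auto
      then obtain j where j: "j \<in> P" "u (w j) \<noteq> 0" by blast
      have "0 = (\<Sum>v\<in>w ` P. scale_fun (u v) v) j" using u(2) by simp
      also have "\<dots> = (\<Sum>i\<in>P. u (w i) * w i j)"
        by (simp add: sum.reindex[OF inj] sum_fun_apply scale_fun_def)
      also have "\<dots> = (\<Sum>i\<in>P. if i = j then u (w i) else 0)" using w(2) j by (intro sum.cong) auto
      also have "\<dots> = u (w j)" using P j by simp
      finally show False using j by simp
    qed
    show "card (w ` P) = card P" by (rule card_image[OF inj])
  qed
qed

text \<open>
  Pivots are last non-zero positions, so that they do not change when the ambient coordinate space grows.
\<close>

definition pivots :: "(nat \<Rightarrow> complex) set \<Rightarrow> nat set" where
  "pivots W = {i. \<exists>v \<in> W. v i \<noteq> 0 \<and> (\<forall>j>i. v j = 0)}"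

lemma pivots_zero:
  assumes W: "W \<subseteq> coord_space {..<N}" and v: "v \<in> W" "\<And>j. j \<in> pivots W \<Longrightarrow> v j = 0"
  shows "v = 0"
proof (rule ccontr)
  assume "v \<noteq> 0"
  then obtain i0 where i0: "v i0 \<noteq> 0" by (auto simp: fun_eq_iff)
  have vN: "v i = 0" if "\<not> i \<le> N" for i using v W that by (force simp: coord_space_def)
  let ?i = "GREATEST i. v i \<noteq> 0"
  have i: "v ?i \<noteq> 0" using GreatestI_nat[of "\<lambda>i. v i \<noteq> 0" i0 N] i0 vN by blast
  have "v j = 0" if "?i < j" for j
    using Greatest_le_nat[of "\<lambda>i. v i \<noteq> 0" j N] vN that by force
  then have "?i \<in> pivots W" using i v(1) by (auto simp: pivots_def)
  with v(2) i show False by blast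
qed

lemma pivots_bound: "W \<subseteq> coord_space {..<N} \<Longrightarrow> pivots W \<subseteq> {..<N}"
  by (force simp: pivots_def coord_space_def)

text \<open>
  Prescribe the values at the pivots from the largest pivot downwards: a vector with leading
  position \<open>i\<close> corrects the value at \<open>i\<close> and leaves the values at larger pivots unchanged.
\<close>

lemma pivots_interpolate:
  assumes sub: "cfun.subspace W" and W: "W \<subseteq> coord_space {..<N}"
  shows "\<exists>v \<in> W. \<forall>i \<in> pivots W. v i = a i"
proof -
  have "\<exists>v \<in> W. \<forall>i \<in> pivots W. N - k \<le> i \<longrightarrow> v i = a i" for k
  proof (induction k)
    case 0
    have "i < N" if "i \<in> pivots W" for i using pivots_bound[OF W] that by auto
    then show ?case using cfun.subspace_0[OF sub] by (intro bexI[of _ 0]) fastforce+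
  next
    case (Suc k)
    then obtain v where v: "v \<in> W" "\<And>i. i \<in> pivots W \<Longrightarrow> N - k \<le> i \<Longrightarrow> v i = a i" by blast
    let ?i = "N - Suc k"
    show ?case
    proof (cases "?i \<in> pivots W \<and> k < N")
      case True
      then obtain u where u: "u \<in> W" "u ?i \<noteq> 0" "\<And>j. ?i < j \<Longrightarrow> u j = 0" by (auto simp: pivots_def)
      let ?v = "v + scale_fun ((a ?i - v ?i) / u ?i) u"
      have "?v \<in> W" using sub v u by (intro cfun.subspace_add cfun.subspace_scale)
      moreover have "?v i = a i" if i: "i \<in> pivots W" "?i \<le> i" for i
      proof (cases "i = ?i")
        case False
        then have "?i < i" "N - k \<le> i" using i True by auto
        then show ?thesis using u(3) v(2) i by (simp add: scale_fun_def)
      qed (use u(2) in \<open>simp add: scale_fun_def\<close>)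
      ultimately show ?thesis by blast
    next
      case False
      have "v i = a i" if "i \<in> pivots W" "?i \<le> i" for i
      proof -
        have "N - k \<le> i"
        proof (cases "k < N")
          case True
          then have "i \<noteq> ?i" using False that by auto
          then show ?thesis using that by linarith
        qed simp
        then show ?thesis using v(2) that by blast
      qed
      with v(1) show ?thesis by blast
    qed
  qed
  from this[of N] show ?thesis by auto
qed

lemma reduced_basis:
  assumes sub: "cfun.subspace W" and W: "W \<subseteq> coord_space {..<N}"
  obtains w where "\<And>i. i \<in> pivots W \<Longrightarrow> w i \<in> W"
    "\<And>i j. i \<in> pivots W \<Longrightarrow> j \<in> pivots W \<Longrightarrow> w i j = (if i = j then 1 else 0)"
    "\<And>i j. i \<in> pivots W \<Longrightarrow> i < j \<Longrightarrow> w i j = 0" "card (pivots W) = cfun.dim W"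
proof -
  have "\<exists>v \<in> W. \<forall>j \<in> pivots W. v j = (if i = j then 1 else 0)" for i
    by (rule pivots_interpolate[OF sub W])
  then obtain w where w: "\<And>i. w i \<in> W" "\<And>i j. j \<in> pivots W \<Longrightarrow> w i j = (if i = j then 1 else 0)" by metis
  have fin: "finite (pivots W)" using pivots_bound[OF W] finite_subset by blast
  show ?thesis
  proof (rule that[of w])
    show "card (pivots W) = cfun.dim W"
      by (rule echelon_basis(1)[OF sub fin, of w, symmetric]) (use w pivots_zero[OF W] in auto)
    show "w i j = 0" if i: "i \<in> pivots W" "i < j" for i j
    proof (rule ccontr)
      assume nz: "w i j \<noteq> 0"
      have vN: "w i k = 0" if "\<not> k \<le> N" for k using w(1)[of i] W that by (force simp: coord_space_def)
      let ?g = "GREATEST k. w i k \<noteq> 0"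
      have g: "w i ?g \<noteq> 0" "j \<le> ?g"
        using GreatestI_nat[of "\<lambda>k. w i k \<noteq> 0" j N] Greatest_le_nat[of "\<lambda>k. w i k \<noteq> 0" j N] nz vN by blast+
      have "w i k = 0" if "?g < k" for k
        using Greatest_le_nat[of "\<lambda>k. w i k \<noteq> 0" k N] vN that by force
      then have "?g \<in> pivots W" using g w(1) by (auto simp: pivots_def)
      then show False using w(2)[of ?g i] g i by auto
    qed
  qed (use w in auto)
qed

text \<open>
  The bijection between nondecreasing and strictly increasing sequences. There are \<open>ks ! l\<close> positions below
  the pivot \<open>pivot_list ks ! l\<close> that are not pivots.
\<close>

definition pivot_list :: "nat list \<Rightarrow> nat list" where
  "pivot_list ks = map (\<lambda>l. ks ! l + l) [0..<length ks]"

lemma pivot_list_nth: "l < length ks \<Longrightarrow> pivot_list ks ! l = ks ! l + l"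
  by (simp add: pivot_list_def)

lemma length_pivot_list [simp]: "length (pivot_list ks) = length ks"
  by (simp add: pivot_list_def)

lemma sorted_pivot_list:
  assumes "sorted ks" shows "sorted_wrt (<) (pivot_list ks)"
  unfolding sorted_wrt_iff_nth_less
proof (intro allI impI)
  fix i j assume ij: "i < j" "j < length (pivot_list ks)"
  then have "ks ! i \<le> ks ! j" using assms by (intro sorted_nth_mono) auto
  then show "pivot_list ks ! i < pivot_list ks ! j" using ij by (simp add: pivot_list_nth)
qed

lemma pivot_list_of_set:
  assumes P: "finite P"
  obtains ks where "sorted ks" "length ks = card P" "pivot_list ks = sorted_list_of_set P"
proof -
  let ?ps = "sorted_list_of_set P"
  have lt: "?ps ! i < ?ps ! j" if "i < j" "j < length ?ps" for i j
    using strict_sorted_list_of_set[of P] that by (simp add: sorted_wrt_iff_nth_less)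
  have ge: "i \<le> ?ps ! i" if "i < length ?ps" for i
    using that
  proof (induction i)
    case (Suc i)
    then show ?case using lt[of i "Suc i"] by simp
  qed simp
  define ks where "ks = map (\<lambda>l. ?ps ! l - l) [0..<length ?ps]"
  have step: "ks ! i \<le> ks ! Suc i" if "Suc i < length ks" for i
    using lt[of i "Suc i"] that by (simp add: ks_def)
  have "sorted ks" using step by (simp add: sorted_iff_nth_Suc)
  moreover have "pivot_list ks = ?ps"
    by (rule nth_equalityI) (use ge in \<open>auto simp: pivot_list_def ks_def\<close>)
  moreover have "length ks = card P" using P by (simp add: ks_def)
  ultimately show ?thesis using that by blast
qed

lemma distinct_permutation:
  fixes xs ys :: "'b list"
  assumes "distinct xs" "distinct ys" "set xs = set ys"
  shows "\<exists>\<sigma>. \<sigma> permutes {0..<length ys} \<and> (\<forall>j<length ys. xs ! j = ys ! \<sigma> j)"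
proof -
  have "mset xs = mset ys" using assms by (simp add: set_eq_iff_mset_eq_distinct)
  then obtain p where "p permutes {..<length ys}" "permute_list p ys = xs" by (rule mset_eq_permutation)
  then show ?thesis by (intro exI[of _ p]) (auto simp: permute_list_nth atLeast0LessThan)
qed

lemma det_permute_columns:
  assumes "\<sigma> permutes {0..<n}"
  shows "det (mat n n (\<lambda>(i, j). A i (\<sigma> j))) = signof \<sigma> * (det (mat n n (\<lambda>(i, j). A i j)) :: complex)"
proof -
  let ?B = "mat n n (\<lambda>(i, j). A j i)"
  have \<sigma>: "\<sigma> i < n" if "i < n" for i using permutes_in_image[OF assms, of i] that by simp
  have "det (mat n n (\<lambda>(i, j). A i (\<sigma> j))) = det (transpose_mat (mat n n (\<lambda>(i, j). A i (\<sigma> j))))"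
    by (rule det_transpose[symmetric]) auto
  also have "transpose_mat (mat n n (\<lambda>(i, j). A i (\<sigma> j))) = mat n n (\<lambda>(i, j). ?B $$ (\<sigma> i, j))"
    by (rule eq_matI) (use \<sigma> in auto)
  also have "det \<dots> = signof \<sigma> * det ?B" by (rule det_permute_rows[OF _ assms]) auto
  also have "?B = transpose_mat (mat n n (\<lambda>(i, j). A i j))" by (rule eq_matI) auto
  also have "det \<dots> = det (mat n n (\<lambda>(i, j). A i j))" by (rule det_transpose) auto
  finally show ?thesis .
qed

locale schubert_cell =
  fixes N :: nat and ks :: "nat list"
  assumes sorted: "sorted ks" and pivot_bound: "p \<in> set (pivot_list ks) \<Longrightarrow> p < N"
begin

abbreviation "m \<equiv> length ks"
abbreviation "ps \<equiv> pivot_list ks"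
abbreviation "pset \<equiv> set ps"

lemma ps_less: "i < j \<Longrightarrow> j < m \<Longrightarrow> ps ! i < ps ! j"
  using sorted_pivot_list[OF sorted] by (simp add: sorted_wrt_iff_nth_less)

lemma distinct_ps: "distinct ps"
  using sorted_pivot_list[OF sorted] by (simp add: strict_sorted_iff)

lemma sorted_list_pset: "sorted_list_of_set pset = ps"
  using sorted_pivot_list[OF sorted] by (simp add: sorted_list_of_set.idem_if_sorted_distinct strict_sorted_iff)

lemma ps_eq_iff: "i < m \<Longrightarrow> j < m \<Longrightarrow> ps ! i = ps ! j \<longleftrightarrow> i = j"
  using distinct_ps by (simp add: nth_eq_iff_index_eq)

text \<open>
  The positions of the free entries of a reduced echelon basis. They are as many as the indices in the
  Young diagram \<open>cell_index ks\<close>, which index the coordinates on the side of the symmetric power.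
\<close>

definition entries :: "(nat \<times> nat) set" where
  "entries = {(l, c). l < m \<and> c < ps ! l \<and> c \<notin> pset}"

lemma cell_index_eq: "cell_index ks = prod.swap ` (SIGMA l:{..<m}. {..<ks ! l})"
  by (auto simp: cell_index_def level_slots_def image_iff)

lemma finite_cell_index: "finite (cell_index ks)"
  unfolding cell_index_eq by simp

lemma card_entries: "finite entries" "card entries = card (cell_index ks)"
proof -
  have e1: "entries = (SIGMA l:{..<m}. {..<ps ! l} - pset)" by (auto simp: entries_def)
  then show "finite entries" by simp
  have c1: "card ({..<ps ! l} - pset) = ks ! l" if l: "l < m" for l
  proof -
    have "{..<ps ! l} \<inter> pset = (\<lambda>i. ps ! i) ` {..<l}"
    proof
      show "{..<ps ! l} \<inter> pset \<subseteq> (\<lambda>i. ps ! i) ` {..<l}"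
      proof
        fix x assume x: "x \<in> {..<ps ! l} \<inter> pset"
        then obtain i where i: "i < m" "x = ps ! i" by (auto simp: in_set_conv_nth)
        have "i < l"
        proof (rule ccontr)
          assume "\<not> i < l"
          then have "ps ! l \<le> ps ! i" using ps_less[of l i] i(1) by (cases "i = l") auto
          with x i show False by simp
        qed
        with i show "x \<in> (\<lambda>i. ps ! i) ` {..<l}" by blast
      qed
    qed (use ps_less l in auto)
    moreover have "inj_on (\<lambda>i. ps ! i) {..<l}" using ps_eq_iff l by (auto simp: inj_on_def)
    ultimately have "card ({..<ps ! l} \<inter> pset) = l" by (simp add: card_image)
    then show ?thesis using card_Diff_subset_Int[of "{..<ps ! l}" pset] by (simp add: pivot_list_nth l)
  qed
  have "card entries = (\<Sum>l<m. ks ! l)" unfolding e1 using c1 by (simp add: card_SigmaI)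
  moreover have "card (cell_index ks) = (\<Sum>l<m. ks ! l)"
  proof -
    have "card (cell_index ks) = card (SIGMA l:{..<m}. {..<ks ! l})"
      by (simp add: cell_index_eq card_image)
    then show ?thesis by (simp add: card_SigmaI)
  qed
  ultimately show "card entries = card (cell_index ks)" by simp
qed

definition entry :: "nat \<times> nat \<Rightarrow> nat \<times> nat" where
  "entry = (SOME f. bij_betw f entries (cell_index ks))"

lemma bij_entry: "bij_betw entry entries (cell_index ks)"
proof -
  have "\<exists>f. bij_betw f entries (cell_index ks)"
    using card_entries finite_cell_index by (intro finite_same_card_bij)
  then show ?thesis unfolding entry_def by (rule someI_ex)
qed

abbreviation "coords \<equiv> coord_space (cell_index ks)"

definition row :: "(nat \<times> nat \<Rightarrow> complex) \<Rightarrow> nat \<Rightarrow> nat \<Rightarrow> complex" where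
  "row x l = (\<lambda>c. if c = ps ! l then 1 else if (l, c) \<in> entries then x (entry (l, c)) else 0)"

lemma row_pivot: "l < m \<Longrightarrow> j < m \<Longrightarrow> row x l (ps ! j) = (if l = j then 1 else 0)"
  using ps_eq_iff by (auto simp: row_def entries_def)

lemma row_above: "l < m \<Longrightarrow> ps ! l < c \<Longrightarrow> row x l c = 0"
  by (auto simp: row_def entries_def)

definition subspace_of :: "(nat \<times> nat \<Rightarrow> complex) \<Rightarrow> (nat \<Rightarrow> complex) set" where
  "subspace_of x = range (\<lambda>a. (\<lambda>c. \<Sum>l<m. a l * row x l c))"

lemma subspace_subspace_of: "cfun.subspace (subspace_of x)"
proof (rule cfun.subspaceI)
  show "0 \<in> subspace_of x"
    unfolding subspace_of_def by (rule range_eqI[of _ _ "\<lambda>_. 0"]) (simp add: fun_eq_iff)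
next
  fix v w assume "v \<in> subspace_of x" "w \<in> subspace_of x"
  then obtain a b where "v = (\<lambda>c. \<Sum>l<m. a l * row x l c)" "w = (\<lambda>c. \<Sum>l<m. b l * row x l c)"
    unfolding subspace_of_def by blast
  then show "v + w \<in> subspace_of x"
    unfolding subspace_of_def
    by (intro range_eqI[of _ _ "\<lambda>l. a l + b l"]) (simp add: fun_eq_iff algebra_simps sum.distrib)
next
  fix k v assume "v \<in> subspace_of x"
  then obtain a where "v = (\<lambda>c. \<Sum>l<m. a l * row x l c)"
    unfolding subspace_of_def by blast
  then show "scale_fun k v \<in> subspace_of x"
    unfolding subspace_of_def
    by (intro range_eqI[of _ _ "\<lambda>l. k * a l"]) (simp add: fun_eq_iff scale_fun_def sum_distrib_left algebra_simps)
qed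

lemma row_in: "l < m \<Longrightarrow> row x l \<in> subspace_of x"
  unfolding subspace_of_def by (rule range_eqI[of _ _ "\<lambda>i. if i = l then 1 else 0"]) (simp add: fun_eq_iff if_distrib[of "\<lambda>x. x * _"] cong: if_cong)

lemma subspace_of_at_pivots:
  assumes "v \<in> subspace_of x" shows "v c = (\<Sum>l<m. v (ps ! l) * row x l c)"
proof -
  obtain a where a: "v = (\<lambda>c. \<Sum>l<m. a l * row x l c)" using assms unfolding subspace_of_def by blast
  have "v (ps ! l) = a l" if "l < m" for l
  proof -
    have "v (ps ! l) = (\<Sum>j<m. if j = l then a j else 0)"
      unfolding a using row_pivot that by (intro sum.cong) auto
    then show ?thesis using that by simp
  qed
  then show ?thesis by (simp add: a)
qed

lemma subspace_of_coord_space: "subspace_of x \<subseteq> coord_space {..<N}"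
proof
  fix v assume v: "v \<in> subspace_of x"
  have "v c = 0" if c: "\<not> c < N" for c
  proof -
    have "row x l c = 0" if "l < m" for l
      using pivot_bound[of "ps ! l"] that c by (intro row_above) auto
    then show ?thesis using subspace_of_at_pivots[OF v, of c] by simp
  qed
  then show "v \<in> coord_space {..<N}" by (simp add: coord_space_def)
qed

lemma dim_subspace_of: "cfun.dim (subspace_of x) = m"
proof -
  let ?w = "\<lambda>p. row x (THE l. l < m \<and> ps ! l = p)"
  have the: "(THE j. j < m \<and> ps ! j = ps ! l) = l" if "l < m" for l
    using that ps_eq_iff by (intro the_equality) auto
  have "cfun.dim (subspace_of x) = card pset"
  proof (rule echelon_basis(1)[OF subspace_subspace_of, of pset ?w])
    show "?w i \<in> subspace_of x" if "i \<in> pset" for i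
      using that by (auto simp: in_set_conv_nth the row_in)
    show "?w i j = (if i = j then 1 else 0)" if "i \<in> pset" "j \<in> pset" for i j
      using that by (auto simp: in_set_conv_nth the row_pivot ps_eq_iff)
    show "v = 0" if "v \<in> subspace_of x" "\<And>j. j \<in> pset \<Longrightarrow> v j = 0" for v
      using subspace_of_at_pivots[OF that(1)] that(2) by (auto simp: fun_eq_iff)
  qed simp
  then show ?thesis using distinct_card[OF distinct_ps] by simp
qed

lemma subspace_of_linear: "subspace_of x \<in> linear_subspaces m {..<N}"
  using subspace_subspace_of subspace_of_coord_space dim_subspace_of by (simp add: linear_subspaces_def)

lemma pivots_subspace_of: "pivots (subspace_of x) = pset"
proof
  show "pset \<subseteq> pivots (subspace_of x)"
  proof
    fix p assume "p \<in> pset"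
    then obtain l where l: "l < m" "p = ps ! l" by (auto simp: in_set_conv_nth)
    then show "p \<in> pivots (subspace_of x)"
      unfolding pivots_def using row_in[OF l(1), of x] row_above[OF l(1)] row_pivot[OF l(1,1), of x]
      by (intro CollectI bexI[of _ "row x l"]) auto
  qed
  show "pivots (subspace_of x) \<subseteq> pset"
  proof
    fix i assume "i \<in> pivots (subspace_of x)"
    then obtain v where v: "v \<in> subspace_of x" "v i \<noteq> 0" "\<And>j. i < j \<Longrightarrow> v j = 0" by (auto simp: pivots_def)
    show "i \<in> pset"
    proof (rule ccontr)
      assume i: "i \<notin> pset"
      have z: "v (ps ! l) * row x l i = 0" if l: "l < m" for l
      proof (cases "i < ps ! l")
        case True
        then show ?thesis using v(3) by simp
      next
        case False
        moreover have "ps ! l \<noteq> i" using i l by auto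
        ultimately show ?thesis using row_above[OF l, of i x] by simp
      qed
      have "v i = 0" unfolding subspace_of_at_pivots[OF v(1), of i] by (rule sum.neutral) (use z in blast)
      with v(2) show False ..
    qed
  qed
qed

definition schubert :: "(nat \<Rightarrow> complex) set set" where
  "schubert = {W \<in> linear_subspaces m {..<N}. pivots W = pset}"

lemma subspace_of_inj:
  assumes "x \<in> coords" "y \<in> coords" "subspace_of x = subspace_of y" shows "x = y"
proof
  fix i
  show "x i = y i"
  proof (cases "i \<in> cell_index ks")
    case True
    then obtain l c where lc: "(l, c) \<in> entries" "i = entry (l, c)"
      using bij_entry unfolding bij_betw_def by (metis imageE surj_pair)
    then have l: "l < m" "c \<noteq> ps ! l" by (auto simp: entries_def)
    have "row x l \<in> subspace_of y" using row_in[OF l(1), of x] assms(3) by simp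
    then have "row x l c = (\<Sum>j<m. row x l (ps ! j) * row y j c)" by (rule subspace_of_at_pivots)
    also have "\<dots> = (\<Sum>j<m. if j = l then row y j c else 0)"
      using row_pivot[OF l(1), of _ x] by (intro sum.cong) auto
    finally have "row x l c = row y l c" using l by simp
    then show ?thesis using lc l by (simp add: row_def)
  next
    case False
    then have "x i = 0" "y i = 0" using assms(1,2) unfolding coord_space_def by blast+
    then show ?thesis by simp
  qed
qed

lemma subspace_of_surj:
  assumes "W \<in> schubert" shows "\<exists>x \<in> coords. subspace_of x = W"
proof -
  have W: "cfun.subspace W" "W \<subseteq> coord_space {..<N}" "cfun.dim W = m" "pivots W = pset"
    using assms by (auto simp: schubert_def linear_subspaces_def)
  obtain w where w: "\<And>i. i \<in> pset \<Longrightarrow> w i \<in> W"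
    "\<And>i j. i \<in> pset \<Longrightarrow> j \<in> pset \<Longrightarrow> w i j = (if i = j then 1 else 0)"
    "\<And>i j. i \<in> pset \<Longrightarrow> i < j \<Longrightarrow> w i j = 0"
    using reduced_basis[OF W(1,2)] unfolding W(4) by metis
  define x where "x i = (if i \<in> cell_index ks then (case inv_into entries entry i of (l, c) \<Rightarrow> w (ps ! l) c) else 0)" for i
  have xe: "x (entry (l, c)) = w (ps ! l) c" if "(l, c) \<in> entries" for l c
    using bij_entry that bij_betw_apply[OF bij_entry that] by (simp add: x_def bij_betw_def)
  have row: "row x l = w (ps ! l)" if l: "l < m" for l
  proof
    fix c
    have pl: "ps ! l \<in> pset" using l by simp
    show "row x l c = w (ps ! l) c"
    proof (cases "c \<in> pset \<or> ps ! l < c")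
      case True
      then show ?thesis using w(2)[OF pl] w(3)[OF pl] by (auto simp: row_def entries_def)
    next
      case False
      then have "c \<noteq> ps ! l" using pl by auto
      with False l have "(l, c) \<in> entries" by (auto simp: entries_def)
      with \<open>c \<noteq> ps ! l\<close> show ?thesis by (simp add: row_def xe)
    qed
  qed
  have fin: "finite pset" by simp
  have zero: "v = 0" if "v \<in> W" "\<And>j. j \<in> pset \<Longrightarrow> v j = 0" for v
    using pivots_zero[OF W(2)] that W(4) by blast
  have "subspace_of x = W"
  proof
    show "subspace_of x \<subseteq> W"
    proof
      fix v assume "v \<in> subspace_of x"
      then have "v = (\<Sum>l<m. scale_fun (v (ps ! l)) (row x l))"
        using subspace_of_at_pivots by (auto simp: fun_eq_iff sum_fun_apply scale_fun_def)
      also have "\<dots> \<in> W" using W(1) w(1) by (intro cfun.subspace_sum cfun.subspace_scale) (auto simp: row)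
      finally show "v \<in> W" .
    qed
    show "W \<subseteq> subspace_of x"
    proof
      fix v assume v: "v \<in> W"
      have bij: "bij_betw (\<lambda>l. ps ! l) {..<m} pset"
        using distinct_ps by (auto simp: bij_betw_def inj_on_def nth_eq_iff_index_eq in_set_conv_nth)
      have "v c = (\<Sum>l<m. v (ps ! l) * row x l c)" for c
      proof -
        have "v c = (\<Sum>i\<in>pset. v i * w i c)" by (rule echelon_basis(2)[OF W(1) fin w(1,2) zero v])
        also have "\<dots> = (\<Sum>l<m. v (ps ! l) * w (ps ! l) c)" by (rule sum.reindex_bij_betw[OF bij, symmetric])
        finally show ?thesis by (simp add: row)
      qed
      then have "v = (\<lambda>c. \<Sum>l<m. v (ps ! l) * row x l c)" by (rule ext)
      then show "v \<in> subspace_of x" unfolding subspace_of_def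
        by (rule image_eqI[of v "\<lambda>a c. \<Sum>l<m. a l * row x l c" "\<lambda>l. v (ps ! l)"]) (rule UNIV_I)
    qed
  qed
  moreover have "x \<in> coords" by (simp add: x_def coord_space_def)
  ultimately show ?thesis by blast
qed

definition pl :: "(nat \<times> nat \<Rightarrow> complex) \<Rightarrow> nat set \<Rightarrow> complex" where
  "pl x = plucker_vector m N (map (row x) [0..<m])"

abbreviation "pind \<equiv> plucker_indices m N"

lemma pset_index: "pset \<in> pind"
  using pivot_bound distinct_card[OF distinct_ps] by (auto simp: plucker_indices_def)

lemma pl_eq: "J \<in> pind \<Longrightarrow> pl x J = det (mat m m (\<lambda>(k, l). row x k (sorted_list_of_set J ! l)))"
  unfolding pl_def plucker_vector_def by (auto intro!: arg_cong[of _ _ det] eq_matI)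

lemma pl_pset: "pl x pset = 1"
proof -
  have "mat m m (\<lambda>(k, l). row x k (ps ! l)) = 1\<^sub>m m"
    by (rule eq_matI) (use row_pivot in auto)
  then show ?thesis by (simp add: pl_eq[OF pset_index] sorted_list_pset)
qed

lemma pl_coord_space: "pl x \<in> coord_space pind"
  by (simp add: coord_space_def pl_def plucker_vector_def)

lemma pl_polys: "(\<lambda>x. pl x J) \<in> polys (cell_index ks)"
proof (cases "J \<in> pind")
  case True
  have row: "(\<lambda>x. row x k c) \<in> polys (cell_index ks)" for k c
    using bij_betw_apply[OF bij_entry, of "(k, c)"]
    by (cases "c = ps ! k"; cases "(k, c) \<in> entries") (auto simp: row_def intro: polys_intros polys_var)
  have "(\<lambda>x. \<Sum>p\<in>{p. p permutes {0..<m}}. signof p * (\<Prod>i\<in>{0..<m}. row x i (sorted_list_of_set J ! p i))) \<in> polys (cell_index ks)"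
    using row unfolding polys_def by (intro subalg_sum subalg.mult subalg.const subalg_prod)
  moreover have "pl x J = (\<Sum>p\<in>{p. p permutes {0..<m}}. signof p * (\<Prod>i\<in>{0..<m}. row x i (sorted_list_of_set J ! p i)))" for x
    unfolding pl_eq[OF True] by (auto simp: det_def intro!: sum.cong prod.cong simp: permutes_in_image)
  ultimately show ?thesis by simp
next
  case False
  then show ?thesis by (simp add: pl_def plucker_vector_def polys_intros)
qed

text \<open>
  Any \<open>m\<close> vectors of the subspace are combinations of the rows, and their Pluecker vector is multiplied
  by the determinant of the coefficients.
\<close>

lemma plucker_subspace_of: "plucker m N (subspace_of x) = line (pl x)"
proof -
  have "plucker_vector m N vs = scale_fun (det (mat m m (\<lambda>(k, l). (vs ! k) (ps ! l)))) (pl x)"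
    if vs: "length vs = m" "set vs \<subseteq> subspace_of x" for vs
  proof
    fix J
    show "plucker_vector m N vs J = scale_fun (det (mat m m (\<lambda>(k, l). (vs ! k) (ps ! l)))) (pl x) J"
    proof (cases "J \<in> pind")
      case True
      let ?A = "mat m m (\<lambda>(k, l). (vs ! k) (ps ! l))"
      let ?B = "mat m m (\<lambda>(k, l). row x k (sorted_list_of_set J ! l))"
      have "mat m m (\<lambda>(k, l). (vs ! k) (sorted_list_of_set J ! l)) = ?A * ?B"
      proof (rule eq_matI)
        fix k l assume "k < dim_row (?A * ?B)" "l < dim_col (?A * ?B)"
        then have kl: "k < m" "l < m" by auto
        then have "vs ! k \<in> subspace_of x" using vs by auto
        from subspace_of_at_pivots[OF this, of "sorted_list_of_set J ! l"]
        show "mat m m (\<lambda>(k, l). (vs ! k) (sorted_list_of_set J ! l)) $$ (k, l) = (?A * ?B) $$ (k, l)"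
          using kl by (simp add: scalar_prod_def atLeast0LessThan)
      qed auto
      then show ?thesis using True
        by (simp add: plucker_vector_def scale_fun_def pl_eq det_mult[of _ m])
    qed (simp add: plucker_vector_def scale_fun_def pl_def)
  qed
  then have sub: "{plucker_vector m N vs | vs. length vs = m \<and> set vs \<subseteq> subspace_of x} \<subseteq> line (pl x)"
    by (auto simp: line_def)
  have l: "line (pl x) = cfun.span {pl x}" by (simp add: line_def cfun.span_singleton)
  have "pl x \<in> {plucker_vector m N vs | vs. length vs = m \<and> set vs \<subseteq> subspace_of x}"
    by (intro CollectI exI[of _ "map (row x) [0..<m]"]) (auto simp: pl_def row_in)
  then have "cfun.span {pl x} \<subseteq> plucker m N (subspace_of x)"
    unfolding plucker_def by (intro cfun.span_mono) simp
  moreover have "plucker m N (subspace_of x) \<subseteq> cfun.span {pl x}"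
    unfolding plucker_def using sub by (intro cfun.span_minimal cfun.subspace_span) (simp add: l)
  ultimately show ?thesis by (simp add: l)
qed

lemma pl_nonzero: "pl x \<noteq> 0"
  using pl_pset[of x] by (metis zero_fun_apply zero_neq_one)

lemma plucker_line: "plucker m N (subspace_of x) \<in> linear_subspaces 1 pind"
  unfolding plucker_subspace_of by (rule line_in_linear_subspaces[OF pl_coord_space pl_nonzero])

text \<open>
  Replacing the pivot column \<open>l\<close> by the column \<open>c\<close> in the identity matrix of the pivot columns leaves the
  entry \<open>(l, c)\<close> as determinant. The sign \<open>\<epsilon>\<close> comes from sorting the columns and does not depend on \<open>x\<close>.
\<close>

lemma entry_minor:
  assumes lc: "(l, c) \<in> entries"
  defines "J \<equiv> insert c (pset - {ps ! l})"
  shows "J \<in> pind" "\<exists>\<epsilon> \<noteq> 0. \<forall>x. pl x J = \<epsilon> * x (entry (l, c))"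
proof -
  have l: "l < m" "c < ps ! l" "c \<notin> pset" using lc by (auto simp: entries_def)
  let ?qs = "ps[l := c]"
  have setq: "set ?qs = J"
    using l(1) distinct_ps by (simp add: J_def set_update_distinct)
  have dq: "distinct ?qs" using distinct_ps l by (intro distinct_list_update) auto
  have fin: "finite J" by (simp add: J_def)
  have "card J = m" using distinct_card[OF dq] setq by simp
  moreover have "c < N" using l pivot_bound[of "ps ! l"] by simp
  ultimately show J: "J \<in> pind" using pivot_bound by (auto simp: plucker_indices_def J_def)
  obtain \<sigma> where \<sigma>: "\<sigma> permutes {0..<m}" "\<And>j. j < m \<Longrightarrow> sorted_list_of_set J ! j = ?qs ! \<sigma> j"
    using distinct_permutation[of "sorted_list_of_set J" ?qs] dq setq fin by auto
  have "pl x J = signof \<sigma> * x (entry (l, c))" for x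
  proof -
    have "pl x J = det (mat m m (\<lambda>(k, j). row x k (?qs ! \<sigma> j)))"
      unfolding pl_eq[OF J] by (auto intro!: arg_cong[of _ _ det] eq_matI simp: \<sigma>(2))
    also have "\<dots> = signof \<sigma> * det (mat m m (\<lambda>(k, j). row x k (?qs ! j)))"
      by (rule det_permute_columns[OF \<sigma>(1)])
    also have "mat m m (\<lambda>(k, j). row x k (?qs ! j)) = replace_col (1\<^sub>m m) (1\<^sub>m m *\<^sub>v vec m (\<lambda>k. row x k c)) l"
      by (rule eq_matI) (use l(1) row_pivot in \<open>auto simp: replace_col_def nth_list_update\<close>)
    also have "det \<dots> = vec m (\<lambda>k. row x k c) $ l * det (1\<^sub>m m)"
      by (rule cramer_lemma_mat[of _ m]) (use l in auto)
    finally show ?thesis using l lc by (auto simp: row_def)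
  qed
  then show "\<exists>\<epsilon> \<noteq> 0. \<forall>x. pl x J = \<epsilon> * x (entry (l, c))"
    by (intro exI[of _ "signof \<sigma>"]) (auto simp: sign_def)
qed

text \<open>
  A non-zero minor has a non-zero term in its Leibniz expansion, and row \<open>l\<close> vanishes beyond its pivot.
\<close>

lemma pl_nonzero_dominated:
  assumes J: "J \<in> pind" "pl x J \<noteq> 0"
  shows "\<Sum>J \<le> \<Sum>pset" "\<Sum>J = \<Sum>pset \<Longrightarrow> J = pset"
proof -
  have fJ: "finite J" "card J = m" using J(1) finite_subset by (auto simp: plucker_indices_def)
  let ?J = "sorted_list_of_set J"
  have "\<exists>p. p permutes {0..<m} \<and> (\<Prod>i\<in>{0..<m}. row x i (?J ! p i)) \<noteq> 0"
  proof (rule ccontr)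
    assume no: "\<not> ?thesis"
    have "pl x J = (\<Sum>p\<in>{p. p permutes {0..<m}}. signof p * (\<Prod>i\<in>{0..<m}. row x i (?J ! p i)))"
      unfolding pl_eq[OF J(1)] by (auto simp: det_def intro!: sum.cong prod.cong simp: permutes_in_image)
    also have "\<dots> = 0" using no by (intro sum.neutral) auto
    finally show False using J(2) by simp
  qed
  then obtain p where p: "p permutes {0..<m}" "(\<Prod>i\<in>{0..<m}. row x i (?J ! p i)) \<noteq> 0" by blast
  have nz: "row x i (?J ! p i) \<noteq> 0" if "i < m" for i using p(2) that by auto
  let ?js = "map (\<lambda>i. ?J ! p i) [0..<m]"
  have le: "?js ! i \<le> (\<lambda>x. x) (ps ! i)" if "i < length ?js" for i
    using nz[of i] row_above[of i "?J ! p i" x] that by (simp add: not_less[symmetric]) blast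
  have pb: "bij_betw p {0..<m} {0..<m}" using p(1) by (rule permutes_imp_bij)
  have lJ: "length ?J = m" using fJ by simp
  have bJ: "bij_betw (\<lambda>i. ?J ! i) {0..<m} J"
    by (rule bij_betw_nth) (use fJ lJ in \<open>auto simp: atLeast0LessThan\<close>)
  have bb: "bij_betw (\<lambda>i. ?J ! p i) {0..<m} J" using bij_betw_trans[OF pb bJ] by (simp add: o_def)
  have s1: "sum_list ?js = \<Sum>J"
    using sum.reindex_bij_betw[OF bb, of "\<lambda>x. x"] by (simp add: sum_list_distinct_conv_sum_set interv_sum_list_conv_sum_set_nat)
  have s2: "sum_list (map (\<lambda>x. x) ps) = \<Sum>pset"
    using sum_list_distinct_conv_sum_set[OF distinct_ps, of "\<lambda>x. x"] by simp
  have len: "length ps = length ?js" by simp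
  note dom = leading_positions_dominate[OF len, of "\<lambda>x. x", OF le]
  show "\<Sum>J \<le> \<Sum>pset" using dom(1) s1 s2 by simp
  show "J = pset" if "\<Sum>J = \<Sum>pset"
  proof -
    have "ps = ?js" using dom(2) s1 s2 that by simp
    then have "pset = set ?js" by (rule arg_cong)
    also have "set ?js = J" using bb by (auto simp: bij_betw_def)
    finally show ?thesis by simp
  qed
qed

end

lemma linear_subspace_in_schubert:
  assumes W: "W \<in> linear_subspaces m {..<N}"
  obtains ks where "sorted ks" "length ks = m" "set (pivot_list ks) = pivots W" "schubert_cell N ks"
    "W \<in> schubert_cell.schubert N ks"
proof -
  have W': "cfun.subspace W" "W \<subseteq> coord_space {..<N}" "cfun.dim W = m"
    using W by (auto simp: linear_subspaces_def)
  have fin: "finite (pivots W)" using pivots_bound[OF W'(2)] finite_subset by blast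
  have card: "card (pivots W) = m" using reduced_basis[OF W'(1,2)] W'(3) by metis
  obtain ks where ks: "sorted ks" "length ks = card (pivots W)" "pivot_list ks = sorted_list_of_set (pivots W)"
    using pivot_list_of_set[OF fin] by blast
  have set: "set (pivot_list ks) = pivots W" using fin by (simp add: ks(3))
  have S: "schubert_cell N ks"
    by unfold_locales (use ks(1) set pivots_bound[OF W'(2)] in auto)
  show ?thesis
    by (rule that[of ks]) (use ks set S W card in \<open>auto simp: schubert_cell.schubert_def\<close>)
qed

lemma plucker_in_linear_subspaces:
  assumes "W \<in> linear_subspaces m {..<N}" shows "plucker m N W \<in> linear_subspaces 1 (plucker_indices m N)"
proof -
  obtain ks where ks: "length ks = m" "schubert_cell N ks" "W \<in> schubert_cell.schubert N ks"
    using linear_subspace_in_schubert[OF assms] by blast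
  interpret schubert_cell N ks by fact
  obtain x where "subspace_of x = W" using subspace_of_surj[OF ks(3)] by blast
  then show ?thesis using plucker_line[of x] ks(1) by simp
qed

text \<open>
  The Pluecker line has no preferred generator that is independent of the cell, so an arbitrary one is
  chosen.
\<close>

definition generator :: "('i \<Rightarrow> complex) set \<Rightarrow> 'i \<Rightarrow> complex" where
  "generator L = (SOME v. v \<in> L - {0})"

lemma generator: "L \<in> linear_subspaces 1 I \<Longrightarrow> generator L \<in> L - {0}"
proof -
  assume L: "L \<in> linear_subspaces 1 I"
  then have "\<not> L \<subseteq> {0}" using cfun.dim_le_card[of L "{}"] by (auto simp: linear_subspaces_def)
  then have "\<exists>v. v \<in> L - {0}" by blast
  then show ?thesis unfolding generator_def by (rule someI_ex)
qed

definition pluckers :: "nat \<Rightarrow> nat \<Rightarrow> nat \<Rightarrow> ((nat \<Rightarrow> complex) set \<Rightarrow> complex) set" where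
  "pluckers m N = pulled_back (\<lambda>W. generator (plucker m N W)) (homog (plucker_indices m N))"

lemma pulled_back_comp: "pulled_back \<phi> (pulled_back \<psi> G) = pulled_back (\<lambda>x. \<psi> (\<phi> x)) G"
  by (simp add: pulled_back_def fun_eq_iff image_image)

lemma graded_algebra_pluckers: "graded_algebra (pluckers m N)"
  unfolding pluckers_def by (rule graded_algebra.graded_algebra_pulled_back[OF graded_algebra_homog])

lemma Grassmannian_graded: "same_structure (Grassmannian m N) (graded_fspace (pluckers m N) (linear_subspaces m {..<N}))"
proof -
  have G: "graded_algebra (pulled_back generator (homog (plucker_indices m N)))"
    by (rule graded_algebra.graded_algebra_pulled_back[OF graded_algebra_homog])
  have "projective_space (plucker_indices m N) =
      graded_fspace (pulled_back generator (homog (plucker_indices m N))) (linear_subspaces 1 (plucker_indices m N))"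
    by (rule projective_space_graded[OF generator])
  then have "same_structure (projective_space (plucker_indices m N))
     (graded_fspace (pulled_back generator (homog (plucker_indices m N))) (linear_subspaces 1 (plucker_indices m N)))"
    using same_structure_refl[OF G] by simp
  from same_structure_induced[OF this G, of "plucker m N" "linear_subspaces m {..<N}"]
  show ?thesis
    using plucker_in_linear_subspaces
    unfolding Grassmannian_def pulled_back_comp pluckers_def by blast
qed

context schubert_cell
begin

sublocale G: graded_algebra "pluckers m N"
  by (rule graded_algebra_pluckers)

lemma generator_plucker: "\<exists>u \<noteq> 0. generator (plucker m N (subspace_of x)) = scale_fun u (pl x)"
proof -
  have "generator (plucker m N (subspace_of x)) \<in> line (pl x) - {0}"
    using generator[OF plucker_line[of x]] by (simp add: plucker_subspace_of)
  then obtain u where u: "generator (plucker m N (subspace_of x)) = scale_fun u (pl x)" "scale_fun u (pl x) \<noteq> 0"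
    by (auto simp: line_def)
  moreover have "u \<noteq> 0" using u(2) by (auto simp: scale_fun_def zero_fun_def)
  ultimately show ?thesis by blast
qed

lemma coordinate_pluckers: "J \<in> pind \<Longrightarrow> (\<lambda>W. generator (plucker m N W) J) \<in> pluckers m N 1"
  unfolding pluckers_def using homogeneous.var[of J pind]
    pulled_backI[of "\<lambda>v. v J" "homog pind" 1 "\<lambda>W. generator (plucker m N W)"] by simp

text \<open>
  As for the strata of the symmetric power: the Pluecker coordinate of the pivots does not vanish, and
  all others with at least the same sum of indices do.
\<close>

lemma loc_closed_schubert: "G.loc_closed (linear_subspaces m {..<N}) schubert"
proof -
  let ?r = "\<lambda>J W. generator (plucker m N W) J"
  let ?J = "{J \<in> pind. \<Sum>pset \<le> \<Sum>J \<and> J \<noteq> pset}"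
  let ?L = "linear_subspaces m {..<N}"
  have key: "(?r (pivots W) W \<noteq> 0) \<and> pivots W \<in> pind \<and>
      (\<forall>J \<in> pind. ?r J W \<noteq> 0 \<longrightarrow> \<Sum>J \<le> \<Sum>(pivots W) \<and> (\<Sum>J = \<Sum>(pivots W) \<longrightarrow> J = pivots W))"
    if W: "W \<in> ?L" for W
  proof -
    obtain js where js: "length js = m" "set (pivot_list js) = pivots W" "schubert_cell N js" "W \<in> schubert_cell.schubert N js"
      using W by (rule linear_subspace_in_schubert)
    interpret S: schubert_cell N js by fact
    obtain x where x: "S.subspace_of x = W" using S.subspace_of_surj[OF js(4)] by blast
    obtain u where u: "u \<noteq> 0" "generator (plucker m N W) = scale_fun u (S.pl x)"
      using S.generator_plucker[of x] x js(1) by auto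
    show ?thesis
      using S.pl_pset[of x] S.pset_index S.pl_nonzero_dominated[of _ x] u js(1,2) by (auto simp: scale_fun_def)
  qed
  have "schubert = {W \<in> ?L. \<forall>J \<in> ?J. ?r J W = 0} \<inter> {W \<in> ?L. ?r pset W \<noteq> 0}" (is "_ = ?R")
  proof
    show "schubert \<subseteq> ?R" using key by (fastforce simp: schubert_def)
    show "?R \<subseteq> schubert"
    proof
      fix W assume R: "W \<in> ?R"
      then have W: "W \<in> ?L" "?r pset W \<noteq> 0" by auto
      have "\<Sum>pset \<le> \<Sum>(pivots W)" using key[OF W(1)] W(2) pset_index by blast
      then have "pivots W = pset" using key[OF W(1)] R by blast
      with W show "W \<in> schubert" by (simp add: schubert_def)
    qed
  qed
  moreover have "G.loc_closed ?L {W \<in> ?L. \<forall>J \<in> ?J. ?r J W = 0}"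
    by (rule G.loc_closed_homogeneous_zeros[where d = "\<lambda>_. 1"]) (use coordinate_pluckers in auto)
  moreover have "G.loc_closed ?L {W \<in> ?L. ?r pset W \<noteq> 0}"
    by (rule G.loc_closed_homogeneous_nonzero[OF coordinate_pluckers[OF pset_index]])
  ultimately show ?thesis using G.loc_closed_Int by simp
qed

definition coordinates_of :: "(nat \<Rightarrow> complex) set \<Rightarrow> nat \<times> nat \<Rightarrow> complex" where
  "coordinates_of = inv_into coords subspace_of"

lemma coordinates_of:
  "x \<in> coords \<Longrightarrow> coordinates_of (subspace_of x) = x"
  "W \<in> schubert \<Longrightarrow> coordinates_of W \<in> coords"
  "W \<in> schubert \<Longrightarrow> subspace_of (coordinates_of W) = W"
proof -
  have inj: "inj_on subspace_of coords" using subspace_of_inj by (auto simp: inj_on_def)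
  then show "x \<in> coords \<Longrightarrow> coordinates_of (subspace_of x) = x" by (simp add: coordinates_of_def)
  have "W \<in> schubert \<Longrightarrow> W \<in> subspace_of ` coords" using subspace_of_surj by blast
  then show "W \<in> schubert \<Longrightarrow> coordinates_of W \<in> coords" "W \<in> schubert \<Longrightarrow> subspace_of (coordinates_of W) = W"
    by (simp_all add: coordinates_of_def inv_into_into f_inv_into_f)
qed

lemma subspace_of_schubert: "subspace_of x \<in> schubert"
  using subspace_of_linear pivots_subspace_of by (simp add: schubert_def)

text \<open>
  The Pluecker coordinates are polynomials in the free entries. The generator of the Pluecker line is an
  unknown multiple of the vector of minors; this multiple is the factor \<open>u\<close>.
\<close>

lemma morphism_to_schubert:
  "morphism (graded_fspace (affine_graded (cell_index ks)) Z) (graded_fspace (pluckers m N) (subspace_of ` Z)) subspace_of"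
proof (rule morphism_graded_directI[OF graded_algebra_affine graded_algebra_pluckers])
  fix d
  obtain u where u: "\<And>x. u x \<noteq> 0" "\<And>x. generator (plucker m N (subspace_of x)) = scale_fun (u x) (pl x)"
    using generator_plucker by metis
  have "(\<lambda>x. p (pl x)) \<in> polys (cell_index ks)" if "homogeneous pind d p" for p
    using that by (induction rule: homogeneous.induct) (auto intro: polys_intros pl_polys)
  then show "\<exists>u. (\<forall>x \<in> Z. u x \<noteq> 0) \<and> (\<forall>h \<in> pluckers m N d. \<exists>g \<in> affine_graded (cell_index ks) d. \<forall>x \<in> Z. h (subspace_of x) = u x * g x)"
    using u by (intro exI[of _ "\<lambda>x. u x ^ d"]) (auto elim!: pulled_backE simp: pluckers_def homogeneous_scale)
qed simp

lemma morphism_from_schubert: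
  assumes Z: "Z \<subseteq> coords"
  shows "morphism (graded_fspace (pluckers m N) (subspace_of ` Z)) (graded_fspace (affine_graded (cell_index ks)) Z) coordinates_of"
proof (rule morphism_graded_ratiosI[OF graded_algebra_pluckers graded_algebra_affine])
  show "coordinates_of W \<in> Z" if "W \<in> subspace_of ` Z" for W using that Z coordinates_of(1) by auto
  have "(\<lambda>W. p (coordinates_of W)) \<in> ratios (pluckers m N) (subspace_of ` Z)" if "p \<in> polys (cell_index ks)" for p
    using that unfolding polys_def
  proof (induction rule: subalg.induct)
    case (gen p)
    then obtain i where i: "i \<in> cell_index ks" "p = (\<lambda>v. v i)" by blast
    then obtain l c where lc: "(l, c) \<in> entries" "i = entry (l, c)"
      using bij_betw_imp_surj_on[OF bij_entry] by (metis imageE surj_pair)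
    let ?J = "insert c (pset - {ps ! l})"
    obtain \<epsilon> where e: "\<epsilon> \<noteq> 0" "\<And>x. pl x ?J = \<epsilon> * x i" using entry_minor(2)[OF lc(1)] lc(2) by blast
    have "(\<lambda>W. generator (plucker m N W) ?J) \<in> pluckers m N 1" "(\<lambda>W. generator (plucker m N W) pset) \<in> pluckers m N 1"
      by (intro coordinate_pluckers entry_minor(1)[OF lc(1)] pset_index)+
    then have "(\<lambda>W. generator (plucker m N W) ?J / generator (plucker m N W) pset) \<in> ratios (pluckers m N) (subspace_of ` Z)"
    proof (rule ratiosI)
      fix W assume "W \<in> subspace_of ` Z"
      then obtain x where "W = subspace_of x" by blast
      then show "generator (plucker m N W) pset \<noteq> 0 \<and> generator (plucker m N W) ?J / generator (plucker m N W) pset =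
         generator (plucker m N W) ?J / generator (plucker m N W) pset"
        using generator_plucker[of x] pl_pset[of x] by (auto simp: scale_fun_def)
    qed
    then have "(\<lambda>W. (1 / \<epsilon>) * (generator (plucker m N W) ?J / generator (plucker m N W) pset)) \<in> ratios (pluckers m N) (subspace_of ` Z)"
      by (rule G.ratios_cmult)
    then show ?case
    proof (rule ratios_cong)
      fix W assume "W \<in> subspace_of ` Z"
      then obtain x where x: "W = subspace_of x" "x \<in> Z" by blast
      then have "coordinates_of W = x" using coordinates_of(1) Z by blast
      moreover obtain u where "u \<noteq> 0" "generator (plucker m N W) = scale_fun u (pl x)"
        using generator_plucker[of x] x by blast
      ultimately show "p (coordinates_of W) = (1 / \<epsilon>) * (generator (plucker m N W) ?J / generator (plucker m N W) pset)"
        using e pl_pset[of x] by (simp add: i(2) scale_fun_def)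
    qed
  qed (auto intro: G.ratios_const G.ratios_add G.ratios_mult)
  then show "\<exists>u. (\<forall>W \<in> subspace_of ` Z. u W \<noteq> 0) \<and> (\<forall>h \<in> affine_graded (cell_index ks) d. \<exists>f \<in> ratios (pluckers m N) (subspace_of ` Z).
      \<forall>W \<in> subspace_of ` Z. h (coordinates_of W) = u W * f W)" for d
    by (intro exI[of _ "\<lambda>_. 1"]) auto
qed

lemma schubert_isomorphic:
  assumes Z: "Z \<subseteq> coords"
  shows "graded_fspace (pluckers m N) (subspace_of ` Z) \<cong>\<^sub>v graded_fspace (affine_graded (cell_index ks)) Z"
  using Z coordinates_of(1)
  by (intro graded_isomorphicI[OF graded_algebra_pluckers graded_algebra_affine _ _
        morphism_from_schubert[OF Z] morphism_to_schubert]) auto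

lemma loc_closed_subspace_of:
  assumes Z: "graded_algebra.loc_closed (affine_graded (cell_index ks)) coords Z"
  shows "G.loc_closed (linear_subspaces m {..<N}) (subspace_of ` Z)"
proof -
  have Zc: "Z \<subseteq> coords" by (rule graded_algebra.loc_closed_subset[OF graded_algebra_affine Z])
  have s: "subspace_of ` coords = schubert"
    using subspace_of_schubert subspace_of_surj by blast
  have "G.loc_closed schubert {W \<in> schubert. coordinates_of W \<in> Z}"
    using morphism_from_schubert[of coords, unfolded s]
    by (intro loc_closed_preimage[OF graded_algebra_pluckers graded_algebra_affine _ Z]) simp
  moreover have "{W \<in> schubert. coordinates_of W \<in> Z} = subspace_of ` Z"
  proof
    show "{W \<in> schubert. coordinates_of W \<in> Z} \<subseteq> subspace_of ` Z"
      using coordinates_of(3) by (metis (no_types, lifting) image_eqI mem_Collect_eq subsetI)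
    show "subspace_of ` Z \<subseteq> {W \<in> schubert. coordinates_of W \<in> Z}"
      using Zc coordinates_of(1) subspace_of_schubert by auto
  qed
  ultimately show ?thesis using G.loc_closed_trans[OF loc_closed_schubert] by simp
qed

end

section \<open>Assembling the partitions\<close>

lemma compatible_partitionI:
  assumes J: "countable J"
    and Z: "\<And>j. j \<in> J \<Longrightarrow> Z j = subvariety (X (i j)) (S j)"
    and lc: "\<And>j. j \<in> J \<Longrightarrow> zariski_locally_closed (X (i j)) (S j)"
    and sub: "\<And>j. j \<in> J \<Longrightarrow> S j \<subseteq> points (X (i j))"
    and qp: "\<And>j. j \<in> J \<Longrightarrow> quasi_projective (Z j)"
    and disj: "\<And>j k M. j \<in> J \<Longrightarrow> k \<in> J \<Longrightarrow> M \<in> S j \<Longrightarrow> M \<in> S k \<Longrightarrow> j = k"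
    and cover: "\<And>n. \<exists>K \<subseteq> J. points (X n) = (\<Union>j \<in> K. S j)"
  shows "compatible_partition X J Z"
proof -
  have pts: "points (Z j) = S j" if "j \<in> J" for j
    using sub[OF that] by (auto simp: Z[OF that] points_induced_fspace)
  have un: "(\<Union>j \<in> K. points (Z j)) = (\<Union>j \<in> K. S j)" if "K \<subseteq> J" for K
    using pts that by (intro SUP_cong) auto
  show ?thesis
    unfolding compatible_partition_def
  proof (intro conjI ballI allI J qp)
    show "disjoint_family_on (\<lambda>j. points (Z j)) J"
      unfolding disjoint_family_on_def using disj pts by auto
    show "(\<Union>j \<in> J. points (Z j)) = (\<Union>n. points (X n))"
    proof
      show "(\<Union>j \<in> J. points (Z j)) \<subseteq> (\<Union>n. points (X n))" using sub unfolding un[OF order_refl] by blast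
      show "(\<Union>n. points (X n)) \<subseteq> (\<Union>j \<in> J. points (Z j))"
      proof
        fix x assume "x \<in> (\<Union>n. points (X n))"
        then obtain n where n: "x \<in> points (X n)" by blast
        obtain K where "K \<subseteq> J" "points (X n) = (\<Union>j \<in> K. S j)" using cover[of n] by blast
        with n show "x \<in> (\<Union>j \<in> J. points (Z j))" unfolding un[OF order_refl] by blast
      qed
    qed
    show "\<exists>K \<subseteq> J. points (X n) = (\<Union>j \<in> K. points (Z j))" for n
    proof -
      obtain K where K: "K \<subseteq> J" "points (X n) = (\<Union>j \<in> K. S j)" using cover[of n] by blast
      then show ?thesis using un[OF K(1)] by (intro exI[of _ K]) simp
    qed
    show "\<exists>i. zariski_locally_closed (X i) (points (Z j)) \<and> Z j = subvariety (X i) (points (Z j))" if "j \<in> J" for j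
      using Z[OF that] lc[OF that] pts[OF that] by (intro exI[of _ "i j"]) simp
  qed
qed

lemma subvariety_of_graded:
  assumes X: "same_structure X (graded_fspace G P)" and G: "graded_algebra G"
    and Z: "graded_algebra.loc_closed G P Z"
  shows "zariski_locally_closed X Z" "Z \<subseteq> points X" "subvariety X Z \<cong>\<^sub>v graded_fspace G Z"
proof -
  interpret G: graded_algebra G by fact
  have ZP: "Z \<subseteq> P" by (rule G.loc_closed_subset[OF Z])
  show "zariski_locally_closed X Z"
    using Z same_structure_zariski_locally_closed[OF X] by (simp add: G.loc_closed_def)
  show "Z \<subseteq> points X" using ZP same_structure_points[OF X] by simp
  show "subvariety X Z \<cong>\<^sub>v graded_fspace G Z"
    by (intro same_structure_isomorphic same_structure_subvariety[OF X G ZP])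
qed

type_synonym piece_code = "nat list \<times> (nat \<times> nat \<times> nat list) list"

text \<open>
  The ambient projective space of index \<open>sum_list ks\<close> is large enough for the cells in \<open>ks\<close>; another large
  index would do as well. The same holds for the Grassmannian below.
\<close>

definition sym_piece :: "piece_code \<Rightarrow> (nat \<Rightarrow> complex) set multiset set" where
  "sym_piece = (\<lambda>(ks, ts). symmetric_stratum.piece (sum_list ks) ks ts)"

definition affine_piece_of :: "piece_code \<Rightarrow> (nat \<times> nat \<Rightarrow> complex) set" where
  "affine_piece_of = (\<lambda>(ks, ts). cell_bound.affine_piece ks (sum_list ks) ts)"

definition gr_piece :: "piece_code \<Rightarrow> (nat \<Rightarrow> complex) set set" where
  "gr_piece = (\<lambda>(ks, ts). schubert_cell.subspace_of ks ` affine_piece_of (ks, ts))"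

lemma symmetric_stratumI: "(\<And>k. k \<in> set ks \<Longrightarrow> k \<le> n) \<Longrightarrow> symmetric_stratum n ks"
  by unfold_locales

lemma cell_bound_sum_list: "cell_bound ks (sum_list ks)"
  by unfold_locales (simp add: member_le_sum_list)

lemma affine_piece_of_quasi_projective:
  "quasi_projective (graded_fspace (affine_graded (cell_index ks)) (affine_piece_of (ks, ts)))"
proof -
  interpret cell_bound ks "sum_list ks" by (rule cell_bound_sum_list)
  have "cell_index ks \<subseteq> {..sum_list ks} \<times> {..<length ks}"
    using level_slots_bound by (fastforce simp: cell_index_def level_slots_def)
  then have "finite (cell_index ks)" by (rule finite_subset) simp
  then show ?thesis
    using loc_closed_affine_piece[of ts] by (auto simp: affine_piece_of_def intro: quasi_projective_affine)
qed

lemma affine_piece_of_coords: "affine_piece_of (ks, ts) \<subseteq> coord_space (cell_index ks)"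
proof -
  interpret cell_bound ks "sum_list ks" by (rule cell_bound_sum_list)
  show ?thesis by (auto simp: affine_piece_of_def affine_piece_def)
qed

lemma sym_piece:
  fixes ks ts
  defines "X \<equiv> symmetric_power (length ks) (CP (sum_list ks))"
  shows "zariski_locally_closed X (sym_piece (ks, ts))" "sym_piece (ks, ts) \<subseteq> points X"
    "subvariety X (sym_piece (ks, ts)) \<cong>\<^sub>v graded_fspace (affine_graded (cell_index ks)) (affine_piece_of (ks, ts))"
proof -
  interpret symmetric_stratum "sum_list ks" ks
    by (rule symmetric_stratumI) (simp add: member_le_sum_list)
  have e: "same_structure X (graded_fspace SG mpts)"
    using symmetric_power_graded by (simp add: X_def CP_def)
  have lc: "SG.loc_closed mpts (sym_piece (ks, ts))"
    using R.loc_closed_piece[of ts] by (simp add: sym_piece_def piece_def)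
  note * = subvariety_of_graded[OF e SG.graded_algebra_axioms lc]
  show "zariski_locally_closed X (sym_piece (ks, ts))" "sym_piece (ks, ts) \<subseteq> points X" by (rule *)+
  show "subvariety X (sym_piece (ks, ts)) \<cong>\<^sub>v graded_fspace (affine_graded (cell_index ks)) (affine_piece_of (ks, ts))"
    using isomorphic_trans[OF *(3)] piece_isomorphic[of ts] by (simp add: sym_piece_def affine_piece_of_def)
qed

lemma schubert_cellI:
  assumes "sorted ks" shows "schubert_cell (sum_list ks + length ks) ks"
proof
  fix p assume "p \<in> set (pivot_list ks)"
  then obtain l where "l < length ks" "p = ks ! l + l" by (auto simp: in_set_conv_nth pivot_list_nth)
  moreover from this have "ks ! l \<le> sum_list ks" by (intro member_le_sum_list) auto
  ultimately show "p < sum_list ks + length ks" by simp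
qed (rule assms)

lemma gr_piece:
  fixes ks ts
  assumes "sorted ks"
  defines "X \<equiv> Grassmannian (length ks) (sum_list ks + length ks)"
  shows "zariski_locally_closed X (gr_piece (ks, ts))" "gr_piece (ks, ts) \<subseteq> points X"
    "subvariety X (gr_piece (ks, ts)) \<cong>\<^sub>v graded_fspace (affine_graded (cell_index ks)) (affine_piece_of (ks, ts))"
proof -
  interpret S: schubert_cell "sum_list ks + length ks" ks by (rule schubert_cellI[OF assms(1)])
  interpret C: cell_bound ks "sum_list ks" by (rule cell_bound_sum_list)
  have "S.G.loc_closed (linear_subspaces (length ks) {..<sum_list ks + length ks}) (gr_piece (ks, ts))"
    using S.loc_closed_subspace_of[OF C.loc_closed_affine_piece[of ts]] by (simp add: gr_piece_def affine_piece_of_def)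
  note * = subvariety_of_graded[OF Grassmannian_graded graded_algebra_pluckers this, folded X_def]
  show "zariski_locally_closed X (gr_piece (ks, ts))" "gr_piece (ks, ts) \<subseteq> points X" by (rule *)+
  show "subvariety X (gr_piece (ks, ts)) \<cong>\<^sub>v graded_fspace (affine_graded (cell_index ks)) (affine_piece_of (ks, ts))"
    using isomorphic_trans[OF *(3)] S.schubert_isomorphic[OF affine_piece_of_coords[of ks ts]] by (simp add: gr_piece_def)
qed

lemma sym_piece_iff:
  "M \<in> sym_piece (ks, ts) \<longleftrightarrow> size M = length ks \<and> set_mset M \<subseteq> linear_subspaces 1 {..sum_list ks} \<and>
    image_mset nrm M \<in> cell ks \<and> cell_bound.types (sum_list ks) (image_mset nrm M) = ts"
proof -
  interpret symmetric_stratum "sum_list ks" ks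
    by (rule symmetric_stratumI) (simp add: member_le_sum_list)
  show ?thesis by (auto simp: sym_piece_def piece_def stratum_def)
qed

lemma sym_piece_disjoint:
  assumes "M \<in> sym_piece (ks, ts)" "M \<in> sym_piece (ks', ts')" "sorted ks" "sorted ks'"
  shows "(ks, ts) = (ks', ts')"
proof -
  have "mset ks = mset ks'" using assms(1,2) by (auto simp: sym_piece_iff cell_def)
  then have "ks = ks'" using assms(3,4) by (metis properties_for_sort)
  then show ?thesis using assms(1,2) by (simp add: sym_piece_iff)
qed

lemma sym_piece_cover:
  "points (symmetric_power m (CP n)) =
     (\<Union>(ks, ts) \<in> {(ks, ts). sorted ks \<and> length ks = m \<and> set ks \<subseteq> {..n}}. sym_piece (ks, ts))"
proof -
  have "\<exists>ks ts. sorted ks \<and> length ks = m \<and> set ks \<subseteq> {..n} \<and> M \<in> sym_piece (ks, ts)"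
    if M: "size M = m" "set_mset M \<subseteq> linear_subspaces 1 {..n}" for M
  proof -
    let ?ks = "sorted_list_of_multiset (image_mset lead (image_mset nrm M))"
    have L: "normalized (nrm L)" "line (nrm L) = L" "lead (nrm L) \<le> n" if "L \<in># M" for L
      using line_nrm[of L n] M(2) that by auto
    have mks: "mset ?ks = image_mset lead (image_mset nrm M)" by (rule mset_sorted_list_of_multiset)
    then have sks: "set ?ks = lead ` nrm ` set_mset M" by (metis set_image_mset set_mset_mset)
    have "L \<in> linear_subspaces 1 {..sum_list ?ks}" if l: "L \<in># M" for L
    proof -
      have "lead (nrm L) \<le> sum_list ?ks" using sks l by (intro member_le_sum_list) auto
      from line_normalized[OF L(1)[OF l] this] show ?thesis by (simp add: L(2)[OF l])
    qed
    moreover have "length ?ks = m" using M(1) mks by (metis size_image_mset size_mset)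
    ultimately have "M \<in> sym_piece (?ks, cell_bound.types (sum_list ?ks) (image_mset nrm M))"
      using M(1) L(1) mks by (auto simp: sym_piece_iff cell_def)
    moreover have "set ?ks \<subseteq> {..n}" using sks L(3) by auto
    ultimately show ?thesis using \<open>length ?ks = m\<close> sorted_sorted_list_of_multiset by blast
  qed
  moreover have "size M = m \<and> set_mset M \<subseteq> linear_subspaces 1 {..n}"
    if ks: "length ks = m" "set ks \<subseteq> {..n}" and M: "M \<in> sym_piece (ks, ts)" for ks ts M
  proof -
    have "L \<in> linear_subspaces 1 {..n}" if l: "L \<in># M" for L
    proof -
      have "L \<in> linear_subspaces 1 {..sum_list ks}" using M l by (auto simp: sym_piece_iff)
      note ln = line_nrm[OF this]
      have "lead (nrm L) \<in> set ks" using lead_cell[of "image_mset nrm M" ks "nrm L"] M l by (auto simp: sym_piece_iff)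
      then have "lead (nrm L) \<le> n" using ks by auto
      from line_normalized[OF ln(1) this] show ?thesis by (simp add: ln(2))
    qed
    then show ?thesis using M ks by (auto simp: sym_piece_iff)
  qed
  ultimately show ?thesis
    by (auto simp: points_symmetric_power CP_def points_projective_space) blast+
qed

lemma gr_piece_pivots: "W \<in> gr_piece (ks, ts) \<Longrightarrow> sorted ks \<Longrightarrow> pivots W = set (pivot_list ks)"
  using schubert_cell.pivots_subspace_of[OF schubert_cellI] by (auto simp: gr_piece_def)

lemma gr_piece_disjoint:
  assumes W: "W \<in> gr_piece (ks, ts)" "W \<in> gr_piece (ks', ts')" and s: "sorted ks" "sorted ks'"
    and len: "length ks = length ks'"
  shows "(ks, ts) = (ks', ts')"
proof -
  have "set (pivot_list ks) = set (pivot_list ks')" using gr_piece_pivots W s by metis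
  then have "pivot_list ks = pivot_list ks'"
    using sorted_pivot_list[OF s(1)] sorted_pivot_list[OF s(2)] by (simp add: strict_sorted_equal)
  then have ks: "ks = ks'"
    using len by (auto simp: list_eq_iff_nth_eq pivot_list_nth)
  interpret S: schubert_cell "sum_list ks + length ks" ks by (rule schubert_cellI[OF s(1)])
  interpret C: cell_bound ks "sum_list ks" by (rule cell_bound_sum_list)
  obtain x y where "x \<in> affine_piece_of (ks, ts)" "W = S.subspace_of x"
    "y \<in> affine_piece_of (ks, ts')" "W = S.subspace_of y"
    using W by (auto simp: gr_piece_def ks)
  moreover from this have "x = y" using S.subspace_of_inj affine_piece_of_coords by blast
  ultimately show ?thesis by (simp add: ks[symmetric] affine_piece_of_def C.affine_piece_def)
qed

lemma points_Grassmannian: "points (Grassmannian m n) = linear_subspaces m {..<n}"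
  using same_structure_points[OF Grassmannian_graded[of m n]]
  by (simp add: graded_algebra.points_graded_fspace[OF graded_algebra_pluckers])

lemma gr_piece_cover:
  "points (Grassmannian m n) =
     (\<Union>(ks, ts) \<in> {(ks, ts). sorted ks \<and> length ks = m \<and> set (pivot_list ks) \<subseteq> {..<n}}. gr_piece (ks, ts))"
proof -
  have "\<exists>ks ts. sorted ks \<and> length ks = m \<and> set (pivot_list ks) \<subseteq> {..<n} \<and> W \<in> gr_piece (ks, ts)"
    if W: "W \<in> linear_subspaces m {..<n}" for W
  proof -
    obtain ks where ks: "sorted ks" "length ks = m" "schubert_cell n ks" "W \<in> schubert_cell.schubert n ks"
      using linear_subspace_in_schubert[OF W] by blast
    interpret S: schubert_cell n ks by fact
    interpret C: cell_bound ks "sum_list ks" by (rule cell_bound_sum_list)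
    obtain x where x: "x \<in> S.coords" "S.subspace_of x = W" using S.subspace_of_surj[OF ks(4)] by blast
    then have "W \<in> gr_piece (ks, C.types (C.multiset_of x))"
      by (auto simp: gr_piece_def affine_piece_of_def C.affine_piece_def)
    moreover have "set (pivot_list ks) \<subseteq> {..<n}" using S.pivot_bound by blast
    ultimately show ?thesis using ks by blast
  qed
  moreover have "W \<in> linear_subspaces m {..<n}"
    if ks: "sorted ks" "length ks = m" "set (pivot_list ks) \<subseteq> {..<n}" and W: "W \<in> gr_piece (ks, ts)" for ks ts W
  proof -
    interpret S: schubert_cell n ks by unfold_locales (use ks in auto)
    show ?thesis using W S.subspace_of_linear ks(2) by (auto simp: gr_piece_def)
  qed
  ultimately show ?thesis unfolding points_Grassmannian by auto
qed

theorem theorem2: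
  fixes m :: nat
  assumes "m \<ge> 1"
  shows "\<exists>(J :: nat set) U V.
           compatible_partition (\<lambda>N. symmetric_power m (CP N)) J U \<and>
           compatible_partition (\<lambda>N. Grassmannian m N) J V \<and>
           (\<forall>j \<in> J. U j \<cong>\<^sub>v V j)"
proof -
  \<comment> \<open>The pieces are indexed by the sequence \<open>ks\<close> and the types of all levels; a piece may be empty.\<close>
  let ?codes = "{(ks :: nat list, ts :: (nat \<times> nat \<times> nat list) list). sorted ks \<and> length ks = m}"
  define J where "J = to_nat ` ?codes"
  define dec :: "nat \<Rightarrow> piece_code" where "dec = from_nat"
  define n where "n j = sum_list (fst (dec j))" for j
  define U where "U j = subvariety (symmetric_power m (CP (n j))) (sym_piece (dec j))" for j
  define V where "V j = subvariety (Grassmannian m (n j + m)) (gr_piece (dec j))" for j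
  have dec: "\<exists>ks ts. dec j = (ks, ts) \<and> sorted ks \<and> length ks = m" if "j \<in> J" for j
    using that by (auto simp: J_def dec_def)
  have enc: "to_nat c \<in> J" "dec (to_nat c) = c" if "c \<in> ?codes" for c
    using that by (auto simp: J_def dec_def)
  have "to_nat (dec j) = j" if "j \<in> J" for j
    using that by (auto simp: J_def dec_def)
  then have dec_inj: "j = k" if "j \<in> J" "k \<in> J" "dec j = dec k" for j k
    using that by metis
  have cover: "\<exists>K \<subseteq> J. (\<Union>c \<in> C. S c) = (\<Union>j \<in> K. S (dec j))" if "C \<subseteq> ?codes" for C and S :: "piece_code \<Rightarrow> 'b set"
  proof (intro exI[of _ "to_nat ` C"] conjI)
    show "to_nat ` C \<subseteq> J" using that by (auto simp: J_def)
    have "S c = S (dec (to_nat c))" if "c \<in> C" for c using enc(2)[of c] that \<open>C \<subseteq> ?codes\<close> by auto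
    then show "(\<Union>c \<in> C. S c) = (\<Union>j \<in> to_nat ` C. S (dec j))" unfolding image_image by (rule SUP_cong[OF refl])
  qed
  have iso: "U j \<cong>\<^sub>v graded_fspace (affine_graded (cell_index (fst (dec j)))) (affine_piece_of (dec j))"
    "V j \<cong>\<^sub>v graded_fspace (affine_graded (cell_index (fst (dec j)))) (affine_piece_of (dec j))" if "j \<in> J" for j
    using dec[OF that] sym_piece(3) gr_piece(3) by (auto simp: U_def V_def n_def)
  have qp: "quasi_projective (graded_fspace (affine_graded (cell_index (fst (dec j)))) (affine_piece_of (dec j)))" for j
    using affine_piece_of_quasi_projective[of "fst (dec j)" "snd (dec j)"] by simp
  have "compatible_partition (\<lambda>N. symmetric_power m (CP N)) J U"
  proof (rule compatible_partitionI[where i = n and S = "\<lambda>j. sym_piece (dec j)"])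
    show "countable J" by simp
    show "zariski_locally_closed (symmetric_power m (CP (n j))) (sym_piece (dec j))"
      "sym_piece (dec j) \<subseteq> points (symmetric_power m (CP (n j)))" if jJ: "j \<in> J" for j
    proof -
      obtain ks ts where c: "dec j = (ks, ts)" "length ks = m" using dec[OF jJ] by blast
      then show "zariski_locally_closed (symmetric_power m (CP (n j))) (sym_piece (dec j))"
        "sym_piece (dec j) \<subseteq> points (symmetric_power m (CP (n j)))"
        using sym_piece(1,2)[of ks ts] by (simp_all add: n_def)
    qed
    show "quasi_projective (U j)" if "j \<in> J" for j
      by (rule quasi_projective_isomorphic[OF iso(1)[OF that] qp])
    show "j = k" if "j \<in> J" "k \<in> J" "M \<in> sym_piece (dec j)" "M \<in> sym_piece (dec k)" for j k M
      using dec[OF that(1)] dec[OF that(2)] that sym_piece_disjoint dec_inj by metis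
    show "\<exists>K \<subseteq> J. points (symmetric_power m (CP i)) = (\<Union>j \<in> K. sym_piece (dec j))" for i
      unfolding sym_piece_cover case_prod_eta by (rule cover) auto
  qed (simp add: U_def)
  moreover have "compatible_partition (\<lambda>N. Grassmannian m N) J V"
  proof (rule compatible_partitionI[where i = "\<lambda>j. n j + m" and S = "\<lambda>j. gr_piece (dec j)"])
    show "countable J" by simp
    show "zariski_locally_closed (Grassmannian m (n j + m)) (gr_piece (dec j))"
      "gr_piece (dec j) \<subseteq> points (Grassmannian m (n j + m))" if jJ: "j \<in> J" for j
    proof -
      obtain ks ts where c: "dec j = (ks, ts)" "sorted ks" "length ks = m" using dec[OF jJ] by blast
      then show "zariski_locally_closed (Grassmannian m (n j + m)) (gr_piece (dec j))"
        "gr_piece (dec j) \<subseteq> points (Grassmannian m (n j + m))"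
        using gr_piece(1,2)[of ks ts] by (simp_all add: n_def)
    qed
    show "quasi_projective (V j)" if "j \<in> J" for j
      by (rule quasi_projective_isomorphic[OF iso(2)[OF that] qp])
    show "j = k" if "j \<in> J" "k \<in> J" "M \<in> gr_piece (dec j)" "M \<in> gr_piece (dec k)" for j k M
      using dec[OF that(1)] dec[OF that(2)] that gr_piece_disjoint dec_inj by metis
    show "\<exists>K \<subseteq> J. points (Grassmannian m i) = (\<Union>j \<in> K. gr_piece (dec j))" for i
      unfolding gr_piece_cover case_prod_eta by (rule cover) auto
  qed (simp add: V_def)
  moreover have "U j \<cong>\<^sub>v V j" if "j \<in> J" for j
    by (rule isomorphic_trans[OF iso(1)[OF that] isomorphic_sym[OF iso(2)[OF that]]])
  ultimately show ?thesis by blast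
qed

end
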